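(* For all positive integers $n$ and $k$ (where $k$ may depend on $n$), there is a quantum query algorithm that computes $\mathrm{DYCK}_{k,n}$ with two-sided error probability $\varepsilon<1/2$ using $O\big(\sqrt{n}\,(\log n)^{0.5k}\big)$ queries (its running time is $O\big(\sqrt{n}\,(\log n)^{0.5k}\big)$).
   Context: For $x=x_1\cdots x_n\in\{0,1\}^n$, interpret $x_i=0$ as an opening parenthesis "(" and $x_i=1$ as a closing parenthesis ")". Let $f(y)=|y|_0-|y|_1$ denote the balance of a binary word $y$. $\mathrm{DYCK}_{k,n}(x)=1$ iff $x$ is a correctly balanced parenthesis word of depth at most $k$, i.e. $f(x)=0$ and every prefix $p$ of $x$ satisfies $0\le f(p)\le k$; otherwise $\mathrm{DYCK}_{k,n}(x)=0$. The input is accessed via the standard quantum oracle $|i\rangle|z\rangle|w\rangle\mapsto|i\rangle|z\oplus x_i\rangle|w\rangle$. *)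

theory Defs
  imports
    "HOL-Library.Landau_Symbols"
    "HOL-Library.Log_Nat"
    "HOL-Library.Sublist"
    "Jordan_Normal_Form.Schur_Decomposition"
begin

section \<open>Dyck words of bounded depth\<close>

text \<open>A letter 0 (opening parenthesis) is \<^const>\<open>False\<close>, a letter 1 (closing parenthesis) is
  \<^const>\<open>True\<close>.\<close>

definition balance :: "bool list \<Rightarrow> int" where
  "balance y = int (count_list y False) - int (count_list y True)"

definition dyck :: "nat \<Rightarrow> bool list \<Rightarrow> bool" where
  "dyck k x \<longleftrightarrow> balance x = 0 \<and> (\<forall>p. prefix p x \<longrightarrow> 0 \<le> balance p \<and> balance p \<le> int k)"


section \<open>Gates and the query operator on \<open>m\<close> qubits\<close>

text \<open>States of \<open>m\<close> qubits are complex vectors of dimension \<open>2 ^ m\<close>. The basis state with number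
  \<open>b < 2 ^ m\<close> is the one in which qubit \<open>q\<close> has the value \<^term>\<open>bit (b :: nat) q\<close>.\<close>

definition unitary :: "complex mat \<Rightarrow> bool" where
  "unitary U \<longleftrightarrow> square_mat U \<and> mat_adjoint U * U = 1\<^sub>m (dim_row U)"

text \<open>A gate is a list of qubits together with the matrix that acts on them.\<close>

type_synonym gate = "nat list \<times> complex mat"

definition elementary_gate :: "nat \<Rightarrow> gate \<Rightarrow> bool" where
  "elementary_gate m = (\<lambda>(qs, U). distinct qs \<and> set qs \<subseteq> {..<m} \<and> length qs \<in> {1, 2} \<and>
     U \<in> carrier_mat (2 ^ length qs) (2 ^ length qs) \<and> unitary U)"

definition subindex :: "nat list \<Rightarrow> nat \<Rightarrow> nat" where
  "subindex qs b = horner_sum of_bool 2 (map (bit b) qs)"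

text \<open>The matrix \<open>U\<close> on the qubits \<open>qs\<close>, tensored with the identity on all other qubits.\<close>

definition gate_mat :: "nat \<Rightarrow> gate \<Rightarrow> complex mat" where
  "gate_mat m = (\<lambda>(qs, U). mat (2 ^ m) (2 ^ m) (\<lambda>(r, c).
     if \<forall>q < m. q \<notin> set qs \<longrightarrow> bit r q = bit c q then U $$ (subindex qs r, subindex qs c) else 0))"

text \<open>In \<open>|i\<rangle>|z\<rangle>|w\<rangle>\<close> the index register consists of the qubits below \<^term>\<open>ceillog2 n\<close>, the
  answer qubit is number \<^term>\<open>ceillog2 n\<close>, and all further qubits are workspace. Letters are
  numbered from 0; the index values from \<open>n = length x\<close> on, which occur if \<open>n\<close> is not a power
  of two, are left unchanged by the query.\<close>

definition query_basis :: "bool list \<Rightarrow> nat \<Rightarrow> nat" where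
  "query_basis x b =
     (let a = ceillog2 (length x); i = take_bit a b
      in if i < length x \<and> x ! i then flip_bit a b else b)"

definition query_mat :: "nat \<Rightarrow> bool list \<Rightarrow> complex mat" where
  "query_mat m x = mat (2 ^ m) (2 ^ m) (\<lambda>(r, c). if r = query_basis x c then 1 else 0)"


section \<open>Quantum query algorithms\<close>

text \<open>A step is either an oracle query or an input-independent operation. Running time is
  measured in the manner of a word RAM: an operation on constantly many words of \<open>O(log n)\<close> bits
  (such as arithmetic on indices, or the diffusion step of Grover search over at most \<open>n\<close>
  positions) is one step. Accordingly an operation is a circuit of one- and two-qubit gates, and
  \<open>word_operation\<close> below requires it to involve only \<open>O(log n)\<close> qubits and polylogarithmically
  many gates.\<close>

datatype step = Query | Operation "gate list"

record query_algorithm =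
  qubits :: nat
  steps :: "step list"
  out_qubit :: nat  \<comment> \<open>the qubit that is measured at the end\<close>

definition queries :: "query_algorithm \<Rightarrow> nat" where
  "queries A = count_list (steps A) Query"

definition running_time :: "query_algorithm \<Rightarrow> nat" where
  "running_time A = length (steps A)"

definition word_operation :: "nat \<Rightarrow> nat \<Rightarrow> gate list \<Rightarrow> bool" where
  "word_operation c n gs \<longleftrightarrow>
     real (card (\<Union>(qs, U) \<in> set gs. set qs)) \<le> real c * (1 + log 2 (real n)) \<and>
     real (length gs) \<le> real c * (1 + log 2 (real n)) ^ c"

text \<open>The constant \<open>c\<close> is to be chosen independently of \<open>n\<close>.\<close>

definition is_query_algorithm :: "nat \<Rightarrow> nat \<Rightarrow> query_algorithm \<Rightarrow> bool" where
  "is_query_algorithm c n A \<longleftrightarrow>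
     ceillog2 n + 1 \<le> qubits A \<and> out_qubit A < qubits A \<and>
     (\<forall>gs. Operation gs \<in> set (steps A) \<longrightarrow>
        word_operation c n gs \<and> (\<forall>g \<in> set gs. elementary_gate (qubits A) g))"

fun apply_step :: "nat \<Rightarrow> bool list \<Rightarrow> step \<Rightarrow> complex vec \<Rightarrow> complex vec" where
  "apply_step m x Query v = query_mat m x *\<^sub>v v"
| "apply_step m x (Operation gs) v = fold (\<lambda>g u. gate_mat m g *\<^sub>v u) gs v"

definition final_state :: "query_algorithm \<Rightarrow> bool list \<Rightarrow> complex vec" where
  "final_state A x =
     fold (apply_step (qubits A) x) (steps A) (unit_vec (2 ^ qubits A) 0)"

definition output_prob :: "query_algorithm \<Rightarrow> bool list \<Rightarrow> bool \<Rightarrow> real" where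
  "output_prob A x r =
     (\<Sum>b | b < 2 ^ qubits A \<and> bit b (out_qubit A) = r. (cmod (final_state A x $ b))\<^sup>2)"

definition computes_with_error ::
    "query_algorithm \<Rightarrow> nat \<Rightarrow> (bool list \<Rightarrow> bool) \<Rightarrow> real \<Rightarrow> bool" where
  "computes_with_error A n f \<epsilon> \<longleftrightarrow>
     (\<forall>x. length x = n \<longrightarrow> output_prob A x (\<not> f x) \<le> \<epsilon>)"

end

(*
  Pad the input by k letters -1 on one side and k letters 1 on the other (an opening parenthesis counts
  as 1, a closing one as -1). The input is a Dyck word of depth at most k iff the walk of the padded word
  has range at most k. A segment of length 2^j has range at least i if one of its halves has, or if
  there is a jump across its middle: starting from the middle and going outwards, one meets pieces of
  smaller range whose final letters fit together. This recursion is an AND-OR formula with weighted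
  choices. With weights adapted to the sizes of its witnesses, the square of the witness size grows like
  1024^i 2^j binomial(j + i - 1, j), because of Pascal's rule. At j = log n + O(1), i = k + 1 this is
  n (C log n)^k / k!, and the factorial absorbs C^k as well as the factors of size O(k) below.

  A formula with witnesses of size c is evaluated by a quantum walk. One step of the walk is a product
  of two reflections, each being a bottom-up pass through the formula conjugating an elementary
  reflection, and takes O(k) operations on O(log n) qubits. If the formula is true then the start state
  is close to a fixed vector of this product; if it is false, the start state is a difference of a short
  vector and its image, so that the powers of the product move it away. Both cases are told apart by
  running 1, 2, 4, ... steps of the walk, controlled by clock qubits.

  For k > 3 log n the claimed bound exceeds n^2, and a classical algorithm suffices.
*)
theory Submission
  imports Defs "HOL-Library.Countable"
begin

text \<open>A jump cannot be found by an OR over pairs of letters: whether the pieces fit together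
  depends on how often the smaller ranges are reached upwards, so true and false values of
  subformulas are both needed. Hence a single bound serves for both truth values, and a case
  distinction on a subformula costs its own cost plus that of the continuation. Weights make this
  possible. An AND with a true leaf trades the cost of a positive answer against that of a negative
  one, so that only their product counts, and at a segment the squares of the costs of its halves
  and of the jump add up. A jump of height i evaluates final letters of all smaller ranges. The base
  32 of the costs, whose square is 1024, turns their sum into a geometric series that stays a small
  fraction of the cost at range i; this leaves room for the case distinctions and for additive
  terms. The program is one sequence of instructions for all positions of the game, with a single
  query near its end. Instructions of other segments are idle, so all cells of a plane can be
  executed in one step, which is why a pass needs O(k) steps instead of O(k log n).\<close>

section \<open>Ranges of walks\<close>

text \<open>A word over \<open>{-1, 0, 1}\<close> is read from right to left. \<open>U\<close> is the highest point of this walk,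
  \<open>rng\<close> the length of the interval that it covers, and \<open>final h\<close> the letter with which that length
  reaches \<open>h\<close> (or 0 if it does not).\<close>

fun U :: "int list \<Rightarrow> int" where
  "U [] = 0"
| "U (a # w) = max (U w) (a + sum_list w)"

definition neg :: "int list \<Rightarrow> int list" where "neg = map uminus"

definition rng :: "int list \<Rightarrow> int" where "rng w = U w + U (neg w)"

fun final :: "nat \<Rightarrow> int list \<Rightarrow> int" where
  "final h [] = 0"
| "final h (a # w) = (if int h \<le> rng w then final h w else if int h \<le> rng (a # w) then a else 0)"

definition letters :: "int list \<Rightarrow> bool" where "letters w \<longleftrightarrow> set w \<subseteq> {-1, 0, 1}"

lemma neg_simps [simp]: "neg [] = []" "neg (a # w) = - a # neg w" "neg (v @ w) = neg v @ neg w"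
  "neg (neg w) = w" "rev (neg w) = neg (rev w)" "length (neg w) = length w"
  by (simp_all add: neg_def rev_map comp_def)

lemma letters_simps [simp]: "letters []" "letters (a # w) \<longleftrightarrow> a \<in> {-1, 0, 1} \<and> letters w"
  "letters (v @ w) \<longleftrightarrow> letters v \<and> letters w" "letters (rev w) \<longleftrightarrow> letters w"
  by (auto simp: letters_def)

lemma letters_neg [simp]: "letters (neg w) \<longleftrightarrow> letters w"
  by (induction w) auto

lemma sum_neg [simp]: "sum_list (neg w) = - sum_list w"
  by (induction w) auto

lemma U_ge: "0 \<le> U w" "sum_list w \<le> U w"
  by (induction w) auto

lemma U_append: "U (v @ w) = max (U w) (U v + sum_list w)"
  by (induction v) (use U_ge(2)[of w] in auto)

text \<open>A prefix sum is the total minus a suffix sum, so the highest prefix sum is the total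
  minus the lowest suffix sum.\<close>

lemma U_rev: "U (rev w) = sum_list w + U (neg w)"
proof (induction w)
  case (Cons a w)
  show ?case using Cons U_ge(1)[of "rev w"] by (auto simp: U_append)
qed simp

lemma rng_Nil [simp]: "rng [] = 0" by (simp add: rng_def)

lemma rng_neg [simp]: "rng (neg w) = rng w" by (simp add: rng_def)

lemma rng_ge: "0 \<le> rng w" using U_ge(1)[of w] U_ge(1)[of "neg w"] by (simp add: rng_def)

text \<open>Either both extremes of the walk lie in one part, or there is one in each. In the latter
  case their distance is measured outwards from the middle, which turns \<open>w\<close> into
  \<open>rev w\<close>.\<close>

lemma rng_append:
  "rng (v @ w) = max (max (rng w) (rng v)) (max (U v + U (rev w)) (U (neg v) + U (neg (rev w))))"
  using U_rev[of w] U_rev[of "neg w"] by (auto simp: rng_def U_append)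

lemma rng_rev [simp]: "rng (rev w) = rng w"
  using U_rev[of w] U_rev[of "neg w"] by (auto simp: rng_def)

lemma U_step:
  assumes "a \<in> {-1, 0, 1}"
  shows "U (a # w) = U w \<or> U (a # w) = U w + 1 \<and> a = 1"
  using assms U_ge(2)[of w] by auto

lemma U_neg_step:
  assumes "a \<in> {-1, 0, 1}"
  shows "U (neg (a # w)) = U (neg w) \<or> U (neg (a # w)) = U (neg w) + 1 \<and> a = - 1"
  using U_step[of "- a" "neg w"] assms by auto

lemma final_neg: "final h (neg w) = - final h w"
proof (induction w)
  case (Cons a w)
  have "rng (- a # neg w) = rng (a # w)" using rng_neg[of "a # w"] by simp
  then show ?case using Cons by simp
qed simp

lemma rng_Cons_ge: "rng w \<le> rng (a # w)"
  using U_ge[of w] by (auto simp: rng_def)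

text \<open>A letter 0 moves neither extreme, so it is never the letter with which a new range is
  reached. This makes 0 a safe default in \<open>final\<close>.\<close>

lemma final_eq_0_iff: "letters w \<Longrightarrow> 1 \<le> h \<Longrightarrow> final h w = 0 \<longleftrightarrow> rng w < int h"
proof (induction w)
  case (Cons a w)
  have a: "a \<in> {-1, 0, 1}" using Cons by simp
  have "rng (a # w) = rng w \<or> a \<noteq> 0"
    using U_step[OF a, of w] U_neg_step[OF a, of w] unfolding rng_def by linarith
  moreover have "final h w = 0 \<longleftrightarrow> rng w < int h" using Cons by simp
  ultimately show ?case using rng_Cons_ge[of w a] by auto
qed simp

text \<open>The height reached before the range exceeds \<open>h - 1\<close>.\<close>

fun height :: "nat \<Rightarrow> int list \<Rightarrow> int" where
  "height h [] = 0"
| "height h (a # w) = (if int h \<le> rng w + 1 then height h w else U (a # w))"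

text \<open>Once the range is \<open>h - 1\<close>, the maximum can only move together with the
  range. Freezing it there loses nothing as long as the range is below \<open>h\<close>.\<close>

lemma height_eq_U: "letters w \<Longrightarrow> rng w < int h \<Longrightarrow> height h w = U w"
proof (induction w)
  case (Cons a w)
  have a: "a \<in> {-1, 0, 1}" using Cons by simp
  have "rng w < int h" using rng_Cons_ge[of w a] Cons by simp
  then have IH: "height h w = U w" using Cons by simp
  show ?case
    using IH Cons.prems(2) U_step[OF a, of w] U_neg_step[OF a, of w]
    by (simp only: height.simps rng_def) (auto split: if_splits)
qed simp

text \<open>The range grows one by one, and reaching a new range raises the maximum exactly if this
  happens with the letter 1. The heights frozen for \<open>h\<close> and for \<open>Suc h\<close>
  are separated by the event that range \<open>h\<close> is reached.\<close>

lemma height_Suc: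
  "letters w \<Longrightarrow> 1 \<le> h \<Longrightarrow> height (Suc h) w = height h w + of_bool (final h w = 1)"
proof (induction w)
  case (Cons a w)
  have a: "a \<in> {-1, 0, 1}" using Cons by simp
  have IH: "height (Suc h) w = height h w + of_bool (final h w = 1)" using Cons by simp
  consider "int h \<le> rng w" | "int h = rng w + 1" | "int h > rng w + 1" by linarith
  then show ?case
  proof cases
    case 1
    then show ?thesis using IH by simp
  next
    case 2
    then have "height h w = U w" using Cons.prems by (intro height_eq_U) auto
    then show ?thesis using 2 U_step[OF a, of w] U_neg_step[OF a, of w]
      by (simp only: height.simps final.simps rng_def) (auto split: if_splits simp del: U.simps)
  next
    case 3
    then have "\<not> int h \<le> rng (a # w)"
      using U_step[OF a, of w] U_neg_step[OF a, of w] by (auto simp only: rng_def)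
    with 3 show ?thesis by simp
  qed
qed simp

text \<open>Expresses a frozen height by final letters at smaller ranges, which is the form that the
  formula can evaluate recursively.\<close>

definition climbs :: "nat \<Rightarrow> int list \<Rightarrow> nat" where
  "climbs h w = (\<Sum>i = 1..<h. of_bool (final i w = 1))"

lemma height_1: "height (Suc 0) w = 0"
  by (induction w) (use rng_ge in auto)

lemma climbs_eq_height: "letters w \<Longrightarrow> 1 \<le> h \<Longrightarrow> int (climbs h w) = height h w"
proof (induction h)
  case (Suc h)
  show ?case
  proof (cases "h = 0")
    case False
    then show ?thesis using Suc height_Suc[of w h] by (simp add: climbs_def)
  qed (simp add: climbs_def height_1)
qed simp

lemma height_bounds:
  assumes "letters w" "1 \<le> h"
  shows "height h w + height h (neg w) < int h" "0 \<le> height h w"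
proof -
  have "height h w + height h (neg w) < int h \<and> 0 \<le> height h w"
    using assms
  proof (induction w)
    case (Cons a w)
    have a: "a \<in> {-1, 0, 1}" using Cons by simp
    show ?case
      using Cons U_step[OF a, of w] U_neg_step[OF a, of w] U_ge(1)[of "a # w"]
      by (simp only: height.simps neg_simps rng_neg) (auto simp: rng_def split: if_splits simp del: U.simps)
  qed simp
  then show "height h w + height h (neg w) < int h" "0 \<le> height h w" by auto
qed

text \<open>Both halves are read away from the middle: \<open>v\<close> is read from its right end
  anyway, and \<open>rev w\<close> reads \<open>w\<close> from its left end.\<close>

definition jump :: "nat \<Rightarrow> int list \<Rightarrow> int list \<Rightarrow> bool" where
  "jump h v w \<longleftrightarrow> h \<le> climbs h v + climbs h (rev w)"

lemma jump_iff:
  assumes "letters v" "letters w" "1 \<le> h" "rng w < int h"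
  shows "jump h v w \<longleftrightarrow> int h \<le> height h v + U (rev w)"
  using assms climbs_eq_height[of v h] climbs_eq_height[of "rev w" h] height_eq_U[of "rev w" h]
  unfolding jump_def by auto

lemma height_mono: "letters (a # w) \<Longrightarrow> height h w \<le> height h (a # w)"
  using height_eq_U[of w h] U_ge by auto

text \<open>Until \<open>v\<close> alone reaches range \<open>h\<close> its frozen heights are
  exact, so a jump that has happened by then is due to a letter that moves the corresponding
  extreme. If no jump has happened by then, the letter that brings \<open>v\<close> to range
  \<open>h\<close> is also the one that brings \<open>v @ w\<close> there, since the combined range
  was smaller before.\<close>

lemma split_aux:
  assumes "letters v" "letters w" "1 \<le> h" "rng w < int h"
  shows "(int h \<le> rng (v @ w) \<longleftrightarrow>
      int h \<le> rng v \<or> int h \<le> height h v + U (rev w) \<or> int h \<le> height h (neg v) + U (neg (rev w))) \<and>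
    final h (v @ w) = (if int h \<le> height h v + U (rev w) then 1
      else if int h \<le> height h (neg v) + U (neg (rev w)) then - 1 else final h v)"
  using assms(1)
proof (induction v)
  case Nil
  have "rng w < int h" "U (rev w) \<ge> 0" "U (neg (rev w)) \<ge> 0" "rng w = U (rev w) + U (neg (rev w))"
    using assms U_ge rng_rev[of w] unfolding rng_def by auto
  moreover have "final h w = 0" using final_eq_0_iff[of w h] assms by auto
  ultimately show ?case using assms by auto
next
  case (Cons a v)
  have a: "a \<in> {-1, 0, 1}" and v: "letters v" using Cons by auto
  define u d where "u = U (rev w)" and "d = U (neg (rev w))"
  have ud: "u + d < int h" "0 \<le> u" "0 \<le> d"
    using assms U_ge rng_rev[of w] unfolding rng_def u_def d_def by auto
  note IH = Cons.IH[OF v, folded u_def d_def]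
  note hb = height_bounds[OF Cons.prems assms(3)]
  note hm = height_mono[OF Cons.prems, of h] height_mono[of "- a" "neg v" h]
  have hn: "height h (neg (a # v)) = (if int h \<le> rng v + 1 then height h (neg v) else U (neg (a # v)))"
    using rng_neg[of v] by simp
  have hp: "height h (a # v) = (if int h \<le> rng v + 1 then height h v else U (a # v))" by simp
  have ra: "rng ((a # v) @ w) = max (max (rng w) (rng (a # v))) (max (U (a # v) + u) (U (neg (a # v)) + d))"
    unfolding rng_append u_def d_def by simp
  have rv: "rng (v @ w) = max (max (rng w) (rng v)) (max (U v + u) (U (neg v) + d))"
    unfolding rng_append u_def d_def by simp
  note st = U_step[OF a, of v] U_neg_step[OF a, of v]
  have r1: "rng v = U v + U (neg v)" "rng (a # v) = U (a # v) + U (neg (a # v))" by (simp_all only: rng_def)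
  have eqU: "rng v < int h \<Longrightarrow> height h v = U v \<and> height h (neg v) = U (neg v)"
    using height_eq_U[OF v, of h] height_eq_U[of "neg v" h] v by simp
  have f1: "final h ((a # v) @ w) = (if int h \<le> rng (v @ w) then final h (v @ w) else if int h \<le> rng ((a # v) @ w) then a else 0)"
    by simp
  have f2: "final h (a # v) = (if int h \<le> rng v then final h v else if int h \<le> rng (a # v) then a else 0)"
    by simp
  have mono: "height h v \<le> height h (a # v)" "height h (neg v) \<le> height h (neg (a # v))"
    using hm a v by auto
  have rw: "rng w < int h" by fact
  show ?case unfolding u_def[symmetric] d_def[symmetric]
  \<comment> \<open>In the first case the heights are already frozen, in the second they still
    coincide with \<open>U\<close>. Both are linear arithmetic over the collected facts.\<close>
  proof (cases "int h \<le> rng v + 1")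
    case True
    then show "(int h \<le> rng ((a # v) @ w)) = (int h \<le> rng (a # v) \<or> int h \<le> height h (a # v) + u \<or> int h \<le> height h (neg (a # v)) + d) \<and>
       final h ((a # v) @ w) = (if int h \<le> height h (a # v) + u then 1 else if int h \<le> height h (neg (a # v)) + d then - 1 else final h (a # v))"
      using [[smt_timeout = 300]] IH hb hn hp ra rv st r1 eqU f1 f2 mono rw ud
      by (smt (z3))
  next
    case False
    then show "(int h \<le> rng ((a # v) @ w)) = (int h \<le> rng (a # v) \<or> int h \<le> height h (a # v) + u \<or> int h \<le> height h (neg (a # v)) + d) \<and>
       final h ((a # v) @ w) = (if int h \<le> height h (a # v) + u then 1 else if int h \<le> height h (neg (a # v)) + d then - 1 else final h (a # v))"
      using [[smt_timeout = 300]] IH hb hn hp ra rv st r1 eqU f1 f2 mono rw ud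
      by (smt (z3))
  qed
qed

lemma jump_neg_iff:
  assumes "letters v" "letters w" "1 \<le> h" "rng w < int h"
  shows "jump h (neg v) (neg w) \<longleftrightarrow> int h \<le> height h (neg v) + U (neg (rev w))"
  using jump_iff[of "neg v" "neg w" h] assms by simp

lemma final_append_right:
  assumes "int h \<le> rng w"
  shows "final h (v @ w) = final h w"
proof (induction v)
  case (Cons a v)
  have "int h \<le> rng (v @ w)" using assms unfolding rng_append by simp
  with Cons show ?case by simp
qed simp

text \<open>Reading from the right, \<open>w\<close> comes first, so a range that is reached inside
  \<open>w\<close> settles the letter.\<close>

lemma final_append:
  assumes "letters v" "letters w" "1 \<le> h"
  shows "final h (v @ w) = (if int h \<le> rng w then final h w
      else if jump h v w then 1 else if jump h (neg v) (neg w) then - 1 else final h v)"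
proof (cases "int h \<le> rng w")
  case False
  then show ?thesis using split_aux[of v w h] jump_iff[of v w h] jump_neg_iff[of v w h] assms by simp
qed (use final_append_right in simp)

lemma rng_append_ge_iff:
  assumes "letters v" "letters w" "1 \<le> h"
  shows "int h \<le> rng (v @ w) \<longleftrightarrow>
    int h \<le> rng v \<or> int h \<le> rng w \<or> jump h v w \<or> jump h (neg v) (neg w)"
proof (cases "int h \<le> rng w")
  case True
  then show ?thesis unfolding rng_append by simp
next
  case False
  then show ?thesis using split_aux[of v w h] jump_iff[of v w h] jump_neg_iff[of v w h] assms by simp
qed

lemma jump_rev: "jump h (rev w) (rev v) \<longleftrightarrow> jump h v w"
  by (simp add: jump_def add.commute)

section \<open>Dyck words as walks of bounded range\<close>

lemma U_filter: "U (filter (\<lambda>a. a \<noteq> 0) w) = U w"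
proof -
  have s: "sum_list (filter (\<lambda>a. a \<noteq> 0) w) = sum_list w" for w :: "int list" by (induction w) auto
  show ?thesis using s by (induction w) (use U_ge in auto)
qed

text \<open>Justifies filling up the text with zeros to a power of two.\<close>

lemma rng_filter: "rng (filter (\<lambda>a. a \<noteq> 0) w) = rng w"
proof -
  have "neg (filter (\<lambda>a. a \<noteq> 0) w) = filter (\<lambda>a. a \<noteq> 0) (neg w)" by (induction w) auto
  then show ?thesis by (simp add: rng_def U_filter)
qed

lemma U_le_iff: "U w \<le> c \<longleftrightarrow> (\<forall>i \<le> length w. sum_list (drop i w) \<le> c)"
proof (induction w)
  case (Cons a w)
  have split: "(\<forall>i \<le> Suc n. P i) \<longleftrightarrow> P 0 \<and> (\<forall>i \<le> n. P (Suc i))" for n P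
    by (metis Suc_le_mono le0 not0_implies_Suc)
  have "(\<forall>i \<le> length (a # w). sum_list (drop i (a # w)) \<le> c) \<longleftrightarrow>
     a + sum_list w \<le> c \<and> (\<forall>i \<le> length w. sum_list (drop i w) \<le> c)"
    using split[of "length w" "\<lambda>i. sum_list (drop i (a # w)) \<le> c"] by simp
  then show ?case using Cons by auto
qed simp

definition steps_of :: "bool list \<Rightarrow> int list" where
  "steps_of = map (\<lambda>c. if c then - 1 else 1)"

lemma balance_eq: "balance y = sum_list (steps_of y)"
  by (induction y) (auto simp: balance_def steps_of_def)

text \<open>A suffix sum is the total balance minus the balance of a prefix. The first condition
  says that no prefix has less than the total; with the empty prefix the total is at most 0, and the
  last condition makes it equal to 0.\<close>

lemma dyck_iff_U:
  "dyck k x \<longleftrightarrow> U (steps_of x) = 0 \<and> U (neg (steps_of x)) \<le> int k \<and> 0 \<le> sum_list (steps_of x)"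
proof -
  let ?w = "steps_of x"
  have pre: "(\<forall>p. prefix p x \<longrightarrow> P (balance p)) \<longleftrightarrow> (\<forall>i \<le> length x. P (sum_list (take i ?w)))" for P
  proof -
    have "(\<forall>p. prefix p x \<longrightarrow> P (balance p)) \<longleftrightarrow> (\<forall>i \<le> length x. P (balance (take i x)))"
      by (metis append_eq_conv_conj prefixE prefix_length_le take_is_prefix)
    then show ?thesis by (simp add: balance_eq steps_of_def take_map)
  qed
  have sp: "sum_list (drop i ?w) = sum_list ?w - sum_list (take i ?w)" for i
    by (metis add_diff_cancel_left' append_take_drop_id sum_list_append)
  have U0: "U ?w = 0 \<longleftrightarrow> U ?w \<le> 0" using U_ge(1)[of ?w] by auto
  have dn: "drop i (neg ?w) = neg (drop i ?w)" for i by (simp add: neg_def drop_map)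
  have len: "length ?w = length x" by (simp add: steps_of_def)
  have U1: "U ?w \<le> 0 \<longleftrightarrow> (\<forall>i\<le>length x. sum_list ?w \<le> sum_list (take i ?w))"
    using U_le_iff[of ?w 0] sp len by auto
  have U2: "U (neg ?w) \<le> int k \<longleftrightarrow> (\<forall>i\<le>length x. sum_list (take i ?w) - sum_list ?w \<le> int k)"
    using U_le_iff[of "neg ?w" "int k"] sp len dn by auto
  have U3: "(\<forall>i\<le>length x. sum_list ?w \<le> sum_list (take i ?w)) \<Longrightarrow> sum_list ?w \<le> 0" by force
  show ?thesis
    unfolding dyck_def pre[of "\<lambda>b. 0 \<le> b \<and> b \<le> int k"] U0 U1 U2
    unfolding balance_eq using U3 by (smt (z3))
qed

lemma U_replicate: "U (replicate k a) = max 0 (int k * a)"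
proof (induction k)
  case (Suc k)
  have "a + int k * a = int (Suc k) * a" by (simp add: algebra_simps)
  moreover have "max (max 0 (int k * a)) (int (Suc k) * a) = max 0 (int (Suc k) * a)"
  proof (cases "a \<ge> 0")
    case True
    then show ?thesis by (auto simp: algebra_simps)
  next
    case False
    then have "int k * a \<le> 0" by (simp add: mult_nonneg_nonpos)
    then show ?thesis by auto
  qed
  ultimately show ?case using Suc by (simp add: sum_list_replicate)
qed simp

text \<open>Read from the right, the walk climbs to \<open>k\<close>, follows the input from there
  and finally descends by \<open>k\<close>. The interval from 0 to \<open>k\<close> is covered in
  any case, so the range is at most \<open>k\<close> iff the walk stays inside: the input must not
  rise above its start, not sink by more than \<open>k\<close>, and not end below its start.\<close>

lemma dyck_iff_rng:
  "dyck k x \<longleftrightarrow> rng (replicate k (- 1) @ steps_of x @ replicate k 1) \<le> int k"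
proof -
  have [simp]: "neg (replicate k a) = replicate k (- a)" for a by (simp add: neg_def)
  show ?thesis
    unfolding dyck_iff_U rng_def
    using U_ge[of "steps_of x"] U_ge[of "neg (steps_of x)"]
    by (auto simp: U_append U_replicate sum_list_replicate)
qed

section \<open>Multiply controlled reflections\<close>

type_synonym 'v lits = "('v \<times> bool) list"

definition holds :: "('v \<Rightarrow> bool) \<Rightarrow> 'v lits \<Rightarrow> bool" where
  "holds st ls \<longleftrightarrow> (\<forall>(v, s) \<in> set ls. st v = s)"

lemma holds_simps [simp]: "holds st []" "holds st ((v, s) # ls) \<longleftrightarrow> st v = s \<and> holds st ls"
  "holds st (ls @ ls') \<longleftrightarrow> holds st ls \<and> holds st ls'"
  by (auto simp: holds_def)

lemma holds_cong: "(\<And>v. v \<in> fst ` set ls \<Longrightarrow> st v = st' v) \<Longrightarrow> holds st ls = holds st' ls"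
  unfolding holds_def by force

text \<open>States are functions on basis numbers rather than vectors. A gate with one target then
  only combines the values at \<open>b\<close> and \<open>flip_bit q b\<close>.\<close>

definition ap :: "nat lits \<Rightarrow> nat \<Rightarrow> (bool \<Rightarrow> bool \<Rightarrow> complex) \<Rightarrow> (nat \<Rightarrow> complex) \<Rightarrow> nat \<Rightarrow> complex" where
  "ap ls q M \<psi> b = (if holds (bit b) ls
     then M (bit b q) (bit b q) * \<psi> b + M (bit b q) (\<not> bit b q) * \<psi> (flip_bit q b) else \<psi> b)"

lemma flip_flip [simp]: "flip_bit q (flip_bit q b) = (b :: nat)"
  by (rule bit_eqI) (auto simp: bit_flip_bit_iff)

lemma flip_commute: "flip_bit q (flip_bit r b) = flip_bit r (flip_bit q (b :: nat))"
  by (rule bit_eqI) (auto simp: bit_flip_bit_iff)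

lemma bit_flip: "bit (flip_bit q b) v \<longleftrightarrow> (if v = q then \<not> bit b v else bit b v)" for b :: nat
  by (auto simp: bit_flip_bit_iff)

lemma less_exp_iff: "b < 2 ^ m \<longleftrightarrow> (\<forall>i \<ge> m. \<not> bit b i)" for b :: nat
proof
  assume "b < 2 ^ m"
  then show "\<forall>i \<ge> m. \<not> bit b i"
    by (metis bit_take_bit_iff not_less take_bit_nat_eq_self)
next
  assume "\<forall>i \<ge> m. \<not> bit b i"
  then have "take_bit m b = b" by (intro bit_eqI) (metis bit_take_bit_iff not_less)
  then show "b < 2 ^ m" by (metis take_bit_nat_less_exp)
qed

lemma flip_less [simp]: "q < m \<Longrightarrow> flip_bit q b < 2 ^ m \<longleftrightarrow> b < 2 ^ m" for b :: nat
  unfolding less_exp_iff by (auto simp: bit_flip)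

lemma flip_neq [simp]: "flip_bit q b \<noteq> (b :: nat)" "b \<noteq> flip_bit q b"
  by (metis bit_flip)+

lemma holds_flip: "q \<notin> fst ` set ls \<Longrightarrow> holds (bit (flip_bit q b)) ls = holds (bit (b :: nat)) ls"
  by (rule holds_cong) (auto simp: bit_flip)

section \<open>Elementary gates as local maps on amplitudes\<close>

definition mat1 :: "(bool \<Rightarrow> bool \<Rightarrow> complex) \<Rightarrow> complex mat" where
  "mat1 M = mat 2 2 (\<lambda>(i, j). M (i = 1) (j = 1))"

text \<open>In \<open>subindex [v, q]\<close> the control \<open>v\<close> is the low bit, so its
  value is the parity of the index, and \<open>2 \<le> i\<close> is the value of the target.\<close>

definition mat2 :: "bool \<Rightarrow> (bool \<Rightarrow> bool \<Rightarrow> complex) \<Rightarrow> complex mat" where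
  "mat2 s M = mat 4 4 (\<lambda>(i, j). if odd i \<noteq> odd j then 0
     else if odd i = s then M (2 \<le> i) (2 \<le> j) else of_bool (i = j))"

fun gate1 :: "nat lits \<Rightarrow> nat \<Rightarrow> (bool \<Rightarrow> bool \<Rightarrow> complex) \<Rightarrow> gate" where
  "gate1 [] q M = ([q], mat1 M)"
| "gate1 ((v, s) # _) q M = ([v, q], mat2 s M)"

lemma subindex1: "subindex [q] b = of_bool (bit b q)"
  by (simp add: subindex_def)

lemma subindex2: "subindex [v, q] b = of_bool (bit b v) + 2 * of_bool (bit b q)"
  by (simp add: subindex_def)

lemma sum_two:
  fixes f :: "nat \<Rightarrow> complex"
  assumes "r < 2 ^ m" "q < m" "\<And>c. c < 2 ^ m \<Longrightarrow> c \<noteq> r \<Longrightarrow> c \<noteq> flip_bit q r \<Longrightarrow> f c = 0"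
  shows "(\<Sum>c = 0..<2 ^ m. f c) = f r + f (flip_bit q r)"
proof -
  have "(\<Sum>c = 0..<2 ^ m. f c) = (\<Sum>c \<in> {r, flip_bit q r}. f c)"
    using assms by (intro sum.mono_neutral_right) auto
  also have "\<dots> = f r + f (flip_bit q r)" by (subst sum.insert) auto
  finally show ?thesis .
qed

lemma gate_mat_mult:
  assumes "q < m" and "\<And>r c. r < 2 ^ m \<Longrightarrow> c < 2 ^ m \<Longrightarrow> gate_mat m g $$ (r, c) =
      (if c = r then (if holds (bit r) ls then M (bit r q) (bit r q) else 1)
       else if c = flip_bit q r \<and> holds (bit r) ls then M (bit r q) (\<not> bit r q) else 0)"
  shows "gate_mat m g *\<^sub>v vec (2 ^ m) \<psi> = vec (2 ^ m) (ap ls q M \<psi>)"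
proof (rule eq_vecI)
  fix r assume "r < dim_vec (vec (2 ^ m) (ap ls q M \<psi>))"
  then have r: "r < 2 ^ m" by simp
  obtain qs V where g: "g = (qs, V)" by force
  have "(gate_mat m g *\<^sub>v vec (2 ^ m) \<psi>) $ r = (\<Sum>c = 0..<2 ^ m. gate_mat m g $$ (r, c) * \<psi> c)"
    using r by (simp add: scalar_prod_def g gate_mat_def)
  also have "\<dots> = gate_mat m g $$ (r, r) * \<psi> r + gate_mat m g $$ (r, flip_bit q r) * \<psi> (flip_bit q r)"
    using r assms by (intro sum_two) auto
  also have "\<dots> = ap ls q M \<psi> r"
    using r assms by (simp add: ap_def)
  finally show "(gate_mat m g *\<^sub>v vec (2 ^ m) \<psi>) $ r = vec (2 ^ m) (ap ls q M \<psi>) $ r" using r by simp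
qed (simp add: gate_mat_def split: prod.splits)

lemma eq_or_flip:
  assumes "r < 2 ^ m" "c < 2 ^ m" "\<And>i. i < m \<Longrightarrow> i \<noteq> q \<Longrightarrow> bit r i = bit c i"
  shows "c = r \<or> c = flip_bit q (r :: nat)"
proof (cases "bit r q = bit c q")
  case True
  have "c = r"
  proof (rule bit_eqI)
    fix i show "bit c i = bit r i"
      using assms True unfolding less_exp_iff by (cases "i < m"; cases "i = q") auto
  qed
  then show ?thesis ..
next
  case False
  have "c = flip_bit q r"
  proof (rule bit_eqI)
    fix i show "bit c i = bit (flip_bit q r) i"
      using assms False unfolding less_exp_iff bit_flip by (cases "i < m"; cases "i = q") auto
  qed
  then show ?thesis ..
qed

lemma gate1_mult:
  assumes "q < m" "length ls \<le> 1" "fst ` set ls \<subseteq> {..<m} - {q}"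
  shows "gate_mat m (gate1 ls q M) *\<^sub>v vec (2 ^ m) \<psi> = vec (2 ^ m) (ap ls q M \<psi>)"
proof (rule gate_mat_mult[OF assms(1)])
  fix r c :: nat assume rc: "r < 2 ^ m" "c < 2 ^ m"
  show "gate_mat m (gate1 ls q M) $$ (r, c) =
      (if c = r then (if holds (bit r) ls then M (bit r q) (bit r q) else 1)
       else if c = flip_bit q r \<and> holds (bit r) ls then M (bit r q) (\<not> bit r q) else 0)"
  proof (cases ls)
    case Nil
    show ?thesis
    proof (cases "\<forall>i<m. i \<noteq> q \<longrightarrow> bit r i = bit c i")
      case True
      then consider "c = r" | "c = flip_bit q r" using eq_or_flip[OF rc] by blast
      then show ?thesis using Nil rc assms(1)
        by cases (simp_all add: gate_mat_def mat1_def subindex1 bit_flip)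
    next
      case False
      then have "c \<noteq> r" "c \<noteq> flip_bit q r" by (auto simp: bit_flip)
      then show ?thesis using Nil rc False by (auto simp: gate_mat_def)
    qed
  next
    case (Cons l ls')
    then obtain v s where ls: "ls = [(v, s)]" using assms(2) by (cases l) auto
    have v: "v < m" "v \<noteq> q" using assms ls by auto
    show ?thesis
    proof (cases "(\<forall>i<m. i \<noteq> q \<longrightarrow> bit r i = bit c i)")
      case True
      then consider "c = r" | "c = flip_bit q r" using eq_or_flip[OF rc] by blast
      then show ?thesis using ls rc v assms(1)
        by cases (auto simp: gate_mat_def mat2_def subindex2 bit_flip)
    next
      case False
      then have n: "c \<noteq> r" "c \<noteq> flip_bit q r" by (auto simp: bit_flip)
      show ?thesis
      proof (cases "(\<forall>i<m. i \<noteq> q \<and> i \<noteq> v \<longrightarrow> bit r i = bit c i)")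
        case True
        then have "bit r v \<noteq> bit c v" using False by auto
        then show ?thesis using n ls rc by (auto simp: gate_mat_def mat2_def subindex2)
      next
        case False
        then show ?thesis using n ls rc by (auto simp: gate_mat_def)
      qed
    qed
  qed
qed

definition unit2 :: "(bool \<Rightarrow> bool \<Rightarrow> complex) \<Rightarrow> bool" where
  "unit2 M \<longleftrightarrow> (\<forall>i j. cnj (M True i) * M True j + cnj (M False i) * M False j = of_bool (i = j))"

lemma mat_adjoint_index:
  "i < dim_col A \<Longrightarrow> j < dim_row A \<Longrightarrow> mat_adjoint A $$ (i, j) = cnj ((A :: complex mat) $$ (j, i))"
  by (simp add: mat_adjoint_def mat_of_rows_index)

lemma unitaryI:
  assumes "A \<in> carrier_mat d d"
    "\<And>i j. i < d \<Longrightarrow> j < d \<Longrightarrow> (\<Sum>k = 0..<d. cnj (A $$ (k, i)) * A $$ (k, j)) = of_bool (i = j)"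
  shows "unitary A"
proof -
  have d: "dim_row A = d" "dim_col A = d" using assms by auto
  have ad: "dim_row (mat_adjoint A) = d" "dim_col (mat_adjoint A) = d" using d by (auto simp: mat_adjoint_def)
  have "mat_adjoint A * A = 1\<^sub>m d"
  proof (rule eq_matI)
    fix i j assume "i < dim_row (1\<^sub>m d :: complex mat)" "j < dim_col (1\<^sub>m d :: complex mat)"
    then have ij: "i < d" "j < d" by auto
    then have "(mat_adjoint A * A) $$ (i, j) = (\<Sum>k = 0..<d. mat_adjoint A $$ (i, k) * A $$ (k, j))"
      using d ad by (simp add: scalar_prod_def)
    also have "\<dots> = (\<Sum>k = 0..<d. cnj (A $$ (k, i)) * A $$ (k, j))"
      using d ij by (intro sum.cong) (auto simp: mat_adjoint_index)
    finally show "(mat_adjoint A * A) $$ (i, j) = 1\<^sub>m d $$ (i, j)" using assms(2) ij by simp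
  qed (use d ad in auto)
  then show ?thesis using d by (simp add: unitary_def)
qed

lemma gate1_elementary:
  assumes "q < m" "length ls \<le> 1" "fst ` set ls \<subseteq> {..<m} - {q}" "unit2 M"
  shows "elementary_gate m (gate1 ls q M)"
proof (cases ls)
  case Nil
  have "unitary (mat1 M)"
  proof (rule unitaryI[of _ 2])
    fix i j :: nat assume "i < 2" "j < 2"
    then show "(\<Sum>k = 0..<2. cnj (mat1 M $$ (k, i)) * mat1 M $$ (k, j)) = of_bool (i = j)"
      using assms(4)[unfolded unit2_def, rule_format, of "i = 1" "j = 1"]
      by (auto simp: mat1_def numeral_2_eq_2 less_Suc_eq add.commute)
  qed (simp add: mat1_def)
  then show ?thesis using Nil assms by (auto simp: elementary_gate_def mat1_def)
next
  case (Cons l ls')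
  then obtain v s where ls: "ls = [(v, s)]" using assms(2) by (cases l) auto
  have u: "cnj (M True i) * M True j + cnj (M False i) * M False j = of_bool (i = j)" for i j
    using assms(4) unfolding unit2_def by blast
  have u': "cnj (M False i) * M False j + cnj (M True i) * M True j = of_bool (i = j)" for i j
    using u[of i j] by (simp add: add.commute)
  have "unitary (mat2 s M)"
  proof (rule unitaryI[of _ 4])
    fix i j :: nat assume ij: "i < 4" "j < 4"
    have "{0..<4} = {0, 1, 2, 3 :: nat}" by auto
    moreover from ij have "i = 0 \<or> i = 1 \<or> i = 2 \<or> i = 3" "j = 0 \<or> j = 1 \<or> j = 2 \<or> j = 3" by auto
    ultimately show "(\<Sum>k = 0..<4. cnj (mat2 s M $$ (k, i)) * mat2 s M $$ (k, j)) = of_bool (i = j)"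
      by (cases s) (auto simp: mat2_def u u')
  qed (simp add: mat2_def)
  then show ?thesis using ls assms by (auto simp: elementary_gate_def mat2_def)
qed

text \<open>The power of exponent \<open>\<alpha>\<close> of the NOT matrix: eigenvalue 1 on the
  symmetric vector and \<open>cis (pi * \<alpha>)\<close> on the antisymmetric one.\<close>

definition XP :: "real \<Rightarrow> bool \<Rightarrow> bool \<Rightarrow> complex" where
  "XP \<alpha> i j = (if i = j then 1 + cis (pi * \<alpha>) else 1 - cis (pi * \<alpha>)) / 2"

text \<open>The reflection whose fixed vector has angle \<open>\<theta> / 2\<close>. Angle 0 gives a
  sign on the value 1, \<open>pi\<close> a sign on the value 0, \<open>pi / 2\<close> the NOT gate
  and \<open>pi / 4\<close> the Hadamard gate.\<close>

definition RF :: "real \<Rightarrow> bool \<Rightarrow> bool \<Rightarrow> complex" where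
  "RF \<theta> i j = of_real (if i = j then (if i then - cos \<theta> else cos \<theta>) else sin \<theta>)"

lemma unit2_XP: "unit2 (XP \<alpha>)"
proof -
  let ?e = "cis (pi * \<alpha>)"
  have e: "cnj ?e * ?e = 1" by (simp add: cis_cnj cis_mult)
  have "4 * (cnj (XP \<alpha> True i) * XP \<alpha> True j + cnj (XP \<alpha> False i) * XP \<alpha> False j) = 4 * of_bool (i = j)" for i j
    using e by (cases i; cases j) (simp_all add: XP_def field_simps)
  then have "cnj (XP \<alpha> True i) * XP \<alpha> True j + cnj (XP \<alpha> False i) * XP \<alpha> False j = of_bool (i = j)" for i j
    by (metis mult_left_cancel zero_neq_numeral)
  then show ?thesis unfolding unit2_def by blast
qed

lemma unit2_RF: "unit2 (RF \<theta>)"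
proof -
  have "complex_of_real (cos \<theta>) * cos \<theta> + complex_of_real (sin \<theta>) * sin \<theta> = 1"
    by (metis of_real_1 of_real_add of_real_mult power2_eq_square sin_cos_squared_add2)
  then show ?thesis by (auto simp: unit2_def RF_def algebra_simps)
qed

definition mm :: "(bool \<Rightarrow> bool \<Rightarrow> complex) \<Rightarrow> (bool \<Rightarrow> bool \<Rightarrow> complex) \<Rightarrow> bool \<Rightarrow> bool \<Rightarrow> complex" where
  "mm M N i j = M i False * N False j + M i True * N True j"

lemma ap_ap:
  assumes "q \<notin> fst ` set ls"
  shows "ap ls q M (ap ls q N \<psi>) = ap ls q (mm M N) \<psi>"
proof
  fix b
  show "ap ls q M (ap ls q N \<psi>) b = ap ls q (mm M N) \<psi> b"
    using holds_flip[OF assms, of b]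
    by (cases "bit b q") (auto simp: ap_def mm_def bit_flip algebra_simps)
qed

lemma XP_mult: "mm (XP \<alpha>) (XP \<beta>) = XP (\<alpha> + \<beta>)"
proof (intro ext)
  fix i j
  have "cis (pi * (\<alpha> + \<beta>)) = cis (pi * \<alpha>) * cis (pi * \<beta>)" by (simp add: cis_mult algebra_simps)
  then show "mm (XP \<alpha>) (XP \<beta>) i j = XP (\<alpha> + \<beta>) i j"
    by (cases i; cases j) (simp_all add: XP_def mm_def field_simps)
qed

lemma ap_XP0: "ap ls q (XP 0) \<psi> = \<psi>"
  by (rule ext) (simp add: ap_def XP_def)

lemma ap_XP1: "ap ls q (XP 1) \<psi> b = (if holds (bit b) ls then \<psi> (flip_bit q b) else \<psi> b)"
  by (simp add: ap_def XP_def)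

text \<open>The square-root construction of multiply controlled gates, which needs no auxiliary
  qubits. The number of gates triples with each control, but no more than 10 controls will
  occur.\<close>

fun mcx :: "nat lits \<Rightarrow> nat \<Rightarrow> real \<Rightarrow> gate list" where
  "mcx [] q \<alpha> = [gate1 [] q (XP \<alpha>)]"
| "mcx (l # ls) q \<alpha> = gate1 [l] q (XP (\<alpha> / 2)) # mcx ls (fst l) 1 @
     gate1 [l] q (XP (- \<alpha> / 2)) # mcx ls (fst l) 1 @ mcx ls q (\<alpha> / 2)"

definition run_gates :: "nat \<Rightarrow> gate list \<Rightarrow> complex vec \<Rightarrow> complex vec" where
  "run_gates m gs v = fold (\<lambda>g u. gate_mat m g *\<^sub>v u) gs v"

lemma run_gates_simps [simp]: "run_gates m [] v = v"
  "run_gates m (g # gs) v = run_gates m gs (gate_mat m g *\<^sub>v v)"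
  "run_gates m (gs @ hs) v = run_gates m hs (run_gates m gs v)"
  by (simp_all add: run_gates_def)

text \<open>If \<open>ls\<close> fails, nothing toggles \<open>l\<close>, and the first two roots
  cancel. If \<open>ls\<close> and \<open>l\<close> hold, the inverse root is skipped and the other
  two multiply. If only \<open>ls\<close> holds, the toggle enables the inverse root, which the last
  root cancels.\<close>

lemma mcx_correct:
  assumes "q < m" "distinct (q # map fst ls)" "fst ` set ls \<subseteq> {..<m}"
  shows "run_gates m (mcx ls q \<alpha>) (vec (2 ^ m) \<psi>) = vec (2 ^ m) (ap ls q (XP \<alpha>) \<psi>)"
  using assms
proof (induction ls arbitrary: q \<alpha> \<psi>)
  case Nil
  then show ?case by (simp only: mcx.simps run_gates_simps) (subst gate1_mult, auto)
next
  case (Cons l ls)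
  obtain v s where l: "l = (v, s)" by force
  have *: "q < m" "v < m" "v \<noteq> q" "q \<notin> fst ` set ls" "v \<notin> fst ` set ls" "distinct (map fst ls)"
    "fst ` set ls \<subseteq> {..<m}" using Cons.prems l by auto
  define A where "A = ap [l] q (XP (\<alpha> / 2)) \<psi>"
  define B where "B = ap ls v (XP 1) A"
  define C where "C = ap [l] q (XP (- \<alpha> / 2)) B"
  define D where "D = ap ls v (XP 1) C"
  define E where "E = ap ls q (XP (\<alpha> / 2)) D"
  have g: "gate_mat m (gate1 [l] q (XP \<beta>)) *\<^sub>v vec (2 ^ m) \<phi> = vec (2 ^ m) (ap [l] q (XP \<beta>) \<phi>)" for \<beta> \<phi>
    by (rule gate1_mult) (use * l in auto)
  have run: "run_gates m (mcx (l # ls) q \<alpha>) (vec (2 ^ m) \<psi>) = vec (2 ^ m) E"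
  proof -
    have IH: "run_gates m (mcx ls v 1) (vec (2 ^ m) \<phi>) = vec (2 ^ m) (ap ls v (XP 1) \<phi>)"
      "run_gates m (mcx ls q \<beta>) (vec (2 ^ m) \<phi>) = vec (2 ^ m) (ap ls q (XP \<beta>) \<phi>)" for \<beta> \<phi>
      using Cons.IH * by auto
    have v: "fst l = v" using l by simp
    show ?thesis
      unfolding E_def D_def C_def B_def A_def mcx.simps run_gates_simps g v IH ..
  qed
  have hf: "holds (bit (flip_bit v b)) ls = holds (bit b) ls" "holds (bit (flip_bit q b)) ls = holds (bit b) ls"
    for b :: nat using * holds_flip by auto
  have comp: "ap ks q (XP \<beta>) (ap ks q (XP \<gamma>) \<phi>) = ap ks q (XP (\<beta> + \<gamma>)) \<phi>" if "q \<notin> fst ` set ks" for ks \<beta> \<gamma> \<phi>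
    using ap_ap[OF that] XP_mult by simp
  have "E b = ap (l # ls) q (XP \<alpha>) \<psi> b" for b
  proof (cases "holds (bit b) ls")
    case False
    have D: "D b' = C b'" "B b' = A b'" if "\<not> holds (bit b') ls" for b'
      using that by (auto simp: D_def B_def ap_XP1)
    have "C b = ap [l] q (XP (- \<alpha> / 2)) A b"
      using D(2)[OF False] D(2)[of "flip_bit q b"] False hf by (simp add: C_def ap_def)
    also have "\<dots> = \<psi> b" unfolding A_def by (subst comp) (use * l in \<open>auto simp: ap_XP0\<close>)
    finally have "C b = \<psi> b" .
    then show ?thesis using False D(1)[OF False] l by (simp add: E_def ap_def)
  next
    case True
    have D: "D b' = C (flip_bit v b')" "B b' = A (flip_bit v b')" if "holds (bit b') ls" for b'
      using that by (auto simp: D_def B_def ap_XP1)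
    have on: "holds (bit (flip_bit v b')) [l] \<longleftrightarrow> \<not> holds (bit b') [l]" for b' :: nat
      using l by (auto simp: bit_flip)
    have onq: "holds (bit (flip_bit q b')) [l] \<longleftrightarrow> holds (bit b') [l]" for b' :: nat
      using l * by (auto simp: bit_flip)
    have E: "E b = XP (\<alpha> / 2) (bit b q) (bit b q) * C (flip_bit v b)
        + XP (\<alpha> / 2) (bit b q) (\<not> bit b q) * C (flip_bit v (flip_bit q b))"
      using True D(1)[OF True] D(1)[of "flip_bit q b"] hf by (simp add: E_def ap_def)
    show ?thesis
    proof (cases "holds (bit b) [l]")
      case l1: True
      have "C (flip_bit v b') = A b'" if "holds (bit b') ls" "holds (bit b') [l]" for b'
        using that on[of b'] D(2)[of "flip_bit v b'"] hf by (simp add: C_def ap_def)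
      then have "E b = ap [l] q (XP (\<alpha> / 2)) A b"
        using E True l1 onq hf by (simp add: ap_def)
      also have "\<dots> = ap [l] q (XP \<alpha>) \<psi> b" unfolding A_def by (subst comp) (use * l in auto)
      finally show ?thesis using True l1 l by (simp add: ap_def)
    next
      case l0: False
      have A: "A b' = \<psi> b'" if "\<not> holds (bit b') [l]" for b' using that by (simp add: A_def ap_def)
      have "C (flip_bit v b') = XP (- \<alpha> / 2) (bit b' q) (bit b' q) * \<psi> b' + XP (- \<alpha> / 2) (bit b' q) (\<not> bit b' q) * \<psi> (flip_bit q b')"
        if "holds (bit b') ls" "\<not> holds (bit b') [l]" for b'
      proof -
        have q: "bit (flip_bit v b') q = bit b' q" using * by (simp add: bit_flip)
        have "B (flip_bit v b') = \<psi> b'" using D(2)[of "flip_bit v b'"] hf that A by simp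
        moreover have "B (flip_bit q (flip_bit v b')) = \<psi> (flip_bit q b')"
          using D(2)[of "flip_bit q (flip_bit v b')"] hf that A[of "flip_bit q b'"] onq[of b']
          by (simp add: flip_commute[of v q])
        ultimately show ?thesis using that on[of b'] q by (simp add: C_def ap_def)
      qed
      then have "E b = ap [] q (XP (\<alpha> / 2)) (ap [] q (XP (- \<alpha> / 2)) \<psi>) b"
        using E True l0 onq hf by (simp add: ap_def)
      also have "\<dots> = \<psi> b" by (subst comp) (auto simp: ap_XP0)
      finally show ?thesis using l0 l by (simp add: ap_def)
    qed
  qed
  then show ?case unfolding run by (intro eq_vecI) auto
qed

lemma length_mcx: "length (mcx ls q \<alpha>) \<le> 2 * 3 ^ length ls - 1"
proof (induction ls arbitrary: q \<alpha>)
  case (Cons l ls)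
  have "1 \<le> (3 :: nat) ^ length ls" by simp
  moreover have "length (mcx ls q (\<alpha> / 2)) \<le> 2 * 3 ^ length ls - 1"
    "length (mcx ls (fst l) 1) \<le> 2 * 3 ^ length ls - 1" by (rule Cons)+
  moreover have "length (mcx (l # ls) q \<alpha>) = 2 + 2 * length (mcx ls (fst l) 1) + length (mcx ls q (\<alpha> / 2))"
    by simp
  moreover have "(3 :: nat) ^ length (l # ls) = 3 * 3 ^ length ls" by simp
  ultimately show ?case by linarith
qed simp

text \<open>Only the inner NOT is controlled. The outer reflections are involutions and cancel when
  the control fails.\<close>

definition refl :: "nat lits \<times> nat \<times> real \<Rightarrow> gate list" where
  "refl = (\<lambda>(ls, q, \<theta>). gate1 [] q (RF (\<theta> / 2 + pi / 4)) # mcx ls q 1 @ [gate1 [] q (RF (\<theta> / 2 + pi / 4))])"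

definition cr :: "nat lits \<times> nat \<times> real \<Rightarrow> (nat \<Rightarrow> complex) \<Rightarrow> nat \<Rightarrow> complex" where
  "cr = (\<lambda>(ls, q, \<theta>). ap ls q (RF \<theta>))"

definition wf_refl :: "nat \<Rightarrow> nat lits \<times> nat \<times> real \<Rightarrow> bool" where
  "wf_refl m = (\<lambda>(ls, q, \<theta>). q < m \<and> distinct (q # map fst ls) \<and> fst ` set ls \<subseteq> {..<m})"

lemma RF_RF: "mm (RF \<theta>) (RF \<theta>) = XP 0"
proof (intro ext)
  fix i j
  have "complex_of_real (cos \<theta>) * cos \<theta> + complex_of_real (sin \<theta>) * sin \<theta> = 1"
    by (metis of_real_1 of_real_add of_real_mult power2_eq_square sin_cos_squared_add2)
  then show "mm (RF \<theta>) (RF \<theta>) i j = XP 0 i j"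
    by (cases i; cases j) (simp_all add: mm_def RF_def XP_def algebra_simps)
qed

text \<open>Conjugating the reflection of angle \<open>\<pi> / 2\<close> (the NOT gate) by that of angle \<open>a\<close> gives the one of
  angle \<open>2 a - \<pi> / 2\<close>.\<close>

lemma RF_conj: "mm (RF (\<theta> / 2 + pi / 4)) (mm (XP 1) (RF (\<theta> / 2 + pi / 4))) = RF \<theta>"
proof (intro ext)
  fix i j
  let ?a = "\<theta> / 2 + pi / 4"
  have a: "2 * ?a = \<theta> + pi / 2" by (simp add: field_simps)
  have c: "cos \<theta> = 2 * sin ?a * cos ?a" using sin_double[of ?a] unfolding a by (simp add: sin_add)
  have s: "sin \<theta> = sin ?a * sin ?a - cos ?a * cos ?a"
    using cos_double[of ?a] unfolding a by (simp add: cos_add power2_eq_square)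
  show "mm (RF ?a) (mm (XP 1) (RF ?a)) i j = RF \<theta> i j"
    unfolding mm_def XP_def using c s by (cases i; cases j) (simp_all add: RF_def)
qed

lemma refl_correct:
  assumes "wf_refl m g"
  shows "run_gates m (refl g) (vec (2 ^ m) \<psi>) = vec (2 ^ m) (cr g \<psi>)"
proof -
  obtain ls q \<theta> where g: "g = (ls, q, \<theta>)" by (metis prod_cases3)
  have *: "q < m" "distinct (q # map fst ls)" "fst ` set ls \<subseteq> {..<m}" "q \<notin> fst ` set ls"
    using assms by (auto simp: g wf_refl_def)
  let ?R = "RF (\<theta> / 2 + pi / 4)"
  have 1: "gate_mat m (gate1 [] q ?R) *\<^sub>v vec (2 ^ m) \<phi> = vec (2 ^ m) (ap [] q ?R \<phi>)" for \<phi>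
    by (rule gate1_mult) (use * in auto)
  have "ap [] q ?R (ap ls q (XP 1) (ap [] q ?R \<psi>)) b = ap ls q (RF \<theta>) \<psi> b" for b
  proof (cases "holds (bit b) ls")
    case True
    have "ap [] q ?R (ap ls q (XP 1) (ap [] q ?R \<psi>)) b = ap [] q ?R (ap [] q (XP 1) (ap [] q ?R \<psi>)) b"
      using True holds_flip[OF *(4), of b] by (simp add: ap_def)
    also have "\<dots> = ap [] q (RF \<theta>) \<psi> b" by (simp add: ap_ap RF_conj)
    finally show ?thesis using True by (simp add: ap_def)
  next
    case False
    have "ap [] q ?R (ap ls q (XP 1) (ap [] q ?R \<psi>)) b = ap [] q ?R (ap [] q ?R \<psi>) b"
      using False holds_flip[OF *(4), of b] by (simp add: ap_def)
    also have "\<dots> = \<psi> b" by (simp add: ap_ap RF_RF ap_XP0)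
    finally show ?thesis using False by (simp add: ap_def)
  qed
  then have "ap [] q ?R (ap ls q (XP 1) (ap [] q ?R \<psi>)) = ap ls q (RF \<theta>) \<psi>" by (rule ext)
  then show ?thesis
    unfolding refl_def g prod.case run_gates_simps 1 mcx_correct[OF *(1-3)] cr_def by simp
qed

lemma refl_gates:
  assumes "wf_refl m (ls, q, \<theta>)" "g \<in> set (refl (ls, q, \<theta>))"
  shows "elementary_gate m g" "set (fst g) \<subseteq> insert q (fst ` set ls)"
proof -
  have R: "elementary_gate m (gate1 [] q (RF \<beta>))" for \<beta>
    by (rule gate1_elementary) (use assms in \<open>auto simp: wf_refl_def unit2_RF\<close>)
  have M: "g \<in> set (mcx ls q \<alpha>) \<Longrightarrow> q < m \<Longrightarrow> distinct (q # map fst ls) \<Longrightarrow> fst ` set ls \<subseteq> {..<m} \<Longrightarrow>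
    elementary_gate m g \<and> set (fst g) \<subseteq> insert q (fst ` set ls)" for g \<alpha>
  proof (induction ls arbitrary: q \<alpha>)
    case Nil
    then show ?case using gate1_elementary[of q m "[]" "XP \<alpha>"] unit2_XP by auto
  next
    case (Cons l ls)
    obtain v s where l: "l = (v, s)" by force
    have e: "elementary_gate m (gate1 [l] q (XP \<beta>))" for \<beta>
      by (rule gate1_elementary) (use Cons l in \<open>auto simp: unit2_XP\<close>)
    from Cons.prems(1) consider \<beta> where "g = gate1 [l] q (XP \<beta>)" | "g \<in> set (mcx ls (fst l) 1)"
      | "g \<in> set (mcx ls q (\<alpha> / 2))" by auto
    then show ?case
    proof cases
      case 1
      then show ?thesis using e l by auto
    next
      case 2
      from Cons.IH[OF 2] Cons.prems show ?thesis by auto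
    next
      case 3
      from Cons.IH[OF 3] Cons.prems show ?thesis by auto
    qed
  qed
  show "elementary_gate m g" "set (fst g) \<subseteq> insert q (fst ` set ls)"
    using assms R M[of g] by (auto simp: refl_def wf_refl_def)
qed

lemma length_refl: "length (refl (ls, q, \<theta>)) \<le> 2 * 3 ^ length ls + 1"
proof -
  have "1 \<le> (3 :: nat) ^ length ls" by simp
  moreover have "length (refl (ls, q, \<theta>)) = 2 + length (mcx ls q 1)" by (simp add: refl_def)
  ultimately show ?thesis using length_mcx[of ls q 1] by linarith
qed

section \<open>Linear operators on amplitude functions\<close>

definition norm2 :: "nat \<Rightarrow> (nat \<Rightarrow> complex) \<Rightarrow> real" where
  "norm2 m \<psi> = (\<Sum>b < 2 ^ m. (cmod (\<psi> b))\<^sup>2)"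

definition linop :: "((nat \<Rightarrow> complex) \<Rightarrow> nat \<Rightarrow> complex) \<Rightarrow> bool" where
  "linop F \<longleftrightarrow> (\<forall>\<psi> \<phi> x y. F (\<lambda>b. x * \<psi> b + y * \<phi> b) = (\<lambda>b. x * F \<psi> b + y * F \<phi> b))"

lemma linopD: "linop F \<Longrightarrow> F (\<lambda>b. x * \<psi> b + y * \<phi> b) = (\<lambda>b. x * F \<psi> b + y * F \<phi> b)"
  by (simp add: linop_def)

lemma linop_scale: "linop F \<Longrightarrow> F (\<lambda>b. x * \<psi> b) = (\<lambda>b. x * F \<psi> b)"
  using linopD[of F x \<psi> 0 \<psi>] by simp

lemma linop_add: "linop F \<Longrightarrow> F (\<lambda>b. \<psi> b + \<phi> b) = (\<lambda>b. F \<psi> b + F \<phi> b)"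
  using linopD[of F 1 \<psi> 1 \<phi>] by simp

lemma linop_comp: "linop F \<Longrightarrow> linop G \<Longrightarrow> linop (F \<circ> G)"
  by (simp add: linop_def)

lemma linop_cr: "linop (cr g)"
  unfolding linop_def cr_def ap_def by (auto simp: fun_eq_iff algebra_simps split: prod.splits)

lemma linop_perm: "linop (\<lambda>\<psi>. \<psi> \<circ> f)"
  by (auto simp: linop_def)

lemma cr_cr: "wf_refl m g \<Longrightarrow> cr g (cr g \<psi>) = \<psi>"
  by (cases g) (simp add: cr_def wf_refl_def ap_ap RF_RF ap_XP0)

lemma norm2_perm:
  assumes "\<And>b. b < 2 ^ m \<Longrightarrow> f b < 2 ^ m" "\<And>b. f (f b) = b"
  shows "norm2 m (\<psi> \<circ> f) = norm2 m \<psi>"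
  unfolding norm2_def comp_def
  by (rule sum.reindex_bij_witness[of _ f f]) (use assms in auto)

lemma norm2_cr:
  assumes "wf_refl m g"
  shows "norm2 m (cr g \<psi>) = norm2 m \<psi>"
proof -
  obtain ls q \<theta> where g: "g = (ls, q, \<theta>)" by (metis prod_cases3)
  have q: "q < m" "q \<notin> fst ` set ls" using assms by (auto simp: g wf_refl_def)
  let ?\<phi> = "cr g \<psi>" and ?f = "flip_bit q"
  have two: "2 * norm2 m \<phi> = (\<Sum>b < 2 ^ m. (cmod (\<phi> b))\<^sup>2 + (cmod (\<phi> (?f b)))\<^sup>2)" for \<phi>
  proof -
    have "norm2 m (\<phi> \<circ> ?f) = norm2 m \<phi>" by (rule norm2_perm) (use q in auto)
    then show ?thesis by (simp add: norm2_def sum.distrib comp_def)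
  qed
  have rot: "(cmod (of_real (cos \<theta>) * x + of_real (sin \<theta>) * y))\<^sup>2 + (cmod (of_real (sin \<theta>) * x - of_real (cos \<theta>) * y))\<^sup>2
      = (cmod x)\<^sup>2 + (cmod y)\<^sup>2" for x y
  proof -
    have "(cmod (of_real a * x + of_real b * y))\<^sup>2 + (cmod (of_real b * x - of_real a * y))\<^sup>2
      = (a\<^sup>2 + b\<^sup>2) * ((cmod x)\<^sup>2 + (cmod y)\<^sup>2)" for a b :: real
      unfolding cmod_power2 by (simp add: power2_eq_square algebra_simps)
    from this[of "cos \<theta>" "sin \<theta>"] show ?thesis by simp
  qed
  have "(cmod (?\<phi> b))\<^sup>2 + (cmod (?\<phi> (?f b)))\<^sup>2 = (cmod (\<psi> b))\<^sup>2 + (cmod (\<psi> (?f b)))\<^sup>2" for b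
    using holds_flip[OF q(2), of b] rot[of "\<psi> b" "\<psi> (?f b)"] rot[of "\<psi> (?f b)" "\<psi> b"]
    by (cases "bit b q") (simp_all add: g cr_def ap_def RF_def bit_flip algebra_simps)
  then have "2 * norm2 m ?\<phi> = 2 * norm2 m \<psi>" unfolding two by (intro sum.cong) auto
  then show ?thesis by simp
qed

section \<open>AND-OR programs\<close>

text \<open>A program evaluates a game-like AND-OR formula whose positions are the states of its variables.
  \<open>Asg t ls\<close> adds the conjunction \<open>ls\<close> to \<open>t\<close>; \<open>Ch q z ls k p\<close> is, at the positions with \<open>ls\<close>, an AND
  (\<open>k\<close>) or OR (\<open>\<not> k\<close>) over the two values of the fresh variable \<open>q\<close>, with weights \<open>p\<close> and \<open>1 - p\<close>. The
  polarity \<open>pl\<close> exchanges AND and OR. The value of a leaf is that of \<open>lv\<close>.\<close>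

datatype 'v instr = Asg 'v "'v lits" | Qry | Ch 'v 'v "'v lits" bool real

text \<open>\<open>ev P st v c\<close>: the position \<open>st\<close> has value \<open>v\<close>, and the squared norm of a witness is at most \<open>c\<close>.\<close>

inductive ev :: "'v \<Rightarrow> 'v \<Rightarrow> 'v \<Rightarrow> (('v \<Rightarrow> bool) \<Rightarrow> bool) \<Rightarrow> 'v instr list \<Rightarrow> ('v \<Rightarrow> bool) \<Rightarrow> bool \<Rightarrow> real \<Rightarrow> bool"
  for pl lv an orc where
  ev_Nil: "1 \<le> c \<Longrightarrow> v = st lv \<Longrightarrow> ev pl lv an orc [] st v c"
| ev_Asg: "ev pl lv an orc P (st(t := (st t \<noteq> holds st ls))) v c \<Longrightarrow> ev pl lv an orc (Asg t ls # P) st v c"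
| ev_Qry: "ev pl lv an orc P (st(an := (st an \<noteq> orc st))) v c \<Longrightarrow> ev pl lv an orc (Qry # P) st v c"
| ev_Skip: "\<not> holds st ls \<Longrightarrow> ev pl lv an orc P st v c \<Longrightarrow> ev pl lv an orc (Ch q z ls k p # P) st v c"
| ev_All: "holds st ls \<Longrightarrow> v = (k \<noteq> st pl) \<Longrightarrow> 0 \<le> p \<Longrightarrow> p \<le> 1 \<Longrightarrow> ev pl lv an orc P st v c0 \<Longrightarrow>
    ev pl lv an orc P (st(q := True)) v c1 \<Longrightarrow> p * c0 + (1 - p) * c1 \<le> c \<Longrightarrow> ev pl lv an orc (Ch q z ls k p # P) st v c"
| ev_One0: "holds st ls \<Longrightarrow> v \<noteq> (k \<noteq> st pl) \<Longrightarrow> 0 < p \<Longrightarrow> p \<le> 1 \<Longrightarrow> ev pl lv an orc P st v c0 \<Longrightarrow>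
    c0 / p \<le> c \<Longrightarrow> ev pl lv an orc (Ch q z ls k p # P) st v c"
| ev_One1: "holds st ls \<Longrightarrow> v \<noteq> (k \<noteq> st pl) \<Longrightarrow> 0 \<le> p \<Longrightarrow> p < 1 \<Longrightarrow> ev pl lv an orc P (st(q := True)) v c1 \<Longrightarrow>
    c1 / (1 - p) \<le> c \<Longrightarrow> ev pl lv an orc (Ch q z ls k p # P) st v c"

fun writes :: "'v \<Rightarrow> 'v instr list \<Rightarrow> 'v set" where
  "writes an [] = {}"
| "writes an (Asg t ls # P) = insert t (writes an P)"
| "writes an (Qry # P) = insert an (writes an P)"
| "writes an (Ch q z ls k p # P) = insert q (insert z (writes an P))"

fun chvars :: "'v instr list \<Rightarrow> 'v set" where
  "chvars [] = {}"
| "chvars (Ch q z ls k p # P) = insert q (insert z (chvars P))"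
| "chvars (_ # P) = chvars P"

text \<open>The qubit that marks the unwanted component after the pass through \<open>P\<close>.
  Every choice merges the older flag with its own rejected component into its new qubit
  \<open>z\<close>.\<close>

fun flag :: "'v \<Rightarrow> 'v instr list \<Rightarrow> 'v" where
  "flag f [] = f"
| "flag f (Ch q z ls k p # P) = z"
| "flag f (_ # P) = flag f P"

text \<open>The control variables are kept apart: \<open>X\<close> contains the final flag, \<open>act\<close> and \<open>rt\<close>.\<close>

fun wf_prog :: "'v \<Rightarrow> 'v \<Rightarrow> 'v set \<Rightarrow> 'v instr list \<Rightarrow> bool" where
  "wf_prog pl an X [] \<longleftrightarrow> True"
| "wf_prog pl an X (Asg t ls # P) \<longleftrightarrow> distinct (t # map fst ls) \<and> t \<notin> chvars P \<and> t \<notin> X \<and> wf_prog pl an X P"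
| "wf_prog pl an X (Qry # P) \<longleftrightarrow> an \<notin> chvars P \<and> an \<notin> X \<and> wf_prog pl an X P"
| "wf_prog pl an X (Ch q z ls k p # P) \<longleftrightarrow> distinct (q # z # pl # map fst ls) \<and> fst ` set ls \<inter> (X \<union> chvars P) = {} \<and>
     pl \<notin> X \<and> pl \<notin> chvars P \<and> q \<notin> X \<and> z \<notin> X \<and> q \<notin> writes an P \<and> z \<notin> writes an P \<and> wf_prog pl an X P"

datatype op = R "nat lits \<times> nat \<times> real" | Q

text \<open>Instructions occur in reverse order because the pass runs from the leaves to the root.
  With \<open>sg\<close>, the component rejected at a choice gets the sign -1 where the choice acts
  as an AND under the current polarity. There a rejected component arises only for the value False,
  at an OR only for True, so that the sign always agrees with the value.\<close>

fun bwo :: "nat \<Rightarrow> nat \<Rightarrow> nat \<Rightarrow> bool \<Rightarrow> nat \<Rightarrow> nat instr list \<Rightarrow> op list" where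
  "bwo pl act rt sg f [] = []"
| "bwo pl act rt sg f (Asg t ls # P) = bwo pl act rt sg f P @ [R (ls, t, pi / 2)]"
| "bwo pl act rt sg f (Qry # P) = bwo pl act rt sg f P @ [Q]"
| "bwo pl act rt sg f (Ch q z ls k p # P) = bwo pl act rt sg f P @ [R ((flag f P, False) # ls, q, arccos (sqrt p))] @
     (if sg then [R ((act, True) # (rt, False) # (flag f P, False) # (pl, \<not> k) # ls, q, 0)] else []) @
     [R ([(q, True)], z, pi / 2), R ([(flag f P, True), (q, False)], z, pi / 2)]"

fun run1 :: "bool list \<Rightarrow> op \<Rightarrow> (nat \<Rightarrow> complex) \<Rightarrow> nat \<Rightarrow> complex" where
  "run1 x (R g) \<psi> = cr g \<psi>"
| "run1 x Q \<psi> = \<psi> \<circ> query_basis x"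

definition run :: "bool list \<Rightarrow> op list \<Rightarrow> (nat \<Rightarrow> complex) \<Rightarrow> nat \<Rightarrow> complex" where
  "run x = fold (run1 x)"

lemma run_simps [simp]: "run x [] \<psi> = \<psi>" "run x (g # gs) \<psi> = run x gs (run1 x g \<psi>)"
  "run x (gs @ hs) \<psi> = run x hs (run x gs \<psi>)"
  by (simp_all add: run_def)

definition ket :: "nat \<Rightarrow> nat \<Rightarrow> complex" where "ket b b' = of_bool (b' = b)"

definition asg :: "nat lits \<Rightarrow> nat \<Rightarrow> nat \<Rightarrow> nat" where
  "asg ls t b = (if holds (bit b) ls then flip_bit t b else b)"

lemma cr_not: "cr (ls, t, pi / 2) \<psi> = \<psi> \<circ> asg ls t"
  by (rule ext) (simp add: cr_def ap_def RF_def asg_def)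

lemma asg_asg: "t \<notin> fst ` set ls \<Longrightarrow> asg ls t (asg ls t b) = b"
  by (simp add: asg_def holds_flip)

lemma bit_asg: "bit (asg ls t b) v = (if v = t then bit b v \<noteq> holds (bit b) ls else bit b v)"
  by (auto simp: asg_def bit_flip)

lemma asg_less: "t < m \<Longrightarrow> asg ls t b < 2 ^ m \<longleftrightarrow> b < 2 ^ m"
  by (simp add: asg_def)

lemma linop_run1: "linop (run1 x g)"
  by (cases g) (use linop_cr linop_perm in \<open>auto simp: linop_def\<close>)

lemma linop_run: "linop (run x gs)"
proof (induction gs)
  case (Cons g gs)
  have "run x (g # gs) = run x gs \<circ> run1 x g" by (rule ext) simp
  then show ?case using linop_comp[OF Cons linop_run1[of x g]] by (simp only:)
qed (simp add: linop_def)

lemma cr_fix: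
  assumes "\<And>b. \<psi> b \<noteq> 0 \<Longrightarrow> \<not> holds (bit b) ls" "q \<notin> fst ` set ls"
  shows "cr (ls, q, \<theta>) \<psi> = \<psi>"
proof
  fix b
  show "cr (ls, q, \<theta>) \<psi> b = \<psi> b"
  proof (cases "holds (bit b) ls")
    case True
    then have "\<psi> b = 0" "\<psi> (flip_bit q b) = 0"
      using assms(1)[of b] assms(1)[of "flip_bit q b"] holds_flip[OF assms(2), of b] by auto
    then show ?thesis by (simp add: cr_def ap_def)
  qed (simp add: cr_def ap_def)
qed

lemma cr_plane:
  assumes "holds (bit b) ls" "q \<notin> fst ` set ls" "\<not> bit b q"
  shows "cr (ls, q, \<theta>) (\<lambda>b'. x * ket b b' + y * ket (flip_bit q b) b') =
    (\<lambda>b'. (x * cos \<theta> + y * sin \<theta>) * ket b b' + (x * sin \<theta> - y * cos \<theta>) * ket (flip_bit q b) b')"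
proof
  fix b'
  have "flip_bit q b' = b \<longleftrightarrow> b' = flip_bit q b" "flip_bit q b' = flip_bit q b \<longleftrightarrow> b' = b"
    by (metis flip_flip)+
  then show "cr (ls, q, \<theta>) (\<lambda>b'. x * ket b b' + y * ket (flip_bit q b) b') b' =
    (x * cos \<theta> + y * sin \<theta>) * ket b b' + (x * sin \<theta> - y * cos \<theta>) * ket (flip_bit q b) b'"
    using assms holds_flip[OF assms(2), of b]
    by (auto simp: cr_def ap_def ket_def RF_def bit_flip algebra_simps)
qed

lemma query_basis_invol: "query_basis x (query_basis x b) = b"
proof -
  have "take_bit a (flip_bit a b) = take_bit a b" for a by (rule bit_eqI) (auto simp: bit_take_bit_iff bit_flip)
  then show ?thesis by (simp add: query_basis_def Let_def)
qed

definition reads :: "bool list \<Rightarrow> (nat \<Rightarrow> bool) \<Rightarrow> bool" where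
  "reads x st = (let i = horner_sum of_bool 2 (map st [0..<ceillog2 (length x)]) in i < length x \<and> x ! i)"

lemma query_basis_reads:
  "query_basis x b = (if reads x (bit b) then flip_bit (ceillog2 (length x)) b else b)"
  by (simp add: query_basis_def reads_def Let_def horner_sum_bit_eq_take_bit)

fun fits :: "nat \<Rightarrow> nat instr list \<Rightarrow> bool" where
  "fits m [] \<longleftrightarrow> True"
| "fits m (Asg t ls # P) \<longleftrightarrow> t < m \<and> fst ` set ls \<subseteq> {..<m} \<and> fits m P"
| "fits m (Qry # P) \<longleftrightarrow> fits m P"
| "fits m (Ch q z ls k p # P) \<longleftrightarrow> q < m \<and> z < m \<and> fst ` set ls \<subseteq> {..<m} \<and> fits m P"

lemma flag_cases: "flag f P = f \<or> flag f P \<in> chvars P"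
  by (induction P rule: chvars.induct) auto

lemma chvars_writes: "chvars P \<subseteq> writes an P"
  by (induction P rule: chvars.induct) auto

lemma fits_chvars: "fits m P \<Longrightarrow> chvars P \<subseteq> {..<m}"
  by (induction P rule: chvars.induct) auto

definition agree :: "nat set \<Rightarrow> nat \<Rightarrow> nat \<Rightarrow> bool" where
  "agree W b b' \<longleftrightarrow> (\<forall>v. v \<notin> W \<longrightarrow> bit b v = bit b' v)"

definition sgn_of :: "bool \<Rightarrow> complex" where "sgn_of v = (if v then 1 else - 1)"

text \<open>The controls of the two NOTs exclude each other, so \<open>z\<close> is toggled exactly
  if \<open>q\<close> or \<open>F\<close> is set.\<close>

lemma flag_shift:
  fixes b :: nat
  assumes "q < m" "z < m" "\<not> bit b q" "\<not> bit b z" "\<not> bit b F" "q \<noteq> z" "F \<noteq> q" "F \<noteq> z" "z \<notin> W"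
  defines "a \<equiv> asg [(q, True)] z \<circ> asg [(F, True), (q, False)] z"
  shows "ket b (a b') = ket b b'"
    and "(\<And>b'. \<eta> b' \<noteq> 0 \<Longrightarrow> b' < 2 ^ m \<and> agree (insert q W) b' b \<and> (bit b' F \<or> bit b' q)) \<Longrightarrow>
      (\<eta> \<circ> a) b' \<noteq> 0 \<Longrightarrow> b' < 2 ^ m \<and> agree (insert q (insert z W)) b' b \<and> bit b' z"
proof -
  have "a b = b" using assms by (simp add: a_def asg_def)
  moreover have "a b' = b \<Longrightarrow> b' = b"
  proof -
    assume "a b' = b"
    then have "asg [(F, True), (q, False)] z (asg [(q, True)] z b) = b'"
      using assms by (auto simp: a_def asg_asg)
    then show "b' = b" using assms by (simp add: asg_def)
  qed
  ultimately show "ket b (a b') = ket b b'" by (auto simp: ket_def)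
next
  assume \<eta>: "\<And>b'. \<eta> b' \<noteq> 0 \<Longrightarrow> b' < 2 ^ m \<and> agree (insert q W) b' b \<and> (bit b' F \<or> bit b' q)"
    and nz: "(\<eta> \<circ> a) b' \<noteq> 0"
  have less: "a b' < 2 ^ m \<longleftrightarrow> b' < 2 ^ m" using assms by (simp add: a_def asg_less)
  have ag: "bit (a b') w = bit b' w" if "w \<noteq> z" for w using that by (auto simp: a_def bit_asg)
  have az: "bit (a b') z = (bit b' z \<noteq> (bit b' q \<or> bit b' F))" using assms by (auto simp: a_def bit_asg)
  have e: "a b' < 2 ^ m" "agree (insert q W) (a b') b" "bit (a b') F \<or> bit (a b') q"
    using \<eta>[of "a b'"] nz by auto
  have "bit (a b') z = bit b z" using e assms by (auto simp: agree_def)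
  then have "bit b' z" using az e(3) ag[of F] ag[of q] assms by auto
  then show "b' < 2 ^ m \<and> agree (insert q (insert z W)) b' b \<and> bit b' z"
    using e less ag unfolding agree_def by (metis insert_iff)
qed

text \<open>One level of the bottom-up pass through the formula: on the main component the reflection maps the
  combination of the children to the parent; its other output is flagged by \<open>z\<close>.\<close>

lemma choice_level:
  fixes b :: nat and \<eta> :: "nat \<Rightarrow> complex"
  assumes q: "q < m" "z < m" and b: "b < 2 ^ m" "\<not> bit b q" "\<not> bit b z" "\<not> bit b F"
    and d: "distinct (q # z # pl # map fst ls)" "F \<notin> fst ` set ls" "F \<noteq> q" "F \<noteq> z" "F \<noteq> pl"
      "act \<notin> {q, z, pl, F}" "rt \<notin> {q, z, pl, F}" "act \<notin> fst ` set ls" "rt \<notin> fst ` set ls"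
    and H: "holds (bit b) ls"
    and \<eta>: "\<And>b'. \<eta> b' \<noteq> 0 \<Longrightarrow> b' < 2 ^ m \<and> agree (insert q W) b' b \<and> bit b' F" and W: "z \<notin> W"
    and x: "x * cos \<theta> + y * sin \<theta> = 1" "r = x * sin \<theta> - y * cos \<theta>"
    and v: "v = (k \<noteq> bit b pl) \<Longrightarrow> r = 0"
  defines "A \<equiv> R ((F, False) # ls, q, \<theta>)"
    and "Z \<equiv> R ((act, True) # (rt, False) # (F, False) # (pl, \<not> k) # ls, q, 0)"
    and "B \<equiv> [R ([(q, True)], z, pi / 2), R ([(F, True), (q, False)], z, pi / 2)]"
  shows "\<exists>\<eta>'. (\<forall>b'. \<eta>' b' \<noteq> 0 \<longrightarrow> b' < 2 ^ m \<and> agree (insert q (insert z W)) b' b \<and> bit b' z) \<and>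
    run X (A # B) (\<lambda>b'. x * ket b b' + y * ket (flip_bit q b) b' + \<eta> b') = (\<lambda>b'. ket b b' + \<eta>' b') \<and>
    (bit b act \<and> \<not> bit b rt \<longrightarrow>
     run X (A # Z # B) (\<lambda>b'. x * ket b b' + y * ket (flip_bit q b) b' + sgn_of v * \<eta> b') = (\<lambda>b'. ket b b' + sgn_of v * \<eta>' b'))"
proof -
  let ?b1 = "flip_bit q b"
  have qls: "q \<notin> fst ` set ls" using d by auto
  define a where "a = asg [(q, True)] z \<circ> asg [(F, True), (q, False)] z"
  define \<eta>' where "\<eta>' = (\<lambda>b'. r * ket ?b1 b' + \<eta> b') \<circ> a"
  have runB: "run X B \<psi> = \<psi> \<circ> a" for \<psi>
    unfolding B_def a_def by (simp add: cr_not fun_eq_iff)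
  have ketb: "ket b (a b') = ket b b'" for b'
    unfolding a_def by (rule flag_shift) (use q b d W in auto)
  have fixA: "cr ((F, False) # ls, q, \<theta>) (\<lambda>b'. s * \<eta> b') = (\<lambda>b'. s * \<eta> b')" for s
    by (rule cr_fix) (use \<eta> qls d in auto)
  have stepA: "run1 X A (\<lambda>b'. x * ket b b' + y * ket ?b1 b' + s * \<eta> b') = (\<lambda>b'. ket b b' + r * ket ?b1 b' + s * \<eta> b')" for s
  proof -
    have "cr ((F, False) # ls, q, \<theta>) (\<lambda>b'. x * ket b b' + y * ket ?b1 b') = (\<lambda>b'. ket b b' + r * ket ?b1 b')"
      by (subst cr_plane) (use b H qls d x in auto)
    then show ?thesis unfolding A_def run1.simps using linop_add[OF linop_cr] fixA by simp
  qed
  have supp: "b' < 2 ^ m \<and> agree (insert q (insert z W)) b' b \<and> bit b' z" if "\<eta>' b' \<noteq> 0" for b'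
  proof (rule flag_shift(2)[of q m z b F W])
    show "((\<lambda>b'. r * ket ?b1 b' + \<eta> b') \<circ> (asg [(q, True)] z \<circ> asg [(F, True), (q, False)] z)) b' \<noteq> 0"
      using that unfolding \<eta>'_def a_def .
    fix b' assume "r * ket ?b1 b' + \<eta> b' \<noteq> 0"
    then have "b' = ?b1 \<or> \<eta> b' \<noteq> 0" by (auto simp: ket_def)
    then show "b' < 2 ^ m \<and> agree (insert q W) b' b \<and> (bit b' F \<or> bit b' q)"
      using \<eta>[of b'] b q by (auto simp: agree_def bit_flip)
  qed (use q b d W in auto)
  have un: "run X (A # B) (\<lambda>b'. x * ket b b' + y * ket ?b1 b' + \<eta> b') = (\<lambda>b'. ket b b' + \<eta>' b')"
    using stepA[of 1] by (simp add: runB \<eta>'_def ketb comp_def add.assoc)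
  have si: "run X (A # Z # B) (\<lambda>b'. x * ket b b' + y * ket ?b1 b' + sgn_of v * \<eta> b') = (\<lambda>b'. ket b b' + sgn_of v * \<eta>' b')"
    if act: "bit b act" "\<not> bit b rt"
  proof -
    let ?ls = "(act, True) # (rt, False) # (F, False) # (pl, \<not> k) # ls"
    have qz: "q \<notin> fst ` set ?ls" using d by auto
    have "cr (?ls, q, 0) (\<lambda>b'. ket b b' + r * ket ?b1 b') = (\<lambda>b'. ket b b' + sgn_of v * r * ket ?b1 b')"
    proof (cases "v = (k \<noteq> bit b pl)")
      case True
      have "cr (?ls, q, 0) (\<lambda>b'. ket b b') = (\<lambda>b'. ket b b')"
      proof
        fix b'
        show "cr (?ls, q, 0) (\<lambda>b'. ket b b') b' = ket b b'"
          using b by (auto simp: cr_def ap_def RF_def ket_def)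
      qed
      then show ?thesis using True v by simp
    next
      case nv: False
      show ?thesis
      proof (cases v)
        case True
        have "cr (?ls, q, 0) (\<lambda>b'. ket b b' + r * ket ?b1 b') = (\<lambda>b'. ket b b' + r * ket ?b1 b')"
        proof (rule cr_fix[OF _ qz])
          fix b' assume "ket b b' + r * ket ?b1 b' \<noteq> 0"
          then have "b' = b \<or> b' = ?b1" by (auto simp: ket_def)
          then have "bit b' pl = bit b pl" using d by (auto simp: bit_flip)
          then show "\<not> holds (bit b') ?ls" using nv True by auto
        qed
        then show ?thesis using True by (simp add: sgn_of_def)
      next
        case False
        have "holds (bit b) ?ls" using H act b nv False by auto
        from cr_plane[OF this qz b(2), of 0 1 r] show ?thesis using False by (simp add: sgn_of_def)
      qed
    qed
    moreover have "cr (?ls, q, 0) (\<lambda>b'. sgn_of v * \<eta> b') = (\<lambda>b'. sgn_of v * \<eta> b')"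
      by (rule cr_fix[OF _ qz]) (use \<eta> in auto)
    ultimately have "run1 X Z (\<lambda>b'. ket b b' + r * ket ?b1 b' + sgn_of v * \<eta> b')
        = (\<lambda>b'. ket b b' + sgn_of v * r * ket ?b1 b' + sgn_of v * \<eta> b')"
      unfolding Z_def run1.simps using linop_add[OF linop_cr] by simp
    then have "run X (A # Z # B) (\<lambda>b'. x * ket b b' + y * ket ?b1 b' + sgn_of v * \<eta> b')
        = (\<lambda>b'. ket b b' + sgn_of v * r * ket ?b1 b' + sgn_of v * \<eta> b') \<circ> a"
      by (simp only: run_simps(2) stepA runB)
    then show ?thesis by (simp add: \<eta>'_def ketb comp_def algebra_simps)
  qed
  show ?thesis using supp un si by blast
qed

text \<open>The rotation and the sign are blocked, on \<open>b\<close> by \<open>ls\<close> and on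
  \<open>\<eta>\<close> by the flag. All that happens is that the flag moves on from
  \<open>F\<close> to \<open>z\<close>.\<close>

lemma skip_level:
  fixes b :: nat and \<eta> :: "nat \<Rightarrow> complex" and \<theta> :: real and k :: bool
  assumes q: "q < m" "z < m" and b: "\<not> bit b q" "\<not> bit b z" "\<not> bit b F"
    and d: "distinct (q # z # pl # map fst ls)" "F \<noteq> q" "F \<noteq> z" "F \<noteq> pl" "F \<notin> fst ` set ls"
      "act \<notin> {q, z, pl, F}" "rt \<notin> {q, z, pl, F}"
    and H: "\<not> holds (bit b) ls" and W: "q \<notin> W" "z \<notin> W"
    and \<eta>: "\<And>b'. \<eta> b' \<noteq> 0 \<Longrightarrow> b' < 2 ^ m \<and> agree W b' b \<and> bit b' F"
  defines "A \<equiv> R ((F, False) # ls, q, \<theta>)"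
    and "Z \<equiv> R ((act, True) # (rt, False) # (F, False) # (pl, \<not> k) # ls, q, 0)"
    and "B \<equiv> [R ([(q, True)], z, pi / 2), R ([(F, True), (q, False)], z, pi / 2)]"
  shows "\<exists>\<eta>'. (\<forall>b'. \<eta>' b' \<noteq> 0 \<longrightarrow> b' < 2 ^ m \<and> agree (insert q (insert z W)) b' b \<and> bit b' z) \<and>
    (\<forall>s. run X (A # B) (\<lambda>b'. ket b b' + s * \<eta> b') = (\<lambda>b'. ket b b' + s * \<eta>' b')) \<and>
    (bit b act \<and> \<not> bit b rt \<longrightarrow>
      (\<forall>s. run X (A # Z # B) (\<lambda>b'. ket b b' + s * \<eta> b') = (\<lambda>b'. ket b b' + s * \<eta>' b')))"
proof -
  define a where "a = asg [(q, True)] z \<circ> asg [(F, True), (q, False)] z"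
  have runB: "run X B \<psi> = \<psi> \<circ> a" for \<psi>
    unfolding B_def a_def by (simp add: cr_not fun_eq_iff)
  have ketb: "ket b (a b') = ket b b'" for b'
    unfolding a_def by (rule flag_shift) (use q b d W in auto)
  have nh: "\<not> holds (bit b') ((F, False) # ls)" if "ket b b' + s * \<eta> b' \<noteq> 0" for b' s
    using that \<eta>[of b'] H by (cases "\<eta> b' = 0"; cases "b' = b") (auto simp: ket_def)
  have A: "run1 X A (\<lambda>b'. ket b b' + s * \<eta> b') = (\<lambda>b'. ket b b' + s * \<eta> b')" for s
    unfolding A_def run1.simps by (rule cr_fix) (use nh[where s = s] d in auto)
  have Z: "run1 X Z (\<lambda>b'. ket b b' + s * \<eta> b') = (\<lambda>b'. ket b b' + s * \<eta> b')" if "bit b act" "\<not> bit b rt" for s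
    unfolding Z_def run1.simps by (rule cr_fix) (use nh[where s = s] d in auto)
  have "b' < 2 ^ m \<and> agree (insert q (insert z W)) b' b \<and> bit b' z" if "(\<eta> \<circ> a) b' \<noteq> 0" for b'
    by (rule flag_shift(2)[of q m z b F W \<eta> b', folded a_def])
      (use q b d W that \<eta> in \<open>auto simp: agree_def\<close>)
  then show ?thesis using A Z
    by (intro exI[of _ "\<eta> \<circ> a"]) (auto simp: runB ketb comp_def)
qed

lemma perm_level:
  assumes "\<And>b. a (a b) = b" "\<And>b. b < 2 ^ m \<Longrightarrow> a b < 2 ^ m" "\<And>b w. w \<noteq> t \<Longrightarrow> bit (a b) w = bit b w"
    and "\<And>b'. \<eta> b' \<noteq> 0 \<Longrightarrow> b' < 2 ^ m \<and> agree W b' (a b) \<and> bit b' F" "F \<noteq> t"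
  shows "(\<eta> \<circ> a) b' \<noteq> 0 \<Longrightarrow> b' < 2 ^ m \<and> agree (insert t W) b' b \<and> bit b' F"
    and "(\<lambda>b'. ket (a b) b' + s * \<eta> b') \<circ> a = (\<lambda>b'. ket b b' + s * (\<eta> \<circ> a) b')"
proof -
  assume nz: "(\<eta> \<circ> a) b' \<noteq> 0"
  then have e: "a b' < 2 ^ m" "agree W (a b') (a b)" "bit (a b') F" using assms(4)[of "a b'"] by auto
  have "b' < 2 ^ m" using assms(1)[of b'] assms(2)[OF e(1)] by simp
  moreover have "agree (insert t W) b' b" using e(2) assms(3) unfolding agree_def by (metis insert_iff)
  moreover have "bit b' F" using e(3) assms(3)[OF assms(5)] by simp
  ultimately show "b' < 2 ^ m \<and> agree (insert t W) b' b \<and> bit b' F" by blast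
next
  have "a b' = a b \<longleftrightarrow> b' = b" for b' using assms(1) by metis
  then show "(\<lambda>b'. ket (a b) b' + s * \<eta> b') \<circ> a = (\<lambda>b'. ket b b' + s * (\<eta> \<circ> a) b')"
    by (auto simp: ket_def fun_eq_iff)
qed

lemma wf_prog_chvars: "wf_prog pl an X P \<Longrightarrow> chvars P \<inter> X = {}"
  by (induction P rule: chvars.induct) auto

text \<open>Both passes start from the same \<open>wit\<close>. That their flagged parts differ by
  the sign of \<open>v\<close> is the property that the walk exploits.\<close>

definition witnessed :: "nat \<Rightarrow> bool list \<Rightarrow> nat \<Rightarrow> nat \<Rightarrow> nat \<Rightarrow> nat \<Rightarrow> nat \<Rightarrow> nat \<Rightarrow> nat instr list \<Rightarrow> nat \<Rightarrow> bool \<Rightarrow> real \<Rightarrow> bool" where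
  "witnessed m x pl lv an act rt f P b v c \<longleftrightarrow> (\<exists>wit \<eta>. norm2 m wit \<le> c \<and>
     (\<forall>b'. wit b' \<noteq> 0 \<longrightarrow> b' < 2 ^ m \<and> agree (writes an P) b' b \<and> bit b' lv = v) \<and>
     (\<forall>b'. \<eta> b' \<noteq> 0 \<longrightarrow> b' < 2 ^ m \<and> agree (writes an P) b' b \<and> bit b' (flag f P)) \<and>
     run x (bwo pl act rt False f P) wit = (\<lambda>b'. ket b b' + \<eta> b') \<and>
     (bit b act \<and> \<not> bit b rt \<longrightarrow> run x (bwo pl act rt True f P) wit = (\<lambda>b'. ket b b' + sgn_of v * \<eta> b')))"

lemma witnessed_perm:
  assumes w: "witnessed m x pl lv an act rt f P (a b) v c"
    and a: "\<And>b. a (a b) = b" "\<And>b. b < 2 ^ m \<Longrightarrow> a b < 2 ^ m" "\<And>b w. w \<noteq> t \<Longrightarrow> bit (a b) w = bit b w"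
    and F: "flag f P \<noteq> t" "act \<noteq> t" "rt \<noteq> t"
    and W: "writes an (i # P) = insert t (writes an P)" "flag f (i # P) = flag f P"
    and o: "\<And>sg. bwo pl act rt sg f (i # P) = bwo pl act rt sg f P @ [g]" "\<And>\<psi>. run1 x g \<psi> = \<psi> \<circ> a"
  shows "witnessed m x pl lv an act rt f (i # P) b v c"
proof -
  from w obtain wit \<eta> where 1: "norm2 m wit \<le> c"
     and 2: "\<And>b'. wit b' \<noteq> 0 \<Longrightarrow> b' < 2 ^ m \<and> agree (writes an P) b' (a b) \<and> bit b' lv = v"
     and 3: "\<And>b'. \<eta> b' \<noteq> 0 \<Longrightarrow> b' < 2 ^ m \<and> agree (writes an P) b' (a b) \<and> bit b' (flag f P)"
     and 4: "run x (bwo pl act rt False f P) wit = (\<lambda>b'. ket (a b) b' + \<eta> b')"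
     and 5: "bit (a b) act \<and> \<not> bit (a b) rt \<Longrightarrow>
       run x (bwo pl act rt True f P) wit = (\<lambda>b'. ket (a b) b' + sgn_of v * \<eta> b')"
    unfolding witnessed_def by blast
  note p = perm_level[of a m t \<eta> "writes an P" b "flag f P", OF a 3 F(1)]
  have ag: "agree (insert t (writes an P)) b' b" if "agree (writes an P) b' (a b)" for b'
    using that a(3) unfolding agree_def by (metis insert_iff)
  have "bit (a b) act = bit b act" "bit (a b) rt = bit b rt" using a(3) F by auto
  then show ?thesis
    unfolding witnessed_def W o(1) run_simps o(2)
    using 1 2 p(1) p(2)[of 1] p(2)[of "sgn_of v"] 4 5 ag
    by (intro exI[of _ wit] exI[of _ "\<eta> \<circ> a"]) auto
qed

lemma norm2_scale: "norm2 m (\<lambda>b. x * w b) = (cmod x)\<^sup>2 * norm2 m w"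
  by (simp add: norm2_def norm_mult power_mult_distrib sum_distrib_left)

lemma arccos_sqrt:
  assumes "0 \<le> p" "p \<le> 1"
  shows "cos (arccos (sqrt p)) = sqrt p" "sin (arccos (sqrt p)) = sqrt (1 - p)"
proof -
  have p: "- 1 \<le> sqrt p" "sqrt p \<le> 1" using assms order_trans[of "- 1" 0 "sqrt p"] by auto
  show "cos (arccos (sqrt p)) = sqrt p" using p by simp
  show "sin (arccos (sqrt p)) = sqrt (1 - p)" using p assms by (simp add: sin_arccos)
qed

context
  fixes m :: nat and x :: "bool list" and pl lv an act rt f :: nat and X :: "nat set"
  assumes an: "an = ceillog2 (length x)" "an < m"
    and X: "{f, act, rt} \<subseteq> X" "distinct [f, act, rt]"
begin

text \<open>\<open>a0\<close> and \<open>a1\<close> are the amplitudes given to the witnesses of the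
  two children. The first equation normalises the component on the parent; the second one makes the
  rejected component vanish where both children are needed.\<close>

lemma witnessed_choice:
  fixes b :: nat
  assumes wf: "wf_prog pl an X (Ch q z ls k p # P)" "fits m (Ch q z ls k p # P)"
    and b: "b < 2 ^ m" "\<And>w. w \<in> chvars (Ch q z ls k p # P) \<Longrightarrow> \<not> bit b w" "\<not> bit b f"
    and H: "holds (bit b) ls" and p: "0 \<le> p" "p \<le> 1"
    and w0: "a0 \<noteq> 0 \<Longrightarrow> witnessed m x pl lv an act rt f P b v c0"
    and w1: "a1 \<noteq> 0 \<Longrightarrow> witnessed m x pl lv an act rt f P (flip_bit q b) v c1"
    and a: "(a0 :: real) * sqrt p + a1 * sqrt (1 - p) = 1"
      "v = (k \<noteq> bit b pl) \<Longrightarrow> a0 * sqrt (1 - p) = a1 * sqrt p"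
      "a0\<^sup>2 * c0 + a1\<^sup>2 * c1 \<le> c"
  shows "witnessed m x pl lv an act rt f (Ch q z ls k p # P) b v c"
proof -
  let ?b1 = "flip_bit q b" and ?F = "flag f P" and ?W = "writes an P"
  \<comment> \<open>A child of amplitude 0 may have no witness at all; the zero vector then takes
    its place.\<close>
  have "\<exists>wit \<eta>. norm2 m (\<lambda>b'. of_real a0 * wit b') \<le> a0\<^sup>2 * c0 \<and>
     (\<forall>b'. wit b' \<noteq> 0 \<longrightarrow> b' < 2 ^ m \<and> agree ?W b' b \<and> bit b' lv = v) \<and>
     (\<forall>b'. \<eta> b' \<noteq> 0 \<longrightarrow> b' < 2 ^ m \<and> agree ?W b' b \<and> bit b' ?F) \<and>
     (\<lambda>b'. of_real a0 * run x (bwo pl act rt False f P) wit b') = (\<lambda>b'. of_real a0 * (ket b b' + \<eta> b')) \<and>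
     (bit b act \<and> \<not> bit b rt \<longrightarrow> (\<lambda>b'. of_real a0 * run x (bwo pl act rt True f P) wit b') = (\<lambda>b'. of_real a0 * (ket b b' + sgn_of v * \<eta> b')))"
  proof (cases "a0 = 0")
    case True
    then show ?thesis by (intro exI[of _ "\<lambda>_. 0"]) (simp add: norm2_def)
  next
    case False
    from w0[OF this] show ?thesis unfolding witnessed_def norm2_scale
      by (elim ex_forward) (auto intro: mult_left_mono)
  qed
  then obtain wit0 \<eta>0 where A0: "norm2 m (\<lambda>b'. of_real a0 * wit0 b') \<le> a0\<^sup>2 * c0"
     "\<And>b'. wit0 b' \<noteq> 0 \<Longrightarrow> b' < 2 ^ m \<and> agree ?W b' b \<and> bit b' lv = v"
     "\<And>b'. \<eta>0 b' \<noteq> 0 \<Longrightarrow> b' < 2 ^ m \<and> agree ?W b' b \<and> bit b' ?F"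
     "(\<lambda>b'. of_real a0 * run x (bwo pl act rt False f P) wit0 b') = (\<lambda>b'. of_real a0 * (ket b b' + \<eta>0 b'))"
     "bit b act \<and> \<not> bit b rt \<Longrightarrow> (\<lambda>b'. of_real a0 * run x (bwo pl act rt True f P) wit0 b') = (\<lambda>b'. of_real a0 * (ket b b' + sgn_of v * \<eta>0 b'))"
    by blast
  have "\<exists>wit \<eta>. norm2 m (\<lambda>b'. of_real a1 * wit b') \<le> a1\<^sup>2 * c1 \<and>
     (\<forall>b'. wit b' \<noteq> 0 \<longrightarrow> b' < 2 ^ m \<and> agree ?W b' ?b1 \<and> bit b' lv = v) \<and>
     (\<forall>b'. \<eta> b' \<noteq> 0 \<longrightarrow> b' < 2 ^ m \<and> agree ?W b' ?b1 \<and> bit b' ?F) \<and>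
     (\<lambda>b'. of_real a1 * run x (bwo pl act rt False f P) wit b') = (\<lambda>b'. of_real a1 * (ket ?b1 b' + \<eta> b')) \<and>
     (bit ?b1 act \<and> \<not> bit ?b1 rt \<longrightarrow> (\<lambda>b'. of_real a1 * run x (bwo pl act rt True f P) wit b') = (\<lambda>b'. of_real a1 * (ket ?b1 b' + sgn_of v * \<eta> b')))"
  proof (cases "a1 = 0")
    case True
    then show ?thesis by (intro exI[of _ "\<lambda>_. 0"]) (simp add: norm2_def)
  next
    case False
    from w1[OF this] show ?thesis unfolding witnessed_def norm2_scale
      by (elim ex_forward) (auto intro: mult_left_mono)
  qed
  then obtain wit1 \<eta>1 where A1: "norm2 m (\<lambda>b'. of_real a1 * wit1 b') \<le> a1\<^sup>2 * c1"
     "\<And>b'. wit1 b' \<noteq> 0 \<Longrightarrow> b' < 2 ^ m \<and> agree ?W b' ?b1 \<and> bit b' lv = v"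
     "\<And>b'. \<eta>1 b' \<noteq> 0 \<Longrightarrow> b' < 2 ^ m \<and> agree ?W b' ?b1 \<and> bit b' ?F"
     "(\<lambda>b'. of_real a1 * run x (bwo pl act rt False f P) wit1 b') = (\<lambda>b'. of_real a1 * (ket ?b1 b' + \<eta>1 b'))"
     "bit ?b1 act \<and> \<not> bit ?b1 rt \<Longrightarrow> (\<lambda>b'. of_real a1 * run x (bwo pl act rt True f P) wit1 b') = (\<lambda>b'. of_real a1 * (ket ?b1 b' + sgn_of v * \<eta>1 b'))"
    by blast
  define wit \<eta> where "wit = (\<lambda>b'. of_real a0 * wit0 b' + of_real a1 * wit1 b')"
    and "\<eta> = (\<lambda>b'. of_real a0 * \<eta>0 b' + of_real a1 * \<eta>1 b')"
  have wfP: "wf_prog pl an X P" using wf by simp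
  have chX: "chvars P \<inter> X = {}" using wf_prog_chvars[OF wfP] .
  have qz: "q < m" "z < m" "q \<notin> ?W" "z \<notin> ?W" "q \<notin> X" "z \<notin> X" "q \<noteq> z" using wf by auto
  have Fc: "?F = f \<or> ?F \<in> chvars P" by (rule flag_cases)
  have cw: "chvars P \<subseteq> ?W" by (rule chvars_writes)
  have Fb: "\<not> bit b ?F" using Fc b by auto
  have d: "?F \<notin> fst ` set ls" "?F \<noteq> q" "?F \<noteq> z" "?F \<noteq> pl"
      "act \<notin> {q, z, pl, ?F}" "rt \<notin> {q, z, pl, ?F}" "act \<notin> fst ` set ls" "rt \<notin> fst ` set ls"
    using Fc X wf chX cw by auto
  have bb: "\<not> bit b q" "\<not> bit b z" using b(2) by auto
  have bit1: "bit ?b1 act = bit b act" "bit ?b1 rt = bit b rt" using d by (auto simp: bit_flip)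
  have ag1: "agree (insert q ?W) b' b" if "agree ?W b' ?b1" for b' using that by (auto simp: agree_def bit_flip)
  have ag0: "agree (insert q ?W) b' b" if "agree ?W b' b" for b' using that by (auto simp: agree_def)
  have lin: "run x gs wit = (\<lambda>b'. of_real a0 * run x gs wit0 b' + of_real a1 * run x gs wit1 b')" for gs
    unfolding wit_def by (rule linopD[OF linop_run])
  have R0: "run x (bwo pl act rt False f P) wit = (\<lambda>b'. of_real a0 * ket b b' + of_real a1 * ket ?b1 b' + \<eta> b')"
    unfolding lin \<eta>_def using fun_cong[OF A0(4)] fun_cong[OF A1(4)] by (simp add: algebra_simps fun_eq_iff)
  have R1: "run x (bwo pl act rt True f P) wit = (\<lambda>b'. of_real a0 * ket b b' + of_real a1 * ket ?b1 b' + sgn_of v * \<eta> b')"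
    if "bit b act \<and> \<not> bit b rt"
    unfolding lin \<eta>_def using fun_cong[OF A0(5)[OF that]] fun_cong[OF A1(5)] that bit1 by (simp add: algebra_simps fun_eq_iff)
  have \<eta>s: "b' < 2 ^ m \<and> agree (insert q ?W) b' b \<and> bit b' ?F" if "\<eta> b' \<noteq> 0" for b'
    using that A0(3)[of b'] A1(3)[of b'] ag0 ag1 unfolding \<eta>_def by fastforce
  \<comment> \<open>The supports are told apart by \<open>q\<close>, which the rest of the program
    does not write. So the squared norms add up.\<close>
  have disj: "wit0 b' = 0 \<or> wit1 b' = 0" for b'
    using A0(2)[of b'] A1(2)[of b'] qz(3) bb unfolding agree_def by (metis bit_flip)
  have nrm: "norm2 m wit \<le> c"
  proof -
    have "(cmod (wit b'))\<^sup>2 = (cmod (of_real a0 * wit0 b'))\<^sup>2 + (cmod (of_real a1 * wit1 b'))\<^sup>2" for b'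
      using disj[of b'] by (auto simp: wit_def)
    then have "norm2 m wit = norm2 m (\<lambda>b'. of_real a0 * wit0 b') + norm2 m (\<lambda>b'. of_real a1 * wit1 b')"
      by (simp add: norm2_def sum.distrib)
    then show ?thesis using A0(1) A1(1) a(3) by linarith
  qed
  let ?\<theta> = "arccos (sqrt p)" and ?r = "complex_of_real (a0 * sqrt (1 - p) - a1 * sqrt p)"
  have x1: "complex_of_real a0 * complex_of_real (cos ?\<theta>) + complex_of_real a1 * complex_of_real (sin ?\<theta>) = 1"
    using a(1) arccos_sqrt[OF p] by (metis of_real_1 of_real_add of_real_mult)
  have x2: "?r = complex_of_real a0 * complex_of_real (sin ?\<theta>) - complex_of_real a1 * complex_of_real (cos ?\<theta>)"
    using arccos_sqrt[OF p] by simp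
  have x3: "?r = 0" if "v = (k \<noteq> bit b pl)" using a(2)[OF that] by simp
  have dist: "distinct (q # z # pl # map fst ls)" using wf by simp
  from choice_level[OF qz(1,2) b(1) bb Fb dist d(1-8) H \<eta>s qz(4) x1 x2 x3, where X = x]
  obtain \<eta>' where E: "\<And>b'. \<eta>' b' \<noteq> 0 \<Longrightarrow> b' < 2 ^ m \<and> agree (insert q (insert z ?W)) b' b \<and> bit b' z"
    and Eu: "run x (R ((?F, False) # ls, q, ?\<theta>) # [R ([(q, True)], z, pi / 2), R ([(?F, True), (q, False)], z, pi / 2)])
      (\<lambda>b'. of_real a0 * ket b b' + of_real a1 * ket ?b1 b' + \<eta> b') = (\<lambda>b'. ket b b' + \<eta>' b')"
    and Es: "bit b act \<and> \<not> bit b rt \<longrightarrow> run x (R ((?F, False) # ls, q, ?\<theta>) #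
        R ((act, True) # (rt, False) # (?F, False) # (pl, \<not> k) # ls, q, 0) # [R ([(q, True)], z, pi / 2), R ([(?F, True), (q, False)], z, pi / 2)])
      (\<lambda>b'. of_real a0 * ket b b' + of_real a1 * ket ?b1 b' + sgn_of v * \<eta> b') = (\<lambda>b'. ket b b' + sgn_of v * \<eta>' b')"
    by blast
  have Eu: "run x (bwo pl act rt False f (Ch q z ls k p # P)) wit = (\<lambda>b'. ket b b' + \<eta>' b')"
    unfolding bwo.simps run_simps(3) R0 using Eu by simp
  have Es: "run x (bwo pl act rt True f (Ch q z ls k p # P)) wit = (\<lambda>b'. ket b b' + sgn_of v * \<eta>' b')"
    if "bit b act \<and> \<not> bit b rt"
    unfolding bwo.simps run_simps(3) R1[OF that] using Es that by simp
  have ws: "b' < 2 ^ m \<and> agree (insert q (insert z ?W)) b' b \<and> bit b' lv = v" if "wit b' \<noteq> 0" for b'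
  proof -
    from that have "wit0 b' \<noteq> 0 \<or> wit1 b' \<noteq> 0" by (auto simp: wit_def)
    then show ?thesis using A0(2)[of b'] A1(2)[of b'] ag0 ag1 unfolding agree_def by blast
  qed
  show ?thesis unfolding witnessed_def writes.simps flag.simps
    using nrm ws E Eu Es by (intro exI[of _ wit] exI[of _ \<eta>']) blast
qed

theorem ev_witnessed:
  assumes "ev pl lv an (reads x) P st v c" "st = bit (b :: nat)" "wf_prog pl an X P" "fits m P" "b < 2 ^ m"
    "\<And>w. w \<in> chvars P \<Longrightarrow> \<not> bit b w" "\<not> bit b f"
  shows "witnessed m x pl lv an act rt f P b v c"
  using assms
proof (induction arbitrary: b rule: ev.induct)
  case (ev_Nil c v st)
  have "norm2 m (ket b) = (\<Sum>b' < 2 ^ m. of_bool (b' = b))"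
    unfolding norm2_def ket_def by (intro sum.cong) auto
  also have "\<dots> = 1" using ev_Nil by (simp add: of_bool_def sum.delta)
  finally have "norm2 m (ket b) \<le> c" using ev_Nil by simp
  then show ?case using ev_Nil unfolding witnessed_def
    by (intro exI[of _ "ket b"] exI[of _ "\<lambda>_. 0"]) (auto simp: ket_def agree_def)
next
  case (ev_Asg P st t ls v c)
  have t: "t \<notin> fst ` set ls" "t < m" "t \<notin> X" "t \<notin> chvars P" using ev_Asg.prems by auto
  have st: "st(t := (st t \<noteq> holds st ls)) = bit (asg ls t b)"
    unfolding ev_Asg.prems(1) by (auto simp: bit_asg fun_eq_iff)
  have w: "witnessed m x pl lv an act rt f P (asg ls t b) v c"
    using ev_Asg.prems t X by (intro ev_Asg.IH[OF st]) (auto simp: asg_less bit_asg)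
  have "flag f P \<noteq> t" using flag_cases[of f P] t X by auto
  with t X show ?case
    by (intro witnessed_perm[where a = "asg ls t" and t = t and g = "R (ls, t, pi / 2)"] w)
      (auto simp: asg_asg asg_less bit_asg cr_not)
next
  case (ev_Qry P st v c)
  have t: "an \<notin> X" "an \<notin> chvars P" using ev_Qry.prems by auto
  have q: "query_basis x b = (if reads x (bit b) then flip_bit an b else b)" for b
    using query_basis_reads an by simp
  have st: "st(an := (st an \<noteq> reads x st)) = bit (query_basis x b)"
    unfolding ev_Qry.prems(1) by (auto simp: q bit_flip fun_eq_iff)
  have w: "witnessed m x pl lv an act rt f P (query_basis x b) v c"
    using ev_Qry.prems t X an by (intro ev_Qry.IH[OF st]) (auto simp: q bit_flip)
  have "flag f P \<noteq> an" using flag_cases[of f P] t X by auto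
  with t X an show ?case
    by (intro witnessed_perm[where a = "query_basis x" and t = an and g = Q] w query_basis_invol)
      (auto simp: q bit_flip)
next
  case (ev_Skip st ls P v c q z k p)
  have wfP: "wf_prog pl an X P" using ev_Skip.prems by simp
  have chX: "chvars P \<inter> X = {}" using wf_prog_chvars[OF wfP] .
  have Fc: "flag f P = f \<or> flag f P \<in> chvars P" by (rule flag_cases)
  have cw: "chvars P \<subseteq> writes an P" by (rule chvars_writes)
  have "witnessed m x pl lv an act rt f P b v c"
    using ev_Skip.prems by (intro ev_Skip.IH) auto
  then obtain wit \<eta> where 1: "norm2 m wit \<le> c"
     and 2: "\<And>b'. wit b' \<noteq> 0 \<Longrightarrow> b' < 2 ^ m \<and> agree (writes an P) b' b \<and> bit b' lv = v"
     and 3: "\<And>b'. \<eta> b' \<noteq> 0 \<Longrightarrow> b' < 2 ^ m \<and> agree (writes an P) b' b \<and> bit b' (flag f P)"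
     and 4: "run x (bwo pl act rt False f P) wit = (\<lambda>b'. ket b b' + \<eta> b')"
     and 5: "bit b act \<and> \<not> bit b rt \<Longrightarrow>
       run x (bwo pl act rt True f P) wit = (\<lambda>b'. ket b b' + sgn_of v * \<eta> b')"
    unfolding witnessed_def by blast
  have un1: "run x (bwo pl act rt False f P) wit = (\<lambda>b'. ket b b' + 1 * \<eta> b')" using 4 by simp
  have "\<exists>\<eta>'. (\<forall>b'. \<eta>' b' \<noteq> 0 \<longrightarrow> b' < 2 ^ m \<and> agree (insert q (insert z (writes an P))) b' b \<and> bit b' z) \<and>
    (\<forall>s. run x (R ((flag f P, False) # ls, q, arccos (sqrt p)) # [R ([(q, True)], z, pi / 2), R ([(flag f P, True), (q, False)], z, pi / 2)]) (\<lambda>b'. ket b b' + s * \<eta> b') = (\<lambda>b'. ket b b' + s * \<eta>' b')) \<and>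
    (bit b act \<and> \<not> bit b rt \<longrightarrow>
      (\<forall>s. run x (R ((flag f P, False) # ls, q, arccos (sqrt p)) # R ((act, True) # (rt, False) # (flag f P, False) # (pl, \<not> k) # ls, q, 0) #
       [R ([(q, True)], z, pi / 2), R ([(flag f P, True), (q, False)], z, pi / 2)]) (\<lambda>b'. ket b b' + s * \<eta> b') = (\<lambda>b'. ket b b' + s * \<eta>' b')))"
    by (rule skip_level) (use ev_Skip Fc X chX cw 3 in auto)
  then obtain \<eta>' where E: "\<And>b'. \<eta>' b' \<noteq> 0 \<Longrightarrow> b' < 2 ^ m \<and> agree (insert q (insert z (writes an P))) b' b \<and> bit b' z"
    "\<And>s. run x (R ((flag f P, False) # ls, q, arccos (sqrt p)) # [R ([(q, True)], z, pi / 2), R ([(flag f P, True), (q, False)], z, pi / 2)]) (\<lambda>b'. ket b b' + s * \<eta> b') = (\<lambda>b'. ket b b' + s * \<eta>' b')"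
    "\<And>s. bit b act \<and> \<not> bit b rt \<Longrightarrow> run x (R ((flag f P, False) # ls, q, arccos (sqrt p)) # R ((act, True) # (rt, False) # (flag f P, False) # (pl, \<not> k) # ls, q, 0) #
       [R ([(q, True)], z, pi / 2), R ([(flag f P, True), (q, False)], z, pi / 2)]) (\<lambda>b'. ket b b' + s * \<eta> b') = (\<lambda>b'. ket b b' + s * \<eta>' b')"
    by blast
  have E2: "run x (bwo pl act rt False f (Ch q z ls k p # P)) wit = (\<lambda>b'. ket b b' + \<eta>' b')"
    unfolding bwo.simps run_simps(3) un1 using E(2)[of 1] by simp
  have E3: "run x (bwo pl act rt True f (Ch q z ls k p # P)) wit = (\<lambda>b'. ket b b' + sgn_of v * \<eta>' b')" if "bit b act \<and> \<not> bit b rt"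
    unfolding bwo.simps run_simps(3) 5[OF that] using E(3)[OF that, of "sgn_of v"] by simp
  have ws: "b' < 2 ^ m \<and> agree (insert q (insert z (writes an P))) b' b \<and> bit b' lv = v" if "wit b' \<noteq> 0" for b'
    using 2[OF that] unfolding agree_def by blast
  show ?case unfolding witnessed_def writes.simps flag.simps
    using 1 ws E(1) E2 E3 by (intro exI[of _ wit] exI[of _ \<eta>']) blast
next
  case (ev_All st ls v k p P c0 q c1 c z)
  have q: "q \<notin> writes an P" "\<not> bit b q" "q \<notin> X" "q < m" using ev_All.prems by auto
  have st: "st(q := True) = bit (flip_bit q b)" using ev_All.prems q by (auto simp: fun_eq_iff bit_flip)
  have w0: "witnessed m x pl lv an act rt f P b v c0" using ev_All.prems by (intro ev_All.IH) auto
  have w1: "witnessed m x pl lv an act rt f P (flip_bit q b) v c1"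
    using ev_All.prems q chvars_writes[of P an] X by (intro ev_All.IH(2)[OF st]) (auto simp: bit_flip)
  \<comment> \<open>These amplitudes form the unit vector of the choice itself: nothing is rejected,
    and the squared norms are averaged.\<close>
  show ?case
    by (rule witnessed_choice[of q z ls k p P b "sqrt p" v c0 "sqrt (1 - p)" c1])
      (use ev_All w0 w1 in \<open>auto simp flip: power2_eq_square\<close>)
next
  case (ev_One0 st ls v k p P c0 c q z)
  have w0: "witnessed m x pl lv an act rt f P b v c0" using ev_One0.prems by (intro ev_One0.IH) auto
  \<comment> \<open>A single child has overlap \<open>sqrt p\<close> with the unit vector of the
    choice, so its amplitude must be the inverse, and its squared norm is divided by
    \<open>p\<close>.\<close>
  show ?case
    by (rule witnessed_choice[of q z ls k p P b "1 / sqrt p" v c0 0 c0])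
      (use ev_One0 w0 in \<open>auto simp: power_divide\<close>)
next
  case (ev_One1 st ls v k p P q c1 c z)
  have q: "q \<notin> writes an P" "\<not> bit b q" "q \<notin> X" "q < m" using ev_One1.prems by auto
  have st: "st(q := True) = bit (flip_bit q b)" using ev_One1.prems q by (auto simp: fun_eq_iff bit_flip)
  have w1: "witnessed m x pl lv an act rt f P (flip_bit q b) v c1"
    using ev_One1.prems q chvars_writes[of P an] X by (intro ev_One1.IH[OF st]) (auto simp: bit_flip)
  show ?case
    by (rule witnessed_choice[of q z ls k p P b 0 v c1 "1 / sqrt (1 - p)" c1])
      (use ev_One1 w1 in \<open>auto simp: power_divide\<close>)
qed

end

section \<open>Phase detection\<close>

definition supp :: "(nat \<Rightarrow> bool) \<Rightarrow> (nat \<Rightarrow> complex) \<Rightarrow> bool" where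
  "supp S \<psi> \<longleftrightarrow> (\<forall>b. \<psi> b \<noteq> 0 \<longrightarrow> S b)"

fun target :: "nat \<Rightarrow> op \<Rightarrow> nat" where
  "target an (R (ls, q, \<theta>)) = q"
| "target an Q = an"

fun op_vars :: "nat \<Rightarrow> op \<Rightarrow> nat set" where
  "op_vars an (R (ls, q, \<theta>)) = insert q (fst ` set ls)"
| "op_vars an Q = {..an}"

fun wf_op :: "nat \<Rightarrow> op \<Rightarrow> bool" where
  "wf_op m (R g) = wf_refl m g"
| "wf_op m Q = True"

lemma op_cases: obtains (R) ls q \<theta> where "g = R (ls, q, \<theta>)" | (Q) "g = Q"
  by (cases g) auto

lemma wf_prog_writes: "wf_prog pl an X P \<Longrightarrow> writes an P \<inter> X = {}"
  by (induction P rule: chvars.induct) auto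

definition power_ops :: "nat \<Rightarrow> op list \<Rightarrow> op list" where "power_ops N gs = concat (replicate N gs)"

lemma set_power_ops: "set (power_ops N gs) \<subseteq> set gs"
  by (auto simp: power_ops_def)

lemma run_power_add: "run x (power_ops (M + N) gs) \<psi> = run x (power_ops N gs) (run x (power_ops M gs) \<psi>)"
  by (simp add: power_ops_def replicate_add)

lemma run_power_fix: "run x gs \<psi> = \<psi> \<Longrightarrow> run x (power_ops N gs) \<psi> = \<psi>"
  by (induction N) (simp_all add: power_ops_def)

locale ops =
  fixes m an :: nat and x :: "bool list"
  assumes an: "an = ceillog2 (length x)" "an < m"
begin

lemma query_bits: "query_basis x b = (if reads x (bit b) then flip_bit an b else b)"
  using query_basis_reads an by simp

lemma supp_run1:
  assumes "\<And>b. S (flip_bit (target an g) b) = S b" "supp S \<psi>"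
  shows "supp S (run1 x g \<psi>)"
proof (cases g rule: op_cases)
  case (R ls q \<theta>)
  show ?thesis unfolding supp_def
  proof (intro allI impI)
    fix b assume "run1 x g \<psi> b \<noteq> 0"
    then have "\<psi> b \<noteq> 0 \<or> \<psi> (flip_bit q b) \<noteq> 0" using R by (auto simp: cr_def ap_def split: if_splits)
    then show "S b" using assms R unfolding supp_def by auto
  qed
next
  case Q
  show ?thesis unfolding supp_def
  proof (intro allI impI)
    fix b assume "run1 x g \<psi> b \<noteq> 0"
    then have "S (query_basis x b)" using Q assms(2) by (auto simp: supp_def)
    then show "S b" using assms(1)[of b] Q by (auto simp: query_bits split: if_splits)
  qed
qed

lemma supp_run:
  assumes "\<And>g b. g \<in> set gs \<Longrightarrow> S (flip_bit (target an g) b) = S b" "supp S \<psi>"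
  shows "supp S (run x gs \<psi>)"
  using assms by (induction gs arbitrary: \<psi>) (auto intro!: supp_run1)

lemma run1_run1: "wf_op m g \<Longrightarrow> run1 x g (run1 x g \<psi>) = \<psi>"
  by (cases g) (auto simp: cr_cr query_basis_invol fun_eq_iff)

lemma run_rev_run: "\<forall>g \<in> set gs. wf_op m g \<Longrightarrow> run x (rev gs) (run x gs \<psi>) = \<psi>"
  by (induction gs arbitrary: \<psi>) (auto simp: run1_run1)

lemma run_run_rev: "\<forall>g \<in> set gs. wf_op m g \<Longrightarrow> run x gs (run x (rev gs) \<psi>) = \<psi>"
  using run_rev_run[of "rev gs"] by simp

lemma norm2_run: "\<forall>g \<in> set gs. wf_op m g \<Longrightarrow> norm2 m (run x gs \<psi>) = norm2 m \<psi>"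
proof (induction gs arbitrary: \<psi>)
  case (Cons g gs)
  have "norm2 m (run1 x g \<psi>) = norm2 m \<psi>"
  proof (cases g)
    case Q
    have "query_basis x b < 2 ^ m" if "b < 2 ^ m" for b using that an by (simp add: query_bits)
    then have "norm2 m (\<psi> \<circ> query_basis x) = norm2 m \<psi>" using query_basis_invol by (rule norm2_perm)
    then show ?thesis using Q by simp
  qed (use Cons.prems in \<open>auto simp: norm2_cr\<close>)
  then show ?case using Cons by simp
qed simp

definition res :: "nat \<Rightarrow> (nat \<Rightarrow> complex) \<Rightarrow> nat \<Rightarrow> complex" where
  "res w \<psi> b = (if bit b w then 0 else \<psi> b)"

lemma res_run: "\<forall>g \<in> set gs. target an g \<noteq> w \<Longrightarrow> res w (run x gs \<psi>) = run x gs (res w \<psi>)"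
proof (induction gs arbitrary: \<psi>)
  case (Cons g gs)
  have "res w (run1 x g \<psi>) = run1 x g (res w \<psi>)"
    using Cons.prems by (cases g rule: op_cases) (auto simp: res_def cr_def ap_def bit_flip query_bits fun_eq_iff)
  then show ?case using Cons by simp
qed simp

lemma reads_flip: "an < w \<Longrightarrow> reads x (bit (flip_bit w b)) = reads x (bit (b :: nat))"
proof -
  assume w: "an < w"
  have "map (bit (flip_bit w b)) [0..<ceillog2 (length x)] = map (bit b) [0..<ceillog2 (length x)]"
    using w an by (auto simp: bit_flip)
  then show ?thesis unfolding reads_def by (simp only:)
qed

lemma run_flip: "\<forall>g \<in> set gs. w \<notin> op_vars an g \<Longrightarrow> run x gs (\<psi> \<circ> flip_bit w) = run x gs \<psi> \<circ> flip_bit w"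
proof (induction gs arbitrary: \<psi>)
  case (Cons g gs)
  have "run1 x g (\<psi> \<circ> flip_bit w) = run1 x g \<psi> \<circ> flip_bit w"
  proof (cases g rule: op_cases)
    case (R ls q \<theta>)
    then have "w \<notin> fst ` set ls" "w \<noteq> q" using Cons.prems by auto
    then show ?thesis using R by (auto simp: cr_def ap_def bit_flip holds_flip flip_commute[of w] fun_eq_iff)
  next
    case Q
    then have "an < w" using Cons.prems by auto
    then show ?thesis using Q by (auto simp: query_bits reads_flip flip_commute[of w] fun_eq_iff)
  qed
  moreover have "run x gs (run1 x g \<psi> \<circ> flip_bit w) = run x gs (run1 x g \<psi>) \<circ> flip_bit w"
    using Cons.prems by (intro Cons.IH) auto
  ultimately show ?case by (simp only: run_simps(2))
qed simp

end

locale walk = ops +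
  fixes pl lv act rt f :: nat and X :: "nat set" and P :: "nat instr list" and t :: real
  assumes X: "{f, act, rt} \<subseteq> X" "distinct [f, act, rt]" "pl \<notin> X" "lv \<noteq> act" "lv \<noteq> rt"
    and wf: "wf_prog pl an X P" "fits m P"
    and less: "f < m" "act < m" "rt < m" "pl < m" "lv < m"
begin

abbreviation "bwU \<equiv> bwo pl act rt False f P"
abbreviation "bwS \<equiv> bwo pl act rt True f P"

text \<open>\<open>rt\<close> distinguishes the start state from the root position. In their plane,
  the reflection of angle \<open>2 * t + pi\<close> fixes \<open>cos t\<close> times the start minus
  \<open>sin t\<close> times the root and reverses the orthogonal combination. The rest is the
  unsigned pass backwards, the sign of the leaves, and the signed pass forwards.\<close>

definition it :: "op list" where
  "it = R ([(act, True), (flag f P, False)], rt, 2 * t + pi) # rev bwU @ R ([(act, True), (rt, False)], lv, pi) # bwS"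

lemma flag_P: "flag f P < m" "flag f P \<noteq> act" "flag f P \<noteq> rt"
  using flag_cases[of f P] X wf_prog_chvars[OF wf(1)] fits_chvars[OF wf(2)] less by auto

lemma bwo_wf:
  "wf_prog pl an X P' \<Longrightarrow> fits m P' \<Longrightarrow> g \<in> set (bwo pl act rt sg f P') \<Longrightarrow> wf_op m g \<and> target an g \<in> writes an P'"
proof (induction P' rule: chvars.induct)
  case (2 q z ls k p P')
  have F: "flag f P' = f \<or> flag f P' \<in> chvars P'" by (rule flag_cases)
  have c: "chvars P' \<subseteq> writes an P'" "chvars P' \<inter> X = {}" "chvars P' \<subseteq> {..<m}"
    using chvars_writes[of P' an] wf_prog_chvars[of pl an X P'] fits_chvars[of m P'] 2 by auto
  have ar: "act \<notin> insert q (insert z (insert pl (insert (flag f P') (fst ` set ls))))"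
      "rt \<notin> insert q (insert z (insert pl (insert (flag f P') (fst ` set ls))))"
      "flag f P' \<notin> insert q (insert z (insert pl (fst ` set ls)))" "flag f P' < m" "act \<noteq> rt"
    using F c X 2(2,3) less by auto
  from 2(4) consider "g \<in> set (bwo pl act rt sg f P')"
    | "g = R ((flag f P', False) # ls, q, arccos (sqrt p))"
    | "g = R ((act, True) # (rt, False) # (flag f P', False) # (pl, \<not> k) # ls, q, 0)"
    | "g = R ([(q, True)], z, pi / 2)" | "g = R ([(flag f P', True), (q, False)], z, pi / 2)"
    by (auto split: if_splits)
  then show ?case
    by cases (use 2 ar less in \<open>auto simp: wf_refl_def\<close>)
qed (auto simp: wf_refl_def split: if_splits)

lemma bw_wf: "\<forall>g \<in> set bwU. wf_op m g" "\<forall>g \<in> set bwS. wf_op m g"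
  using bwo_wf wf by blast+

lemma bwo_target: "g \<in> set bwU \<union> set bwS \<Longrightarrow> target an g \<in> writes an P"
  using bwo_wf[OF wf] by blast

lemma it_wf: "\<forall>g \<in> set it. wf_op m g"
  using bw_wf flag_P X less by (auto simp: it_def wf_refl_def)

lemma it_target: "g \<in> set it \<Longrightarrow> target an g \<in> insert rt (insert lv (writes an P))"
  using bwo_target by (auto simp: it_def)

text \<open>The signs are controlled by \<open>act\<close> and by the absence of \<open>rt\<close>,
  and no operation of a pass moves a state out of \<open>S\<close>.\<close>

lemma signs_off:
  assumes "\<And>b. S b \<Longrightarrow> \<not> (bit b act \<and> \<not> bit b rt)"
    "\<And>b v. v \<in> writes an P' \<Longrightarrow> S (flip_bit v b) = S b" "wf_prog pl an X P'" "fits m P'" "supp S \<psi>"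
  shows "run x (bwo pl act rt True f P') \<psi> = run x (bwo pl act rt False f P') \<psi>"
  using assms(2-)
proof (induction P' rule: chvars.induct)
  case (2 q z ls k p P')
  have IH: "run x (bwo pl act rt True f P') \<psi> = run x (bwo pl act rt False f P') \<psi>"
    using 2 by auto
  let ?A = "R ((flag f P', False) # ls, q, arccos (sqrt p))"
  have "supp S (run x (bwo pl act rt False f (P') @ [?A]) \<psi>)"
    using 2(2-) bwo_wf[of P'] by (intro supp_run) auto
  then have "run1 x (R ((act, True) # (rt, False) # (flag f P', False) # (pl, \<not> k) # ls, q, 0)) (run x (bwo pl act rt False f P' @ [?A]) \<psi>)
      = run x (bwo pl act rt False f P' @ [?A]) \<psi>"
  proof -
    assume s: "supp S (run x (bwo pl act rt False f (P') @ [?A]) \<psi>)"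
    have "flag f P' \<noteq> q" using flag_cases[of f P'] chvars_writes[of P' an] X 2(3) by auto
    then show ?thesis unfolding run1.simps
      by (intro cr_fix) (use s assms(1) X 2(3) in \<open>auto simp: supp_def\<close>)
  qed
  then show ?case using IH by simp
qed auto

text \<open>Without \<open>act\<close> all reflections other than those of the unsigned pass are
  idle, and its two runs cancel. So a controlled power of the walk only needs control over the
  single qubit \<open>act\<close>.\<close>

lemma it_inactive:
  assumes "supp (\<lambda>b. \<not> bit b act) \<psi>"
  shows "run x it \<psi> = \<psi>"
proof -
  let ?S = "\<lambda>b. \<not> bit b act"
  have n: "act \<notin> writes an P" using wf_prog_writes[OF wf(1)] X by auto
  have 1: "run1 x (R ([(act, True), (flag f P, False)], rt, 2 * t + pi)) \<psi> = \<psi>"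
    unfolding run1.simps by (rule cr_fix) (use assms flag_P X in \<open>auto simp: supp_def\<close>)
  have s2: "supp ?S (run x (rev bwU) \<psi>)"
  proof (rule supp_run[OF _ assms])
    fix g and b :: nat assume "g \<in> set (rev bwU)"
    then have "target an g \<noteq> act" using bwo_target[of g] n by auto
    then show "(\<not> bit (flip_bit (target an g) b) act) = (\<not> bit b act)" by (metis bit_flip)
  qed
  have 2: "run1 x (R ([(act, True), (rt, False)], lv, pi)) (run x (rev bwU) \<psi>) = run x (rev bwU) \<psi>"
    unfolding run1.simps by (rule cr_fix) (use s2 X in \<open>auto simp: supp_def\<close>)
  have 3: "run x bwS (run x (rev bwU) \<psi>) = run x bwU (run x (rev bwU) \<psi>)"
    by (rule signs_off[where S = ?S]) (use s2 wf n in \<open>auto simp: bit_flip\<close>)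
  show ?thesis unfolding it_def run_simps 1 2 3 using run_run_rev[OF bw_wf(1)] .
qed

context
  fixes b :: nat and c :: real and v :: bool
  assumes b: "b < 2 ^ m" "\<And>w. w \<in> chvars P \<Longrightarrow> \<not> bit b w" "\<not> bit b f" "bit b act" "\<not> bit b rt"
    and e: "ev pl lv an (reads x) P (bit b) v c"
begin

text \<open>The two passes with the leaf reflection in between send the root plus its flagged part
  to the sign of \<open>v\<close> times the root plus the same flagged part. Combined with the root
  reflection, a true value gives a fixed vector near the start state, and a false value gives a
  vector that differs from its image by \<open>2 * sin t\<close> times the start state.\<close>

lemma iteration:
  obtains \<eta> where "\<And>b'. \<eta> b' \<noteq> 0 \<Longrightarrow> b' < 2 ^ m \<and> agree (writes an P) b' b"
    "norm2 m (\<lambda>b'. ket b b' + \<eta> b') \<le> c" "norm2 m (\<lambda>b'. ket b b' - \<eta> b') \<le> c \<or> v"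
    "v \<Longrightarrow> run x it (\<lambda>b'. cos t * ket (flip_bit rt b) b' - sin t * (ket b b' + \<eta> b')) =
      (\<lambda>b'. cos t * ket (flip_bit rt b) b' - sin t * (ket b b' + \<eta> b'))"
    "\<not> v \<Longrightarrow> run x it (\<lambda>b'. sin t * ket (flip_bit rt b) b' + cos t * (ket b b' - \<eta> b')) =
      (\<lambda>b'. - (sin t) * ket (flip_bit rt b) b' + cos t * (ket b b' - \<eta> b'))"
proof -
  from ev_witnessed[OF an X(1,2) e refl wf b(1-3)]
  obtain wit \<eta> where 1: "norm2 m wit \<le> c"
     and 2: "\<And>b'. wit b' \<noteq> 0 \<Longrightarrow> b' < 2 ^ m \<and> agree (writes an P) b' b \<and> bit b' lv = v"
     and 3: "\<And>b'. \<eta> b' \<noteq> 0 \<Longrightarrow> b' < 2 ^ m \<and> agree (writes an P) b' b \<and> bit b' (flag f P)"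
     and 4: "run x bwU wit = (\<lambda>b'. ket b b' + \<eta> b')"
     and 5: "run x bwS wit = (\<lambda>b'. ket b b' + sgn_of v * \<eta> b')"
    unfolding witnessed_def using b by blast
  let ?bs = "flip_bit rt b" and ?F = "flag f P"
  have nX: "writes an P \<inter> X = {}" using wf_prog_writes[OF wf(1)] .
  have wn: "act \<notin> writes an P" "rt \<notin> writes an P" "act \<noteq> rt" using nX X by auto
  have lin: "linop (run x gs)" for gs by (rule linop_run)
  have Fb: "\<not> bit b ?F" using flag_cases[of f P] b by auto
  have hb: "holds (bit b) [(act, True), (?F, False)]" using b Fb by simp
  have rn: "rt \<notin> fst ` set [(act, True), (?F, False)]" using wn flag_P by simp
  have ct: "complex_of_real (cos (2 * t + pi)) = 2 * (sin t)\<^sup>2 - 1"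
    "complex_of_real (sin (2 * t + pi)) = - 2 * sin t * cos t"
    by (simp_all add: cos_double_sin sin_double flip: of_real_power)
  have sc: "complex_of_real (sin t) * sin t + complex_of_real (cos t) * cos t = 1"
    by (metis of_real_1 of_real_add of_real_mult power2_eq_square sin_cos_squared_add)
  have root: "run1 x (R ([(act, True), (?F, False)], rt, 2 * t + pi)) (\<lambda>b'. (y0 * ket b b' + y1 * ket ?bs b') + s * \<eta> b') =
     (\<lambda>b'. ((y0 * (2 * (sin t)\<^sup>2 - 1) - y1 * (2 * sin t * cos t)) * ket b b'
         + (- y0 * (2 * sin t * cos t) - y1 * (2 * (sin t)\<^sup>2 - 1)) * ket ?bs b') + s * \<eta> b')" for y0 y1 s :: complex
  proof -
    have "cr ([(act, True), (?F, False)], rt, 2 * t + pi) (\<lambda>b'. s * \<eta> b') = (\<lambda>b'. s * \<eta> b')"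
      by (rule cr_fix[OF _ rn]) (use 3 in auto)
    moreover have "cr ([(act, True), (?F, False)], rt, 2 * t + pi) (\<lambda>b'. y0 * ket b b' + y1 * ket ?bs b') =
     (\<lambda>b'. (y0 * (2 * (sin t)\<^sup>2 - 1) - y1 * (2 * sin t * cos t)) * ket b b'
         + (- y0 * (2 * sin t * cos t) - y1 * (2 * (sin t)\<^sup>2 - 1)) * ket ?bs b')"
      by (subst cr_plane[OF hb rn b(5)]) (simp add: ct del: cos_periodic_pi sin_periodic_pi)
    ultimately show ?thesis unfolding run1.simps by (subst linop_add[OF linop_cr]) (simp only:)
  qed
  \<comment> \<open>With \<open>rt\<close> set, the leaf reflection and the signs are off, so the
    passes cancel on the start state.\<close>
  have bs: "run x (rev bwU @ R ([(act, True), (rt, False)], lv, pi) # bwS) (ket ?bs) = ket ?bs"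
  proof -
    let ?S = "\<lambda>b. bit b rt"
    have s1: "supp ?S (ket ?bs)" using b by (auto simp: supp_def ket_def bit_flip)
    have s2: "supp ?S (run x (rev bwU) (ket ?bs))"
    proof (rule supp_run[OF _ s1])
      fix g and b :: nat assume "g \<in> set (rev bwU)"
      then have "target an g \<noteq> rt" using bwo_target[of g] wn by auto
      then show "bit (flip_bit (target an g) b) rt = bit b rt" by (metis bit_flip)
    qed
    have 2: "run1 x (R ([(act, True), (rt, False)], lv, pi)) (run x (rev bwU) (ket ?bs)) = run x (rev bwU) (ket ?bs)"
      unfolding run1.simps by (rule cr_fix) (use s2 X in \<open>auto simp: supp_def\<close>)
    have 3: "run x bwS (run x (rev bwU) (ket ?bs)) = run x bwU (run x (rev bwU) (ket ?bs))"
      by (rule signs_off[where S = ?S]) (use s2 wf wn in \<open>auto simp: bit_flip\<close>)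
    show ?thesis unfolding run_simps 2 3 using run_run_rev[OF bw_wf(1)] .
  qed
  have leaf: "run1 x (R ([(act, True), (rt, False)], lv, pi)) wit = (\<lambda>b'. sgn_of v * wit b')"
  proof
    fix b'
    have "bit b' lv = v" "bit b' act" "\<not> bit b' rt" if "wit b' \<noteq> 0" for b'
      using 2[OF that] b wn unfolding agree_def by auto
    then show "run1 x (R ([(act, True), (rt, False)], lv, pi)) wit b' = sgn_of v * wit b'"
      unfolding run1.simps cr_def prod.case ap_def RF_def sgn_of_def
      by (cases "wit b' = 0") auto
  qed
  have main: "run x (rev bwU @ R ([(act, True), (rt, False)], lv, pi) # bwS) (\<lambda>b'. ket b b' + \<eta> b')
      = (\<lambda>b'. sgn_of v * (ket b b' + sgn_of v * \<eta> b'))"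
    unfolding 4[symmetric] run_simps run_rev_run[OF bw_wf(1)] leaf
    unfolding linop_scale[OF lin] 5 ..
  \<comment> \<open>\<open>y0\<close> and \<open>y1\<close> are the amplitudes of root and start.
    The flagged part enters with the amplitude \<open>s\<close> that the root has after the root
    reflection, so that both together are the image of a witness.\<close>
  have all: "run x it (\<lambda>b'. (y0 * ket b b' + y1 * ket ?bs b') + s * \<eta> b') =
     (\<lambda>b'. (- y0 * (2 * sin t * cos t) - y1 * (2 * (sin t)\<^sup>2 - 1)) * ket ?bs b' + s * (sgn_of v * (ket b b' + sgn_of v * \<eta> b')))"
    if "s = y0 * (2 * (sin t)\<^sup>2 - 1) - y1 * (2 * sin t * cos t)" for y0 y1 s :: complex
  proof -
    have "run x it (\<lambda>b'. (y0 * ket b b' + y1 * ket ?bs b') + s * \<eta> b') =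
      run x (rev bwU @ R ([(act, True), (rt, False)], lv, pi) # bwS) (\<lambda>b'. (- y0 * (2 * sin t * cos t) - y1 * (2 * (sin t)\<^sup>2 - 1)) * ket ?bs b' + s * (ket b b' + \<eta> b'))"
      unfolding it_def run_simps(2) root that[symmetric]
      by (rule arg_cong[where f = "run x (rev bwU @ R ([(act, True), (rt, False)], lv, pi) # bwS)"]) (simp add: algebra_simps fun_eq_iff)
    also have "\<dots> = (\<lambda>b'. (- y0 * (2 * sin t * cos t) - y1 * (2 * (sin t)\<^sup>2 - 1)) * ket ?bs b' + s * (sgn_of v * (ket b b' + sgn_of v * \<eta> b')))"
      unfolding linopD[OF lin] bs main ..
    finally show ?thesis .
  qed
  have aux: "- complex_of_real (sin t) * (2 * (sin t)\<^sup>2 - 1) - complex_of_real (cos t) * (2 * sin t * cos t) = - complex_of_real (sin t)"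
  proof -
    have "- complex_of_real (sin t) * (2 * (sin t)\<^sup>2 - 1) - complex_of_real (cos t) * (2 * sin t * cos t)
        = complex_of_real (sin t) - 2 * complex_of_real (sin t) * (complex_of_real (sin t) * sin t + complex_of_real (cos t) * cos t)"
      by (simp add: power2_eq_square algebra_simps)
    then show ?thesis unfolding sc by simp
  qed
  show ?thesis
  proof (rule that[of \<eta>])
    show "b' < 2 ^ m \<and> agree (writes an P) b' b" if "\<eta> b' \<noteq> 0" for b' using 3[OF that] by blast
    show "norm2 m (\<lambda>b'. ket b b' + \<eta> b') \<le> c"
      using norm2_run[OF bw_wf(1), of wit] 1 4 by simp
    show "norm2 m (\<lambda>b'. ket b b' - \<eta> b') \<le> c \<or> v"
      using norm2_run[OF bw_wf(2), of wit] 1 5 by (auto simp: sgn_of_def)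
  next
    assume v: v
    \<comment> \<open>Amplitudes of the fixed vector of the root reflection.\<close>
    have y: "- complex_of_real (sin t) = - complex_of_real (sin t) * (2 * (sin t)\<^sup>2 - 1) - complex_of_real (cos t) * (2 * sin t * cos t)"
      using aux by simp
    have y': "complex_of_real (cos t) = - (- complex_of_real (sin t)) * (2 * sin t * cos t) - complex_of_real (cos t) * (2 * (sin t)\<^sup>2 - 1)"
      by (simp add: power2_eq_square algebra_simps)
    show "run x it (\<lambda>b'. cos t * ket ?bs b' - sin t * (ket b b' + \<eta> b')) = (\<lambda>b'. cos t * ket ?bs b' - sin t * (ket b b' + \<eta> b'))"
      using all[OF y, unfolded y'[symmetric]] v by (simp add: sgn_of_def algebra_simps)
  next
    assume v: "\<not> v"
    \<comment> \<open>Amplitudes of the vector reversed by the root reflection.\<close>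
    have y: "- complex_of_real (cos t) = complex_of_real (cos t) * (2 * (sin t)\<^sup>2 - 1) - complex_of_real (sin t) * (2 * sin t * cos t)"
      by (simp add: power2_eq_square algebra_simps)
    have y': "- complex_of_real (sin t) = - complex_of_real (cos t) * (2 * sin t * cos t) - complex_of_real (sin t) * (2 * (sin t)\<^sup>2 - 1)"
      by (subst aux[symmetric]) (simp add: algebra_simps)
    show "run x it (\<lambda>b'. sin t * ket ?bs b' + cos t * (ket b b' - \<eta> b')) =
      (\<lambda>b'. - (sin t) * ket ?bs b' + cos t * (ket b b' - \<eta> b'))"
      using all[OF y, unfolded y'[symmetric]] v by (simp add: sgn_of_def algebra_simps)
  qed
qed

end

end

section \<open>Powers of the walk under clock qubits\<close>

context walk
begin

text \<open>A Hadamard test of the \<open>N\<close>-th power: on clock value 0 the qubit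
  \<open>act\<close> is switched off, so only the other branch walks.\<close>

definition dstep :: "nat \<Rightarrow> nat \<Rightarrow> op list" where
  "dstep w N = [R ([], w, pi / 4), R ([(w, False)], act, pi / 2)] @ power_ops N it @
     [R ([(w, False)], act, pi / 2), R ([], w, pi / 4)]"

fun detect :: "nat \<Rightarrow> nat list \<Rightarrow> op list" where
  "detect N [] = []"
| "detect N (w # ws) = dstep w N @ detect (2 * N) ws"

abbreviation pow :: "nat \<Rightarrow> (nat \<Rightarrow> complex) \<Rightarrow> nat \<Rightarrow> complex" where
  "pow N \<equiv> run x (power_ops N it)"

definition clock :: "nat \<Rightarrow> bool" where
  "clock w \<longleftrightarrow> w < m \<and> w \<noteq> act \<and> (\<forall>g \<in> set it. w \<notin> op_vars an g)"

definition ready :: "nat list \<Rightarrow> nat \<Rightarrow> bool" where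
  "ready ws b \<longleftrightarrow> bit b act \<and> (\<forall>w \<in> set ws. \<not> bit b w)"

lemma target_vars: "target an g \<in> op_vars an g"
  by (cases g rule: op_cases) auto

lemma act_target: "g \<in> set it \<Longrightarrow> target an g \<noteq> act"
  using it_target[of g] wf_prog_writes[OF wf(1)] X by auto

lemma ready_flip: "\<forall>w \<in> set ws. clock w \<Longrightarrow> g \<in> set it \<Longrightarrow> ready ws (flip_bit (target an g) b) = ready ws b"
  using act_target[of g] target_vars[of g] unfolding ready_def clock_def by (metis bit_flip)

lemma supp_pow:
  assumes "\<forall>w \<in> set ws. clock w" "supp (ready ws) \<psi>"
  shows "supp (ready ws) (pow N \<psi>)"
  by (rule supp_run[OF _ assms(2)]) (use ready_flip[OF assms(1)] set_power_ops in blast)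

lemma dstep_middle:
  fixes \<psi> :: "nat \<Rightarrow> complex"
  assumes w: "clock w" and s: "supp (\<lambda>b. bit b act \<and> \<not> bit b w) \<psi>"
  shows "run x [R ([], w, pi / 4), R ([(w, False)], act, pi / 2)] \<psi>
      = (\<lambda>b. (1 / sqrt 2) * (\<psi> (flip_bit act b) + \<psi> (flip_bit w b)))" (is ?A)
proof -
  have wa: "w \<noteq> act" using w by (simp add: clock_def)
  have s0: "\<psi> b = 0" if "\<not> bit b act \<or> bit b w" for b using s that by (auto simp: supp_def)
  have c: "complex_of_real (cos (pi / 4)) = 1 / sqrt 2" "complex_of_real (sin (pi / 4)) = 1 / sqrt 2"
    by (simp_all add: cos_45 sin_45 real_div_sqrt flip: of_real_divide)
  show ?A
  proof
    fix b :: nat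
    show "run x [R ([], w, pi / 4), R ([(w, False)], act, pi / 2)] \<psi> b = (1 / sqrt 2) * (\<psi> (flip_bit act b) + \<psi> (flip_bit w b))"
      using s0[of b] s0[of "flip_bit w b"] s0[of "flip_bit act b"] s0[of "flip_bit w (flip_bit act b)"] wa
      by (simp add: cr_not) (auto simp: cr_def ap_def RF_def asg_def bit_flip c)
  qed
qed

lemma pow_middle:
  fixes \<psi> :: "nat \<Rightarrow> complex"
  assumes w: "clock w" and s: "supp (\<lambda>b. bit b act \<and> \<not> bit b w) \<psi>"
  shows "pow N (\<lambda>b. (1 / sqrt 2) * (\<psi> (flip_bit act b) + \<psi> (flip_bit w b)))
    = (\<lambda>b. (1 / sqrt 2) * (\<psi> (flip_bit act b) + pow N \<psi> (flip_bit w b)))"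
proof -
  have lin: "linop (pow N)" by (rule linop_run)
  have "supp (\<lambda>b. \<not> bit b act) (\<psi> \<circ> flip_bit act)" using s by (auto simp: supp_def bit_flip)
  then have 1: "pow N (\<psi> \<circ> flip_bit act) = \<psi> \<circ> flip_bit act" by (intro run_power_fix it_inactive)
  have 2: "pow N (\<psi> \<circ> flip_bit w) = pow N \<psi> \<circ> flip_bit w"
    by (rule run_flip) (use w set_power_ops in \<open>force simp: clock_def\<close>)
  have "pow N (\<lambda>b. (1 / sqrt 2) * (\<psi> \<circ> flip_bit act) b + (1 / sqrt 2) * (\<psi> \<circ> flip_bit w) b)
    = (\<lambda>b. (1 / sqrt 2) * pow N (\<psi> \<circ> flip_bit act) b + (1 / sqrt 2) * pow N (\<psi> \<circ> flip_bit w) b)"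
    by (rule linopD[OF lin])
  then show ?thesis unfolding 1 2 by (simp add: algebra_simps)
qed

lemma dstep_fix:
  assumes w: "clock w" and s: "supp (\<lambda>b. bit b act \<and> \<not> bit b w) \<psi>" and fx: "run x it \<psi> = \<psi>"
  shows "run x (dstep w N) \<psi> = \<psi>"
proof -
  let ?pre = "[R ([], w, pi / 4), R ([(w, False)], act, pi / 2)]"
  have "pow N (run x ?pre \<psi>) = run x ?pre \<psi>"
    unfolding dstep_middle[OF w s] pow_middle[OF w s] run_power_fix[OF fx] ..
  moreover have "run x (rev ?pre) (run x ?pre \<psi>) = \<psi>"
    by (rule run_rev_run) (use w less in \<open>auto simp: wf_refl_def clock_def\<close>)
  ultimately show ?thesis unfolding dstep_def run_simps(3) by simp
qed

text \<open>At the second Hadamard gate the resting and the walking branch interfere, and clock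
  value 0 receives their average.\<close>

lemma dstep_res:
  assumes w: "clock w" and s: "supp (\<lambda>b. bit b act \<and> \<not> bit b w) \<psi>"
  shows "res w (run x (dstep w N) \<psi>) = (\<lambda>b. (1 / 2) * (\<psi> b + pow N \<psi> b))"
proof -
  let ?\<phi> = "pow N \<psi>"
  have wa: "w \<noteq> act" using w by (simp add: clock_def)
  have s': "supp (\<lambda>b. bit b act \<and> \<not> bit b w) ?\<phi>"
  proof -
    have "(\<lambda>b. bit b act \<and> \<not> bit b w) = ready [w]" by (auto simp: ready_def fun_eq_iff)
    then show ?thesis using supp_pow[of "[w]" \<psi> N] w s by simp
  qed
  have z: "\<psi> b = 0" "?\<phi> b = 0" if "\<not> bit b act \<or> bit b w" for b using s s' that by (auto simp: supp_def)
  have c: "complex_of_real (cos (pi / 4)) = 1 / sqrt 2" "complex_of_real (sin (pi / 4)) = 1 / sqrt 2"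
    by (simp_all add: cos_45 sin_45 real_div_sqrt flip: of_real_divide)
  have h: "complex_of_real (1 / sqrt 2) * complex_of_real (1 / sqrt 2) = 1 / 2"
    by (simp flip: of_real_mult add: field_simps)
  have m2: "run x [R ([(w, False)], act, pi / 2)] (\<lambda>b. (1 / sqrt 2) * (\<psi> (flip_bit act b) + ?\<phi> (flip_bit w b)))
      = (\<lambda>b. (1 / sqrt 2) * ((if bit b w then \<psi> (flip_bit act b) else \<psi> b) + (if bit b w then ?\<phi> (flip_bit w b) else ?\<phi> (flip_bit act (flip_bit w b)))))"
    using wa by (auto simp: cr_not asg_def fun_eq_iff bit_flip flip_commute)
  have full: "run x (dstep w N) \<psi> = cr ([], w, pi / 4) (\<lambda>b. (1 / sqrt 2) * ((if bit b w then \<psi> (flip_bit act b) else \<psi> b)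
      + (if bit b w then ?\<phi> (flip_bit w b) else ?\<phi> (flip_bit act (flip_bit w b)))))"
  proof -
    have "dstep w N = [R ([], w, pi / 4), R ([(w, False)], act, pi / 2)] @ power_ops N it @ [R ([(w, False)], act, pi / 2)] @ [R ([], w, pi / 4)]"
      by (simp add: dstep_def)
    then have "run x (dstep w N) \<psi> = run x [R ([], w, pi / 4)] (run x [R ([(w, False)], act, pi / 2)]
        (pow N (run x [R ([], w, pi / 4), R ([(w, False)], act, pi / 2)] \<psi>)))"
      by (simp only: run_simps(3))
    then show ?thesis unfolding dstep_middle[OF w s] pow_middle[OF w s] m2 by simp
  qed
  show ?thesis
  proof
    fix b :: nat
    show "res w (run x (dstep w N) \<psi>) b = 1 / 2 * (\<psi> b + ?\<phi> b)"
    proof (cases "bit b w")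
      case True
      then show ?thesis using z[of b] by (simp add: res_def)
    next
      case False
      have "res w (run x (dstep w N) \<psi>) b =
         (1 / sqrt 2) * ((1 / sqrt 2) * \<psi> b) + (1 / sqrt 2) * ((1 / sqrt 2) * ?\<phi> b)"
        using False z[of "flip_bit w b"] z[of "flip_bit act (flip_bit w b)"] z[of "flip_bit w (flip_bit act b)"] wa
        unfolding full by (simp add: res_def cr_def ap_def RF_def bit_flip c flip_commute)
      then show ?thesis unfolding mult.assoc[symmetric] h[simplified] using h by (simp add: algebra_simps)
    qed
  qed
qed

lemma dstep_target: "g \<in> set (dstep w N) \<Longrightarrow> target an g \<in> insert w (insert act (target an ` set it))"
  using set_power_ops by (fastforce simp: dstep_def)

lemma detect_target: "g \<in> set (detect N ws) \<Longrightarrow> target an g \<in> set ws \<union> insert act (target an ` set it)"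
proof (induction N ws rule: detect.induct)
  case (2 N w ws)
  then show ?case using dstep_target[of g w N] by auto
qed simp

lemma detect_fix:
  assumes "\<forall>w \<in> set ws. clock w" "supp (ready ws) \<psi>" "run x it \<psi> = \<psi>"
  shows "run x (detect N ws) \<psi> = \<psi>"
  using assms
proof (induction N ws rule: detect.induct)
  case (2 N w ws)
  have "run x (dstep w N) \<psi> = \<psi>" by (rule dstep_fix) (use 2 in \<open>auto simp: supp_def ready_def\<close>)
  then show ?case using 2 by (auto simp: supp_def ready_def)
qed simp

definition clock0 :: "nat list \<Rightarrow> (nat \<Rightarrow> complex) \<Rightarrow> nat \<Rightarrow> complex" where
  "clock0 ws \<psi> b = (if \<forall>w \<in> set ws. \<not> bit b w then \<psi> b else 0)"

text \<open>On clock value 0 a step applies half of 1 plus the current power. This turns 1 minus the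
  power into half of 1 minus its square, and since the next step uses the doubled exponent, the
  argument repeats.\<close>

lemma detect_telescope:
  fixes y :: complex
  assumes "\<forall>w \<in> set ws. clock w" "distinct ws" "supp (ready ws) u" "\<psi> = (\<lambda>b. y * (u b - pow N u b))"
  shows "clock0 ws (run x (detect N ws) \<psi>) = (\<lambda>b. y / 2 ^ length ws * (u b - pow (N * 2 ^ length ws) u b))"
  using assms
proof (induction N ws arbitrary: \<psi> y rule: detect.induct)
  case (1 N)
  then show ?case by (simp add: clock0_def fun_eq_iff)
next
  case (2 N w ws)
  have w: "clock w" using 2 by simp
  have sw: "supp (ready (w # ws)) (pow N u)" using supp_pow 2 by blast
  have s: "supp (\<lambda>b. bit b act \<and> \<not> bit b w) \<psi>"
    unfolding supp_def
  proof (intro allI impI)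
    fix b assume "\<psi> b \<noteq> 0"
    then have "u b \<noteq> 0 \<or> pow N u b \<noteq> 0" by (auto simp: 2(5))
    then show "bit b act \<and> \<not> bit b w" using 2(4) sw by (auto simp: supp_def ready_def)
  qed
  have c: "clock0 (w # ws) \<phi> = clock0 ws (res w \<phi>)" for \<phi> by (auto simp: clock0_def res_def fun_eq_iff)
  \<comment> \<open>Later steps do not touch this clock, so it can be projected to 0 right after its
    own step.\<close>
  have "\<forall>g \<in> set (detect (2 * N) ws). target an g \<noteq> w"
    using detect_target[of _ "2 * N" ws] 2(3) w target_vars unfolding clock_def by fastforce
  then have "clock0 (w # ws) (run x (detect N (w # ws)) \<psi>) = clock0 ws (run x (detect (2 * N) ws) (res w (run x (dstep w N) \<psi>)))"
    unfolding c detect.simps run_simps(3) by (subst res_run) auto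
  also have "res w (run x (dstep w N) \<psi>) = (\<lambda>b. y / 2 * (u b - pow (2 * N) u b))"
  proof -
    have "pow N \<psi> = (\<lambda>b. y * pow N u b + (- y) * pow N (pow N u) b)"
      unfolding 2(5) using linopD[OF linop_run, of x "power_ops N it" y u "- y" "pow N u"] by (simp add: algebra_simps)
    moreover have "pow (2 * N) u = pow N (pow N u)" using run_power_add[of x N N it u] by (simp add: mult_2)
    ultimately show ?thesis unfolding dstep_res[OF w s] by (simp add: 2(5) algebra_simps)
  qed
  also have "clock0 ws (run x (detect (2 * N) ws) \<dots>) = (\<lambda>b. y / 2 / 2 ^ length ws * (u b - pow (2 * N * 2 ^ length ws) u b))"
    by (rule 2(1)) (use 2 in \<open>auto simp: supp_def ready_def\<close>)
  also have "\<dots> = (\<lambda>b. y / 2 ^ length (w # ws) * (u b - pow (N * 2 ^ length (w # ws)) u b))"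
    by (simp add: mult.assoc mult.left_commute)
  finally show ?case .
qed

lemma detect_wf: "\<forall>w \<in> set ws. clock w \<Longrightarrow> \<forall>g \<in> set (detect N ws). wf_op m g"
proof (induction N ws rule: detect.induct)
  case (2 N w ws)
  have "wf_op m g" if "g \<in> set (dstep w N)" for g
    using that 2(2) it_wf set_power_ops less by (fastforce simp: dstep_def clock_def wf_refl_def)
  then show ?case using 2 by auto
qed simp

lemma norm2_diff: "norm2 m (\<lambda>b. \<psi> b - \<phi> b) \<le> 2 * norm2 m \<psi> + 2 * norm2 m \<phi>"
proof -
  have "(cmod (a - b))\<^sup>2 \<le> 2 * (cmod a)\<^sup>2 + 2 * (cmod b)\<^sup>2" for a b
  proof -
    have "(cmod (a - b))\<^sup>2 + (cmod (a + b))\<^sup>2 = 2 * (cmod a)\<^sup>2 + 2 * (cmod b)\<^sup>2"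
      unfolding cmod_power2 by (simp add: power2_eq_square algebra_simps)
    then show ?thesis by (smt (verit) zero_le_power2)
  qed
  then have "(\<Sum>b < 2 ^ m. (cmod (\<psi> b - \<phi> b))\<^sup>2) \<le> (\<Sum>b < 2 ^ m. 2 * (cmod (\<psi> b))\<^sup>2 + 2 * (cmod (\<phi> b))\<^sup>2)"
    by (intro sum_mono)
  then show ?thesis unfolding norm2_def by (simp add: sum.distrib sum_distrib_left)
qed

lemma norm2_mono: "(\<And>b. \<psi> b = 0 \<or> \<psi> b = \<phi> b) \<Longrightarrow> norm2 m \<psi> \<le> norm2 m \<phi>"
  unfolding norm2_def by (intro sum_mono) (metis norm_zero order_refl power_mono zero_power2 norm_ge_zero)

text \<open>For a true value the start state is a multiple of the fixed vector plus
  \<open>sin t / cos t\<close> times a vector of squared norm at most \<open>c\<close>, and the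
  fixed vector never leaves clock value 0. For a false value the start state is a difference to
  which telescoping applies: the norms stay bounded while the factor decreases exponentially in the
  number of clocks.\<close>

theorem detection:
  fixes b :: nat
  assumes b: "b < 2 ^ m" "\<And>w. w \<in> chvars P \<Longrightarrow> \<not> bit b w" "\<not> bit b f" "bit b act" "\<not> bit b rt"
    and e: "ev pl lv an (reads x) P (bit b) v c"
    and ws: "\<forall>w \<in> set ws. clock w" "distinct ws" "\<forall>w \<in> set ws. \<not> bit b w \<and> w \<noteq> rt \<and> w \<notin> writes an P"
    and t: "sin t \<noteq> 0" "cos t \<noteq> 0" and c: "1 \<le> c"
  defines "\<Psi> \<equiv> run x (detect 1 ws) (ket (flip_bit rt b))"
  shows "v \<Longrightarrow> norm2 m (\<lambda>b'. \<Psi> b' - clock0 ws \<Psi> b') \<le> (sin t)\<^sup>2 / (cos t)\<^sup>2 * c"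
    and "\<not> v \<Longrightarrow> norm2 m (clock0 ws \<Psi>) \<le> c / ((sin t)\<^sup>2 * (2 ^ length ws)\<^sup>2)"
proof -
  from iteration[OF b e] obtain \<eta> where \<eta>: "\<And>b'. \<eta> b' \<noteq> 0 \<Longrightarrow> b' < 2 ^ m \<and> agree (writes an P) b' b"
    "norm2 m (\<lambda>b'. ket b b' + \<eta> b') \<le> c" "norm2 m (\<lambda>b'. ket b b' - \<eta> b') \<le> c \<or> v"
    "v \<Longrightarrow> run x it (\<lambda>b'. cos t * ket (flip_bit rt b) b' - sin t * (ket b b' + \<eta> b')) =
      (\<lambda>b'. cos t * ket (flip_bit rt b) b' - sin t * (ket b b' + \<eta> b'))"
    "\<not> v \<Longrightarrow> run x it (\<lambda>b'. sin t * ket (flip_bit rt b) b' + cos t * (ket b b' - \<eta> b')) =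
      (\<lambda>b'. - (sin t) * ket (flip_bit rt b) b' + cos t * (ket b b' - \<eta> b'))" by blast
  let ?bs = "flip_bit rt b"
  have wn: "act \<notin> writes an P" "rt \<notin> writes an P" "act \<noteq> rt" using wf_prog_writes[OF wf(1)] X by auto
  have rb: "ready ws b" "ready ws ?bs" using b ws(3) wn by (auto simp: ready_def bit_flip)
  have r\<eta>: "ready ws b'" "\<not> bit b' rt" if "\<eta> b' \<noteq> 0" for b'
    using \<eta>(1)[OF that] b wn ws(3) unfolding agree_def ready_def by auto
  have run\<Psi>: "linop (run x (detect 1 ws))" by (rule linop_run)
  show "norm2 m (\<lambda>b'. \<Psi> b' - clock0 ws \<Psi> b') \<le> (sin t)\<^sup>2 / (cos t)\<^sup>2 * c" if v
  proof -
    let ?\<phi> = "\<lambda>b'. cos t * ket ?bs b' - sin t * (ket b b' + \<eta> b')" and ?\<psi> = "\<lambda>b'. ket b b' + \<eta> b'"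
    have "supp (ready ws) ?\<phi>" unfolding supp_def
    proof (intro allI impI)
      fix b' assume "?\<phi> b' \<noteq> 0"
      then have "b' = b \<or> b' = ?bs \<or> \<eta> b' \<noteq> 0" by (auto simp: ket_def)
      then show "ready ws b'" using rb r\<eta> by auto
    qed
    with ws \<eta>(4)[OF that] have fx: "run x (detect 1 ws) ?\<phi> = ?\<phi>" by (intro detect_fix)
    have ket: "ket ?bs = (\<lambda>b'. (1 / cos t) * ?\<phi> b' + (sin t / cos t) * ?\<psi> b')"
      using t by (auto simp: field_simps fun_eq_iff)
    have \<Psi>: "\<Psi> = (\<lambda>b'. (1 / cos t) * ?\<phi> b' + (sin t / cos t) * run x (detect 1 ws) ?\<psi> b')"
      unfolding \<Psi>_def by (subst ket) (simp only: linopD[OF run\<Psi>] fx)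
    have "norm2 m (\<lambda>b'. \<Psi> b' - clock0 ws \<Psi> b') \<le> norm2 m (\<lambda>b'. (sin t / cos t) * run x (detect 1 ws) ?\<psi> b')"
    proof (rule norm2_mono)
      fix b'
      show "\<Psi> b' - clock0 ws \<Psi> b' = 0 \<or> \<Psi> b' - clock0 ws \<Psi> b' = (sin t / cos t) * run x (detect 1 ws) ?\<psi> b'"
      proof (cases "\<forall>w \<in> set ws. \<not> bit b' w")
        case False
        then have "?\<phi> b' = 0" using \<open>supp (ready ws) ?\<phi>\<close> by (auto simp: supp_def ready_def)
        then show ?thesis using False by (simp add: clock0_def \<Psi>)
      qed (simp add: clock0_def)
    qed
    also have "\<dots> = (sin t)\<^sup>2 / (cos t)\<^sup>2 * norm2 m ?\<psi>"
      unfolding norm2_scale norm2_run[OF detect_wf[OF ws(1)]]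
      by (simp add: norm_divide power_divide)
    also have "\<dots> \<le> (sin t)\<^sup>2 / (cos t)\<^sup>2 * c" using \<eta>(2) by (intro mult_left_mono) auto
    finally show ?thesis .
  qed
  show "norm2 m (clock0 ws \<Psi>) \<le> c / ((sin t)\<^sup>2 * (2 ^ length ws)\<^sup>2)" if v: "\<not> v"
  proof -
    let ?u = "\<lambda>b'. sin t * ket ?bs b' + cos t * (ket b b' - \<eta> b')" and ?N = "2 ^ length ws"
    have sr: "supp (ready ws) ?u" unfolding supp_def
    proof (intro allI impI)
      fix b' assume "?u b' \<noteq> 0"
      then have "b' = b \<or> b' = ?bs \<or> \<eta> b' \<noteq> 0" by (auto simp: ket_def)
      then show "ready ws b'" using rb r\<eta> by auto
    qed
    have it1: "pow 1 ?u = (\<lambda>b'. - (sin t) * ket ?bs b' + cos t * (ket b b' - \<eta> b'))"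
      using \<eta>(5)[OF v] by (simp add: power_ops_def)
    have ket: "ket ?bs = (\<lambda>b'. 1 / (2 * sin t) * (?u b' - pow 1 ?u b'))"
      unfolding it1 using t by (auto simp: field_simps fun_eq_iff)
    have tele: "clock0 ws \<Psi> = (\<lambda>b. complex_of_real (1 / (2 * sin t)) / ?N * (?u b - pow (1 * ?N) ?u b))"
      unfolding \<Psi>_def by (rule detect_telescope[OF ws(1,2) sr ket])
    have np: "norm2 m (pow N \<psi>) = norm2 m \<psi>" for N \<psi>
      by (rule norm2_run) (use it_wf set_power_ops in blast)
    \<comment> \<open>The start state has \<open>rt\<close> set and the rest has not, so the squared
      norm is a mean of 1 and a number at most \<open>c\<close>, with the weights of
      \<open>sin t\<close> and \<open>cos t\<close> squared.\<close>
    have nu: "norm2 m ?u \<le> c"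
    proof -
      have "(cmod (?u b'))\<^sup>2 = (sin t)\<^sup>2 * (cmod (ket ?bs b'))\<^sup>2 + (cos t)\<^sup>2 * (cmod (ket b b' - \<eta> b'))\<^sup>2" for b'
      proof (cases "b' = ?bs")
        case True
        then have "\<eta> b' = 0" "ket b b' = 0" using r\<eta>(2)[of b'] b by (auto simp: bit_flip ket_def)
        then show ?thesis by (simp add: norm_mult power_mult_distrib)
      qed (simp add: ket_def norm_mult power_mult_distrib)
      then have "norm2 m ?u = (sin t)\<^sup>2 * norm2 m (ket ?bs) + (cos t)\<^sup>2 * norm2 m (\<lambda>b'. ket b b' - \<eta> b')"
        by (simp add: norm2_def sum.distrib sum_distrib_left)
      moreover have "(sin t)\<^sup>2 * norm2 m (ket ?bs) \<le> (sin t)\<^sup>2 * c"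
      proof -
        have "norm2 m (ket ?bs) = (\<Sum>b' < 2 ^ m. of_bool (b' = ?bs))"
          unfolding norm2_def ket_def by (intro sum.cong) auto
        also have "\<dots> = 1" using b less by (simp add: of_bool_def sum.delta)
        finally show ?thesis using c by (intro mult_left_mono) auto
      qed
      moreover have "(cos t)\<^sup>2 * norm2 m (\<lambda>b'. ket b b' - \<eta> b') \<le> (cos t)\<^sup>2 * c"
        using \<eta>(3) v by (intro mult_left_mono) auto
      moreover have "(sin t)\<^sup>2 * c + (cos t)\<^sup>2 * c = c" by (metis distrib_right mult_1 sin_cos_squared_add)
      ultimately show ?thesis by linarith
    qed
    have "norm2 m (clock0 ws \<Psi>) = (1 / (2 * sin t) / ?N)\<^sup>2 * norm2 m (\<lambda>b. ?u b - pow (1 * ?N) ?u b)"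
      unfolding tele norm2_scale by (simp add: norm_divide norm_mult norm_power power_divide power_mult_distrib)
    also have "\<dots> \<le> (1 / (2 * sin t) / ?N)\<^sup>2 * (4 * c)"
      using norm2_diff[of ?u "pow (1 * ?N) ?u"] np[of "1 * ?N" ?u] nu by (intro mult_left_mono) auto
    also have "\<dots> = c / ((sin t)\<^sup>2 * ?N\<^sup>2)" by (simp add: power_divide power_mult_distrib)
    finally show ?thesis .
  qed
qed

end

section \<open>Costs\<close>

text \<open>At a segment of length \<open>2 ^ j\<close>, \<open>ecost i j\<close> bounds the cost of deciding whether its range is at least
  \<open>i\<close>, \<open>4 * ecost i j\<close> that of comparing its final letter at range \<open>i\<close> with a sign, and \<open>ycost i j\<close> that of
  deciding whether there is a jump of height \<open>i\<close> between its halves. The weights of the program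
  equalise the costs of positive and negative answers.\<close>

definition ecost :: "nat \<Rightarrow> nat \<Rightarrow> real" where
  "ecost i j = 32 ^ i * sqrt (2 ^ j * real ((j + i - 1) choose j))"

definition ycost :: "nat \<Rightarrow> nat \<Rightarrow> real" where
  "ycost i j = 2 + 8 * (\<Sum>h = 1..<i. ecost h (j - 1))"

text \<open>Weight of an AND with a true leaf. Such an AND multiplies the positive cost by its
  weight, up to an additive term of at most 1, and divides the negative cost by it.\<close>

definition wt1 :: "nat \<Rightarrow> nat \<Rightarrow> real" where
  "wt1 i j = ecost i (j - 1) / ecost i j"

text \<open>The share of the two halves in the square of the cost; the remaining share is that of
  the jump.\<close>

definition wt2 :: "nat \<Rightarrow> nat \<Rightarrow> real" where
  "wt2 i j = 2 * (wt1 i j)\<^sup>2"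

text \<open>Again an AND with a true leaf: it raises the negative cost of the jump to that of a
  half.\<close>

definition wt3 :: "nat \<Rightarrow> nat \<Rightarrow> real" where
  "wt3 i j = (ycost i j - 1) / (ecost i (j - 1) - 1)"

lemma ecost_sq: "(ecost i j)\<^sup>2 = 1024 ^ i * (2 ^ j * real ((j + i - 1) choose j))"
  by (simp add: ecost_def power_mult_distrib flip: power_mult power_even_eq) (simp add: power_mult power2_eq_square flip: power_mult_distrib)

lemma ecost_ge:
  assumes "1 \<le> i"
  shows "32 ^ i \<le> ecost i j" "32 \<le> ecost i j"
proof -
  have "1 \<le> (j + i - 1) choose j" using assms by (simp add: Suc_le_eq)
  then have "1 \<le> real ((j + i - 1) choose j)" by linarith
  then have "1 * 1 \<le> 2 ^ j * real ((j + i - 1) choose j)" by (intro mult_mono) auto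
  then have "1 \<le> sqrt (2 ^ j * real ((j + i - 1) choose j))" by simp
  then show *: "32 ^ i \<le> ecost i j" unfolding ecost_def
    by (metis mult.right_neutral mult_left_mono zero_le_numeral zero_le_power)
  have "(32 :: real) ^ 1 \<le> 32 ^ i" using assms by (intro power_increasing) auto
  then show "32 \<le> ecost i j" using * by simp
qed

text \<open>Pascal's rule splits the square of the cost of a segment into the squares of the costs of its halves
  and of the jump in the middle.\<close>

lemma ecost_Suc_sq:
  assumes "1 \<le> i"
  shows "(ecost i (Suc j))\<^sup>2 = 2 * (ecost i j)\<^sup>2 + 1024 ^ i * (2 ^ Suc j * real ((j + i - 1) choose Suc j))"
proof -
  have "(Suc j + i - 1) choose Suc j = ((j + i - 1) choose j) + ((j + i - 1) choose Suc j)"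
    using assms by (cases i) simp_all
  then have "real ((Suc j + i - 1) choose Suc j) = real ((j + i - 1) choose j) + real ((j + i - 1) choose Suc j)" by simp
  then show ?thesis unfolding ecost_sq by (simp add: algebra_simps)
qed

text \<open>7 / 5 is a rational lower bound for the square root of 2, the growth caused by the two
  halves alone.\<close>

lemma sqrt2_ecost:
  assumes "1 \<le> i"
  shows "7 / 5 * ecost i j \<le> ecost i (Suc j)"
proof (rule power2_le_imp_le)
  have "(7 / 5 * ecost i j)\<^sup>2 \<le> 2 * (ecost i j)\<^sup>2" by (simp add: power_mult_distrib power_divide)
  then show "(7 / 5 * ecost i j)\<^sup>2 \<le> (ecost i (Suc j))\<^sup>2" unfolding ecost_Suc_sq[OF assms] by (simp add: add_increasing2)
  show "0 \<le> ecost i (Suc j)" using ecost_ge(2)[OF assms, of "Suc j"] by linarith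
qed

lemma sum_pow32: "(\<Sum>h = 1..<i. (32 :: real) ^ h) \<le> 32 ^ i / 31"
proof (induction i)
  case (Suc i)
  then show ?case by (cases "i = 0") auto
qed simp

text \<open>\<open>M\<close> is 32 times the cost at range \<open>i - 1\<close> of a half. Pascal's
  rule reserves at least \<open>2 * M\<^sup>2\<close> in the square of the cost for the jump, while
  the jump itself costs only a fraction of \<open>M\<close>.\<close>

lemma cost_bounds:
  assumes "2 \<le> i"
  obtains M where "1024 \<le> M" "ycost i (Suc j) \<le> 27 / 100 * M" "M \<le> ecost i j"
    "2 * M\<^sup>2 \<le> 1024 ^ i * (2 ^ Suc j * real ((j + i - 1) choose Suc j)) \<or> j + i < 2"
    "2 * M\<^sup>2 \<le> (ecost i (Suc j))\<^sup>2 - 2 * (ecost i j)\<^sup>2" "512 * ecost i j \<le> M\<^sup>2"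
proof -
  define s where "s = 2 ^ j * real ((j + i - 2) choose j)"
  define M where "M = 32 ^ i * sqrt s"
  have c1: "1 \<le> (j + i - 2) choose j" using assms by (simp add: Suc_le_eq)
  have s1: "2 ^ j \<le> s"
  proof -
    have "1 \<le> real ((j + i - 2) choose j)" using c1 by linarith
    then have "2 ^ j * 1 \<le> s" unfolding s_def by (intro mult_left_mono) auto
    then show ?thesis by simp
  qed
  have s2: "1 \<le> s" using s1 one_le_power[of "2 :: real" j] by linarith
  have p32: "(32 :: real) ^ 2 \<le> 32 ^ i" using assms by (intro power_increasing) auto
  have M1: "32 ^ i \<le> M" unfolding M_def using s2 by (simp add: mult_le_cancel_left1)
  have M1024: "1024 \<le> M" using M1 p32 by simp
  have Msq: "M\<^sup>2 = 1024 ^ i * s"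
    using s2 by (simp add: M_def power_mult_distrib flip: power_mult power_even_eq) (simp add: power_mult power2_eq_square flip: power_mult_distrib)
  have eh: "ecost h j \<le> 32 ^ h * sqrt s" if "h \<in> {1..<i}" for h
  proof -
    have "(j + h - 1) choose j \<le> (j + i - 2) choose j" using that by (intro binomial_right_mono) auto
    then have "2 ^ j * real ((j + h - 1) choose j) \<le> s" unfolding s_def by (intro mult_left_mono) auto
    then show ?thesis unfolding ecost_def by (intro mult_left_mono) auto
  qed
  \<comment> \<open>The geometric series of base 32 keeps all smaller ranges together below
    \<open>M / 31\<close>. Eight times this plus 2 is below \<open>27 / 100 * M\<close> because
    \<open>M\<close> is at least 1024.\<close>
  have "(\<Sum>h = 1..<i. ecost h j) \<le> (\<Sum>h = 1..<i. 32 ^ h * sqrt s)" by (intro sum_mono eh)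
  also have "\<dots> = (\<Sum>h = 1..<i. 32 ^ h) * sqrt s" by (simp add: sum_distrib_right)
  also have "\<dots> \<le> 32 ^ i / 31 * sqrt s" using s2 by (intro mult_right_mono sum_pow32) auto
  finally have "(\<Sum>h = 1..<i. ecost h j) \<le> M / 31" by (simp add: M_def)
  then have y: "ycost i (Suc j) \<le> 27 / 100 * M" using M1024 unfolding ycost_def by simp
  have "(j + i - 2) choose j \<le> (j + i - 1) choose j" by (intro binomial_right_mono) auto
  then have "s \<le> 2 ^ j * real ((j + i - 1) choose j)" unfolding s_def by (intro mult_left_mono) auto
  then have Me: "M \<le> ecost i j" unfolding M_def ecost_def by (intro mult_left_mono) auto
  show ?thesis
  proof (cases "j = 0 \<and> i = 0")
    case True
    then show ?thesis using assms by simp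
  next
    case False
    have "(j + i - 2) choose j \<le> (j + i - 1) choose Suc j"
    proof -
      obtain n where n: "j + i - 1 = Suc n" "j + i - 2 = n" using assms by (cases "j + i - 1") auto
      show ?thesis unfolding n by simp
    qed
    then have "s \<le> 2 ^ j * real ((j + i - 1) choose Suc j)" unfolding s_def by (intro mult_left_mono) auto
    then have Z: "2 * M\<^sup>2 \<le> 1024 ^ i * (2 ^ Suc j * real ((j + i - 1) choose Suc j))"
      unfolding Msq by (simp add: mult.left_commute)
    \<comment> \<open>The square of \<open>M\<close> dominates the first power of the cost. This
      will absorb the additive term of the true leaf in \<open>cost_jump\<close>.\<close>
    have B: "512 * ecost i j \<le> M\<^sup>2"
    proof (rule power2_le_imp_le)
      have "(j + i - 1) choose j \<le> 2 ^ (j + i - 1)" by (rule binomial_le_pow2)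
      also have "\<dots> \<le> (2 :: nat) ^ (j + i)" by (intro power_increasing) auto
      finally have "real ((j + i - 1) choose j) \<le> 2 ^ (j + i)" by (metis of_nat_le_iff of_nat_numeral of_nat_power)
      then have "(512 * ecost i j)\<^sup>2 \<le> 512\<^sup>2 * (1024 ^ i * (2 ^ j * 2 ^ (j + i)))"
        unfolding power_mult_distrib ecost_sq by (intro mult_left_mono) auto
      also have "\<dots> = 1024 ^ i * (2 ^ j)\<^sup>2 * (512\<^sup>2 * 2 ^ i)" by (simp add: power_add power2_eq_square)
      also have "\<dots> \<le> 1024 ^ i * (2 ^ j)\<^sup>2 * (512 ^ i * 2 ^ i)"
        using assms by (intro mult_left_mono mult_right_mono power_increasing) auto
      also have "\<dots> = (1024 ^ i * 2 ^ j)\<^sup>2" by (simp add: power_mult_distrib power2_eq_square flip: power_mult_distrib)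
      also have "\<dots> \<le> (M\<^sup>2)\<^sup>2" unfolding Msq using s1 by (intro power_mono mult_left_mono) auto
      finally show "(512 * ecost i j)\<^sup>2 \<le> (M\<^sup>2)\<^sup>2" .
    qed simp
    have "2 * M\<^sup>2 \<le> (ecost i (Suc j))\<^sup>2 - 2 * (ecost i j)\<^sup>2"
      using Z ecost_Suc_sq[of i j] assms by simp
    then show ?thesis using that M1024 y Me Z B by blast
  qed
qed

lemma ycost_ge: "2 \<le> ycost i j"
proof -
  have "0 \<le> ecost h (j - 1)" if "h \<in> {1..<i}" for h using ecost_ge(2)[of h "j - 1"] that by force
  then have "0 \<le> (\<Sum>h = 1..<i. ecost h (j - 1))" by (intro sum_nonneg) auto
  then show ?thesis by (simp add: ycost_def)
qed

lemma ycost_le: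
  assumes "1 \<le> i"
  shows "ycost i (Suc j) \<le> 3 / 10 * ecost i j"
proof (cases "i = 1")
  case True
  then show ?thesis using ecost_ge(2)[OF assms, of j] by (simp add: ycost_def)
next
  case False
  then obtain M where "ycost i (Suc j) \<le> 27 / 100 * M" "M \<le> ecost i j" "1024 \<le> M"
    using cost_bounds[of i j] assms by (metis One_nat_def Suc_1 Suc_leI le_neq_implies_less)
  then show ?thesis by linarith
qed

lemma wt_range:
  assumes "1 \<le> i"
  shows "0 < wt1 i (Suc j)" "wt1 i (Suc j) \<le> 1" "0 < wt2 i (Suc j)" "wt2 i (Suc j) \<le> 1"
    "0 < wt3 i (Suc j)" "wt3 i (Suc j) \<le> 1"
proof -
  note e = ecost_ge(2)[OF assms, of j] ecost_ge(2)[OF assms, of "Suc j"] sqrt2_ecost[OF assms, of j]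
  show 1: "0 < wt1 i (Suc j)" "wt1 i (Suc j) \<le> 1" using e by (auto simp: wt1_def)
  show "0 < wt2 i (Suc j)" using 1 by (simp add: wt2_def)
  have "2 * (ecost i j)\<^sup>2 \<le> (ecost i (Suc j))\<^sup>2" unfolding ecost_Suc_sq[OF assms] by simp
  then show "wt2 i (Suc j) \<le> 1" using e by (simp add: wt2_def wt1_def power_divide divide_le_eq_1)
  show "0 < wt3 i (Suc j)" "wt3 i (Suc j) \<le> 1"
    using e ycost_ge[of i "Suc j"] ycost_le[OF assms, of j] by (auto simp: wt3_def divide_le_eq_1)
qed

text \<open>With B the old and t the new cost, both answers cost t - t / B, apart from the true
  leaf, which adds 1 - B / t to the positive one. The reserved unit suffices because t / B + B / t
  is at least 2.\<close>

lemma cost_search: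
  assumes "1 \<le> i"
  shows "wt1 i (Suc j) * (2 * (ecost i j - 1) / wt2 i (Suc j)) + (1 - wt1 i (Suc j)) \<le> ecost i (Suc j) - 1"
    and "(ecost i j - 1) / wt1 i (Suc j) \<le> ecost i (Suc j) - 1"
proof -
  define B \<tau> where "B = ecost i j" and "\<tau> = ecost i (Suc j)"
  have B: "32 \<le> B" "32 \<le> \<tau>" "7 / 5 * B \<le> \<tau>"
    using ecost_ge(2)[OF assms] sqrt2_ecost[OF assms] by (auto simp: B_def \<tau>_def)
  have r: "\<tau> / B + B / \<tau> \<ge> 2"
  proof -
    have "2 * (B * \<tau>) \<le> \<tau> * \<tau> + B * B" using zero_le_square[of "\<tau> - B"] by (simp add: algebra_simps)
    then show ?thesis using B by (simp add: field_simps)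
  qed
  have "wt1 i (Suc j) * (2 * (ecost i j - 1) / wt2 i (Suc j)) = \<tau> - \<tau> / B"
    using B by (simp add: wt1_def wt2_def power2_eq_square field_simps flip: B_def \<tau>_def)
  then show "wt1 i (Suc j) * (2 * (ecost i j - 1) / wt2 i (Suc j)) + (1 - wt1 i (Suc j)) \<le> ecost i (Suc j) - 1"
    using r by (simp add: wt1_def flip: B_def \<tau>_def)
  have "(ecost i j - 1) / wt1 i (Suc j) = \<tau> - \<tau> / B" using B by (simp add: wt1_def field_simps flip: B_def \<tau>_def)
  moreover have "1 \<le> \<tau> / B" using B by simp
  ultimately show "(ecost i j - 1) / wt1 i (Suc j) \<le> ecost i (Suc j) - 1" by (simp flip: \<tau>_def)
qed

lemma cost_search1:
  "wt1 1 (Suc j) * (2 * (ecost 1 j - 1)) + (1 - wt1 1 (Suc j)) \<le> ecost 1 (Suc j) - 1"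
proof -
  have "(ecost 1 (Suc j))\<^sup>2 = 2 * (ecost 1 j)\<^sup>2" using ecost_Suc_sq[of 1 j] by simp
  moreover have "ecost 1 (Suc j) \<noteq> 0" "ecost 1 j \<noteq> 0" using ecost_ge(2)[of 1 "Suc j"] ecost_ge(2)[of 1 j] by auto
  ultimately have "wt2 1 (Suc j) = 1" by (simp add: wt2_def wt1_def power_divide)
  then show ?thesis using cost_search(1)[of 1 j] by simp
qed

text \<open>When its negative cost has been raised to \<open>B - 1\<close>, the positive cost
  \<open>G\<close> of the jump is about \<open>2 * y\<^sup>2 / B\<close>. So \<open>B * G\<close> is
  of the order of \<open>M\<^sup>2\<close>, and the reserve \<open>Z\<close> exceeds it by a factor
  of 2.\<close>

lemma cost_jump:
  assumes "2 \<le> i"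
  shows "wt2 i (Suc j) < 1"
    and "wt1 i (Suc j) * ((wt3 i (Suc j) * (2 * (ycost i (Suc j) - 1)) + (1 - wt3 i (Suc j))) / (1 - wt2 i (Suc j)))
      + (1 - wt1 i (Suc j)) \<le> ecost i (Suc j) - 1"
proof -
  obtain M where M: "1024 \<le> M" "ycost i (Suc j) \<le> 27 / 100 * M" "M \<le> ecost i j"
    "2 * M\<^sup>2 \<le> (ecost i (Suc j))\<^sup>2 - 2 * (ecost i j)\<^sup>2" "512 * ecost i j \<le> M\<^sup>2"
    using cost_bounds[OF assms, of j] by metis
  define B \<tau> y Z where "B = ecost i j" and "\<tau> = ecost i (Suc j)" and "y = ycost i (Suc j)" and "Z = \<tau>\<^sup>2 - 2 * B\<^sup>2"
  have i1: "1 \<le> i" using assms by simp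
  have B: "1024 \<le> B" "7 / 5 * B \<le> \<tau>" "2 * M\<^sup>2 \<le> Z" "512 * B \<le> M\<^sup>2" "2 \<le> y" "y \<le> 27 / 100 * M"
    using M sqrt2_ecost[OF i1, of j] ycost_ge by (auto simp: B_def \<tau>_def Z_def y_def)
  have M2: "0 < M\<^sup>2" using M(1) by simp
  have Z: "0 < Z" using B(3) M2 by linarith
  have w2: "1 - wt2 i (Suc j) = Z / \<tau>\<^sup>2"
    using B by (simp add: wt2_def wt1_def Z_def power_divide diff_divide_distrib flip: B_def \<tau>_def)
  then have "0 < 1 - wt2 i (Suc j)" using Z B by simp
  then show "wt2 i (Suc j) < 1" by simp
  define G where "G = wt3 i (Suc j) * (2 * (y - 1)) + (1 - wt3 i (Suc j))"
  have w3: "0 < wt3 i (Suc j)" using wt_range(5)[OF i1] .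
  have G: "B * G \<le> M\<^sup>2"
  proof -
    have "G \<le> 2 * (y - 1)\<^sup>2 / (B - 1) + 1"
    proof -
      have "wt3 i (Suc j) * (2 * (y - 1)) = 2 * (y - 1)\<^sup>2 / (B - 1)"
        by (simp add: wt3_def power2_eq_square flip: B_def y_def)
      then show ?thesis using w3 by (simp add: G_def)
    qed
    then have "B * G \<le> B * (2 * (y - 1)\<^sup>2 / (B - 1) + 1)" using B by (intro mult_left_mono) auto
    also have "\<dots> = B / (B - 1) * (2 * (y - 1)\<^sup>2) + B" using B by (simp add: field_simps)
    also have "\<dots> \<le> 2 * (2 * (y - 1)\<^sup>2) + B" using B by (intro add_right_mono mult_right_mono) (auto simp: divide_le_eq)
    also have "(y - 1)\<^sup>2 \<le> (27 / 100 * M)\<^sup>2" using B by (intro power_mono) auto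
    \<comment> \<open>The sum of 4 * 729 / 10000 and 1 / 512 is below 1.\<close>
    also have "2 * (2 * (27 / 100 * M)\<^sup>2) + B \<le> M\<^sup>2"
    proof -
      have "(27 / 100 * M)\<^sup>2 = 729 / 10000 * M\<^sup>2" by (simp add: power_mult_distrib power_divide)
      then show ?thesis using B(4) M2 by linarith
    qed
    finally show ?thesis by simp
  qed
  have "wt1 i (Suc j) * (G / (1 - wt2 i (Suc j))) = B * G / Z * \<tau>"
    unfolding w2 using B Z by (simp add: wt1_def field_simps power2_eq_square flip: B_def \<tau>_def)
  also have "\<dots> \<le> 1 / 2 * \<tau>"
  proof (rule mult_right_mono)
    have "2 * (B * G) \<le> Z" using G B(3) by linarith
    then show "B * G / Z \<le> 1 / 2" using Z by (simp add: field_simps)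
  qed (use B in auto)
  also have "\<dots> \<le> \<tau> - 2" using B by simp
  finally show "wt1 i (Suc j) * ((wt3 i (Suc j) * (2 * (ycost i (Suc j) - 1)) + (1 - wt3 i (Suc j))) / (1 - wt2 i (Suc j)))
      + (1 - wt1 i (Suc j)) \<le> ecost i (Suc j) - 1"
    using wt_range(1)[OF i1, of j] by (simp add: G_def flip: \<tau>_def y_def)
qed

text \<open>Origin of the factor 4: one range test, the final letter of a half and two jumps of cost
  3 / 10 must fit into the growth by 7 / 5, and \<open>1 + x + 6 / 10 = 7 / 5 * x\<close> has the
  solution 4.\<close>

lemma cost_final:
  assumes "1 \<le> i"
  shows "(ecost i j - 1) + (4 * ecost i j - 1) + 2 * (ycost i (Suc j) - 1) \<le> 4 * ecost i (Suc j) - 1"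
proof -
  have "B - 1 + (4 * B - 1) + 2 * (y - 1) \<le> 4 * t - 1" if "7 / 5 * B \<le> t" "y \<le> 3 / 10 * B" for B t y :: real
    using that by simp
  then show ?thesis using sqrt2_ecost[OF assms, of j] ycost_le[OF assms, of j] by blast
qed

section \<open>The program for Dyck words\<close>

text \<open>\<open>Ad\<close> holds the bits of a position in the text, \<open>Ans\<close> the answer of the query, \<open>Sg\<close> the sign in
  question (set for -1), \<open>Pl\<close> the polarity, \<open>Lv\<close> the value of the leaf. \<open>Rho i\<close> tells that segments are
  read backwards on plane \<open>i\<close>. \<open>Cnt i\<close> and \<open>Cm i\<close> hold, in unary, the number of climbs that a jump still needs.
  \<open>W i j r\<close> belong to the segments of length \<open>2 ^ j\<close> on plane \<open>i\<close>; the ones with \<open>r = 0, 1, 2\<close> mark the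
  positions of the game: the range is at least \<open>i\<close>; the final letter at range \<open>i\<close> has the given
  sign; the segment has a jump.\<close>

datatype var = Ad nat | Ans | Sg | Pl | Lv | Rho nat | Cnt nat nat | Cm nat nat | W nat nat nat
  | Le bool nat | Aux nat

instance var :: countable by countable_datatype

text \<open>Case distinction on a subformula: guess its value (OR), then either check the guess or go on (AND).
  If the weights are 1/2, then costs add up.\<close>

definition sel :: "nat \<Rightarrow> nat \<Rightarrow> nat \<Rightarrow> var \<Rightarrow> var instr list" where
  "sel i j r G = [Ch (W i j r) (W i j (r + 1)) [(G, True)] False (1 / 2),
     Ch (W i j (r + 2)) (W i j (r + 3)) [(G, True)] True (1 / 2),
     Asg Pl [(G, True), (W i j (r + 2), False), (W i j r, False)],
     Asg (W i j (r + 4)) [(G, True), (W i j (r + 2), False)],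
     Asg (W i j (r + 5)) [(G, True), (W i j (r + 2), True), (W i j r, True)],
     Asg (W i j (r + 6)) [(G, True), (W i j (r + 2), True), (W i j r, False)]]"

text \<open>Plane 0 has no cells. A single mark suffices there, by which the leaf part recognises a
  jump with no ranges left to count.\<close>

definition jl :: "nat \<Rightarrow> nat \<Rightarrow> var" where "jl i j = W i (if i = 0 then 0 else j) 2"

text \<open>Asks for the letters at range \<open>i\<close> on both sides of the middle: in the left
  half as it stands, in the right half with \<open>Rho\<close> set. Each match lowers the counter,
  and the jump goes on with the smaller ranges in plane \<open>i - 1\<close>.\<close>

definition jump_part :: "nat \<Rightarrow> nat \<Rightarrow> nat \<Rightarrow> var instr list" where
  "jump_part k i j = sel i j 10 (jl i j) @
     Asg (W i (j - 1) 1) [(W i j 14, True)] #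
     map (\<lambda>c. Asg (Cm i (c - 1)) [(W i j 15, True), (Cnt i c, True)]) [0..<k + 2] @
     map (\<lambda>c. Asg (Cm i c) [(W i j 16, True), (Cnt i c, True)]) [0..<k + 2] @
     [Asg (W i j 17) [(W i j 15, True)], Asg (W i j 17) [(W i j 16, True)]] @
     sel i j 20 (W i j 17) @
     [Asg (W i (j - 1) 1) [(W i j 24, True)], Asg (Rho i) [(W i j 24, True)], Asg (Ad (j - 1)) [(W i j 24, True)]] @
     map (\<lambda>c. Asg (Cnt (i - 1) (c - 1)) [(W i j 25, True), (Cm i c, True)]) [0..<k + 2] @
     map (\<lambda>c. Asg (Cnt (i - 1) c) [(W i j 26, True), (Cm i c, True)]) [0..<k + 2] @
     [Asg (jl (i - 1) j) [(W i j 25, True)], Asg (jl (i - 1) j) [(W i j 26, True)]]"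

text \<open>Choices 30 and 34 are the ANDs with a true leaf, 32 chooses between halves and jump, and
  36 chooses the half or the direction of the jump.\<close>

definition range_choices :: "nat \<Rightarrow> nat \<Rightarrow> var instr list" where
  "range_choices i j = Ch (W i j 30) (W i j 31) [(W i j 0, True)] True (wt1 i j) #
     (if i = 1 then [] else
       [Ch (W i j 32) (W i j 33) [(W i j 0, True), (W i j 30, False)] False (wt2 i j),
        Ch (W i j 34) (W i j 35) [(W i j 32, True)] True (wt3 i j)]) @
     [Ch (W i j 36) (W i j 37) [(W i j 0, True), (W i j 30, False), (W i j 34, False)] False (1 / 2)]"

definition range_moves :: "nat \<Rightarrow> nat \<Rightarrow> var instr list" where
  "range_moves i j = [Asg Lv [(W i j 0, True), (W i j 30, True)], Asg Lv [(W i j 34, True)],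
     Asg (W i (j - 1) 0) [(W i j 0, True), (W i j 30, False), (W i j 32, False)],
     Asg (Ad (j - 1)) [(W i j 0, True), (W i j 30, False), (W i j 32, False), (W i j 36, True)],
     Asg (W i j 38) [(W i j 32, True), (W i j 34, False)], Asg Sg [(W i j 38, True), (W i j 36, True)],
     Asg (jl (i - 1) j) [(W i j 38, True)], Asg (Cnt (i - 1) i) [(W i j 38, True)]]"

text \<open>Follows \<open>final_append\<close> in the reading direction given by
  \<open>Rho\<close>: does the nearer half reach the range, is there a jump of the given sign (the
  answer is yes), is there one of the opposite sign (the answer is no); otherwise the farther half
  decides.\<close>

definition final_part :: "nat \<Rightarrow> nat \<Rightarrow> var instr list" where
  "final_part i j = sel i j 40 (W i j 1) @
     [Asg (W i (j - 1) 0) [(W i j 44, True)], Asg (Ad (j - 1)) [(W i j 44, True), (Rho i, False)],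
      Asg (W i (j - 1) 1) [(W i j 45, True)], Asg (Ad (j - 1)) [(W i j 45, True), (Rho i, False)]] @
     sel i j 50 (W i j 46) @
     [Asg (jl (i - 1) j) [(W i j 54, True)], Asg (Cnt (i - 1) i) [(W i j 54, True)], Asg Lv [(W i j 55, True)]] @
     sel i j 60 (W i j 56) @
     [Asg (jl (i - 1) j) [(W i j 64, True)], Asg (Cnt (i - 1) i) [(W i j 64, True)], Asg Sg [(W i j 64, True)],
      Asg (W i (j - 1) 1) [(W i j 66, True)], Asg (Ad (j - 1)) [(W i j 66, True), (Rho i, True)]]"

definition cell :: "nat \<Rightarrow> nat \<Rightarrow> nat \<Rightarrow> var instr list" where
  "cell k i j = jump_part k i j @ (range_choices i j @ range_moves i j) @ final_part i j"

fun cells :: "nat \<Rightarrow> nat \<Rightarrow> nat \<Rightarrow> var instr list" where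
  "cells k i 0 = []"
| "cells k i (Suc j) = (if i = 0 then [] else cell k i (Suc j) @ cells k i j)"

text \<open>\<open>Le t j\<close>: the lower \<open>j\<close> bits of the index are at most those of the constant.\<close>

definition compare :: "nat \<Rightarrow> bool \<Rightarrow> nat \<Rightarrow> var instr list" where
  "compare a t c = Asg (Le t 0) [] # concat (map (\<lambda>j. if bit c j
     then [Asg (Le t (Suc j)) [(Ad j, False)], Asg (Le t (Suc j)) [(Ad j, True), (Le t j, True)]]
     else [Asg (Le t (Suc j)) [(Ad j, False), (Le t j, True)]]) [0..<a])"

text \<open>The text has four quarters of length \<open>2 ^ a\<close>; they begin with \<open>k\<close> letters -1, with the input, with
  \<open>k\<close> letters 1, and the rest is 0.\<close>

definition leaf_part :: "nat \<Rightarrow> var instr list" where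
  "leaf_part a = Qry # map (Asg Lv)
     [[(W 1 0 0, True), (Ad a, False), (Ad (Suc a), False), (Le False a, True)],
      [(W 1 0 0, True), (Ad a, False), (Ad (Suc a), True), (Le False a, True)],
      [(W 1 0 0, True), (Ad a, True), (Ad (Suc a), False), (Le True a, True)],
      [(W 1 0 1, True), (Ad a, False), (Ad (Suc a), False), (Le False a, True), (Sg, True)],
      [(W 1 0 1, True), (Ad a, False), (Ad (Suc a), True), (Le False a, True), (Sg, False)],
      [(W 1 0 1, True), (Ad a, True), (Ad (Suc a), False), (Le True a, True), (Ans, False), (Sg, False)],
      [(W 1 0 1, True), (Ad a, True), (Ad (Suc a), False), (Le True a, True), (Ans, True), (Sg, True)],
      [(jl 0 0, True), (Cnt 0 0, True)]]"

definition fin_part :: "nat \<Rightarrow> nat \<Rightarrow> nat \<Rightarrow> var instr list" where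
  "fin_part n k a = (compare a False (k - 1) @ compare a True (n - 1)) @ leaf_part a"

text \<open>The last assignment converts the value relative to the polarity into the value of the
  leaf.\<close>

fun planes :: "nat \<Rightarrow> nat \<Rightarrow> nat \<Rightarrow> nat \<Rightarrow> var instr list" where
  "planes n k a 0 = fin_part n k a @ [Asg Lv [(Pl, True)]]"
| "planes n k a (Suc i) = cells k (Suc i) (a + 2) @ planes n k a i"

definition rest :: "nat \<Rightarrow> nat \<Rightarrow> nat \<Rightarrow> nat \<Rightarrow> nat \<Rightarrow> var instr list" where
  "rest n k a i j = cells k i j @ planes n k a (i - 1)"

text \<open>The formula decides the complement, namely that the range of the whole padded text is at
  least \<open>k + 1\<close>.\<close>

definition dyck_prog :: "nat \<Rightarrow> nat \<Rightarrow> nat \<Rightarrow> var instr list" where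
  "dyck_prog n k a = Asg (W (k + 1) (a + 2) 0) [] # planes n k a (k + 1)"

text \<open>Truth relative to the current polarity, so that statements about a subformula also hold
  where it is used negatively.\<close>

definition rel :: "((var \<Rightarrow> bool) \<Rightarrow> bool) \<Rightarrow> var instr list \<Rightarrow> (var \<Rightarrow> bool) \<Rightarrow> bool \<Rightarrow> real \<Rightarrow> bool" where
  "rel orc P st V c \<longleftrightarrow> ev Pl Lv Ans orc P st (V \<noteq> st Pl) c"

section \<open>Rules for evaluating programs\<close>

lemma ev_mono: "ev pl lv an orc P st v c \<Longrightarrow> c \<le> c' \<Longrightarrow> ev pl lv an orc P st v c'"
proof (induction arbitrary: c' rule: ev.induct)
  case (ev_All st ls v k p P c0 q c1 c z)
  then show ?case by (intro ev.ev_All[where ?c0.0 = c0 and ?c1.0 = c1]) auto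
next
  case (ev_One0 st ls v k p P c0 c q z)
  then show ?case by (intro ev.ev_One0[where ?c0.0 = c0]) auto
next
  case (ev_One1 st ls v k p P q c1 c z)
  then show ?case by (intro ev.ev_One1[where ?c1.0 = c1]) auto
qed (auto intro: ev.intros)

lemma rel_mono: "rel orc P st V c \<Longrightarrow> c \<le> c' \<Longrightarrow> rel orc P st V c'"
  unfolding rel_def by (rule ev_mono)

fun exec :: "'v \<Rightarrow> (('v \<Rightarrow> bool) \<Rightarrow> bool) \<Rightarrow> 'v instr list \<Rightarrow> ('v \<Rightarrow> bool) \<Rightarrow> 'v \<Rightarrow> bool" where
  "exec an orc [] st = st"
| "exec an orc (Asg t ls # P) st = exec an orc P (st(t := (st t \<noteq> holds st ls)))"
| "exec an orc (Qry # P) st = exec an orc P (st(an := (st an \<noteq> orc st)))"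
| "exec an orc (Ch q z ls k p # P) st = exec an orc P st"

lemma exec_append [simp]: "exec an orc (P @ P') st = exec an orc P' (exec an orc P st)"
  by (induction P arbitrary: st rule: chvars.induct) auto

fun classical :: "'v instr \<Rightarrow> bool" where
  "classical (Ch q z ls k p) = False"
| "classical _ = True"

lemma rel_exec:
  assumes "\<forall>i \<in> set P. classical i" "Pl \<notin> writes Ans P" "rel orc T (exec Ans orc P st) V c"
  shows "rel orc (P @ T) st V c"
  using assms
proof (induction P arbitrary: st rule: chvars.induct)
  case H: ("3_1" t ls P)
  have "rel orc (P @ T) (st(t := (st t \<noteq> holds st ls))) V c" using H by auto
  then show ?case using H(3) by (auto simp: rel_def intro: ev_Asg)
next
  case H: ("3_2" P)
  have "rel orc (P @ T) (st(Ans := (st Ans \<noteq> orc st))) V c" using H by auto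
  then show ?case by (auto simp: rel_def intro: ev_Qry)
qed auto

lemma rel_Pl:
  "rel orc P (st(Pl := (st Pl \<noteq> holds st ls))) (V \<noteq> holds st ls) c \<Longrightarrow> rel orc (Asg Pl ls # P) st V c"
  unfolding rel_def by (rule ev_Asg) (cases "holds st ls"; cases "st Pl"; cases V; simp)

lemma rel_Skip: "\<not> holds st ls \<Longrightarrow> rel orc P st V c \<Longrightarrow> rel orc (Ch q z ls k p # P) st V c"
  unfolding rel_def by (rule ev_Skip)

lemma rel_All:
  assumes "holds st ls" "V = k" "q \<noteq> Pl" "0 \<le> p" "p \<le> 1" "rel orc P st V c0" "rel orc P (st(q := True)) V c1"
    "p * c0 + (1 - p) * c1 \<le> c"
  shows "rel orc (Ch q z ls k p # P) st V c"
  using assms unfolding rel_def by (intro ev_All[where ?c0.0 = c0 and ?c1.0 = c1]) auto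

lemma rel_One0:
  assumes "holds st ls" "V \<noteq> k" "0 < p" "p \<le> 1" "rel orc P st V c0" "c0 / p \<le> c"
  shows "rel orc (Ch q z ls k p # P) st V c"
  using assms unfolding rel_def by (intro ev_One0[where ?c0.0 = c0]) auto

lemma rel_One1:
  assumes "holds st ls" "V \<noteq> k" "q \<noteq> Pl" "0 \<le> p" "p < 1" "rel orc P (st(q := True)) V c1" "c1 / (1 - p) \<le> c"
  shows "rel orc (Ch q z ls k p # P) st V c"
  using assms unfolding rel_def by (intro ev_One1[where ?c1.0 = c1]) auto

fun off :: "('v \<Rightarrow> bool) \<Rightarrow> 'v instr \<Rightarrow> bool" where
  "off st (Asg t ls) = (\<not> holds st ls)"
| "off st (Ch q z ls k p) = (\<not> holds st ls)"
| "off st Qry = False"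

text \<open>There is one program for all positions; what belongs to other segments is passed over in
  this way.\<close>

lemma rel_off:
  assumes "\<forall>i \<in> set P. off st i" "rel orc T st V c"
  shows "rel orc (P @ T) st V c"
  using assms
proof (induction P rule: chvars.induct)
  case H: ("3_1" t ls P)
  have "st(t := (st t \<noteq> holds st ls)) = st" using H by (auto simp: fun_eq_iff)
  then show ?case using H unfolding rel_def by (auto intro: ev_Asg)
qed (auto simp: rel_def intro: ev_Skip)

lemma exec_off: "\<forall>i \<in> set P. off st i \<Longrightarrow> exec an orc P st = st"
proof (induction P rule: chvars.induct)
  case H: ("3_1" t ls P)
  have "st(t := (st t \<noteq> holds st ls)) = st" using H by (auto simp: fun_eq_iff)
  then show ?case using H by simp
qed auto

text \<open>The position that verifies the guess \<open>g\<close>. For the guess False the polarity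
  is turned, so that the negation gets evaluated.\<close>

definition checked :: "nat \<Rightarrow> nat \<Rightarrow> nat \<Rightarrow> bool \<Rightarrow> (var \<Rightarrow> bool) \<Rightarrow> var \<Rightarrow> bool" where
  "checked i j r g st = st(W i j r := g, W i j (r + 4) := True, Pl := (st Pl = g))"

definition decided :: "nat \<Rightarrow> nat \<Rightarrow> nat \<Rightarrow> bool \<Rightarrow> (var \<Rightarrow> bool) \<Rightarrow> var \<Rightarrow> bool" where
  "decided i j r g st = st(W i j r := g, W i j (r + 2) := True, W i j (if g then r + 5 else r + 6) := True)"

text \<open>If \<open>V\<close> is true, the correct guess is chosen at the OR, which doubles the
  mean of \<open>a\<close> and \<open>c\<close> paid at the AND. If \<open>V\<close> is false, both
  guesses must be refuted: the correct one by the continuation at cost \<open>2 * c\<close>, the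
  wrong one by its check at cost \<open>2 * a\<close>, and the mean is again
  \<open>a + c\<close>.\<close>

lemma rel_sel:
  assumes G: "st G" "G \<noteq> Pl" "\<And>d. d \<le> 6 \<Longrightarrow> G \<noteq> W i j (r + d)" and free: "\<And>d. d \<le> 6 \<Longrightarrow> \<not> st (W i j (r + d))"
    and check: "\<And>g. rel orc T (checked i j r g st) A a"
    and cont: "rel orc T (decided i j r A st) V c"
  shows "rel orc (sel i j r G @ T) st V (a + c)"
proof -
  have f: "\<not> st (W i j r)" "\<not> st (W i j (r + 2))" "\<not> st (W i j (r + 4))" "\<not> st (W i j (r + 5))" "\<not> st (W i j (r + 6))"
    using free[of 0] free[of 2] free[of 4] free[of 5] free[of 6] by auto
  have g: "G \<noteq> W i j r" "G \<noteq> W i j (r + 2)" "G \<noteq> W i j (r + 4)" "G \<noteq> W i j (r + 5)" "G \<noteq> W i j (r + 6)"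
    using G(3)[of 0] G(3)[of 2] G(3)[of 4] G(3)[of 5] G(3)[of 6] by auto
  define tail where "tail = [Asg (W i j (r + 4)) [(G, True), (W i j (r + 2), False)],
     Asg (W i j (r + 5)) [(G, True), (W i j (r + 2), True), (W i j r, True)],
     Asg (W i j (r + 6)) [(G, True), (W i j (r + 2), True), (W i j r, False)]]"
  define P where "P = Asg Pl [(G, True), (W i j (r + 2), False), (W i j r, False)] # tail @ T"
  have tail: "\<forall>i \<in> set tail. classical i" "Pl \<notin> writes Ans tail" by (auto simp: tail_def)
  have chk: "rel orc P (st(W i j r := g)) (A = g) a" for g
  proof -
    let ?s = "st(W i j r := g)"
    have h: "holds ?s [(G, True), (W i j (r + 2), False), (W i j r, False)] \<longleftrightarrow> \<not> g" using G f g by simp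
    have "exec Ans orc tail (?s(Pl := (?s Pl \<noteq> (\<not> g)))) = checked i j r g st"
      using G f g by (auto simp: tail_def checked_def fun_eq_iff)
    then have "rel orc (tail @ T) (?s(Pl := (?s Pl \<noteq> (\<not> g)))) ((A = g) \<noteq> (\<not> g)) a"
      using check[of g] by (intro rel_exec[OF tail]) (cases g; simp)
    then show ?thesis unfolding P_def by (intro rel_Pl) (simp only: h)
  qed
  have dec: "rel orc P ((st(W i j r := A))(W i j (r + 2) := True)) V c"
  proof -
    let ?s = "(st(W i j r := A))(W i j (r + 2) := True)"
    have h: "\<not> holds ?s [(G, True), (W i j (r + 2), False), (W i j r, False)]" by simp
    have "exec Ans orc tail ?s = decided i j r A st"
      using G f g by (auto simp: tail_def decided_def fun_eq_iff)
    then have "rel orc (tail @ T) ?s V c" using cont by (intro rel_exec[OF tail]) simp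
    then show ?thesis unfolding P_def by (intro rel_off[of "[Asg Pl _]", simplified]) (use h in auto)
  qed
  define N where "N = Ch (W i j (r + 2)) (W i j (r + 3)) [(G, True)] True (1 / 2) # P"
  have Gh: "holds (st(W i j r := g)) [(G, True)]" for g using G g by simp
  have good: "rel orc N (st(W i j r := A)) V (if V then 1 / 2 * a + 1 / 2 * c else 2 * c)"
  proof (cases V)
    case True
    then show ?thesis unfolding N_def
      by (intro rel_All[OF Gh, where ?c0.0 = a and ?c1.0 = c]) (use chk[of A] dec in auto)
  next
    case False
    then show ?thesis unfolding N_def
      by (intro rel_One1[OF Gh, where ?c1.0 = c]) (use dec in auto)
  qed
  have bad: "rel orc N (st(W i j r := (\<not> A))) False (2 * a)"
    unfolding N_def by (intro rel_One0[OF Gh, where ?c0.0 = a]) (use chk[of "\<not> A"] in auto)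
  have st0: "st(W i j r := False) = st" using f by (auto simp: fun_eq_iff)
  have "rel orc (Ch (W i j r) (W i j (r + 1)) [(G, True)] False (1 / 2) # N) st V (a + c)"
  proof (cases V)
    case True
    then show ?thesis
    proof (cases A)
      case A: True
      show ?thesis by (rule rel_One1[where ?c1.0 = "1 / 2 * a + 1 / 2 * c"]) (use good A True G in auto)
    next
      case A: False
      show ?thesis by (rule rel_One0[where ?c0.0 = "1 / 2 * a + 1 / 2 * c"]) (use good A True G st0 in auto)
    qed
  next
    case False
    then show ?thesis
    proof (cases A)
      case A: True
      show ?thesis by (rule rel_All[where ?c0.0 = "2 * a" and ?c1.0 = "2 * c"]) (use good bad A False G st0 in auto)
    next
      case A: False
      show ?thesis by (rule rel_All[where ?c0.0 = "2 * c" and ?c1.0 = "2 * a"]) (use good bad A False G st0 in auto)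
    qed
  qed
  then show ?thesis by (simp add: sel_def N_def P_def tail_def)
qed

section \<open>Addresses and comparison with constants\<close>

definition low :: "nat \<Rightarrow> (var \<Rightarrow> bool) \<Rightarrow> nat" where
  "low a st = (\<Sum>d < a. of_bool (st (Ad d)) * 2 ^ d)"

definition vreads :: "bool list \<Rightarrow> nat \<Rightarrow> (var \<Rightarrow> bool) \<Rightarrow> bool" where
  "vreads x a st \<longleftrightarrow> low a st < length x \<and> x ! low a st"

lemma low_cong: "(\<And>d. st (Ad d) = st' (Ad d)) \<Longrightarrow> low a st = low a st'"
  by (simp add: low_def)

lemma low_less: "low a st < 2 ^ a"
proof (induction a)
  case (Suc a)
  then show ?case by (auto simp: low_def)
qed (simp add: low_def)

lemma exec_other: "v \<notin> writes an P \<Longrightarrow> exec an orc P st v = st v"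
  by (induction P arbitrary: st rule: chvars.induct) auto

lemma compare_Suc: "compare (Suc a) t c = compare a t c @ (if bit c a
     then [Asg (Le t (Suc a)) [(Ad a, False)], Asg (Le t (Suc a)) [(Ad a, True), (Le t a, True)]]
     else [Asg (Le t (Suc a)) [(Ad a, False), (Le t a, True)]])"
  by (simp add: compare_def)

lemma compare_writes: "writes Ans (compare a t c) \<subseteq> {Le t j | j. j \<le> a}"
proof (induction a)
  case (Suc a)
  have w: "writes Ans (P @ P') = writes Ans P \<union> writes Ans P'" for P P' :: "var instr list"
    by (induction P rule: chvars.induct) auto
  show ?case unfolding compare_Suc w using Suc by (auto simp: le_Suc_eq)
qed (simp add: compare_def)

text \<open>A differing top bit decides the comparison, an equal one defers to the lower bits. The
  assignments of one bit exclude each other, so toggling acts as disjunction.\<close>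

lemma compare_exec:
  assumes "\<And>j. \<not> st (Le t j)"
  shows "exec Ans orc (compare a t c) st (Le t a) \<longleftrightarrow> low a st \<le> take_bit a c"
proof (induction a)
  case 0
  show ?case using assms by (simp add: compare_def low_def)
next
  case (Suc a)
  let ?s = "exec Ans orc (compare a t c) st"
  have Ad: "?s (Ad a) = st (Ad a)" by (rule exec_other) (use compare_writes in blast)
  have L: "\<not> ?s (Le t (Suc a))" using assms by (subst exec_other) (use compare_writes[of a t c] in auto)
  have lo: "low (Suc a) st = low a st + of_bool (st (Ad a)) * 2 ^ a" by (simp add: low_def)
  have tb: "take_bit (Suc a) c = of_bool (bit c a) * 2 ^ a + take_bit a c"
    by (simp add: take_bit_Suc_from_most mult.commute)
  define u where "u = take_bit a c"
  then have u: "take_bit a c = u" "u < 2 ^ a" by simp_all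
  have "low a st < 2 ^ a" by (rule low_less)
  then show ?case unfolding compare_Suc lo tb u(1)
    using Suc[unfolded u(1)] Ad L u(2) by (cases "bit c a"; cases "st (Ad a)") auto
qed

section \<open>The text, its segments, and fresh states\<close>

locale dyck_text =
  fixes n k a :: nat and x :: "bool list"
  assumes x: "length x = n" and k: "1 \<le> k" "k \<le> 2 ^ a" and n: "1 \<le> n" "n \<le> 2 ^ a"
begin

definition letter :: "nat \<Rightarrow> int" where
  "letter p = (let i = p mod 2 ^ a; q = p div 2 ^ a in
     if q = 0 \<and> i < k then - 1 else if q = 1 \<and> i < n then (if x ! i then - 1 else 1)
     else if q = 2 \<and> i < k then 1 else 0)"

fun seg :: "nat \<Rightarrow> nat \<Rightarrow> int list" where
  "seg 0 p = [letter p]"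
| "seg (Suc j) p = seg j (2 * p) @ seg j (2 * p + 1)"

lemma letter_values: "letter p \<in> {-1, 0, 1}"
  by (simp add: letter_def Let_def)

lemma letters_seg [simp]: "letters (seg j p)"
  by (induction j arbitrary: p) (use letter_values in auto)

abbreviation "orc \<equiv> vreads x a"
abbreviation "rst \<equiv> rest n k a"

text \<open>The bits below \<open>j\<close> are still to be chosen, so this is the number of the
  current segment of length \<open>2 ^ j\<close>.\<close>

definition adr :: "(var \<Rightarrow> bool) \<Rightarrow> nat \<Rightarrow> nat" where
  "adr st j = (\<Sum>d = j..<a + 2. of_bool (st (Ad d)) * 2 ^ (d - j))"

lemma adr_step:
  assumes "j < a + 2"
  shows "adr st j = of_bool (st (Ad j)) + 2 * adr st (Suc j)"
proof -
  have "adr st j = of_bool (st (Ad j)) + (\<Sum>d = Suc j..<a + 2. of_bool (st (Ad d)) * 2 ^ (d - j))"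
    unfolding adr_def by (subst sum.atLeast_Suc_lessThan) (use assms in simp_all)
  also have "(\<Sum>d = Suc j..<a + 2. of_bool (st (Ad d)) * 2 ^ (d - j)) = 2 * adr st (Suc j)"
    unfolding adr_def sum_distrib_left by (intro sum.cong) (auto simp: Suc_diff_Suc simp flip: power_Suc)
  finally show ?thesis .
qed

lemma adr_cong: "(\<And>d. j \<le> d \<Longrightarrow> st (Ad d) = st' (Ad d)) \<Longrightarrow> adr st j = adr st' j"
  unfolding adr_def by (intro sum.cong) auto

lemma adr_child:
  assumes "j < a + 2" "s (Ad j) = b" "\<And>d. Suc j \<le> d \<Longrightarrow> s (Ad d) = st (Ad d)"
  shows "adr s j = 2 * adr st (Suc j) + of_bool b"
  using adr_step[OF assms(1), of s] adr_cong[of "Suc j" s st] assms by simp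

lemma adr_0:
  "low a st = adr st 0 mod 2 ^ a" "adr st 0 div 2 ^ a = of_bool (st (Ad a)) + 2 * of_bool (st (Ad (Suc a)))"
proof -
  have "adr st 0 = low a st + 2 ^ a * (of_bool (st (Ad a)) + 2 * of_bool (st (Ad (Suc a))))"
    by (simp add: adr_def low_def atLeast0LessThan algebra_simps)
  then show "low a st = adr st 0 mod 2 ^ a" "adr st 0 div 2 ^ a = of_bool (st (Ad a)) + 2 * of_bool (st (Ad (Suc a)))"
    using low_less[of a st] by simp_all
qed

text \<open>The variables that the program from \<open>rest i j\<close> on expects to be zero, if \<open>d\<close> bits of the position are
  still to be chosen.\<close>

fun fut :: "nat \<Rightarrow> nat \<Rightarrow> nat \<Rightarrow> var \<Rightarrow> bool" where
  "fut i j d (W i' j' r) = (i' < i \<or> i' = i \<and> j' \<le> j \<or> i = 0 \<and> i' = 1 \<and> j' = 0)"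
| "fut i j d (Ad j') = (j' < d)"
| "fut i j d (Rho i') = (i' < i)"
| "fut i j d (Cnt i' c) = (i' < i)"
| "fut i j d (Cm i' c) = (i' < i)"
| "fut i j d Lv = True"
| "fut i j d Ans = True"
| "fut i j d (Le t j') = True"
| "fut i j d Sg = False"
| "fut i j d Pl = False"
| "fut i j d (Aux q) = False"

definition fresh :: "nat \<Rightarrow> nat \<Rightarrow> nat \<Rightarrow> var set \<Rightarrow> (var \<Rightarrow> bool) \<Rightarrow> bool" where
  "fresh i j d A st \<longleftrightarrow> (\<forall>v. fut i j d v \<longrightarrow> v \<notin> A \<longrightarrow> \<not> st v)"

lemma freshD: "fresh i j d A st \<Longrightarrow> fut i j d v \<Longrightarrow> v \<notin> A \<Longrightarrow> \<not> st v"
  by (simp add: fresh_def)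

text \<open>Within each kind of position the toggles of \<open>Lv\<close> exclude each other, so
  each kind contributes one truth value.\<close>

lemma fin_rel:
  assumes "\<And>t j. \<not> st (Le t j)" "\<not> st Ans" "1 \<le> c"
    and V: "V = (st Lv \<noteq> ((st (W 1 0 0) \<and> letter (adr st 0) \<noteq> 0) \<noteq>
      ((st (W 1 0 1) \<and> letter (adr st 0) = (if st Sg then - 1 else 1)) \<noteq> (st (jl 0 0) \<and> st (Cnt 0 0)))))"
  shows "rel orc (planes n k a 0) st V c"
proof -
  define s1 where "s1 = exec Ans orc (compare a False (k - 1) @ compare a True (n - 1)) st"
  have wr: "writes Ans (P @ P') = writes Ans P \<union> writes Ans P'" for P P' :: "var instr list"
    by (induction P rule: chvars.induct) auto
  have oth: "s1 v = st v" if "\<And>t j. v \<noteq> Le t j" for v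
  proof -
    have "v \<notin> writes Ans (compare a t c)" for t c using that compare_writes[of a t c] by blast
    then show ?thesis unfolding s1_def by (intro exec_other) (simp add: wr)
  qed
  let ?s0 = "exec Ans orc (compare a False (k - 1)) st"
  have "?s0 (Le False a) \<longleftrightarrow> low a st \<le> take_bit a (k - 1)" using compare_exec assms by blast
  moreover have "s1 (Le False a) = ?s0 (Le False a)"
    unfolding s1_def exec_append by (rule exec_other) (use compare_writes in blast)
  moreover have "take_bit a (k - 1) = k - 1" using k by (simp add: take_bit_nat_eq_self_iff)
  ultimately have leF: "s1 (Le False a) \<longleftrightarrow> low a st < k" using k by auto
  have "\<not> ?s0 (Le True j)" for j using assms(1)[of True j] by (subst exec_other) (use compare_writes[of a False] in auto)
  then have "s1 (Le True a) \<longleftrightarrow> low a ?s0 \<le> take_bit a (n - 1)" unfolding s1_def exec_append by (rule compare_exec)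
  moreover have "low a ?s0 = low a st" by (rule low_cong, rule exec_other) (use compare_writes in blast)
  moreover have "take_bit a (n - 1) = n - 1" using n by (simp add: take_bit_nat_eq_self_iff)
  ultimately have leT: "s1 (Le True a) \<longleftrightarrow> low a st < n" using n by auto
  have low1: "low a s1 = low a st" by (rule low_cong) (use oth in auto)
  have ex: "exec Ans orc (fin_part n k a) st Lv = V"
    unfolding fin_part_def exec_append[of _ _ "compare a False (k - 1) @ compare a True (n - 1)"] s1_def[symmetric] leaf_part_def
    using oth leF leT assms(2) low1 x unfolding V
    by (simp add: vreads_def letter_def Let_def adr_0(2) flip: adr_0(1)) (cases "st (Ad a)"; cases "st (Ad (Suc a))"; auto simp: jl_def)
  have cl: "\<forall>i \<in> set (compare a t c). classical i" for t c by (induction a) (auto simp: compare_Suc, auto simp: compare_def)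
  have pl: "Pl \<notin> writes Ans (compare a t c)" for t c using compare_writes by blast
  let ?s = "exec Ans orc (fin_part n k a) st"
  have "ev Pl Lv Ans orc [] (?s(Lv := (?s Lv \<noteq> holds ?s [(Pl, True)]))) (V \<noteq> ?s Pl) c"
    using ex assms(3) by (intro ev_Nil) auto
  then have "rel orc [Asg Lv [(Pl, True)]] ?s V c" unfolding rel_def by (intro ev_Asg)
  then show ?thesis unfolding planes.simps
    by (intro rel_exec) (use cl pl in \<open>auto simp: fin_part_def leaf_part_def wr\<close>)
qed

lemma cell_off:
  assumes "1 \<le> i" "\<And>r. \<not> st (W i j r)"
  shows "\<forall>ins \<in> set (cell k i j). off st ins"
  using assms by (auto simp: cell_def jump_part_def range_choices_def range_moves_def final_part_def sel_def jl_def)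

lemma cells_off:
  assumes "1 \<le> i" "\<And>j' r. j' \<le> j \<Longrightarrow> \<not> st (W i j' r)"
  shows "\<forall>ins \<in> set (cells k i j). off st ins"
  using assms(2)
proof (induction j)
  case (Suc j)
  then show ?case using cell_off[OF assms(1), of st "Suc j"] assms(1) by auto
qed simp

lemma cells_0 [simp]: "cells k 0 j = []" by (cases j) auto

lemma cells_split: "j \<le> j' \<Longrightarrow> \<exists>U. cells k i j' = U @ cells k i j \<and> (\<forall>ins \<in> set U. 1 \<le> i \<and> (\<exists>j''. j < j'' \<and> ins \<in> set (cell k i j'')))"
proof (induction j' rule: dec_induct)
  case (step j')
  then obtain U where U: "cells k i j' = U @ cells k i j" "\<forall>ins \<in> set U. 1 \<le> i \<and> (\<exists>j''. j < j'' \<and> ins \<in> set (cell k i j''))" by blast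
  have cl: "\<forall>ins \<in> set (cell k i (Suc j')). \<exists>j''. j < j'' \<and> ins \<in> set (cell k i j'')"
    using step(1) by (meson le_imp_less_Suc)
  show ?case
  proof (cases "i = 0")
    case False
    then show ?thesis using U cl by (intro exI[of _ "cell k i (Suc j') @ U"]) auto
  qed simp
qed simp

lemma planes_idle:
  assumes "\<And>i' j' r. 1 \<le> i' \<Longrightarrow> i' \<le> i \<Longrightarrow> \<not> st (W i' j' r)" "rel orc (planes n k a 0) st V c"
  shows "rel orc (planes n k a i) st V c"
  using assms(1)
proof (induction i)
  case (Suc i)
  then have "rel orc (planes n k a i) st V c" by simp
  then show ?case unfolding planes.simps using Suc.prems by (intro rel_off cells_off) auto
qed (use assms(2) in simp)

text \<open>No mark of a position is left, so the game ends with the value already prepared in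
  \<open>Lv\<close>. The true leaves of the weights and the settled answers for final letters end
  this way.\<close>

lemma terminal:
  assumes f: "fresh i j d {Lv} st" and i: "1 \<le> i" and c: "1 \<le> c"
  shows "rel orc (rst i j) st (st Lv) c"
proof -
  have W: "\<not> st (W i' j' r)" if "i' < i \<or> i' = i \<and> j' \<le> j" for i' j' r
    using freshD[OF f, of "W i' j' r"] that by auto
  have W': "\<And>i' j' r. 1 \<le> i' \<Longrightarrow> i' \<le> i - 1 \<Longrightarrow> \<not> st (W i' j' r)" using i by (intro W) auto
  have 1: "\<not> st (jl 0 0)" using W i by (simp add: jl_def)
  have 2: "\<not> st (W 1 0 r)" for r using W[of 1 0] i by (cases "i = 1") auto
  have "rel orc (planes n k a 0) st (st Lv) c"
    by (rule fin_rel) (use freshD[OF f] c 1 2 in auto)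
  then have "rel orc (planes n k a (i - 1)) st (st Lv) c" by (rule planes_idle[rotated]) (rule W')
  then show ?thesis unfolding rest_def by (intro rel_off cells_off) (use W i in auto)
qed

text \<open>The state of a jump that has left its cell at level \<open>Suc j\<close> of plane
  \<open>i\<close> and is bound for plane \<open>i - 1\<close>.\<close>

definition arrive :: "nat \<Rightarrow> nat \<Rightarrow> nat \<Rightarrow> (var \<Rightarrow> bool) \<Rightarrow> bool" where
  "arrive i j c st \<longleftrightarrow> fresh i j (Suc j) ({jl (i - 1) (Suc j)} \<union> range (Cnt (i - 1))) st \<and> st (jl (i - 1) (Suc j)) \<and>
     (\<forall>c'. st (Cnt (i - 1) c') = (c' = c)) \<and> c < k + 2"

definition jstate :: "nat \<Rightarrow> nat \<Rightarrow> nat \<Rightarrow> (var \<Rightarrow> bool) \<Rightarrow> bool" where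
  "jstate i j c st \<longleftrightarrow> fresh i j j {jl i j} st \<and> st (jl i j) \<and> \<not> st (Rho i) \<and> (\<forall>c'. \<not> st (Cm i c')) \<and>
     (\<forall>c'. st (Cnt i c') = (c' = c)) \<and> c < k + 2"

lemma arrive_jstate:
  assumes "arrive i j c st" "1 \<le> i"
  shows "jstate (i - 1) (Suc j) c st"
proof -
  have f: "fresh i j (Suc j) ({jl (i - 1) (Suc j)} \<union> range (Cnt (i - 1))) st" using assms by (simp add: arrive_def)
  have "fresh (i - 1) (Suc j) (Suc j) {jl (i - 1) (Suc j)} st"
    unfolding fresh_def
  proof (intro allI impI)
    fix v assume v: "fut (i - 1) (Suc j) (Suc j) v" "v \<notin> {jl (i - 1) (Suc j)}"
    show "\<not> st v" by (rule freshD[OF f]) (use v assms(2) in \<open>cases v; auto\<close>)+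
  qed
  moreover have "\<not> st (Rho (i - 1))" by (rule freshD[OF f]) (use assms(2) in \<open>auto simp: jl_def\<close>)
  moreover have "\<not> st (Cm (i - 1) c')" for c' by (rule freshD[OF f]) (use assms(2) in \<open>auto simp: jl_def\<close>)
  ultimately show ?thesis using assms(1) unfolding jstate_def arrive_def by blast
qed

text \<open>Two stretches lie between: the lower cells of plane \<open>i\<close> and the higher
  cells of plane \<open>i - 1\<close>. Both are idle.\<close>

lemma arrive_rel:
  assumes arr: "arrive i j c st" and i: "1 \<le> i" and j: "Suc j \<le> a + 2" and r: "rel orc (rst (i - 1) (Suc j)) st V co"
  shows "rel orc (rst i j) st V co"
proof -
  have f: "fresh i j (Suc j) ({jl (i - 1) (Suc j)} \<union> range (Cnt (i - 1))) st" using arr by (simp add: arrive_def)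
  have W: "\<not> st (W i' j' r)" if "i' < i \<or> i' = i \<and> j' \<le> j" "W i' j' r \<noteq> jl (i - 1) (Suc j)" for i' j' r
    using freshD[OF f, of "W i' j' r"] that by auto
  have "rel orc (planes n k a (i - 1)) st V co"
  proof (cases "i - 1")
    case 0
    then show ?thesis using r by (simp add: rest_def)
  next
    case (Suc i2)
    obtain U where U: "cells k (Suc i2) (a + 2) = U @ cells k (Suc i2) (Suc j)"
      "\<forall>ins \<in> set U. \<exists>j''. Suc j < j'' \<and> ins \<in> set (cell k (Suc i2) j'')" using cells_split[OF j] by blast
    have "off st ins" if ins: "ins \<in> set U" for ins
    proof -
      obtain j'' where j'': "Suc j < j''" "ins \<in> set (cell k (Suc i2) j'')" using U(2) ins by blast
      have "\<not> st (W (Suc i2) j'' r)" for r by (rule W) (use Suc j'' in \<open>auto simp: jl_def\<close>)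
      then show ?thesis using cell_off[of "Suc i2" st j''] j'' by auto
    qed
    moreover have "planes n k a (i - 1) = U @ rst (i - 1) (Suc j)"
      unfolding Suc planes.simps U(1) rest_def by simp
    ultimately show ?thesis using r by (simp only:) (rule rel_off, blast+)
  qed
  then show ?thesis unfolding rest_def by (intro rel_off cells_off) (use W i in \<open>auto simp: jl_def\<close>)
qed

text \<open>Moves a unary counter to a new place: of all these assignments only the one for
  \<open>c\<close> can fire.\<close>

lemma exec_unary:
  assumes "\<And>d. st (u d) = (d = c)" "c < M" "\<And>d. f d \<noteq> g" "\<And>d d'. f d \<noteq> u d'"
  shows "exec an oo (map (\<lambda>d. Asg (f d) [(g, True), (u d, True)]) [0..<M]) st = (if st g then st(f c := (\<not> st (f c))) else st)"
proof -
  have split: "[0..<M] = [0..<c] @ c # [Suc c..<M]" using assms(2)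
    by (metis append_Cons upt_add_eq_append upt_conv_Cons le_add_diff_inverse less_imp_le zero_le)
  have n: "u d' \<noteq> f d" for d d' using assms(4) by metis
  have o1: "\<forall>i \<in> set (map (\<lambda>d. Asg (f d) [(g, True), (u d, True)]) [0..<c]). off st i" using assms by auto
  have o2: "\<forall>i \<in> set (map (\<lambda>d. Asg (f d) [(g, True), (u d, True)]) [Suc c..<M]). off (st(f c := b)) i" for b using assms n by auto
  show ?thesis
  proof (cases "st g")
    case True
    then show ?thesis using assms by (simp add: split exec_off[OF o1] exec_off[OF o2])
  next
    case False
    then have "\<forall>i \<in> set (map (\<lambda>d. Asg (f d) [(g, True), (u d, True)]) [0..<M]). off st i" by auto
    then show ?thesis using False by (simp add: exec_off)
  qed
qed

end

section \<open>Claims about positions, and their step for ranges\<close>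

context dyck_text
begin

definition sg :: "(var \<Rightarrow> bool) \<Rightarrow> int" where "sg st = (if st Sg then - 1 else 1)"

definition orient :: "bool \<Rightarrow> int list \<Rightarrow> int list" where "orient r w = (if r then rev w else w)"

text \<open>Still \<open>c\<close> climbs are needed, and the ranges from 1 to \<open>i\<close> are
  left to provide them.\<close>

definition jval :: "nat \<Rightarrow> nat \<Rightarrow> nat \<Rightarrow> (var \<Rightarrow> bool) \<Rightarrow> bool" where
  "jval i j c st \<longleftrightarrow> c \<le> (\<Sum>h = 1..<Suc i. of_bool (final h (seg j (2 * adr st (Suc j))) = sg st) +
     of_bool (final h (rev (seg j (2 * adr st (Suc j) + 1))) = sg st))"

text \<open>Asking for the letter -1 amounts to negating both halves, since this negates their final
  letters.\<close>

lemma jval_jump: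
  assumes "1 \<le> i"
  shows "jval (i - 1) j i st = (let v = seg j (2 * adr st (Suc j)); w = seg j (2 * adr st (Suc j) + 1) in
    if st Sg then jump i (neg v) (neg w) else jump i v w)"
  using assms by (simp add: jval_def jump_def climbs_def Let_def sg_def final_neg sum.distrib minus_equation_iff[of _ 1] eq_commute[of "- 1"])

text \<open>The unit below \<open>ecost\<close> makes room for the true leaf that the next level
  adds.\<close>

definition E_claim :: "nat \<Rightarrow> nat \<Rightarrow> bool" where
  "E_claim i j \<longleftrightarrow> (\<forall>st. fresh i j j {W i j 0} st \<longrightarrow> st (W i j 0) \<longrightarrow>
     rel orc (rst i j) st (int i \<le> rng (seg j (adr st j))) (ecost i j - 1))"

definition L_claim :: "nat \<Rightarrow> nat \<Rightarrow> bool" where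
  "L_claim i j \<longleftrightarrow> (\<forall>st. fresh i j j {W i j 1} st \<longrightarrow> st (W i j 1) \<longrightarrow>
     rel orc (rst i j) st (final i (orient (st (Rho i)) (seg j (adr st j))) = sg st) (4 * ecost i j - 1))"

text \<open>Two final letters for every range, and 1 for the leaf at the end.\<close>

definition J_claim :: "nat \<Rightarrow> nat \<Rightarrow> bool" where
  "J_claim i j \<longleftrightarrow> (\<forall>st c. jstate i (Suc j) c st \<longrightarrow>
     rel orc (rst i (Suc j)) st (jval i j c st) (1 + (\<Sum>h = 1..<Suc i. 2 * (4 * ecost h j - 1))))"

lemma J_claim_ycost:
  assumes "J_claim (i - 1) j" "1 \<le> i" "Suc j \<le> a + 2" "arrive i j c st"
  shows "rel orc (rst i j) st (jval (i - 1) j c st) (ycost i (Suc j) - 1)"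
proof -
  have "1 + (\<Sum>h = 1..<Suc (i - 1). 2 * (4 * ecost h j - 1)) = 1 + 8 * (\<Sum>h = 1..<i. ecost h j) - 2 * real (i - 1)"
    using assms(2) by (simp add: sum_subtractf sum_distrib_left algebra_simps of_nat_diff)
  also have "\<dots> \<le> ycost i (Suc j) - 1" by (simp add: ycost_def)
  finally show ?thesis
    using assms arrive_jstate[OF assms(4,2)] unfolding J_claim_def
    by (intro arrive_rel[OF assms(4,2,3)]) (blast intro: rel_mono)
qed

lemma rst_Suc: "1 \<le> i \<Longrightarrow> rst i (Suc j) = jump_part k i (Suc j) @ (range_choices i (Suc j) @ range_moves i (Suc j)) @ final_part i (Suc j) @ rst i j"
  by (simp add: rest_def cell_def)

lemma jump_part_off: "1 \<le> i \<Longrightarrow> (\<And>r. r = 2 \<or> 10 \<le> r \<and> r < 30 \<Longrightarrow> \<not> s (W i j r)) \<Longrightarrow> \<forall>ins \<in> set (jump_part k i j). off s ins"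
  by (auto simp: jump_part_def sel_def jl_def)

lemma range_part_off: "(\<And>r. r = 0 \<or> 30 \<le> r \<and> r < 40 \<Longrightarrow> \<not> s (W i j r)) \<Longrightarrow> \<forall>ins \<in> set (range_choices i j @ range_moves i j). off s ins"
  by (auto simp: range_choices_def range_moves_def)

lemma final_part_off: "(\<And>r. r = 1 \<or> 40 \<le> r \<Longrightarrow> \<not> s (W i j r)) \<Longrightarrow> \<forall>ins \<in> set (final_part i j). off s ins"
  by (auto simp: final_part_def sel_def)

lemma freshI: "(\<And>v. fut i j d v \<Longrightarrow> v \<notin> A \<Longrightarrow> \<not> st v) \<Longrightarrow> fresh i j d A st"
  by (simp add: fresh_def)

lemma rel_exec_off:
  assumes "rel orc T (exec Ans orc P s) V c" "\<forall>i \<in> set P. classical i" "Pl \<notin> writes Ans P"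
    "\<forall>i \<in> set F. off (exec Ans orc P s) i"
  shows "rel orc (P @ F @ T) s V c"
  by (rule rel_exec[OF assms(2,3)]) (rule rel_off[OF assms(4,1)])

lemma range_step:
  assumes i: "1 \<le> i" "i \<le> k + 1" and j: "Suc j \<le> a + 2" and EC: "E_claim i j" and JC: "J_claim (i - 1) j"
  shows "E_claim i (Suc j)"
  unfolding E_claim_def
proof (intro allI impI)
  fix st assume f: "fresh i (Suc j) (Suc j) {W i (Suc j) 0} st" and on: "st (W i (Suc j) 0)"
  let ?w = "W i (Suc j)" and ?T = "range_moves i (Suc j) @ final_part i (Suc j) @ rst i j"
  let ?p = "adr st (Suc j)"
  let ?v = "seg j (2 * ?p)" and ?u = "seg j (2 * ?p + 1)"
  have free: "\<not> st (W i (Suc j) r)" if "r \<noteq> 0" for r using freshD[OF f, of "W i (Suc j) r"] that by auto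
  have free': "\<not> st (W i j r)" "\<not> st (Ad j)" "\<not> st Lv" "\<not> st (Cnt (i - 1) i)" for r
    using freshD[OF f, of "W i j r"] freshD[OF f, of "Ad j"] freshD[OF f, of Lv] freshD[OF f, of "Cnt (i - 1) i"] i by auto
  have freej: "\<not> st (W (i - 1) j' r)" for r j' using freshD[OF f, of "W (i - 1) j' r"] i by (cases i) auto
  have cl: "\<forall>ins \<in> set (range_moves i (Suc j)). classical ins" "Pl \<notin> writes Ans (range_moves i (Suc j))"
    by (auto simp: range_moves_def jl_def)
  have fo: "\<forall>ins \<in> set (final_part i (Suc j)). off s ins" if "\<And>r. r = 1 \<or> 40 \<le> r \<Longrightarrow> \<not> s (?w r)" for s
    using that by (rule final_part_off)
  \<comment> \<open>Branches of the weighted ANDs that lead to a true leaf.\<close>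
  have dead: "rel orc ?T s True 1"
    if ex: "exec Ans orc (range_moves i (Suc j)) s = s(Lv := True)"
      and s: "\<And>v. \<not> st v \<Longrightarrow> s v \<Longrightarrow> v \<in> {?w 30, ?w 32, ?w 34}" for s
  proof -
    have fr: "fresh i j (Suc j) {Lv} (s(Lv := True))"
    proof (rule freshI)
      fix v assume v: "fut i j (Suc j) v" "v \<notin> {Lv}"
      then have "\<not> st v" using freshD[OF f, of v] i by (cases v) auto
      moreover have "v \<notin> {?w 30, ?w 32, ?w 34}" using v i by auto
      ultimately show "\<not> (s(Lv := True)) v" using s[of v] v by auto
    qed
    have "\<not> s (?w r)" if "r = 1 \<or> 40 \<le> r" for r using s[of "?w r"] free[of r] that by auto
    moreover have "rel orc (rst i j) (s(Lv := True)) ((s(Lv := True)) Lv) 1" by (rule terminal[OF fr i(1)]) simp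
    ultimately show ?thesis using ex by (intro rel_exec_off cl fo) simp_all
  qed
  have dead_a: "rel orc ?T (st(?w 30 := True)) True 1"
    by (rule dead) (use on free free' in \<open>auto simp: range_moves_def jl_def fun_eq_iff split: if_splits\<close>)
  have dead_b: "rel orc ?T (st(?w 32 := True, ?w 34 := True)) True 1"
    by (rule dead) (use on free free' in \<open>auto simp: range_moves_def jl_def fun_eq_iff split: if_splits\<close>)
  have child: "rel orc ?T (st(?w 36 := b)) (int i \<le> rng (seg j (2 * ?p + of_bool b))) (ecost i j - 1)" for b
  proof -
    let ?s = "st(?w 36 := b, W i j 0 := True, Ad j := b)"
    have ex: "exec Ans orc (range_moves i (Suc j)) (st(?w 36 := b)) = ?s"
      using on free free' by (auto simp: range_moves_def jl_def fun_eq_iff)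
    have fr: "fresh i j j {W i j 0} ?s"
    proof (rule freshI)
      fix v assume "fut i j j v" "v \<notin> {W i j 0}"
      then show "\<not> ?s v" using freshD[OF f, of v] i by (cases v) auto
    qed
    have "adr ?s j = 2 * ?p + of_bool b" by (rule adr_child) (use j in auto)
    moreover have "rel orc (rst i j) ?s (int i \<le> rng (seg j (adr ?s j))) (ecost i j - 1)"
      using EC fr unfolding E_claim_def by auto
    ultimately show ?thesis using ex free by (intro rel_exec_off cl fo) auto
  qed
  \<comment> \<open>The choice 36 turns the sign or not, so both directions occur whatever sign is
    inherited.\<close>
  have jmp: "rel orc ?T (st(?w 32 := True, ?w 36 := b)) (if st Sg \<noteq> b then jump i (neg ?v) (neg ?u) else jump i ?v ?u) (ycost i (Suc j) - 1)" for b
  proof -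
    let ?s = "st(?w 32 := True, ?w 36 := b, ?w 38 := True, Sg := (st Sg \<noteq> b), jl (i - 1) (Suc j) := True, Cnt (i - 1) i := True)"
    have ex: "exec Ans orc (range_moves i (Suc j)) (st(?w 32 := True, ?w 36 := b)) = ?s"
      using on free free' freej i by (auto simp: range_moves_def jl_def fun_eq_iff)
    have fr: "fresh i j (Suc j) ({jl (i - 1) (Suc j)} \<union> range (Cnt (i - 1))) ?s"
    proof (rule freshI)
      fix v assume "fut i j (Suc j) v" "v \<notin> {jl (i - 1) (Suc j)} \<union> range (Cnt (i - 1))"
      then show "\<not> ?s v" using freshD[OF f, of v] i by (cases v) auto
    qed
    have "\<not> st (Cnt (i - 1) c)" for c using freshD[OF f, of "Cnt (i - 1) c"] i by auto
    then have arr: "arrive i j i ?s" using fr i by (auto simp: arrive_def jl_def)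
    have adr: "adr ?s (Suc j) = ?p" by (rule adr_cong) (auto simp: jl_def)
    have sgs: "?s Sg = (st Sg \<noteq> b)" by (simp add: jl_def)
    have "rel orc (rst i j) ?s (jval (i - 1) j i ?s) (ycost i (Suc j) - 1)" by (rule J_claim_ycost[OF JC i(1) j arr])
    then have "rel orc (rst i j) ?s (if st Sg \<noteq> b then jump i (neg ?v) (neg ?u) else jump i ?v ?u) (ycost i (Suc j) - 1)"
      unfolding jval_jump[OF i(1)] Let_def adr sgs .
    then show ?thesis using ex free i by (intro rel_exec_off cl fo) (auto simp: jl_def)
  qed
  note wr = wt_range[OF i(1), of j] and cs = cost_search[OF i(1), of j]
  have B: "32 \<le> ecost i j" "32 \<le> ecost i (Suc j)" using ecost_ge i by auto
  have st30: "st(?w 36 := False) = st" "st(?w 32 := True, ?w 36 := False) = st(?w 32 := True)"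
    using free by (auto simp: fun_eq_iff)
  \<comment> \<open>The program from each choice on, treated from the innermost choice
    outwards.\<close>
  define C4 C3 where "C4 = Ch (?w 36) (?w 37) [(?w 0, True), (?w 30, False), (?w 34, False)] False (1 / 2) # ?T"
    and "C3 = Ch (?w 34) (?w 35) [(?w 32, True)] True (wt3 i (Suc j)) # C4"
  define V1 where "V1 \<longleftrightarrow> int i \<le> rng ?v \<or> int i \<le> rng ?u"
  define V2 where "V2 \<longleftrightarrow> jump i ?v ?u \<or> jump i (neg ?v) (neg ?u)"
  have n4: "rel orc C4 st V1 (if V1 then 2 * (ecost i j - 1) else ecost i j - 1)"
  proof -
    have h: "holds st [(?w 0, True), (?w 30, False), (?w 34, False)]" using on free by simp
    consider "int i \<le> rng ?v" | "int i \<le> rng ?u" | "\<not> V1" unfolding V1_def by blast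
    then show ?thesis
    proof cases
      case 1
      then show ?thesis unfolding C4_def by (intro rel_One0[OF h, where ?c0.0 = "ecost i j - 1"]) (use child[of False] st30 in \<open>auto simp: V1_def\<close>)
    next
      case 2
      then show ?thesis unfolding C4_def by (intro rel_One1[OF h, where ?c1.0 = "ecost i j - 1"]) (use child[of True] in \<open>auto simp: V1_def\<close>)
    next
      case 3
      then show ?thesis unfolding C4_def by (intro rel_All[OF h, where ?c0.0 = "ecost i j - 1" and ?c1.0 = "ecost i j - 1"])
        (use child[of False] child[of True] st30 in \<open>auto simp: V1_def\<close>)
    qed
  qed
  have j4: "rel orc C4 (st(?w 32 := True)) V2 (if V2 then 2 * (ycost i (Suc j) - 1) else ycost i (Suc j) - 1)"
  proof -
    have h: "holds (st(?w 32 := True)) [(?w 0, True), (?w 30, False), (?w 34, False)]" using on free by simp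
    have b: "rel orc ?T (st(?w 32 := True)) (if st Sg then jump i (neg ?v) (neg ?u) else jump i ?v ?u) (ycost i (Suc j) - 1)"
      using jmp[of False] st30 by simp
    consider "if st Sg then jump i (neg ?v) (neg ?u) else jump i ?v ?u" | "if \<not> st Sg then jump i (neg ?v) (neg ?u) else jump i ?v ?u" | "\<not> V2"
      unfolding V2_def by (cases "st Sg"; simp only: if_True if_False not_True_eq_False not_False_eq_True; blast)
    then show ?thesis
    proof cases
      case 1
      then show ?thesis unfolding C4_def by (intro rel_One0[OF h, where ?c0.0 = "ycost i (Suc j) - 1"]) (use b in \<open>auto simp: V2_def split: if_splits\<close>)
    next
      case 2
      then show ?thesis unfolding C4_def by (intro rel_One1[OF h, where ?c1.0 = "ycost i (Suc j) - 1"]) (use jmp[of True] in \<open>auto simp: V2_def split: if_splits\<close>)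
    next
      case 3
      then show ?thesis unfolding C4_def by (intro rel_All[OF h, where ?c0.0 = "ycost i (Suc j) - 1" and ?c1.0 = "ycost i (Suc j) - 1"])
        (use b jmp[of True] in \<open>auto simp: V2_def split: if_splits\<close>)
    qed
  qed
  have dead4: "rel orc C4 (st(?w 30 := True)) True 1" "rel orc C4 (st(?w 32 := True, ?w 34 := True)) True 1"
    unfolding C4_def by (rule rel_Skip[OF _ dead_a], simp, rule rel_Skip[OF _ dead_b], simp)
  have dead3: "rel orc C3 (st(?w 30 := True)) True 1"
    unfolding C3_def by (rule rel_Skip[OF _ dead4(1)]) (use free in auto)
  have n3: "rel orc C3 st V1 (if V1 then 2 * (ecost i j - 1) else ecost i j - 1)"
    unfolding C3_def by (rule rel_Skip) (use n4 free in auto)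
  have j3: "rel orc C3 (st(?w 32 := True)) V2 (if V2 then wt3 i (Suc j) * (2 * (ycost i (Suc j) - 1)) + (1 - wt3 i (Suc j)) else ecost i j - 1)"
  proof (cases V2)
    case True
    have "rel orc C4 (st(?w 32 := True, ?w 34 := True)) V2 1" using dead4 True by simp
    then show ?thesis unfolding C3_def using j4 True wr
      by (intro rel_All[where ?c0.0 = "2 * (ycost i (Suc j) - 1)" and ?c1.0 = 1]) auto
  next
    case False
    \<comment> \<open>The weight \<open>wt3\<close> is defined so as to give this equality.\<close>
    have "(ycost i (Suc j) - 1) / wt3 i (Suc j) = ecost i j - 1"
      using ycost_ge[of i "Suc j"] B by (simp add: wt3_def)
    then show ?thesis unfolding C3_def using j4 False wr
      by (intro rel_One0[where ?c0.0 = "ycost i (Suc j) - 1"]) auto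
  qed
  have V: "int i \<le> rng (seg (Suc j) ?p) \<longleftrightarrow> V1 \<or> V2"
    unfolding V1_def V2_def seg.simps using rng_append_ge_iff[of ?v ?u i] i by auto
  \<comment> \<open>A jump of height 1 would have to be composed of ranges below 1.\<close>
  have V2_1: "\<not> V2" if "i = 1" using that by (simp add: V2_def jump_def climbs_def)
  have main: "rel orc (range_choices i (Suc j) @ ?T) st (V1 \<or> V2) (ecost i (Suc j) - 1)"
  proof (cases "i = 1")
    case True
    have v: "(V1 \<or> V2) = V1" using V2_1[OF True] by simp
    have rc: "range_choices i (Suc j) @ ?T = Ch (?w 30) (?w 31) [(?w 0, True)] True (wt1 i (Suc j)) # C4"
      using True by (simp add: range_choices_def C4_def)
    show ?thesis unfolding rc v
    proof (cases V1)
      case V1: True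
      have "rel orc C4 (st(?w 30 := True)) V1 1" using dead4 V1 by simp
      then show "rel orc (Ch (?w 30) (?w 31) [(?w 0, True)] True (wt1 i (Suc j)) # C4) st V1 (ecost i (Suc j) - 1)"
        using n4 V1 on wr cost_search1[of j] True
        by (intro rel_All[where ?c0.0 = "2 * (ecost i j - 1)" and ?c1.0 = 1]) auto
    next
      case V1: False
      then show "rel orc (Ch (?w 30) (?w 31) [(?w 0, True)] True (wt1 i (Suc j)) # C4) st V1 (ecost i (Suc j) - 1)"
        using n4 on wr cs by (intro rel_One0[where ?c0.0 = "ecost i j - 1"]) auto
    qed
  next
    case False
    then have i2: "2 \<le> i" using i by simp
    define C2 where "C2 = Ch (?w 32) (?w 33) [(?w 0, True), (?w 30, False)] False (wt2 i (Suc j)) # C3"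
    have rc: "range_choices i (Suc j) @ ?T = Ch (?w 30) (?w 31) [(?w 0, True)] True (wt1 i (Suc j)) # C2"
      using False by (simp add: range_choices_def C4_def C3_def C2_def)
    have h: "holds st [(?w 0, True), (?w 30, False)]" using on free by simp
    have dead2: "rel orc C2 (st(?w 30 := True)) True 1"
      unfolding C2_def by (rule rel_Skip) (use dead3 in auto)
    show ?thesis unfolding rc
    proof (cases "V1 \<or> V2")
      case V: True
      then have d: "rel orc C2 (st(?w 30 := True)) (V1 \<or> V2) 1" using dead2 by simp
      show "rel orc (Ch (?w 30) (?w 31) [(?w 0, True)] True (wt1 i (Suc j)) # C2) st (V1 \<or> V2) (ecost i (Suc j) - 1)"
      proof (cases V1)
        case True
        then have "rel orc C2 st (V1 \<or> V2) (2 * (ecost i j - 1) / wt2 i (Suc j))"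
          unfolding C2_def using n3 wr by (intro rel_One0[OF h, where ?c0.0 = "2 * (ecost i j - 1)"]) auto
        then show ?thesis using d V on wr cs
          by (intro rel_All[where ?c0.0 = "2 * (ecost i j - 1) / wt2 i (Suc j)" and ?c1.0 = 1]) auto
      next
        case False
        let ?G = "wt3 i (Suc j) * (2 * (ycost i (Suc j) - 1)) + (1 - wt3 i (Suc j))"
        from False V have "rel orc C2 st (V1 \<or> V2) (?G / (1 - wt2 i (Suc j)))"
          unfolding C2_def using j3 wr cost_jump(1)[OF i2] by (intro rel_One1[OF h, where ?c1.0 = ?G]) auto
        then show ?thesis using d V on wr cost_jump(2)[OF i2]
          by (intro rel_All[where ?c0.0 = "?G / (1 - wt2 i (Suc j))" and ?c1.0 = 1]) auto
      qed
    next
      case V: False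
      \<comment> \<open>Halves and jump have the same negative cost, so their weighted mean does not
        depend on \<open>wt2\<close>.\<close>
      have "wt2 i (Suc j) * (ecost i j - 1) + (1 - wt2 i (Suc j)) * (ecost i j - 1) = ecost i j - 1"
        by (simp add: algebra_simps)
      then have "rel orc C2 st (V1 \<or> V2) (ecost i j - 1)"
        unfolding C2_def using V n3 j3 wr
        by (intro rel_All[OF h, where ?c0.0 = "ecost i j - 1" and ?c1.0 = "ecost i j - 1"]) auto
      then show "rel orc (Ch (?w 30) (?w 31) [(?w 0, True)] True (wt1 i (Suc j)) # C2) st (V1 \<or> V2) (ecost i (Suc j) - 1)"
        using V on wr cs by (intro rel_One0[where ?c0.0 = "ecost i j - 1"]) auto
    qed
  qed
  show "rel orc (rst i (Suc j)) st (int i \<le> rng (seg (Suc j) ?p)) (ecost i (Suc j) - 1)"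
    unfolding V rst_Suc[OF i(1)] append_assoc
    by (rule rel_off[OF jump_part_off[OF i(1)] main]) (use free in auto)
qed

end

section \<open>Steps for final letters and for jumps\<close>

context dyck_text
begin

text \<open>The two heights of \<open>v\<close> add up to less than \<open>h\<close>, and so do
  those of \<open>w\<close>; both jumps together would need \<open>2 * h\<close>.\<close>

lemma jump_exclusive:
  assumes "letters v" "letters w" "1 \<le> h" "rng w < int h"
  shows "\<not> (jump h v w \<and> jump h (neg v) (neg w))"
proof -
  have "height h v + height h (neg v) < int h" using assms height_bounds by blast
  moreover have "U (rev w) + U (neg (rev w)) < int h" using assms rng_rev[of w] by (simp add: rng_def)
  ultimately show ?thesis using jump_iff[OF assms] jump_neg_iff[OF assms] by linarith
qed

text \<open>Reversal exchanges the roles of the halves, but a jump across the middle is the same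
  from either side.\<close>

lemma final_orient:
  fixes p j :: nat and r :: bool
  assumes "1 \<le> i"
  defines "v \<equiv> seg j (2 * p)" and "w \<equiv> seg j (2 * p + 1)"
    and "near \<equiv> seg j (2 * p + of_bool (\<not> r))" and "far \<equiv> seg j (2 * p + of_bool r)"
  shows "final i (orient r (seg (Suc j) p)) = (if int i \<le> rng near then final i (orient r near)
      else if jump i v w then 1 else if jump i (neg v) (neg w) then - 1 else final i (orient r far))"
    and "\<not> int i \<le> rng near \<Longrightarrow> \<not> (jump i v w \<and> jump i (neg v) (neg w))"
proof -
  have n: "jump i (neg (rev w)) (neg (rev v)) = jump i (neg v) (neg w)"
    using jump_rev[of i "neg w" "neg v"] by simp
  show "final i (orient r (seg (Suc j) p)) = (if int i \<le> rng near then final i (orient r near)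
      else if jump i v w then 1 else if jump i (neg v) (neg w) then - 1 else final i (orient r far))"
  proof (cases r)
    case True
    have "final i (rev w @ rev v) = (if int i \<le> rng (rev v) then final i (rev v)
      else if jump i (rev w) (rev v) then 1 else if jump i (neg (rev w)) (neg (rev v)) then - 1 else final i (rev w))"
      by (rule final_append) (use assms in \<open>auto simp: v_def w_def\<close>)
    then show ?thesis using True unfolding jump_rev n by (simp add: orient_def near_def far_def v_def w_def)
  next
    case False
    have "final i (v @ w) = (if int i \<le> rng w then final i w
      else if jump i v w then 1 else if jump i (neg v) (neg w) then - 1 else final i v)"
      by (rule final_append) (use assms in \<open>auto simp: v_def w_def\<close>)
    then show ?thesis using False by (simp add: orient_def near_def far_def v_def w_def)
  qed
  show "\<not> (jump i v w \<and> jump i (neg v) (neg w))" if "\<not> int i \<le> rng near"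
  proof (cases r)
    case True
    then show ?thesis using jump_exclusive[of "rev w" "rev v" i] that assms(1) unfolding jump_rev n
      by (simp add: near_def v_def w_def)
  next
    case False
    then show ?thesis using jump_exclusive[of v w i] that assms(1) by (simp add: near_def v_def w_def)
  qed
qed

lemma decided_other: "(\<And>q. v \<noteq> W i j q) \<Longrightarrow> decided i j r g s v = s v"
  by (simp add: decided_def)

lemma checked_other: "(\<And>q. v \<noteq> W i j q) \<Longrightarrow> v \<noteq> Pl \<Longrightarrow> checked i j r g s v = s v"
  by (simp add: checked_def)

text \<open>A frame rule: what a cell changes besides the exceptions in \<open>A\<close> are its own
  variables, the polarity and the counter \<open>Cm\<close>, none of which is expected to be zero
  later.\<close>

lemma fresh_next:
  assumes f: "fresh i (Suc j) (Suc j) {W i (Suc j) r0} st" and i: "1 \<le> i" and d: "d \<le> Suc j"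
    and h: "\<And>v. fut i j d v \<Longrightarrow> v \<notin> A \<Longrightarrow> (\<And>r. v \<noteq> W i (Suc j) r) \<Longrightarrow> v \<noteq> Pl \<Longrightarrow>
    (\<And>c. v \<noteq> Cm i c) \<Longrightarrow> s v = st v"
  shows "fresh i j d A s"
proof (rule freshI)
  fix v assume v: "fut i j d v" "v \<notin> A"
  have n: "v \<noteq> W i (Suc j) r" for r using v(1) i by auto
  have "v \<noteq> Pl" "v \<noteq> Cm i c" for c using v(1) by auto
  then have "s v = st v" using h v n by blast
  moreover have "fut i (Suc j) (Suc j) v" using v(1) i d by (cases v) auto
  then have "\<not> st v" using freshD[OF f] n by blast
  ultimately show "\<not> s v" by simp
qed

lemma final_step:
  assumes i: "1 \<le> i" "i \<le> k + 1" and j: "Suc j \<le> a + 2"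
    and EC: "E_claim i j" and LC: "L_claim i j" and JC: "J_claim (i - 1) j"
  shows "L_claim i (Suc j)"
  unfolding L_claim_def
proof (intro allI impI)
  fix st assume f: "fresh i (Suc j) (Suc j) {W i (Suc j) 1} st" and on: "st (W i (Suc j) 1)"
  let ?w = "W i (Suc j)" and ?p = "adr st (Suc j)" and ?r = "st (Rho i)"
  let ?v = "seg j (2 * ?p)" and ?u = "seg j (2 * ?p + 1)"
  let ?near = "seg j (2 * ?p + of_bool (\<not> ?r))" and ?far = "seg j (2 * ?p + of_bool ?r)"
  have free: "\<not> st (W i (Suc j) r)" if "r \<noteq> 1" for r using freshD[OF f, of "W i (Suc j) r"] that by auto
  have free': "\<not> st (W i j r)" "\<not> st (Ad j)" "\<not> st Lv" "\<not> st (Cnt (i - 1) i)" for r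
    using freshD[OF f, of "W i j r"] freshD[OF f, of "Ad j"] freshD[OF f, of Lv] freshD[OF f, of "Cnt (i - 1) i"] i by auto
  have freej: "\<not> st (W (i - 1) j' r)" for r j' using freshD[OF f, of "W (i - 1) j' r"] i by (cases i) auto
  have freec: "\<not> st (Cnt (i - 1) c)" for c using freshD[OF f, of "Cnt (i - 1) c"] i by auto
  have jn: "jl (i - 1) (Suc j) \<noteq> W i j' r" "\<not> st (jl (i - 1) (Suc j))" for j' r
    using i freej by (auto simp: jl_def)
  note jn' = jn(1)[THEN not_sym]
  have jo: "jl i' j' \<noteq> Sg" "jl i' j' \<noteq> Pl" "jl i' j' \<noteq> Lv" "jl i' j' \<noteq> Ad d" "jl i' j' \<noteq> Cnt i'' d" "jl i' j' \<noteq> Rho d" for i' i'' j' d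
    by (auto simp: jl_def)
  note jo' = jo[THEN not_sym]
  define F1 where "F1 = [Asg (W i j 0) [(?w 44, True)], Asg (Ad j) [(?w 44, True), (Rho i, False)],
      Asg (W i j 1) [(?w 45, True)], Asg (Ad j) [(?w 45, True), (Rho i, False)]]"
  define F2 where "F2 = [Asg (jl (i - 1) (Suc j)) [(?w 54, True)], Asg (Cnt (i - 1) i) [(?w 54, True)], Asg Lv [(?w 55, True)]]"
  define F3 where "F3 = [Asg (jl (i - 1) (Suc j)) [(?w 64, True)], Asg (Cnt (i - 1) i) [(?w 64, True)], Asg Sg [(?w 64, True)],
      Asg (W i j 1) [(?w 66, True)], Asg (Ad j) [(?w 66, True), (Rho i, True)]]"
  let ?S5 = "sel i (Suc j) 50 (?w 46)" and ?S6 = "sel i (Suc j) 60 (?w 56)"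
  have fp: "final_part i (Suc j) = sel i (Suc j) 40 (?w 1) @ F1 @ ?S5 @ F2 @ ?S6 @ F3"
    by (simp add: final_part_def F1_def F2_def F3_def)
  have cl: "\<forall>ins \<in> set F1. classical ins" "Pl \<notin> writes Ans F1" "\<forall>ins \<in> set F2. classical ins" "Pl \<notin> writes Ans F2"
    "\<forall>ins \<in> set F3. classical ins" "Pl \<notin> writes Ans F3"
    by (auto simp: F1_def F2_def F3_def jl_def)
  have off5: "\<forall>ins \<in> set (?S5 @ F2 @ ?S6 @ F3). off s ins" if "\<And>r. 46 \<le> r \<Longrightarrow> \<not> s (?w r)" for s
    using that by (auto simp: F2_def F3_def sel_def)
  have off6: "\<forall>ins \<in> set (?S6 @ F3). off s ins" if "\<And>r. 56 \<le> r \<Longrightarrow> \<not> s (?w r)" for s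
    using that by (auto simp: F3_def sel_def)
  define B y where "B = ecost i j" and "y = ycost i (Suc j)"
  have B: "32 \<le> B" "2 \<le> y" using ecost_ge i ycost_ge by (auto simp: B_def y_def)
  define A where "A \<longleftrightarrow> int i \<le> rng ?near"
  \<comment> \<open>\<open>JS\<close> is the jump in the direction asked for, \<open>JO\<close> the
    one in the opposite direction.\<close>
  define JS where "JS \<longleftrightarrow> (if st Sg then jump i (neg ?v) (neg ?u) else jump i ?v ?u)"
  define JO where "JO \<longleftrightarrow> (if \<not> st Sg then jump i (neg ?v) (neg ?u) else jump i ?v ?u)"
  define V3 where "V3 \<longleftrightarrow> final i (orient ?r ?far) = sg st"
  define V where "V \<longleftrightarrow> (if A then final i (orient ?r ?near) = sg st else if JS then True else if JO then False else V3)"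
  have V: "(final i (orient ?r (seg (Suc j) ?p)) = sg st) = V"
  proof -
    have "((if a then X else if p then 1 else if q then - 1 else Z) = (if S then - 1 else (1 :: int))) =
        (if a then X = (if S then - 1 else 1) else if (if S then q else p) then True
         else if (if \<not> S then q else p) then False else Z = (if S then - 1 else 1))"
      if "\<not> a \<Longrightarrow> \<not> (p \<and> q)" for a p q S X Z using that by auto
    then show ?thesis
      unfolding final_orient(1)[OF i(1), where p = ?p and j = j and r = ?r] V_def V3_def A_def JS_def JO_def sg_def
      using final_orient(2)[OF i(1), where p = ?p and j = j and r = ?r] by blast
  qed

  have jmp: "rel orc (rst i j) s (if s Sg then jump i (neg ?v) (neg ?u) else jump i ?v ?u) (y - 1)"
    if s: "fresh i j (Suc j) ({jl (i - 1) (Suc j)} \<union> range (Cnt (i - 1))) s" "s (jl (i - 1) (Suc j))"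
      "\<And>c. s (Cnt (i - 1) c) = (c = i)" "\<And>d. s (Ad d) = st (Ad d)" for s
  proof -
    have arr: "arrive i j i s" using s i by (simp add: arrive_def)
    have adr: "adr s (Suc j) = ?p" by (rule adr_cong) (use s in auto)
    have "rel orc (rst i j) s (jval (i - 1) j i s) (y - 1)" unfolding y_def by (rule J_claim_ycost[OF JC i(1) j arr])
    then show ?thesis unfolding jval_jump[OF i(1)] Let_def adr .
  qed

  \<comment> \<open>The states after the successive case distinctions if all of them are decided
    negatively.\<close>
  let ?d4 = "decided i (Suc j) 40 False st"
  let ?d5 = "decided i (Suc j) 50 False ?d4"
  let ?d6 = "decided i (Suc j) 60 False ?d5"

  have x1: "exec Ans orc F1 s = s(W i j 0 := True, Ad j := \<not> s (Rho i))" if "s (?w 44)" "\<not> s (?w 45)" "\<not> s (W i j 0)" "\<not> s (Ad j)" for s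
    using that by (simp add: F1_def fun_upd_idem)
  have x1t: "exec Ans orc F1 s = s(W i j 1 := True, Ad j := \<not> s (Rho i))" if "\<not> s (?w 44)" "s (?w 45)" "\<not> s (W i j 1)" "\<not> s (Ad j)" for s
    using that by (simp add: F1_def fun_upd_idem)
  have x2: "exec Ans orc F2 s = s(jl (i - 1) (Suc j) := True, Cnt (i - 1) i := True)"
    if "s (?w 54)" "\<not> s (?w 55)" "\<not> s (jl (i - 1) (Suc j))" "\<not> s (Cnt (i - 1) i)" for s
    using that jn' jo jo' by (simp add: F2_def fun_upd_idem)
  have x2t: "exec Ans orc F2 s = s(Lv := True)" if "\<not> s (?w 54)" "s (?w 55)" "\<not> s Lv" for s
    using that by (simp add: F2_def fun_upd_idem)
  have x3: "exec Ans orc F3 s = s(jl (i - 1) (Suc j) := True, Cnt (i - 1) i := True, Sg := \<not> s Sg)"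
    if "s (?w 64)" "\<not> s (?w 66)" "\<not> s (jl (i - 1) (Suc j))" "\<not> s (Cnt (i - 1) i)" for s
    using that jn' jo jo' by (simp add: F3_def fun_upd_idem)
  have x3f: "exec Ans orc F3 s = s(W i j 1 := True, Ad j := s (Rho i))" if "\<not> s (?w 64)" "s (?w 66)" "\<not> s (W i j 1)" "\<not> s (Ad j)" for s
    using that by (simp add: F3_def fun_upd_idem)
  have x1o: "exec Ans orc F1 s = s" if "\<not> s (?w 44)" "\<not> s (?w 45)" for s using that by (simp add: F1_def fun_upd_idem)
  have x2o: "exec Ans orc F2 s = s" if "\<not> s (?w 54)" "\<not> s (?w 55)" for s using that by (simp add: F2_def fun_upd_idem)
  have x3o: "exec Ans orc F3 s = s" if "\<not> s (?w 64)" "\<not> s (?w 66)" for s using that by (simp add: F3_def fun_upd_idem)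
  have wj: "(\<And>r. v \<noteq> ?w r) \<Longrightarrow> decided i (Suc j) q g s v = s v" "(\<And>r. v \<noteq> ?w r) \<Longrightarrow> v \<noteq> Pl \<Longrightarrow> checked i (Suc j) q g s v = s v" for v q g s
    by (simp_all add: decided_other checked_other)
  note fn = fresh_next[OF f i(1)]
  \<comment> \<open>One fact for each exit from the cell. They only rely on \<open>s\<close>
    agreeing with \<open>st\<close> outside the cell, up to the polarity and, for terminal states,
    the leaf value.\<close>
  have E_go: "rel orc (rst i j) (s(W i j 0 := True, Ad j := \<not> ?r)) A (B - 1)"
    if s: "\<And>v. (\<And>r. v \<noteq> ?w r) \<Longrightarrow> v \<noteq> Pl \<Longrightarrow> s v = st v" for s
  proof -
    let ?s = "s(W i j 0 := True, Ad j := \<not> ?r)"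
    have fr: "fresh i j j {W i j 0} ?s" by (rule fn) (use s in auto)
    have "adr ?s j = 2 * ?p + of_bool (\<not> ?r)" by (rule adr_child) (use j s in auto)
    moreover have "rel orc (rst i j) ?s (int i \<le> rng (seg j (adr ?s j))) (ecost i j - 1)"
      using EC fr unfolding E_claim_def by auto
    ultimately show ?thesis unfolding A_def B_def by simp
  qed
  have L_go: "rel orc (rst i j) (s(W i j 1 := True, Ad j := b)) (final i (orient ?r (seg j (2 * ?p + of_bool b))) = sg st) (4 * B - 1)"
    if s: "\<And>v. (\<And>r. v \<noteq> ?w r) \<Longrightarrow> v \<noteq> Pl \<Longrightarrow> s v = st v" for s b
  proof -
    let ?s = "s(W i j 1 := True, Ad j := b)"
    have fr: "fresh i j j {W i j 1} ?s" by (rule fn) (use s in auto)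
    have "adr ?s j = 2 * ?p + of_bool b" by (rule adr_child) (use j s in auto)
    moreover have "rel orc (rst i j) ?s (final i (orient (?s (Rho i)) (seg j (adr ?s j))) = sg ?s) (4 * ecost i j - 1)"
      using LC fr unfolding L_claim_def by auto
    moreover have "?s (Rho i) = ?r" "sg ?s = sg st" using s by (auto simp: sg_def)
    ultimately show ?thesis unfolding B_def by simp
  qed
  have J_go: "rel orc (rst i j) (s(jl (i - 1) (Suc j) := True, Cnt (i - 1) i := True, Sg := b))
      (if b then jump i (neg ?v) (neg ?u) else jump i ?v ?u) (y - 1)"
    if s: "\<And>v. (\<And>r. v \<noteq> ?w r) \<Longrightarrow> v \<noteq> Pl \<Longrightarrow> s v = st v" for s b
  proof -
    let ?s = "s(jl (i - 1) (Suc j) := True, Cnt (i - 1) i := True, Sg := b)"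
    have "rel orc (rst i j) ?s (if ?s Sg then jump i (neg ?v) (neg ?u) else jump i ?v ?u) (y - 1)"
    proof (rule jmp)
      show "fresh i j (Suc j) ({jl (i - 1) (Suc j)} \<union> range (Cnt (i - 1))) ?s" by (rule fn) (use s in auto)
      show "?s (Cnt (i - 1) c) = (c = i)" for c using s[of "Cnt (i - 1) c"] freec jo jo' by auto
      show "?s (Ad d) = st (Ad d)" for d using s[of "Ad d"] jo' by auto
    qed (use jo in auto)
    then show ?thesis by simp
  qed
  have T_go: "rel orc (rst i j) s (s Lv) 1"
    if s: "\<And>v. (\<And>r. v \<noteq> ?w r) \<Longrightarrow> v \<noteq> Pl \<Longrightarrow> v \<noteq> Lv \<Longrightarrow> s v = st v" for s
  proof -
    have fr: "fresh i j (Suc j) {Lv} s" by (rule fn) (use s in auto)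
    show ?thesis by (rule terminal[OF fr i(1)]) simp
  qed

  have c4: "rel orc (F1 @ (?S5 @ F2 @ ?S6 @ F3) @ rst i j) (checked i (Suc j) 40 g st) A (B - 1)" for g
  proof -
    let ?c = "checked i (Suc j) 40 g st"
    have "exec Ans orc F1 ?c = ?c(W i j 0 := True, Ad j := \<not> ?c (Rho i))"
      by (rule x1) (use free free' in \<open>auto simp: checked_def\<close>)
    moreover have "?c (Rho i) = ?r" by (simp add: wj)
    ultimately have ex: "exec Ans orc F1 ?c = ?c(W i j 0 := True, Ad j := \<not> ?r)" by simp
    have "rel orc (rst i j) (?c(W i j 0 := True, Ad j := \<not> ?r)) A (B - 1)" by (rule E_go) (simp add: wj)
    then show ?thesis using ex free by (intro rel_exec_off cl off5) (auto simp: checked_def)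
  qed
  have d4: "rel orc (F1 @ (?S5 @ F2 @ ?S6 @ F3) @ rst i j) (decided i (Suc j) 40 True st) (final i (orient ?r ?near) = sg st) (4 * B - 1)"
  proof -
    let ?c = "decided i (Suc j) 40 True st"
    have "exec Ans orc F1 ?c = ?c(W i j 1 := True, Ad j := \<not> ?c (Rho i))"
      by (rule x1t) (use free free' in \<open>auto simp: decided_def\<close>)
    moreover have "?c (Rho i) = ?r" by (simp add: wj)
    ultimately have ex: "exec Ans orc F1 ?c = ?c(W i j 1 := True, Ad j := \<not> ?r)" by simp
    have "rel orc (rst i j) (?c(W i j 1 := True, Ad j := \<not> ?r)) (final i (orient ?r ?near) = sg st) (4 * B - 1)" by (rule L_go) (simp add: wj)
    then show ?thesis using ex free by (intro rel_exec_off cl off5) (auto simp: decided_def)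
  qed
  have c5: "rel orc (F2 @ (?S6 @ F3) @ rst i j) (checked i (Suc j) 50 g ?d4) JS (y - 1)" for g
  proof -
    let ?c = "checked i (Suc j) 50 g ?d4"
    have e: "?c Sg = st Sg" "?c (jl (i - 1) (Suc j)) = False" "?c (Cnt (i - 1) i) = False" using jn jo free' by (simp_all add: wj)
    have "exec Ans orc F2 ?c = ?c(jl (i - 1) (Suc j) := True, Cnt (i - 1) i := True)"
      by (rule x2) (use free e in \<open>auto simp: checked_def decided_def\<close>)
    also have "\<dots> = ?c(jl (i - 1) (Suc j) := True, Cnt (i - 1) i := True, Sg := st Sg)"
      using e jo jo' by (auto simp: fun_eq_iff)
    finally have ex: "exec Ans orc F2 ?c = ?c(jl (i - 1) (Suc j) := True, Cnt (i - 1) i := True, Sg := st Sg)" .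
    have "rel orc (rst i j) (?c(jl (i - 1) (Suc j) := True, Cnt (i - 1) i := True, Sg := st Sg)) JS (y - 1)"
      unfolding JS_def by (rule J_go) (simp add: wj)
    then show ?thesis using ex free jn' by (intro rel_exec_off cl off6) (auto simp: checked_def decided_def)
  qed
  have c6: "rel orc (F3 @ rst i j) (checked i (Suc j) 60 g ?d5) JO (y - 1)" for g
  proof -
    let ?c = "checked i (Suc j) 60 g ?d5"
    have e: "?c Sg = st Sg" "?c (jl (i - 1) (Suc j)) = False" "?c (Cnt (i - 1) i) = False" using jn jo free' by (simp_all add: wj)
    have "exec Ans orc F3 ?c = ?c(jl (i - 1) (Suc j) := True, Cnt (i - 1) i := True, Sg := \<not> ?c Sg)"
      by (rule x3) (use free e in \<open>auto simp: checked_def decided_def\<close>)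
    then have ex: "exec Ans orc F3 ?c = ?c(jl (i - 1) (Suc j) := True, Cnt (i - 1) i := True, Sg := \<not> st Sg)" using e by simp
    have "rel orc (rst i j) (?c(jl (i - 1) (Suc j) := True, Cnt (i - 1) i := True, Sg := \<not> st Sg)) JO (y - 1)"
      unfolding JO_def by (rule J_go) (simp add: wj)
    then show ?thesis using ex by (intro rel_exec cl) simp
  qed
  have t5: "rel orc (F2 @ (?S6 @ F3) @ rst i j) (decided i (Suc j) 50 True ?d4) True 1"
  proof -
    let ?c = "decided i (Suc j) 50 True ?d4"
    have ex: "exec Ans orc F2 ?c = ?c(Lv := True)"
      by (rule x2t) (use free free' in \<open>auto simp: decided_def\<close>)
    have "rel orc (rst i j) (?c(Lv := True)) ((?c(Lv := True)) Lv) 1" by (rule T_go) (simp add: wj)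
    then show ?thesis using ex free by (intro rel_exec_off cl off6) (auto simp: decided_def)
  qed
  have t6: "rel orc (F3 @ rst i j) (decided i (Suc j) 60 True ?d5) False 1"
  proof -
    let ?c = "decided i (Suc j) 60 True ?d5"
    have ex: "exec Ans orc F3 ?c = ?c" by (rule x3o) (use free in \<open>auto simp: decided_def\<close>)
    have "rel orc (rst i j) ?c (?c Lv) 1" by (rule T_go) (simp add: wj)
    moreover have "?c Lv = False" using free' by (simp add: wj)
    ultimately show ?thesis using ex by (intro rel_exec cl) simp
  qed
  have d6: "rel orc (F3 @ rst i j) ?d6 V3 (4 * B - 1)"
  proof -
    have "exec Ans orc F3 ?d6 = ?d6(W i j 1 := True, Ad j := ?d6 (Rho i))"
      by (rule x3f) (use free free' in \<open>auto simp: decided_def\<close>)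
    moreover have "?d6 (Rho i) = ?r" by (simp add: wj)
    ultimately have ex: "exec Ans orc F3 ?d6 = ?d6(W i j 1 := True, Ad j := ?r)" by simp
    have "rel orc (rst i j) (?d6(W i j 1 := True, Ad j := ?r)) V3 (4 * B - 1)"
      unfolding V3_def by (rule L_go) (simp add: wj)
    then show ?thesis using ex by (intro rel_exec cl) simp
  qed

  \<comment> \<open>The three case distinctions are put together from the last one to the
    first.\<close>
  have s6: "rel orc (?S6 @ F3 @ rst i j) ?d5 (if JO then False else V3) ((y - 1) + (4 * B - 1))"
  proof (rule rel_sel)
    show "rel orc (F3 @ rst i j) (decided i (Suc j) 60 JO ?d5) (if JO then False else V3) (4 * B - 1)"
    proof (cases JO)
      case True
      then show ?thesis using t6 B by (auto intro: rel_mono)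
    next
      case False
      then show ?thesis using d6 by simp
    qed
  qed (use c6 free in \<open>auto simp: decided_def\<close>)
  have f5: "exec Ans orc F2 ?d5 = ?d5" by (rule x2o) (use free in \<open>auto simp: decided_def\<close>)
  have s5: "rel orc (?S5 @ F2 @ (?S6 @ F3) @ rst i j) ?d4 (if JS then True else if JO then False else V3) ((y - 1) + ((y - 1) + (4 * B - 1)))"
  proof (rule rel_sel)
    show "rel orc (F2 @ (?S6 @ F3) @ rst i j) (decided i (Suc j) 50 JS ?d4) (if JS then True else if JO then False else V3) ((y - 1) + (4 * B - 1))"
    proof (cases JS)
      case True
      then show ?thesis using t5 B by (auto intro: rel_mono)
    next
      case False
      have "rel orc (F2 @ (?S6 @ F3) @ rst i j) ?d5 (if JO then False else V3) ((y - 1) + (4 * B - 1))"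
        by (rule rel_exec[OF cl(3,4)]) (use s6 f5 in simp)
      then show ?thesis using False by simp
    qed
  qed (use c5 free in \<open>auto simp: decided_def\<close>)
  have f4: "exec Ans orc F1 ?d4 = ?d4" by (rule x1o) (use free in \<open>auto simp: decided_def\<close>)
  have s4: "rel orc (sel i (Suc j) 40 (?w 1) @ F1 @ (?S5 @ F2 @ ?S6 @ F3) @ rst i j) st V ((B - 1) + ((y - 1) + ((y - 1) + (4 * B - 1))))"
  proof (rule rel_sel)
    show "rel orc (F1 @ (?S5 @ F2 @ ?S6 @ F3) @ rst i j) (decided i (Suc j) 40 A st) V ((y - 1) + ((y - 1) + (4 * B - 1)))"
    proof (cases A)
      case True
      then show ?thesis using d4 B by (auto simp: V_def intro: rel_mono)
    next
      case False
      have "rel orc (F1 @ (?S5 @ F2 @ ?S6 @ F3) @ rst i j) ?d4 (if JS then True else if JO then False else V3) ((y - 1) + ((y - 1) + (4 * B - 1)))"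
        by (rule rel_exec[OF cl(1,2)]) (use s5 f4 in simp)
      then show ?thesis using False by (simp add: V_def)
    qed
  qed (use on c4 free in auto)
  have fin: "rel orc (final_part i (Suc j) @ rst i j) st V (4 * ecost i (Suc j) - 1)"
    unfolding fp using s4 cost_final[OF i(1), of j] by (auto simp: B_def y_def intro: rel_mono)
  show "rel orc (rst i (Suc j)) st (final i (orient ?r (seg (Suc j) ?p)) = sg st) (4 * ecost i (Suc j) - 1)"
    unfolding V rst_Suc[OF i(1)]
    by (rule rel_off[OF jump_part_off[OF i(1)] rel_off[OF range_part_off fin]]) (use free in auto)
qed

lemma jump_step:
  assumes i: "1 \<le> i" and j: "Suc j \<le> a + 2" and LC: "L_claim i j" and JC: "J_claim (i - 1) j"
  shows "J_claim i j"
  unfolding J_claim_def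
proof (intro allI impI)
  fix st c assume js: "jstate i (Suc j) c st"
  let ?w = "W i (Suc j)" and ?p = "adr st (Suc j)"
  let ?v = "seg j (2 * ?p)" and ?u = "seg j (2 * ?p + 1)"
  have jl: "jl i (Suc j) = ?w 2" using i by (simp add: jl_def)
  have f: "fresh i (Suc j) (Suc j) {?w 2} st" and on: "st (?w 2)" and rho: "\<not> st (Rho i)"
    and cm: "\<And>d. \<not> st (Cm i d)" and cnt: "\<And>d. st (Cnt i d) = (d = c)" and c: "c < k + 2"
    using js by (auto simp: jstate_def jl)
  have free: "\<not> st (?w r)" if "r \<noteq> 2" for r using freshD[OF f, of "W i (Suc j) r"] that by auto
  have free': "\<not> st (W i j r)" "\<not> st (Ad j)" for r
    using freshD[OF f, of "W i j r"] freshD[OF f, of "Ad j"] by auto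
  have freej: "\<not> st (W (i - 1) j' r)" for r j' using freshD[OF f, of "W (i - 1) j' r"] i by (cases i) auto
  have freec: "\<not> st (Cnt (i - 1) c)" for c using freshD[OF f, of "Cnt (i - 1) c"] i by auto
  define M1 where "M1 = map (\<lambda>c. Asg (Cm i (c - 1)) [(?w 15, True), (Cnt i c, True)]) [0..<k + 2]"
  define M2 where "M2 = map (\<lambda>c. Asg (Cm i c) [(?w 16, True), (Cnt i c, True)]) [0..<k + 2]"
  define M3 where "M3 = map (\<lambda>c. Asg (Cnt (i - 1) (c - 1)) [(?w 25, True), (Cm i c, True)]) [0..<k + 2]"
  define M4 where "M4 = map (\<lambda>c. Asg (Cnt (i - 1) c) [(?w 26, True), (Cm i c, True)]) [0..<k + 2]"
  define P1 where "P1 = Asg (W i j 1) [(?w 14, True)] # M1 @ M2 @ [Asg (?w 17) [(?w 15, True)], Asg (?w 17) [(?w 16, True)]]"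
  define P2 where "P2 = [Asg (W i j 1) [(?w 24, True)], Asg (Rho i) [(?w 24, True)], Asg (Ad j) [(?w 24, True)]] @ M3 @ M4 @
     [Asg (jl (i - 1) (Suc j)) [(?w 25, True)], Asg (jl (i - 1) (Suc j)) [(?w 26, True)]]"
  let ?S2 = "sel i (Suc j) 20 (?w 17)"
  let ?F = "(range_choices i (Suc j) @ range_moves i (Suc j)) @ final_part i (Suc j)"
  have jp: "jump_part k i (Suc j) = sel i (Suc j) 10 (?w 2) @ P1 @ ?S2 @ P2"
    by (simp add: jump_part_def P1_def P2_def M1_def M2_def M3_def M4_def jl)
  have wr: "writes Ans (Q1 @ Q2) = writes Ans Q1 \<union> writes Ans Q2" for Q1 Q2 :: "var instr list"
    by (induction Q1 rule: chvars.induct) auto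
  have wm: "Pl \<notin> writes Ans (map (\<lambda>c. Asg (g c) (l c)) xs)" if "\<And>c. g c \<noteq> Pl" for g l and xs :: "nat list"
    using that[THEN not_sym] by (induction xs) auto
  have cl: "\<forall>ins \<in> set P1. classical ins" "Pl \<notin> writes Ans P1" "\<forall>ins \<in> set P2. classical ins" "Pl \<notin> writes Ans P2"
    by (auto simp: P1_def P2_def M1_def M2_def M3_def M4_def wr wm jl_def)
  have offF: "\<forall>ins \<in> set ?F. off s ins" if "\<And>r. r < 2 \<or> 30 \<le> r \<Longrightarrow> \<not> s (?w r)" for s
  proof -
    have "\<forall>ins \<in> set (range_choices i (Suc j) @ range_moves i (Suc j)). off s ins" by (rule range_part_off) (use that in auto)
    moreover have "\<forall>ins \<in> set (final_part i (Suc j)). off s ins" by (rule final_part_off) (use that in auto)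
    ultimately show ?thesis by auto
  qed
  have off2: "\<forall>ins \<in> set (?S2 @ P2 @ ?F). off s ins" if "\<And>r. r < 2 \<or> 17 \<le> r \<Longrightarrow> \<not> s (?w r)" for s
  proof -
    have "\<forall>ins \<in> set ?F. off s ins" by (rule offF) (use that in auto)
    moreover have "\<forall>ins \<in> set (?S2 @ P2). off s ins" using that by (auto simp: P2_def M3_def M4_def sel_def)
    ultimately show ?thesis by auto
  qed
  define g1 g2 where "g1 \<longleftrightarrow> final i ?v = sg st" and "g2 \<longleftrightarrow> final i (rev ?u) = sg st"
  \<comment> \<open>Truncated subtraction is right here: a counter that has come down to 0 stays
    there, and further matches do no harm.\<close>
  define c1 c2 where "c1 = (if g1 then c - 1 else c)" and "c2 = (if g2 then c1 - 1 else c1)"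
  have c12: "c1 < k + 2" "c2 < k + 2" using c by (auto simp: c1_def c2_def)
  define B where "B = ecost i j"

  have jn: "jl (i - 1) (Suc j) \<noteq> W i j' r" "\<not> st (jl (i - 1) (Suc j))" for j' r
    using i freej by (auto simp: jl_def)
  note jn' = jn(1)[THEN not_sym]
  have jo: "jl i' j' \<noteq> Sg" "jl i' j' \<noteq> Pl" "jl i' j' \<noteq> Lv" "jl i' j' \<noteq> Ad d" "jl i' j' \<noteq> Cnt i'' d" "jl i' j' \<noteq> Cm i'' d" "jl i' j' \<noteq> Rho d" for i' i'' j' d
    by (auto simp: jl_def)
  note jo' = jo[THEN not_sym]
  note fn = fresh_next[OF f i]
  have wj: "(\<And>r. v \<noteq> ?w r) \<Longrightarrow> decided i (Suc j) q g s v = s v" "(\<And>r. v \<noteq> ?w r) \<Longrightarrow> v \<noteq> Pl \<Longrightarrow> checked i (Suc j) q g s v = s v" for v q g s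
    by (simp_all add: decided_other checked_other)
  have x17: "exec Ans orc [Asg (?w 17) [(?w 15, True)], Asg (?w 17) [(?w 16, True)]] s = s(?w 17 := True)"
    if "s (?w 15) \<noteq> s (?w 16)" "\<not> s (?w 17)" for s using that by (cases "s (?w 15)") (auto simp: fun_upd_idem)
  have xj: "exec Ans orc [Asg (jl (i - 1) (Suc j)) [(?w 25, True)], Asg (jl (i - 1) (Suc j)) [(?w 26, True)]] s = s(jl (i - 1) (Suc j) := True)"
    if "s (?w 25) \<noteq> s (?w 26)" "\<not> s (jl (i - 1) (Suc j))" for s using that jn jn' by (cases "s (?w 25)") (auto simp: fun_upd_idem)
  have x14: "exec Ans orc P1 s = s(W i j 1 := True)" if "s (?w 14)" "\<not> s (?w 15)" "\<not> s (?w 16)" "\<not> s (W i j 1)" for s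
  proof -
    have "\<forall>ins \<in> set (M1 @ M2 @ [Asg (?w 17) [(?w 15, True)], Asg (?w 17) [(?w 16, True)]]). off (s(W i j 1 := True)) ins"
      using that by (auto simp: M1_def M2_def)
    from exec_off[OF this] show ?thesis using that by (simp add: P1_def)
  qed
  have x24: "exec Ans orc P2 s = s(W i j 1 := True, Rho i := True, Ad j := True)"
    if "s (?w 24)" "\<not> s (?w 25)" "\<not> s (?w 26)" "\<not> s (W i j 1)" "\<not> s (Rho i)" "\<not> s (Ad j)" for s
  proof -
    have "\<forall>ins \<in> set (M3 @ M4 @ [Asg (jl (i - 1) (Suc j)) [(?w 25, True)], Asg (jl (i - 1) (Suc j)) [(?w 26, True)]]). off (s(W i j 1 := True, Rho i := True, Ad j := True)) ins"
      using that by (auto simp: M3_def M4_def)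
    from exec_off[OF this] show ?thesis using that by (simp add: P2_def)
  qed

  have x14o: "exec Ans orc P1 s = exec Ans orc [Asg (?w 17) [(?w 15, True)], Asg (?w 17) [(?w 16, True)]] (exec Ans orc M2 (exec Ans orc M1 s))"
    if "\<not> s (?w 14)" for s using that by (simp add: P1_def fun_upd_idem)
  have x24o: "exec Ans orc P2 s = exec Ans orc [Asg (jl (i - 1) (Suc j)) [(?w 25, True)], Asg (jl (i - 1) (Suc j)) [(?w 26, True)]]
      (exec Ans orc M4 (exec Ans orc M3 s))" if "\<not> s (?w 24)" for s using that by (simp add: P2_def fun_upd_idem)
  have k1: "rel orc (P1 @ (?S2 @ P2 @ ?F) @ rst i j) (checked i (Suc j) 10 g st) g1 (4 * B - 1)" for g
  proof -
    let ?c = "checked i (Suc j) 10 g st" let ?s = "?c(W i j 1 := True)"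
    have ex: "exec Ans orc P1 ?c = ?s" by (rule x14) (use free free' in \<open>auto simp: checked_def\<close>)
    have fr: "fresh i j j {W i j 1} ?s" by (rule fn) (auto simp: wj)
    have "adr ?s j = 2 * ?p + of_bool False" by (rule adr_child) (use j free' in \<open>auto simp: wj\<close>)
    moreover have "rel orc (rst i j) ?s (final i (orient (?s (Rho i)) (seg j (adr ?s j))) = sg ?s) (4 * ecost i j - 1)"
      using LC fr unfolding L_claim_def by auto
    moreover have "?s (Rho i) = False" "sg ?s = sg st" using rho by (auto simp: wj sg_def)
    ultimately have "rel orc (rst i j) ?s g1 (4 * B - 1)" by (simp add: B_def g1_def orient_def)
    then show ?thesis using ex free by (intro rel_exec_off cl off2) (auto simp: checked_def)
  qed

  let ?d = "decided i (Suc j) 10 g1 st"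
  let ?e = "?d(Cm i c1 := True, ?w 17 := True)"
  have exd: "exec Ans orc P1 ?d = ?e"
  proof -
    have "exec Ans orc P1 ?d = exec Ans orc [Asg (?w 17) [(?w 15, True)], Asg (?w 17) [(?w 16, True)]] (exec Ans orc M2 (exec Ans orc M1 ?d))"
      by (rule x14o) (use free in \<open>simp add: decided_def\<close>)
    also have "exec Ans orc M1 ?d = (if ?d (?w 15) then ?d(Cm i (c - 1) := \<not> ?d (Cm i (c - 1))) else ?d)"
      unfolding M1_def by (rule exec_unary) (use cnt c in \<open>auto simp: wj\<close>)
    also have "\<dots> = (if g1 then ?d(Cm i (c - 1) := True) else ?d)" using free cm by (simp add: decided_def)
    also have "exec Ans orc M2 \<dots> = ?d(Cm i c1 := True)"
    proof (cases g1)
      case True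
      then have "\<forall>ins \<in> set M2. off (?d(Cm i (c - 1) := True)) ins" using free by (auto simp: M2_def decided_def)
      then show ?thesis using True by (simp add: exec_off c1_def)
    next
      case False
      have "exec Ans orc M2 ?d = (if ?d (?w 16) then ?d(Cm i c := \<not> ?d (Cm i c)) else ?d)"
        unfolding M2_def by (rule exec_unary) (use cnt c in \<open>auto simp: wj\<close>)
      then show ?thesis using False cm by (simp add: c1_def decided_def)
    qed
    also have "exec Ans orc [Asg (?w 17) [(?w 15, True)], Asg (?w 17) [(?w 16, True)]] \<dots> = ?e"
      by (rule x17) (use free in \<open>cases g1; simp add: decided_def\<close>)+
    finally show ?thesis .
  qed
  have we: "?e v = st v" if "\<And>r. v \<noteq> ?w r" "\<And>d. v \<noteq> Cm i d" for v using that by (simp add: wj)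
  have k2: "rel orc (P2 @ ?F @ rst i j) (checked i (Suc j) 20 g ?e) g2 (4 * B - 1)" for g
  proof -
    let ?c = "checked i (Suc j) 20 g ?e" let ?s = "?c(W i j 1 := True, Rho i := True, Ad j := True)"
    have wc: "?c v = st v" if "\<And>r. v \<noteq> ?w r" "\<And>d. v \<noteq> Cm i d" "v \<noteq> Pl" for v using that we by (simp add: wj)
    have ex: "exec Ans orc P2 ?c = ?s"
    proof (rule x24)
      show "\<not> ?c (Rho i)" "\<not> ?c (W i j 1)" "\<not> ?c (Ad j)" using rho free' by (simp_all add: wc)
    qed (use free in \<open>simp_all add: checked_def decided_def\<close>)
    have fr: "fresh i j j {W i j 1} ?s" by (rule fn) (auto simp: wc)
    have "adr ?s j = 2 * ?p + of_bool True" by (rule adr_child) (use j in \<open>auto simp: wc\<close>)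
    moreover have "rel orc (rst i j) ?s (final i (orient (?s (Rho i)) (seg j (adr ?s j))) = sg ?s) (4 * ecost i j - 1)"
      using LC fr unfolding L_claim_def by auto
    moreover have "?s (Rho i) = True" "sg ?s = sg st" by (auto simp: wc sg_def)
    ultimately have "rel orc (rst i j) ?s g2 (4 * B - 1)" by (simp add: B_def g2_def orient_def)
    then show ?thesis using ex free by (intro rel_exec_off cl offF) (auto simp: checked_def decided_def)
  qed

  let ?h = "decided i (Suc j) 20 g2 ?e"
  let ?z = "?h(Cnt (i - 1) c2 := True, jl (i - 1) (Suc j) := True)"
  have wh: "?h v = st v" if "\<And>r. v \<noteq> ?w r" "\<And>d. v \<noteq> Cm i d" for v using that we by (simp add: wj)
  have exh: "exec Ans orc P2 ?h = ?z"
  proof -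
    have one: "?h (Cm i d) = (d = c1)" for d using cm by (auto simp: wj)
    have "exec Ans orc P2 ?h = exec Ans orc [Asg (jl (i - 1) (Suc j)) [(?w 25, True)], Asg (jl (i - 1) (Suc j)) [(?w 26, True)]]
        (exec Ans orc M4 (exec Ans orc M3 ?h))"
      by (rule x24o) (use free in \<open>simp add: decided_def\<close>)
    also have "exec Ans orc M3 ?h = (if ?h (?w 25) then ?h(Cnt (i - 1) (c1 - 1) := \<not> ?h (Cnt (i - 1) (c1 - 1))) else ?h)"
      unfolding M3_def by (rule exec_unary) (use one c12(1) in auto)
    also have "\<dots> = (if g2 then ?h(Cnt (i - 1) (c1 - 1) := True) else ?h)" using free freec by (simp add: decided_def)
    also have "exec Ans orc M4 \<dots> = ?h(Cnt (i - 1) c2 := True)"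
    proof (cases g2)
      case True
      then have "\<forall>ins \<in> set M4. off (?h(Cnt (i - 1) (c1 - 1) := True)) ins" using free by (auto simp: M4_def decided_def)
      then show ?thesis using True by (simp add: exec_off c2_def)
    next
      case False
      have "exec Ans orc M4 ?h = (if ?h (?w 26) then ?h(Cnt (i - 1) c1 := \<not> ?h (Cnt (i - 1) c1)) else ?h)"
        unfolding M4_def by (rule exec_unary) (use one c12(1) in auto)
      then show ?thesis using False freec by (simp add: c2_def decided_def)
    qed
    also have "exec Ans orc [Asg (jl (i - 1) (Suc j)) [(?w 25, True)], Asg (jl (i - 1) (Suc j)) [(?w 26, True)]] \<dots> = ?z"
    proof (rule xj)
      show "\<not> (?h(Cnt (i - 1) c2 := True)) (jl (i - 1) (Suc j))" using jn jn' jo jo' by (simp add: wh)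
    qed (use free in \<open>cases g2; simp add: decided_def\<close>)+
    finally show ?thesis .
  qed
  have go: "rel orc (rst (i - 1) (Suc j)) ?z (jval (i - 1) j c2 ?z) (1 + (\<Sum>h = 1..<Suc (i - 1). 2 * (4 * ecost h j - 1)))"
    and arr: "arrive i j c2 ?z"
  proof -
    have "fresh i j (Suc j) ({jl (i - 1) (Suc j)} \<union> range (Cnt (i - 1))) ?z"
      by (rule fn) (auto simp: wh)
    moreover have "?z (Cnt (i - 1) d) = (d = c2)" for d using freec jo jo' by (auto simp: wh)
    ultimately show arr: "arrive i j c2 ?z" using c12 by (simp add: arrive_def)
    show "rel orc (rst (i - 1) (Suc j)) ?z (jval (i - 1) j c2 ?z) (1 + (\<Sum>h = 1..<Suc (i - 1). 2 * (4 * ecost h j - 1)))"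
      using JC arrive_jstate[OF arr i] unfolding J_claim_def by blast
  qed
  have jv: "jval (i - 1) j c2 ?z = jval i j c st"
  proof -
    have adr: "adr ?z (Suc j) = ?p" by (rule adr_cong) (use jo jo' in \<open>auto simp: wh\<close>)
    have sgz: "sg ?z = sg st" using jo jo' by (simp add: sg_def wh)
    have S: "(\<Sum>h = 1..<Suc i. F h) = (\<Sum>h = 1..<Suc (i - 1). F h) + F i" for F :: "nat \<Rightarrow> nat"
      using i by (cases i) auto
    have eq: "c \<le> X + (of_bool g1 + of_bool g2) \<longleftrightarrow> c2 \<le> X" for X by (auto simp: c2_def c1_def)
    show ?thesis unfolding jval_def adr sgz S by (simp only: eq[unfolded g1_def g2_def])
  qed
  have fini: "rel orc (P2 @ ?F @ rst i j) ?h (jval i j c st) (1 + (\<Sum>h = 1..<Suc (i - 1). 2 * (4 * ecost h j - 1)))"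
    using arrive_rel[OF arr i j go] exh free jn' unfolding jv
    by (intro rel_exec_off cl offF) (auto simp: decided_def)
  let ?C = "1 + (\<Sum>h = 1..<Suc (i - 1). 2 * (4 * ecost h j - 1))"
  have s2: "rel orc (?S2 @ P2 @ ?F @ rst i j) ?e (jval i j c st) ((4 * B - 1) + ?C)"
    by (rule rel_sel) (use k2 fini free in \<open>auto simp: decided_def\<close>)
  have s1: "rel orc (P1 @ ?S2 @ P2 @ ?F @ rst i j) ?d (jval i j c st) ((4 * B - 1) + ?C)"
    by (rule rel_exec[OF cl(1,2)]) (use s2 exd in simp)
  have r: "rel orc (sel i (Suc j) 10 (?w 2) @ P1 @ ?S2 @ P2 @ ?F @ rst i j) st (jval i j c st) ((4 * B - 1) + ((4 * B - 1) + ?C))"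
    by (rule rel_sel) (use k1 s1 on free in \<open>auto simp: decided_def\<close>)
  have e: "(4 * B - 1) + ((4 * B - 1) + ?C) = 1 + (\<Sum>h = 1..<Suc i. 2 * (4 * ecost h j - 1))"
    using i by (cases i) (simp_all add: B_def)
  show "rel orc (rst i (Suc j)) st (jval i j c st) (1 + (\<Sum>h = 1..<Suc i. 2 * (4 * ecost h j - 1)))"
    using r unfolding e rst_Suc[OF i] jp append_assoc .
qed

end

section \<open>Single letters and the value of the whole program\<close>

context dyck_text
begin

text \<open>In plane 0 the leaf only asks whether the counter has come down to 0.\<close>

lemma J_claim_0: "J_claim 0 j"
  unfolding J_claim_def
proof (intro allI impI)
  fix st c assume js: "jstate 0 (Suc j) c st"
  then have f: "fresh 0 (Suc j) (Suc j) {W 0 0 2} st" and on: "st (W 0 0 2)" "\<And>d. st (Cnt 0 d) = (d = c)"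
    by (auto simp: jstate_def jl_def)
  have "rel orc (planes n k a 0) st (c \<le> 0) 1"
    by (rule fin_rel) (use freshD[OF f] on in \<open>auto simp: jl_def\<close>)
  then show "rel orc (rst 0 (Suc j)) st (jval 0 j c st) (1 + (\<Sum>h = 1..<Suc 0. 2 * (4 * ecost h j - 1)))"
    by (simp add: rest_def jval_def)
qed

lemma rng_single: "rng [l] = \<bar>l\<bar>"
  by (simp add: rng_def)

text \<open>A single letter has range at most 1. For larger \<open>i\<close> the mark lies in a
  plane that the leaf part does not look at, so the leaf is false as it should be.\<close>

lemma E_claim_0:
  assumes i: "1 \<le> i"
  shows "E_claim i 0"
  unfolding E_claim_def
proof (intro allI impI)
  fix st assume f: "fresh i 0 0 {W i 0 0} st" and on: "st (W i 0 0)"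
  let ?l = "letter (adr st 0)"
  have l: "?l \<in> {-1, 0, 1}" by (rule letter_values)
  have c: "1 \<le> ecost i 0 - 1" using ecost_ge(2)[OF i, of 0] by simp
  have lv: "\<not> st Lv" "\<And>t j. \<not> st (Le t j)" "\<not> st Ans" "\<not> st (jl 0 0)" "\<not> st (W 1 0 1)"
    using freshD[OF f, of Lv] freshD[OF f, of "Le _ _"] freshD[OF f, of Ans] freshD[OF f, of "W 0 0 2"]
      freshD[OF f, of "W 1 0 1"] i[unfolded le_less] by (auto simp: jl_def)
  have "rel orc (planes n k a (i - 1)) st (int i \<le> rng [?l]) (ecost i 0 - 1)"
  proof (rule planes_idle)
    fix i' j' r assume "1 \<le> i'" "i' \<le> i - 1"
    then have "i' < i" using i by linarith
    then show "\<not> st (W i' j' r)" using freshD[OF f, of "W i' j' r"] by auto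
  next
    have "st (W 1 0 0) = (i = 1)" using freshD[OF f, of "W 1 0 0"] on i by (cases "i = 1") auto
    then show "rel orc (planes n k a 0) st (int i \<le> rng [?l]) (ecost i 0 - 1)"
      using lv c l i by (intro fin_rel) (auto simp: rng_single)
  qed
  then show "rel orc (rst i 0) st (int i \<le> rng (seg 0 (adr st 0))) (ecost i 0 - 1)"
    by (simp add: rest_def)
qed

lemma L_claim_0:
  assumes i: "1 \<le> i"
  shows "L_claim i 0"
  unfolding L_claim_def
proof (intro allI impI)
  fix st assume f: "fresh i 0 0 {W i 0 1} st" and on: "st (W i 0 1)"
  let ?l = "letter (adr st 0)"
  have l: "?l \<in> {-1, 0, 1}" by (rule letter_values)
  have c: "1 \<le> 4 * ecost i 0 - 1" using ecost_ge(2)[OF i, of 0] by simp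
  have lv: "\<not> st Lv" "\<And>t j. \<not> st (Le t j)" "\<not> st Ans" "\<not> st (jl 0 0)" "\<not> st (W 1 0 0)"
    using freshD[OF f, of Lv] freshD[OF f, of "Le _ _"] freshD[OF f, of Ans] freshD[OF f, of "W 0 0 2"]
      freshD[OF f, of "W 1 0 0"] i[unfolded le_less] by (auto simp: jl_def)
  have o: "orient b [y] = [y]" for b y by (simp add: orient_def)
  have fl: "final i [?l] = (if i = 1 then ?l else 0)" using l i by (auto simp: rng_single)
  have "rel orc (planes n k a (i - 1)) st (final i [?l] = sg st) (4 * ecost i 0 - 1)"
  proof (rule planes_idle)
    fix i' j' r assume "1 \<le> i'" "i' \<le> i - 1"
    then have "i' < i" using i by linarith
    then show "\<not> st (W i' j' r)" using freshD[OF f, of "W i' j' r"] by auto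
  next
    have "st (W 1 0 1) = (i = 1)" using freshD[OF f, of "W 1 0 1"] on i by (cases "i = 1") auto
    then show "rel orc (planes n k a 0) st (final i [?l] = sg st) (4 * ecost i 0 - 1)"
      unfolding fl using lv c i by (intro fin_rel) (auto simp: sg_def)
  qed
  then show "rel orc (rst i 0) st (final i (orient (st (Rho i)) (seg 0 (adr st 0))) = sg st) (4 * ecost i 0 - 1)"
    by (simp add: rest_def o)
qed

lemma claims:
  assumes "j \<le> a + 2" "1 \<le> i" "i \<le> k + 1"
  shows "E_claim i j \<and> L_claim i j"
  using assms
proof (induction j arbitrary: i)
  case 0
  then show ?case using E_claim_0 L_claim_0 by blast
next
  case (Suc j)
  \<comment> \<open>Jumps at level \<open>Suc j\<close> ask for final letters at level
    \<open>j\<close> only. So all heights are settled by an inner induction before the ranges and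
    final letters of level \<open>Suc j\<close>.\<close>
  have J: "h \<le> k + 1 \<Longrightarrow> J_claim h j" for h
  proof (induction h)
    case (Suc h)
    then show ?case using Suc.IH jump_step[of "Suc h" j] \<open>\<And>i. _ \<Longrightarrow> _ \<Longrightarrow> _ \<Longrightarrow> E_claim i j \<and> L_claim i j\<close>[of "Suc h"] \<open>Suc j \<le> a + 2\<close>
      by auto
  qed (rule J_claim_0)
  then have JC: "J_claim (i - 1) j" using Suc.prems by auto
  have "E_claim i j" "L_claim i j" using Suc by auto
  then show ?case using range_step[OF Suc.prems(2,3,1) _ JC] final_step[OF Suc.prems(2,3,1) _ _ JC] by blast
qed

lemma seg_map: "seg j p = map (\<lambda>i. letter (p * 2 ^ j + i)) [0..<2 ^ j]"
proof (induction j arbitrary: p)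
  case (Suc j)
  have "[0..<2 ^ Suc j] = [0..<2 ^ j] @ map (\<lambda>i. i + 2 ^ j) [0..<2 ^ j]"
    by (simp add: map_add_upt mult_2 upt_add_eq_append[of 0])
  then show ?case unfolding seg.simps Suc by (simp add: algebra_simps)
qed simp

lemma filter_prefix:
  assumes "c \<le> m" "\<And>i. i < m \<Longrightarrow> f i = (if i < c then g i else 0)" "\<And>i. g i \<noteq> (0 :: int)"
  shows "filter (\<lambda>l. l \<noteq> 0) (map f [0..<m]) = map g [0..<c]"
proof -
  have "[0..<m] = [0..<c] @ [c..<m]" using assms(1) upt_add_eq_append[of 0 c "m - c"] by simp
  moreover have "map f [0..<c] = map g [0..<c]" using assms by auto
  moreover have "filter (\<lambda>l. l \<noteq> 0) (map f [c..<m]) = []" using assms by (auto simp: filter_empty_conv)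
  moreover have "filter (\<lambda>l. l \<noteq> 0) (map g [0..<c]) = map g [0..<c]" using assms(3) by (simp add: filter_id_conv)
  ultimately show ?thesis by (simp only: map_append filter_append append_Nil2)
qed

text \<open>Without its zeros the text is the padded input of \<open>dyck_iff_rng\<close>.\<close>

lemma text_dyck: "int (k + 1) \<le> rng (seg (a + 2) 0) \<longleftrightarrow> \<not> dyck k x"
proof -
  let ?f = "filter (\<lambda>l :: int. l \<noteq> 0)"
  have "?f (seg a 0) = map (\<lambda>_. - 1) [0..<k]"
    unfolding seg_map by (rule filter_prefix) (use k in \<open>auto simp: letter_def\<close>)
  moreover have "?f (seg a 1) = map (\<lambda>i. if x ! i then - 1 else 1) [0..<n]"
    unfolding seg_map by (rule filter_prefix) (use n in \<open>auto simp: letter_def\<close>)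
  moreover have "?f (seg a 2) = map (\<lambda>_. 1) [0..<k]"
    unfolding seg_map by (rule filter_prefix) (use k in \<open>auto simp: letter_def\<close>)
  moreover have "?f (seg a 3) = map (\<lambda>_. 1) [0..<0]"
    unfolding seg_map by (rule filter_prefix) (auto simp: letter_def)
  moreover have "map (\<lambda>i. if x ! i then - 1 else 1) [0..<n] = steps_of x"
    unfolding steps_of_def by (rule nth_equalityI) (use x in auto)
  moreover have "seg (a + 2) 0 = (seg a 0 @ seg a 1) @ (seg a 2 @ seg a 3)"
    by (simp add: numeral_2_eq_2 numeral_3_eq_3)
  ultimately have "?f (seg (a + 2) 0) = replicate k (- 1) @ steps_of x @ replicate k 1"
    by (simp add: map_replicate_trivial map_replicate_const)
  then have "rng (seg (a + 2) 0) = rng (replicate k (- 1) @ steps_of x @ replicate k 1)"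
    using rng_filter[of "seg (a + 2) 0"] by simp
  then show ?thesis using dyck_iff_rng[of k x] by linarith
qed

theorem dyck_prog_rel:
  assumes "\<And>v. (\<And>q. v \<noteq> Aux q) \<Longrightarrow> \<not> st v"
  shows "ev Pl Lv Ans orc (dyck_prog n k a) st (\<not> dyck k x) (ecost (k + 1) (a + 2))"
proof -
  let ?s = "st(W (k + 1) (a + 2) 0 := True)"
  have "fresh (k + 1) (a + 2) (a + 2) {W (k + 1) (a + 2) 0} ?s"
  proof (rule freshI)
    fix v assume "fut (k + 1) (a + 2) (a + 2) v" "v \<notin> {W (k + 1) (a + 2) 0}"
    then show "\<not> ?s v" using assms[of v] by (cases v) auto
  qed
  then have "rel orc (rst (k + 1) (a + 2)) ?s (int (k + 1) \<le> rng (seg (a + 2) (adr ?s (a + 2)))) (ecost (k + 1) (a + 2) - 1)"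
    using claims[of "a + 2" "k + 1"] unfolding E_claim_def by auto
  moreover have "adr ?s (a + 2) = 0" by (simp add: adr_def)
  ultimately have "rel orc (rst (k + 1) (a + 2)) ?s (\<not> dyck k x) (ecost (k + 1) (a + 2) - 1)"
    by (simp only: text_dyck)
  then have "ev Pl Lv Ans orc (rst (k + 1) (a + 2)) ?s ((\<not> dyck k x) \<noteq> ?s Pl) (ecost (k + 1) (a + 2) - 1)"
    unfolding rel_def .
  moreover have "\<not> ?s Pl" "\<not> st (W (k + 1) (a + 2) 0)" using assms by auto
  moreover have "planes n k a (k + 1) = rst (k + 1) (a + 2)" by (simp add: rest_def)
  ultimately have "ev Pl Lv Ans orc (planes n k a (k + 1)) ?s (\<not> dyck k x) (ecost (k + 1) (a + 2))"
    by (auto intro: ev_mono)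
  then show ?thesis unfolding dyck_prog_def using \<open>\<not> st (W (k + 1) (a + 2) 0)\<close> by (intro ev_Asg) simp
qed

end

section \<open>Qubit numbers and well-formedness\<close>

definition mp :: "('v \<Rightarrow> 'w) \<Rightarrow> 'v instr list \<Rightarrow> 'w instr list" where "mp f = map (map_instr f)"

lemma mp_simps [simp]: "mp f [] = []" "mp f (Asg t ls # P) = Asg (f t) (map (map_prod f id) ls) # mp f P"
  "mp f (Qry # P) = Qry # mp f P"
  "mp f (Ch q z ls k p # P) = Ch (f q) (f z) (map (map_prod f id) ls) k p # mp f P" "mp f (P @ P') = mp f P @ mp f P'"
  by (simp_all add: mp_def)

lemma holds_map: "holds st (map (map_prod f id) ls) = holds (st \<circ> f) ls"
  by (auto simp: holds_def)

lemma upd_map: "inj f \<Longrightarrow> (st(f t := b)) \<circ> f = (st \<circ> f)(t := b)"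
  by (auto simp: fun_eq_iff inj_eq)

lemma ev_map:
  assumes "ev pl lv an orc P s v c" "s = st \<circ> f" and f: "inj f" and o: "\<And>st. orc' st = orc (st \<circ> f)"
  shows "ev (f pl) (f lv) (f an) orc' (mp f P) st v c"
  using assms(1,2)
proof (induction arbitrary: st rule: ev.induct)
  case (ev_Nil c v s)
  then show ?case by (auto intro: ev.ev_Nil)
next
  case (ev_Asg P s t ls v c)
  have "ev (f pl) (f lv) (f an) orc' (mp f P) (st(f t := (st (f t) \<noteq> holds (st \<circ> f) ls))) v c"
    by (rule ev_Asg.IH) (unfold ev_Asg.prems upd_map[OF f], simp)
  then show ?case unfolding mp_simps by (intro ev.ev_Asg) (simp add: holds_map)
next
  case (ev_Qry P s v c)
  have "ev (f pl) (f lv) (f an) orc' (mp f P) (st(f an := (st (f an) \<noteq> orc (st \<circ> f)))) v c"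
    by (rule ev_Qry.IH) (unfold ev_Qry.prems upd_map[OF f], simp)
  then show ?case unfolding mp_simps o[of st, symmetric] by (rule ev.ev_Qry)
next
  case (ev_Skip s ls P v c q z k p)
  have h: "holds st (map (map_prod f id) ls) = holds s ls" unfolding holds_map ev_Skip.prems ..
  show ?case unfolding mp_simps
    by (rule ev.ev_Skip) (use h ev_Skip.hyps(1) ev_Skip.IH[OF ev_Skip.prems] in blast)+
next
  case (ev_All s ls v k p P c0 q c1 c z)
  have h: "holds st (map (map_prod f id) ls) = holds s ls" "st (f pl) = s pl"
    unfolding holds_map ev_All.prems by simp_all
  have "ev (f pl) (f lv) (f an) orc' (mp f P) (st(f q := True)) v c1"
    by (rule ev_All.IH(2)) (unfold ev_All.prems upd_map[OF f], simp)
  then show ?case unfolding mp_simps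
    using ev_All.hyps h ev_All.IH(1)[OF ev_All.prems] by (intro ev.ev_All[where ?c0.0 = c0 and ?c1.0 = c1]) simp_all
next
  case (ev_One0 s ls v k p P c0 c q z)
  have h: "holds st (map (map_prod f id) ls) = holds s ls" "st (f pl) = s pl"
    unfolding holds_map ev_One0.prems by simp_all
  show ?case unfolding mp_simps
    using ev_One0.hyps h ev_One0.IH[OF ev_One0.prems] by (intro ev.ev_One0[where ?c0.0 = c0]) simp_all
next
  case (ev_One1 s ls v k p P q c1 c z)
  have h: "holds st (map (map_prod f id) ls) = holds s ls" "st (f pl) = s pl"
    unfolding holds_map ev_One1.prems by simp_all
  have "ev (f pl) (f lv) (f an) orc' (mp f P) (st(f q := True)) v c1"
    by (rule ev_One1.IH) (unfold ev_One1.prems upd_map[OF f], simp)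
  then show ?case unfolding mp_simps
    using ev_One1.hyps h by (intro ev.ev_One1[where ?c1.0 = c1]) simp_all
qed

lemma exec_map:
  assumes f: "inj f" and o: "\<And>st. orc' st = orc (st \<circ> f)"
  shows "exec (f an) orc' (mp f P) st \<circ> f = exec an orc P (st \<circ> f)"
proof (induction P arbitrary: st rule: chvars.induct)
  case (2 q z ls k p P)
  then show ?case by simp
qed (simp_all add: holds_map upd_map[OF f] o)

section \<open>Well-formedness of the program\<close>

fun pvars :: "'v \<Rightarrow> 'v instr list \<Rightarrow> 'v set" where
  "pvars an [] = {}"
| "pvars an (Asg t ls # P) = insert t (fst ` set ls \<union> pvars an P)"
| "pvars an (Qry # P) = insert an (pvars an P)"
| "pvars an (Ch q z ls k p # P) = insert q (insert z (fst ` set ls \<union> pvars an P))"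

lemma finite_pvars [simp]: "finite (pvars an P)"
  by (induction P rule: chvars.induct) auto

lemma pvars_append [simp]: "pvars an (P @ P') = pvars an P \<union> pvars an P'"
  by (induction P rule: chvars.induct) auto

lemma chvars_append [simp]: "chvars (P @ P') = chvars P \<union> chvars P'"
  by (induction P rule: chvars.induct) auto

lemma writes_append [simp]: "writes an (P @ P') = writes an P \<union> writes an P'"
  by (induction P rule: chvars.induct) auto

lemma writes_pvars: "writes an P \<subseteq> pvars an P"
  by (induction P rule: chvars.induct) auto

lemma maps_asg [simp]:
  "chvars (map (\<lambda>c. Asg (g c) (l c)) xs) = {}" "writes an (map (\<lambda>c. Asg (g c) (l c)) xs) = g ` set xs"
  "pvars an (map (\<lambda>c. Asg (g c) (l c)) xs) = g ` set xs \<union> (\<Union>c \<in> set xs. fst ` set (l c))"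
  by (induction xs) auto

lemma image_sets:
  "chvars (mp f P) = f ` chvars P" "writes (f an) (mp f P) = f ` writes an P" "pvars (f an) (mp f P) = f ` pvars an P"
  by (induction P rule: chvars.induct) (simp_all add: image_Un image_image)

lemma fits_pvars: "pvars an P \<subseteq> {..<m} \<Longrightarrow> fits m P"
  by (induction P rule: chvars.induct) auto

lemma wf_prog_map:
  assumes f: "inj f"
  shows "wf_prog pl an X P \<Longrightarrow> wf_prog (f pl) (f an) (f ` X) (mp f P)"
proof (induction P rule: chvars.induct)
  have d: "distinct (map f ys) = distinct ys" for ys
    using f by (auto simp: distinct_map intro: inj_on_subset)
  have m: "map fst (map (map_prod f id) ls) = map f (map fst ls)" for ls :: "('a \<times> bool) list" by simp
  have i: "fst ` set (map (map_prod f id) ls) = f ` fst ` set ls" for ls :: "('a \<times> bool) list" by force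
  {
    case (2 q z ls k p P)
    have "distinct (map f (q # z # pl # map fst ls))" unfolding d using 2(2) by simp
    then have 1: "distinct (f q # f z # f pl # map f (map fst ls))" by (simp only: list.map)
    have 2: "f ` fst ` set ls \<inter> (f ` X \<union> f ` chvars P) = {}"
      using 2(2) f unfolding image_Un[symmetric] image_Int[OF f, symmetric] by auto
    show ?case unfolding mp_simps wf_prog.simps image_sets m i
      using 1 2 "2.IH" "2.prems" inj_image_mem_iff[OF f] by (intro conjI) simp_all
  next
    case ("3_1" t ls P)
    have "distinct (map f (t # map fst ls))" unfolding d using "3_1"(2) by simp
    then have 1: "distinct (f t # map f (map fst ls))" by (simp only: list.map)
    show ?case unfolding mp_simps wf_prog.simps image_sets m i
      using 1 "3_1" inj_image_mem_iff[OF f] by (intro conjI) simp_all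
  next
    case ("3_2" P)
    then show ?case using f by (simp add: image_sets inj_image_mem_iff)
  next
    case 1
    then show ?case by simp
  }
qed

text \<open>The part of \<open>wf_prog\<close> that relates the instructions of a first program to
  those of a second one following it.\<close>

fun xs :: "'v \<Rightarrow> 'v \<Rightarrow> 'v instr list \<Rightarrow> 'v instr list \<Rightarrow> bool" where
  "xs pl an [] P' \<longleftrightarrow> True"
| "xs pl an (Asg t ls # P) P' \<longleftrightarrow> t \<notin> chvars P' \<and> xs pl an P P'"
| "xs pl an (Qry # P) P' \<longleftrightarrow> an \<notin> chvars P' \<and> xs pl an P P'"
| "xs pl an (Ch q z ls k p # P) P' \<longleftrightarrow> fst ` set ls \<inter> chvars P' = {} \<and> pl \<notin> chvars P' \<and>
     q \<notin> writes an P' \<and> z \<notin> writes an P' \<and> xs pl an P P'"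

lemma wf_prog_append: "wf_prog pl an X (P @ P') \<longleftrightarrow> wf_prog pl an X P \<and> wf_prog pl an X P' \<and> xs pl an P P'"
  by (induction P rule: chvars.induct) auto

lemma xs_append: "xs pl an (P1 @ P2) P' \<longleftrightarrow> xs pl an P1 P' \<and> xs pl an P2 P'"
  by (induction P1 rule: chvars.induct) auto

lemma xs_map: "xs pl an (map (\<lambda>c. Asg (g c) (l c)) ys) P' \<longleftrightarrow> (\<forall>c \<in> set ys. g c \<notin> chvars P')"
  by (induction ys) auto

lemma wf_prog_map_asg: "wf_prog pl an X (map (\<lambda>c. Asg (g c) (l c)) ys) \<longleftrightarrow>
    (\<forall>c \<in> set ys. distinct (g c # map fst (l c)) \<and> g c \<notin> X)"
  by (induction ys) auto

lemma xsI: "pvars an P \<inter> chvars P' = {} \<Longrightarrow> chvars P \<inter> writes an P' = {} \<Longrightarrow> pl \<notin> chvars P' \<Longrightarrow> xs pl an P P'"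
  by (induction P rule: chvars.induct) auto

definition XA :: "var set" where "XA = {Aux 0, Aux 1, Aux 2}"

text \<open>Numbers from 10 on are internal to a cell; smaller ones are the marks by which other
  cells hand over the game.\<close>

definition tmp :: "nat \<Rightarrow> nat \<Rightarrow> var set" where "tmp i j = {W i j r | r. 10 \<le> r}"

lemma cell_wf_parts:
  assumes "1 \<le> i" "1 \<le> j"
  shows "wf_prog Pl Ans XA (jump_part k i j)" "wf_prog Pl Ans XA (range_choices i j @ range_moves i j)"
    "wf_prog Pl Ans XA (final_part i j)"
proof -
  have ne: "i - Suc 0 \<noteq> i" "j - Suc 0 \<noteq> j" using assms by auto
  show "wf_prog Pl Ans XA (jump_part k i j)"
    unfolding jump_part_def sel_def jl_def XA_def
    using ne by (auto simp: wf_prog_append xs_append xs_map wf_prog_map_asg)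
  show "wf_prog Pl Ans XA (range_choices i j @ range_moves i j)"
    unfolding range_choices_def range_moves_def jl_def XA_def
    using ne by (auto simp: wf_prog_append xs_append)
  show "wf_prog Pl Ans XA (final_part i j)"
    unfolding final_part_def sel_def jl_def XA_def
    using ne by (auto simp: wf_prog_append xs_append)
qed

lemma cell_chvars: "chvars (cell k i j) \<subseteq> tmp i j"
  by (auto simp: cell_def jump_part_def range_choices_def range_moves_def final_part_def sel_def tmp_def)

definition cvars :: "nat \<Rightarrow> nat \<Rightarrow> nat \<Rightarrow> var set" where
  "cvars k i j = (\<lambda>r. W i j r) ` {..<70} \<union> {W i (j - 1) 0, W i (j - 1) 1, jl i j, jl (i - 1) j, Rho i, Ad (j - 1), Sg, Pl, Lv} \<union>
     (Cnt i ` {..<k + 2} \<union> Cnt (i - 1) ` {..<k + 2} \<union> Cm i ` {..<k + 2})"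

lemma cell_pvars:
  assumes "i \<le> k + 1"
  shows "pvars Ans (cell k i j) \<subseteq> cvars k i j"
  using assms unfolding cell_def pvars_append
proof (intro Un_least)
  show "pvars Ans (jump_part k i j) \<subseteq> cvars k i j"
    by (auto simp: jump_part_def sel_def cvars_def)
  show "pvars Ans (range_choices i j) \<subseteq> cvars k i j"
    by (auto simp: range_choices_def cvars_def)
  show "pvars Ans (range_moves i j) \<subseteq> cvars k i j"
    using assms by (auto simp: range_moves_def cvars_def)
  show "pvars Ans (final_part i j) \<subseteq> cvars k i j"
    using assms by (auto simp: final_part_def sel_def cvars_def)
qed

text \<open>Cells interact through marks, counters and registers only. As all choices are internal,
  the conditions between different cells follow.\<close>

lemma cvars_tmp: "v \<in> cvars k i j \<Longrightarrow> v \<in> tmp i' j' \<Longrightarrow> i' = i \<and> j' = j"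
  by (auto simp: cvars_def tmp_def jl_def split: if_splits)

text \<open>The choices of the three parts use the number ranges 10 to 29, 30 to 39 and 40 to 69,
  and no part mentions the choices of a later part or writes those of an earlier one.\<close>

lemma cell_wf:
  assumes "1 \<le> i" "1 \<le> j" "i \<le> k + 1"
  shows "wf_prog Pl Ans XA (cell k i j)"
proof -
  define A B C where "A = jump_part k i j" and "B = range_choices i j @ range_moves i j" and "C = final_part i j"
  have cA: "chvars A \<subseteq> W i j ` {10..<30}" by (simp add: jump_part_def sel_def A_def)
  have cB: "chvars B \<subseteq> W i j ` {30..<40}" by (simp add: range_choices_def range_moves_def B_def)
  have cC: "chvars C \<subseteq> W i j ` {40..<70}" by (simp add: final_part_def sel_def C_def)
  have ja: "jl i' j' \<noteq> W i j r" if "10 \<le> r" for i' j' r using that by (auto simp: jl_def)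
  have vA: "W i j r \<notin> pvars Ans A" if "30 \<le> r" for r
    using that by (simp add: A_def jump_part_def sel_def ja[THEN not_sym]) auto
  have vB: "W i j r \<notin> pvars Ans B" if "10 \<le> r \<and> r < 30 \<or> 40 \<le> r" for r
    using that by (auto simp: B_def range_choices_def range_moves_def jl_def)
  have vC: "W i j r \<notin> pvars Ans C" if "10 \<le> r" "r < 40" for r
    using that ja[THEN not_sym, of r] by (simp add: C_def final_part_def sel_def)
  have cases: "v \<in> chvars A \<Longrightarrow> \<exists>r. v = W i j r \<and> 10 \<le> r \<and> r < 30"
    "v \<in> chvars B \<Longrightarrow> \<exists>r. v = W i j r \<and> 30 \<le> r \<and> r < 40" "v \<in> chvars C \<Longrightarrow> \<exists>r. v = W i j r \<and> 40 \<le> r" for v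
    using cA cB cC by auto
  have x1: "xs Pl Ans A (B @ C)"
  proof (rule xsI)
    have "v \<notin> pvars Ans A" if v: "v \<in> chvars (B @ C)" for v
    proof -
      obtain r where "v = W i j r" "30 \<le> r" using v cases(2,3)[of v] unfolding chvars_append by fastforce
      then show ?thesis using vA by blast
    qed
    then show "pvars Ans A \<inter> chvars (B @ C) = {}" by blast
    have "v \<notin> writes Ans (B @ C)" if v: "v \<in> chvars A" for v
    proof -
      obtain r where "v = W i j r" "10 \<le> r" "r < 30" using cases(1)[OF v] by blast
      then have "v \<notin> pvars Ans B" "v \<notin> pvars Ans C" using vB[of r] vC[of r] by auto
      then show ?thesis using writes_pvars[of Ans B] writes_pvars[of Ans C] unfolding writes_append by blast
    qed
    then show "chvars A \<inter> writes Ans (B @ C) = {}" by blast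
    show "Pl \<notin> chvars (B @ C)" unfolding chvars_append using cases(2,3)[of Pl] by blast
  qed
  have x2: "xs Pl Ans B C"
  proof (rule xsI)
    have "v \<notin> pvars Ans B" if v: "v \<in> chvars C" for v
      using cases(3)[OF v] vB by blast
    then show "pvars Ans B \<inter> chvars C = {}" by blast
    have "v \<notin> writes Ans C" if v: "v \<in> chvars B" for v
    proof -
      obtain r where "v = W i j r" "30 \<le> r" "r < 40" using cases(2)[OF v] by blast
      then have "v \<notin> pvars Ans C" using vC[of r] by auto
      then show ?thesis using writes_pvars[of Ans C] by blast
    qed
    then show "chvars B \<inter> writes Ans C = {}" by blast
    show "Pl \<notin> chvars C" using cases(3)[of Pl] by blast
  qed
  have "wf_prog Pl Ans XA (A @ B @ C)"
    unfolding wf_prog_append[of _ _ _ A] wf_prog_append[of _ _ _ B] using x1 x2 cell_wf_parts[OF assms(1,2)]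
    unfolding A_def B_def C_def by blast
  then show ?thesis by (simp add: cell_def A_def B_def C_def)
qed

lemma cells_wf:
  assumes "1 \<le> i" "i \<le> k + 1"
  shows "wf_prog Pl Ans XA (cells k i j)" "chvars (cells k i j) \<subseteq> (\<Union>j' \<in> {1..j}. tmp i j')"
    "pvars Ans (cells k i j) \<subseteq> (\<Union>j' \<in> {1..j}. cvars k i j')"
proof -
  have "wf_prog Pl Ans XA (cells k i j) \<and> chvars (cells k i j) \<subseteq> (\<Union>j' \<in> {1..j}. tmp i j') \<and>
    pvars Ans (cells k i j) \<subseteq> (\<Union>j' \<in> {1..j}. cvars k i j')"
  proof (induction j)
    case (Suc j)
    let ?c = "cell k i (Suc j)"
    have cp: "pvars Ans ?c \<subseteq> cvars k i (Suc j)" by (rule cell_pvars[OF assms(2)])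
    have cc: "chvars ?c \<subseteq> tmp i (Suc j)" by (rule cell_chvars)
    have IH: "wf_prog Pl Ans XA (cells k i j)" "chvars (cells k i j) \<subseteq> (\<Union>j' \<in> {1..j}. tmp i j')"
      "pvars Ans (cells k i j) \<subseteq> (\<Union>j' \<in> {1..j}. cvars k i j')" using Suc by auto
    have x: "xs Pl Ans ?c (cells k i j)"
    proof (rule xsI)
      have "v \<notin> chvars (cells k i j)" if v: "v \<in> pvars Ans ?c" for v
      proof
        assume "v \<in> chvars (cells k i j)"
        then obtain j' where j': "j' \<in> {1..j}" "v \<in> tmp i j'" using IH(2) by blast
        have "v \<in> cvars k i (Suc j)" using v cp by blast
        from cvars_tmp[OF this j'(2)] j'(1) show False by simp
      qed
      then show "pvars Ans ?c \<inter> chvars (cells k i j) = {}" by blast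
      have "v \<notin> writes Ans (cells k i j)" if v: "v \<in> chvars ?c" for v
      proof
        assume "v \<in> writes Ans (cells k i j)"
        then have "v \<in> pvars Ans (cells k i j)" using writes_pvars[of Ans "cells k i j"] by blast
        then obtain j' where j': "j' \<in> {1..j}" "v \<in> cvars k i j'" using IH(3) by blast
        have "v \<in> tmp i (Suc j)" using v cc by blast
        from cvars_tmp[OF j'(2) this] j'(1) show False by simp
      qed
      then show "chvars ?c \<inter> writes Ans (cells k i j) = {}" by blast
      have "Pl \<notin> tmp i j'" for j' by (simp add: tmp_def)
      then show "Pl \<notin> chvars (cells k i j)" using IH(2) by blast
    qed
    have cs: "cells k i (Suc j) = ?c @ cells k i j" using assms by simp
    have s: "{1..Suc j} = insert (Suc j) {1..j}" by auto
    have "wf_prog Pl Ans XA ?c" by (rule cell_wf) (use assms in auto)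
    then show ?case unfolding cs s wf_prog_append chvars_append pvars_append using x IH cp cc by blast
  qed simp
  then show "wf_prog Pl Ans XA (cells k i j)" "chvars (cells k i j) \<subseteq> (\<Union>j' \<in> {1..j}. tmp i j')"
    "pvars Ans (cells k i j) \<subseteq> (\<Union>j' \<in> {1..j}. cvars k i j')" by auto
qed

lemma compare_wf: "wf_prog Pl Ans XA (compare a t c)" "chvars (compare a t c) = {}"
  "pvars Ans (compare a t c) \<subseteq> Le t ` {..a} \<union> Ad ` {..<a}"
proof -
  have "wf_prog Pl Ans XA (compare a t c) \<and> chvars (compare a t c) = {} \<and> pvars Ans (compare a t c) \<subseteq> Le t ` {..a} \<union> Ad ` {..<a}"
  proof (induction a)
    case (Suc a)
    have x: "xs Pl Ans P P'" if "chvars P = {}" "chvars P' = {}" for P P' :: "var instr list"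
      using that by (intro xsI) auto
    show ?case unfolding compare_Suc wf_prog_append chvars_append pvars_append using Suc
      by (auto simp: XA_def intro!: x)
  qed (simp add: compare_def XA_def)
  then show "wf_prog Pl Ans XA (compare a t c)" "chvars (compare a t c) = {}"
    "pvars Ans (compare a t c) \<subseteq> Le t ` {..a} \<union> Ad ` {..<a}" by auto
qed

definition last_part :: "nat \<Rightarrow> var instr list" where "last_part a = leaf_part a @ [Asg Lv [(Pl, True)]]"

lemma last_part_wf: "wf_prog Pl Ans XA (last_part a)" "chvars (last_part a) = {}"
  "pvars Ans (last_part a) \<subseteq> {Ans, Lv, Pl, Sg, W 1 0 0, W 1 0 1, W 0 0 2, Cnt 0 0, Ad a, Ad (Suc a), Le False a, Le True a}"
  by (auto simp: last_part_def leaf_part_def XA_def jl_def)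

lemma planes_wf:
  assumes "i \<le> k + 1"
  shows "wf_prog Pl Ans XA (planes n k a i) \<and> chvars (planes n k a i) \<subseteq> (\<Union>i' \<in> {1..i}. \<Union>j. tmp i' j) \<and>
    (\<forall>i' j. i < i' \<longrightarrow> pvars Ans (planes n k a i) \<inter> tmp i' j = {})"
  using assms
proof (induction i)
  case 0
  have pl: "planes n k a 0 = compare a False (k - 1) @ compare a True (n - 1) @ last_part a"
    unfolding planes.simps fin_part_def last_part_def append_assoc ..
  have x: "xs Pl Ans P P'" if "chvars P = {}" "chvars P' = {}" for P P' :: "var instr list"
    using that by (intro xsI) auto
  have "xs Pl Ans (compare a False (k - 1)) (compare a True (n - 1) @ last_part a)"
    by (rule x) (simp_all only: chvars_append compare_wf(2) last_part_wf(2) Un_empty_left)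
  moreover have "xs Pl Ans (compare a True (n - 1)) (last_part a)"
    by (rule x) (simp_all only: compare_wf(2) last_part_wf(2))
  ultimately have w: "wf_prog Pl Ans XA (planes n k a 0)" unfolding pl wf_prog_append
    using compare_wf(1) last_part_wf(1) by blast
  have v: "pvars Ans (planes n k a 0) \<inter> tmp i' j = {}" for i' j
  proof -
    have 1: "(Le t ` {..a} \<union> Ad ` {..<a}) \<inter> tmp i' j = {}" for t by (auto simp: tmp_def)
    have 2: "{Ans, Lv, Pl, Sg, W 1 0 0, W 1 0 1, W 0 0 2, Cnt 0 0, Ad a, Ad (Suc a), Le False a, Le True a} \<inter> tmp i' j = {}"
      by (auto simp: tmp_def)
    have d: "A \<inter> C = {}" if "A \<subseteq> B" "B \<inter> C = {}" for A B C :: "var set" using that by blast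
    show ?thesis unfolding pl pvars_append Int_Un_distrib2 Un_empty
      by (intro conjI d[OF compare_wf(3) 1] d[OF last_part_wf(3) 2])
  qed
  have "chvars (planes n k a 0) = {}" unfolding pl chvars_append using compare_wf last_part_wf by simp
  then have "chvars (planes n k a 0) \<subseteq> (\<Union>i' \<in> {1..0}. \<Union>j. tmp i' j)" by (simp only: empty_subsetI)
  then show ?case by (intro conjI allI impI w v)
next
  case (Suc i)
  then have IH: "wf_prog Pl Ans XA (planes n k a i)" "chvars (planes n k a i) \<subseteq> (\<Union>i' \<in> {1..i}. \<Union>j. tmp i' j)"
    "\<And>i' j. i < i' \<Longrightarrow> pvars Ans (planes n k a i) \<inter> tmp i' j = {}" by auto
  define C where "C = cells k (Suc i) (a + 2)"
  have k: "Suc i \<le> k + 1" by fact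
  have c: "wf_prog Pl Ans XA C" "chvars C \<subseteq> (\<Union>j. tmp (Suc i) j)" "pvars Ans C \<subseteq> (\<Union>j. cvars k (Suc i) j)"
  proof -
    have "1 \<le> Suc i" by simp
    note w = cells_wf[OF this k, of "a + 2"]
    show "wf_prog Pl Ans XA C" "chvars C \<subseteq> (\<Union>j. tmp (Suc i) j)" "pvars Ans C \<subseteq> (\<Union>j. cvars k (Suc i) j)"
      unfolding C_def by (rule w(1), (rule subset_trans[OF w(2)] subset_trans[OF w(3)], rule UN_mono; simp)+)
  qed
  have cv: "v \<notin> tmp i' j" if vi: "v \<in> pvars Ans C" "i' \<noteq> Suc i" for i' j v
  proof
    assume t: "v \<in> tmp i' j"
    obtain j' where "v \<in> cvars k (Suc i) j'" using c(3) vi(1) by blast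
    from cvars_tmp[OF this t] vi(2) show False by simp
  qed
  have x: "xs Pl Ans C (planes n k a i)"
  proof (rule xsI)
    have "v \<notin> chvars (planes n k a i)" if v: "v \<in> pvars Ans C" for v
    proof
      assume "v \<in> chvars (planes n k a i)"
      then obtain i' j where i': "i' \<in> {1..i}" "v \<in> tmp i' j" using IH(2) by blast
      with cv[OF v, of i' j] show False by simp
    qed
    then show "pvars Ans C \<inter> chvars (planes n k a i) = {}" by blast
    show "chvars C \<inter> writes Ans (planes n k a i) = {}"
      using c(2) IH(3)[of "Suc i"] writes_pvars[of Ans "planes n k a i"] by blast
    have "Pl \<notin> tmp i' j" for i' j by (simp add: tmp_def)
    then show "Pl \<notin> chvars (planes n k a i)" using IH(2) by blast
  qed
  have s: "{1..Suc i} = insert (Suc i) {1..i}" by auto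
  have d: "pvars Ans C \<inter> tmp i' j = {}" if "Suc i < i'" for i' j
  proof -
    have "v \<notin> tmp i' j" if "v \<in> pvars Ans C" for v using cv[OF that] \<open>Suc i < i'\<close> by simp
    then show ?thesis by blast
  qed
  have pl: "planes n k a (Suc i) = C @ planes n k a i" by (simp add: C_def)
  have "chvars (planes n k a (Suc i)) \<subseteq> (\<Union>i' \<in> {1..Suc i}. \<Union>j. tmp i' j)"
    unfolding pl s chvars_append UN_insert by (rule Un_mono[OF c(2) IH(2)])
  moreover have "pvars Ans (planes n k a (Suc i)) \<inter> tmp i' j = {}" if "Suc i < i'" for i' j
    unfolding pl pvars_append using d[OF that] IH(3)[of i' j] that by (simp add: Int_Un_distrib2)
  moreover have "wf_prog Pl Ans XA (planes n k a (Suc i))" unfolding pl wf_prog_append using x c(1) IH(1) by blast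
  ultimately show ?case by (intro conjI allI impI)
qed

lemma dyck_prog_wf: "wf_prog Pl Ans XA (dyck_prog n k a)"
  using planes_wf[of "k + 1" k n a] by (auto simp: dyck_prog_def XA_def tmp_def)

text \<open>The oracle prescribes the places of the index bits and of the answer. All other
  variables go above, in an arbitrary numbering: the total number of qubits may be large, but only
  those touched by an operation count.\<close>

definition enc :: "nat \<Rightarrow> var \<Rightarrow> nat" where
  "enc a v = (case v of Ad j \<Rightarrow> if j < a then j else a + 1 + to_nat v | Ans \<Rightarrow> a | _ \<Rightarrow> a + 1 + to_nat v)"

lemma enc_cases: "enc a v = a + 1 + to_nat v \<or> (\<exists>j < a. v = Ad j \<and> enc a v = j) \<or> v = Ans \<and> enc a v = a"
  by (cases v) (auto simp: enc_def)

lemma enc_simps [simp]: "j < a \<Longrightarrow> enc a (Ad j) = j" "enc a Ans = a"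
  by (auto simp: enc_def)

lemma inj_enc: "inj (enc a)"
proof (rule injI)
  fix v w assume "enc a v = enc a w"
  then show "v = w" using enc_cases[of a v] enc_cases[of a w] by (auto dest: injD[OF inj_to_nat])
qed

lemma enc_gt: "v \<noteq> Ans \<Longrightarrow> (\<And>j. v \<noteq> Ad j) \<Longrightarrow> a < enc a v"
  using enc_cases[of a v] by auto

lemma reads_enc: "a = ceillog2 (length x) \<Longrightarrow> reads x st = vreads x a (st \<circ> enc a)"
proof -
  assume a: "a = ceillog2 (length x)"
  have "horner_sum of_bool 2 (map st [0..<a]) = low a (st \<circ> enc a)"
    unfolding horner_sum_eq_sum low_def by (intro sum.cong) (auto simp: atLeast0LessThan)
  then show ?thesis using a by (simp add: reads_def vreads_def Let_def)
qed

section \<open>Steps\<close>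

text \<open>A list of operations which makes up one step: it has at most \<open>l\<close> operations and involves at
  most \<open>B\<close> qubits.\<close>

definition one_step :: "nat \<Rightarrow> nat \<Rightarrow> op list \<Rightarrow> bool" where
  "one_step B l c \<longleftrightarrow> length c \<le> l \<and> (\<exists>V. finite V \<and> card V \<le> B \<and>
     (\<forall>g \<in> set c. \<exists>ls q \<theta>. g = R (ls, q, \<theta>) \<and> insert q (fst ` set ls) \<subseteq> V \<and> length ls \<le> 10))"

definition time_le :: "nat \<Rightarrow> nat \<Rightarrow> op list \<Rightarrow> nat \<Rightarrow> bool" where
  "time_le B l L s \<longleftrightarrow> (\<exists>cs. concat cs = L \<and> (\<forall>c \<in> set cs. c = [Q] \<or> one_step B l c) \<and> length cs \<le> s)"

lemma time_le_Nil: "time_le B l [] s"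
  unfolding time_le_def by (rule exI[of _ "[]"]) simp

lemma time_le_append:
  assumes "time_le B l L s" "time_le B l L' s'"
  shows "time_le B l (L @ L') (s + s')"
proof -
  obtain cs cs' where "concat cs = L" "\<forall>c \<in> set cs. c = [Q] \<or> one_step B l c" "length cs \<le> s"
    "concat cs' = L'" "\<forall>c \<in> set cs'. c = [Q] \<or> one_step B l c" "length cs' \<le> s'"
    using assms unfolding time_le_def by blast
  then show ?thesis unfolding time_le_def by (intro exI[of _ "cs @ cs'"]) auto
qed

lemma time_le_mono: "time_le B l L s \<Longrightarrow> s \<le> s' \<Longrightarrow> time_le B l L s'"
  unfolding time_le_def by (blast intro: order_trans)

lemma time_le_one_step: "one_step B l c \<Longrightarrow> time_le B l c 1"
  unfolding time_le_def by (rule exI[of _ "[c]"]) simp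

lemma time_le_Q: "time_le B l [Q] 1"
  unfolding time_le_def by (rule exI[of _ "[[Q]]"]) simp

lemma time_le_rev:
  assumes "time_le B l L s"
  shows "time_le B l (rev L) s"
proof -
  obtain cs where cs: "concat cs = L" "\<forall>c \<in> set cs. c = [Q] \<or> one_step B l c" "length cs \<le> s"
    using assms unfolding time_le_def by blast
  have "one_step B l (rev c)" if "one_step B l c" for c using that by (simp add: one_step_def)
  then have "\<forall>c \<in> set (map rev (rev cs)). c = [Q] \<or> one_step B l c" using cs(2) by fastforce
  then show ?thesis unfolding time_le_def using cs by (intro exI[of _ "map rev (rev cs)"]) (simp add: rev_concat[symmetric] rev_map)
qed

lemma time_le_power:
  assumes "time_le B l gs s"
  shows "time_le B l (power_ops N gs) (N * s)"
proof (induction N)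
  case (Suc N)
  have "power_ops (Suc N) gs = gs @ power_ops N gs" by (simp add: power_ops_def)
  then show ?case using time_le_append[OF assms Suc] by simp
qed (simp add: power_ops_def time_le_Nil)

lemma one_step_single: "length ls \<le> 10 \<Longrightarrow> 11 \<le> B \<Longrightarrow> 1 \<le> l \<Longrightarrow> one_step B l [R (ls, q, \<theta>)]"
proof -
  assume a: "length ls \<le> 10" "11 \<le> B" "1 \<le> l"
  have "card (insert q (fst ` set ls)) \<le> Suc (card (fst ` set ls))" by (rule card_insert_le_m1) auto
  also have "card (fst ` set ls) \<le> length ls" using card_image_le[of "set ls" fst] card_length[of ls] by simp
  finally have "card (insert q (fst ` set ls)) \<le> B" using a by simp
  then show ?thesis unfolding one_step_def using a by (intro conjI exI[of _ "insert q (fst ` set ls)"]) auto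
qed

lemma time_le_singles:
  assumes "\<forall>g \<in> set L. g = Q \<or> (\<exists>ls q \<theta>. g = R (ls, q, \<theta>) \<and> length ls \<le> 10)" "11 \<le> B" "1 \<le> l"
  shows "time_le B l L (length L)"
  using assms(1)
proof (induction L)
  case (Cons g L)
  have "time_le B l [g] 1" using Cons(2) one_step_single[OF _ assms(2,3)] time_le_one_step time_le_Q by auto
  then show ?case using time_le_append[of B l "[g]" 1 L "length L"] Cons by simp
qed (rule time_le_Nil)

fun op_gates :: "op \<Rightarrow> gate list" where
  "op_gates (R g) = refl g"
| "op_gates Q = []"

definition to_step :: "op list \<Rightarrow> step" where
  "to_step c = (if c = [Q] then Query else Operation (concat (map op_gates c)))"

lemma query_mat_correct:
  assumes "ceillog2 (length x) < m"
  shows "query_mat m x *\<^sub>v vec (2 ^ m) \<psi> = vec (2 ^ m) (\<psi> \<circ> query_basis x)"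
proof (rule eq_vecI)
  fix r :: nat assume "r < dim_vec (vec (2 ^ m) (\<psi> \<circ> query_basis x))"
  then have r: "r < 2 ^ m" by simp
  have q: "query_basis x r < 2 ^ m" using r assms by (simp add: query_basis_reads)
  have "(query_mat m x *\<^sub>v vec (2 ^ m) \<psi>) $ r = (\<Sum>c = 0..<2 ^ m. (if r = query_basis x c then 1 else 0) * \<psi> c)"
    using r by (simp add: query_mat_def scalar_prod_def)
  also have "\<dots> = (\<Sum>c = 0..<2 ^ m. if c = query_basis x r then \<psi> c else 0)"
    by (intro sum.cong) (auto simp: query_basis_invol)
  also have "\<dots> = \<psi> (query_basis x r)" using q by (simp add: sum.delta)
  finally show "(query_mat m x *\<^sub>v vec (2 ^ m) \<psi>) $ r = vec (2 ^ m) (\<psi> \<circ> query_basis x) $ r" using r by simp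
qed (simp add: query_mat_def)

lemma run_gates_append: "run_gates m (gs @ hs) v = run_gates m hs (run_gates m gs v)"
  by (simp add: run_gates_def)

lemma op_gates_correct:
  assumes "\<forall>g \<in> set c. wf_op m g \<and> g \<noteq> Q"
  shows "run_gates m (concat (map op_gates c)) (vec (2 ^ m) \<psi>) = vec (2 ^ m) (run x c \<psi>)"
  using assms
proof (induction c arbitrary: \<psi>)
  case (Cons g c)
  obtain r where "g = R r" "wf_refl m r" using Cons(2) by (cases g) auto
  then show ?case using Cons by (simp add: run_gates_append refl_correct)
qed simp

lemma one_step_Q: "one_step B l c \<Longrightarrow> g \<in> set c \<Longrightarrow> g \<noteq> Q"
  unfolding one_step_def by fastforce

lemma to_step_correct:
  assumes "c = [Q] \<or> one_step B l c" "\<forall>g \<in> set c. wf_op m g" "ceillog2 (length x) < m"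
  shows "apply_step m x (to_step c) (vec (2 ^ m) \<psi>) = vec (2 ^ m) (run x c \<psi>)"
proof (cases "c = [Q]")
  case True
  then show ?thesis using query_mat_correct[OF assms(3)] by (simp add: to_step_def)
next
  case False
  then have "\<forall>g \<in> set c. wf_op m g \<and> g \<noteq> Q" using assms one_step_Q by blast
  from op_gates_correct[OF this, of \<psi> x] show ?thesis using False by (simp add: to_step_def run_gates_def)
qed

lemma length_op_gates:
  assumes "\<And>g. g \<in> set c \<Longrightarrow> \<exists>ls q \<theta>. g = R (ls, q, \<theta>) \<and> length ls \<le> 10"
  shows "length (concat (map op_gates c)) \<le> length c * (2 * 3 ^ 10 + 1)"
  using assms
proof (induction c)
  case (Cons g c)
  obtain ls q \<theta> where g: "g = R (ls, q, \<theta>)" "length ls \<le> 10" using Cons(2)[of g] by auto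
  have "length (refl (ls, q, \<theta>)) \<le> 2 * 3 ^ length ls + 1" by (rule length_refl)
  also have "\<dots> \<le> 2 * 3 ^ 10 + 1" using power_increasing[OF g(2), of "3 :: nat"] by simp
  finally have "length (refl (ls, q, \<theta>)) \<le> 2 * 3 ^ 10 + 1" .
  moreover have "length (concat (map op_gates c)) \<le> length c * (2 * 3 ^ 10 + 1)" by (rule Cons.IH) (use Cons(2) in auto)
  ultimately show ?case using g by simp
qed simp

text \<open>A reflection with 10 controls takes at most \<open>2 * 3 ^ 10 + 1\<close> gates, see
  \<open>length_refl\<close>.\<close>

definition size_ok :: "nat \<Rightarrow> nat \<Rightarrow> nat \<Rightarrow> nat \<Rightarrow> bool" where
  "size_ok c n B l \<longleftrightarrow> real B \<le> real c * (1 + log 2 (real n)) \<and>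
     real (l * (2 * 3 ^ 10 + 1)) \<le> real c * (1 + log 2 (real n)) ^ c"

lemma to_step_ok:
  assumes "one_step B l c" "\<forall>g \<in> set c. wf_op m g" "size_ok k n B l"
  shows "word_operation k n (concat (map op_gates c))" "g \<in> set (concat (map op_gates c)) \<Longrightarrow> elementary_gate m g"
proof -
  obtain V where V: "finite V" "card V \<le> B" "length c \<le> l"
    "\<And>g. g \<in> set c \<Longrightarrow> \<exists>ls q \<theta>. g = R (ls, q, \<theta>) \<and> insert q (fst ` set ls) \<subseteq> V \<and> length ls \<le> 10"
    using assms(1) unfolding one_step_def by blast
  have g: "elementary_gate m g \<and> set (fst g) \<subseteq> V" if gc: "g \<in> set (concat (map op_gates c))" for g
  proof -
    obtain h where h: "h \<in> set c" "g \<in> set (op_gates h)" using gc by auto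
    obtain ls q \<theta> where r: "h = R (ls, q, \<theta>)" "insert q (fst ` set ls) \<subseteq> V" using V(4)[OF h(1)] by blast
    then have "wf_refl m (ls, q, \<theta>)" using assms(2) h(1) by auto
    from refl_gates[OF this, of g] show ?thesis using h(2) r by auto
  qed
  then show "g \<in> set (concat (map op_gates c)) \<Longrightarrow> elementary_gate m g" by blast
  have "(\<Union>(qs, U) \<in> set (concat (map op_gates c)). set qs) \<subseteq> V" using g by fastforce
  from card_mono[OF V(1) this] have 1: "card (\<Union>(qs, U) \<in> set (concat (map op_gates c)). set qs) \<le> B" using V(2) by simp
  have "length (concat (map op_gates c)) \<le> length c * (2 * 3 ^ 10 + 1)"
    by (rule length_op_gates) (use V(4) in blast)
  also have "\<dots> \<le> l * (2 * 3 ^ 10 + 1)" using V(3) by simp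
  finally have 2: "length (concat (map op_gates c)) \<le> l * (2 * 3 ^ 10 + 1)" .
  show "word_operation k n (concat (map op_gates c))" unfolding word_operation_def
  proof
    show "real (card (\<Union>(qs, U) \<in> set (concat (map op_gates c)). set qs)) \<le> real k * (1 + log 2 (real n))"
      using assms(3) 1 unfolding size_ok_def by linarith
    show "real (length (concat (map op_gates c))) \<le> real k * (1 + log 2 (real n)) ^ k"
      using assms(3) of_nat_mono[OF 2, where 'a = real] unfolding size_ok_def by linarith
  qed
qed

theorem algorithm_of_ops:
  assumes L: "time_le B l L s" "\<forall>g \<in> set L. wf_op m g" "size_ok c n B l" and m: "ceillog2 n < m" "out < m"
    and err: "\<And>x. length x = n \<Longrightarrow> norm2 m (\<lambda>b. if bit b out = (\<not> f x) then run x L (ket 0) b else 0) \<le> \<epsilon>"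
  shows "\<exists>A. is_query_algorithm c n A \<and> computes_with_error A n f \<epsilon> \<and> queries A \<le> s \<and> running_time A \<le> s"
proof -
  obtain cs where cs: "concat cs = L" "\<forall>c \<in> set cs. c = [Q] \<or> one_step B l c" "length cs \<le> s"
    using L(1) unfolding time_le_def by blast
  have wf: "\<forall>g \<in> set c'. wf_op m g" if "c' \<in> set cs" for c' using that cs(1) L(2) by auto
  define A where "A = \<lparr>qubits = m, steps = map to_step cs, out_qubit = out\<rparr>"
  have "is_query_algorithm c n A" unfolding is_query_algorithm_def
  proof (intro conjI allI impI)
    fix gs assume "Operation gs \<in> set (steps A)"
    then obtain c' where c': "c' \<in> set cs" "to_step c' = Operation gs" by (auto simp: A_def)
    then have "gs = concat (map op_gates c')" "c' \<noteq> [Q]" by (auto simp: to_step_def split: if_splits)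
    then show "word_operation c n gs" "\<forall>g \<in> set gs. elementary_gate (qubits A) g"
      using to_step_ok[OF _ wf[OF c'(1)] L(3)] cs(2) c'(1) by (auto simp: A_def)
  qed (use m in \<open>simp_all add: A_def\<close>)
  moreover have "output_prob A x (\<not> f x) \<le> \<epsilon>" if x: "length x = n" for x
  proof -
    have run: "fold (apply_step m x) (map to_step cs') (vec (2 ^ m) \<psi>) = vec (2 ^ m) (run x (concat cs') \<psi>)"
      if "set cs' \<subseteq> set cs" for cs' \<psi>
      using that
    proof (induction cs' arbitrary: \<psi>)
      case (Cons c' cs')
      have "apply_step m x (to_step c') (vec (2 ^ m) \<psi>) = vec (2 ^ m) (run x c' \<psi>)"
        by (rule to_step_correct[of c' B l]) (use cs(2) Cons(2) wf m(1) x in auto)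
      then show ?case using Cons by simp
    qed simp
    have "unit_vec (2 ^ m) 0 = vec (2 ^ m) (ket 0)" by (auto simp: unit_vec_def ket_def)
    then have fin: "final_state A x = vec (2 ^ m) (run x L (ket 0))"
      using run[of cs] cs(1) by (simp add: final_state_def A_def)
    have "output_prob A x (\<not> f x) = (\<Sum>b | b < 2 ^ m \<and> bit b out = (\<not> f x). (cmod (run x L (ket 0) b))\<^sup>2)"
      unfolding output_prob_def by (rule sum.cong) (simp_all add: fin, simp_all add: A_def)
    also have "\<dots> = norm2 m (\<lambda>b. if bit b out = (\<not> f x) then run x L (ket 0) b else 0)"
      unfolding norm2_def by (rule sum.mono_neutral_cong_left) auto
    finally show ?thesis using err[OF x] by simp
  qed
  moreover have "queries A \<le> s" "running_time A \<le> s" using cs(3) count_le_length[of "map to_step cs" Query]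
    by (auto simp: queries_def running_time_def A_def)
  ultimately show ?thesis unfolding computes_with_error_def by blast
qed

section \<open>Grouping the passes and the walk into steps\<close>

primrec controls :: "'v instr \<Rightarrow> 'v lits" where
  "controls (Asg t ls) = ls"
| "controls Qry = []"
| "controls (Ch q z ls k p) = ls"

lemma length_bwo: "length (bwo pl act rt sg f P) \<le> 4 * length P"
  by (induction P rule: chvars.induct) auto

text \<open>A pass adds at most the four controls \<open>act\<close>, \<open>rt\<close>, flag and
  polarity to the at most six of an instruction.\<close>

lemma bwo_gates:
  assumes "g \<in> set (bwo pl act rt sg f P)" "\<forall>i \<in> set P. length (controls i) \<le> 6"
  shows "g = Q \<and> Qry \<in> set P \<or> (\<exists>ls q \<theta>. g = R (ls, q, \<theta>) \<and> insert q (fst ` set ls) \<subseteq> {act, rt, pl, f} \<union> pvars an P \<and> length ls \<le> 10)"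
  using assms
proof (induction P rule: chvars.induct)
  case (2 q z ls k p P)
  let ?Y = "{act, rt, pl, f} \<union> pvars an (Ch q z ls k p # P)"
  have F: "flag f P \<in> {act, rt, pl, f} \<union> pvars an P"
    using flag_cases[of f P] chvars_writes[of P an] writes_pvars[of an P] by blast
  have l: "length ls \<le> 6" using 2(3) by simp
  have mk: ?case if "g = R (ls', q', \<theta>)" "insert q' (fst ` set ls') \<subseteq> ?Y" "length ls' \<le> 10" for ls' q' \<theta>
    using that by blast
  consider "g \<in> set (bwo pl act rt sg f P)" | "g = R ((flag f P, False) # ls, q, arccos (sqrt p))"
    | "g = R ((act, True) # (rt, False) # (flag f P, False) # (pl, \<not> k) # ls, q, 0)"
    | "g = R ([(q, True)], z, pi / 2)" | "g = R ([(flag f P, True), (q, False)], z, pi / 2)"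
    using 2(2) by (auto split: if_splits)
  then show ?case
  proof cases
    case 1
    have "pvars an P \<subseteq> pvars an (Ch q z ls k p # P)" by auto
    then show ?thesis using "2.IH"[OF 1] 2(3) by (simp only: list.set ball_simps) blast
  next
    case 2
    show ?thesis by (rule mk[OF 2]) (use F l in auto)
  next
    case 3
    show ?thesis by (rule mk[OF 3]) (use F l in auto)
  next
    case 4
    show ?thesis by (rule mk[OF 4]) auto
  next
    case 5
    show ?thesis by (rule mk[OF 5]) (use F in auto)
  qed
next
  case ("3_1" t ls P)
  then show ?case
  proof (cases "g \<in> set (bwo pl act rt sg f P)")
    case True
    have "pvars an P \<subseteq> pvars an (Asg t ls # P)" by auto
    then show ?thesis using "3_1.IH"[OF True] "3_1"(3) by (simp only: list.set ball_simps) blast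
  next
    case False
    then have "g = R (ls, t, pi / 2)" using "3_1"(2) by simp
    moreover have "insert t (fst ` set ls) \<subseteq> {act, rt, pl, f} \<union> pvars an (Asg t ls # P)" "length ls \<le> 10" using "3_1"(3) by auto
    ultimately show ?thesis by blast
  qed
next
  case ("3_2" P)
  then show ?case
  proof (cases "g \<in> set (bwo pl act rt sg f P)")
    case True
    have "pvars an P \<subseteq> pvars an (Qry # P)" by auto
    then show ?thesis using "3_2.IH"[OF True] "3_2"(3) by (simp only: list.set ball_simps) blast
  qed auto
qed auto

lemma time_le_bwo:
  assumes "Qry \<notin> set P" "\<forall>i \<in> set P. length (controls i) \<le> 6" "card (pvars an P) + 4 \<le> B" "4 * length P \<le> l"
  shows "time_le B l (bwo pl act rt sg f P) 1"
proof (rule time_le_one_step, unfold one_step_def, intro conjI exI[of _ "{act, rt, pl, f} \<union> pvars an P"] ballI)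
  show "length (bwo pl act rt sg f P) \<le> l" using length_bwo[of pl act rt sg f P] assms(4) by simp
  have "card ({act, rt, pl, f} \<union> pvars an P) \<le> card {act, rt, pl, f} + card (pvars an P)" by (rule card_Un_le)
  also have "card {act, rt, pl, f} \<le> 4" by (auto simp: card_insert_if)
  finally show "card ({act, rt, pl, f} \<union> pvars an P) \<le> B" using assms(3) by simp
  fix g assume "g \<in> set (bwo pl act rt sg f P)"
  from bwo_gates[OF this assms(2), of an] assms(1)
  show "\<exists>ls q \<theta>. g = R (ls, q, \<theta>) \<and> insert q (fst ` set ls) \<subseteq> {act, rt, pl, f} \<union> pvars an P \<and> length ls \<le> 10" by blast
qed simp

lemma bwo_append: "bwo pl act rt sg f (P @ P') = bwo pl act rt sg f P' @ bwo pl act rt sg (flag f P') P"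
proof (induction P rule: chvars.induct)
  case (2 q z ls k p P)
  have "flag f (P @ P') = flag (flag f P') P" by (induction P rule: chvars.induct) auto
  then show ?case using 2 by simp
qed auto

lemma time_le_bwo_append:
  assumes "\<And>f. time_le B l (bwo pl act rt sg f P) s" "\<And>f. time_le B l (bwo pl act rt sg f P') s'"
  shows "time_le B l (bwo pl act rt sg f (P @ P')) (s' + s)"
  unfolding bwo_append using assms by (intro time_le_append)

context walk
begin

lemma it_vars:
  assumes "g \<in> set it" "\<forall>i \<in> set P. length (controls i) \<le> 6"
  shows "op_vars an g \<subseteq> {..an} \<union> {act, rt, pl, lv, f} \<union> pvars an P"
proof -
  have F: "flag f P \<in> insert f (pvars an P)"
    using flag_cases[of f P] chvars_writes[of P an] writes_pvars[of an P] by blast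
  have "op_vars an g \<subseteq> {..an} \<union> {act, rt, pl, lv, f} \<union> pvars an P" if b: "g \<in> set (bwo pl act rt sg f P)" for sg
    using bwo_gates[OF b assms(2), of an]
  proof
    assume "\<exists>ls q \<theta>. g = R (ls, q, \<theta>) \<and> insert q (fst ` set ls) \<subseteq> {act, rt, pl, f} \<union> pvars an P \<and> length ls \<le> 10"
    then obtain ls q \<theta> where "g = R (ls, q, \<theta>)" "insert q (fst ` set ls) \<subseteq> {act, rt, pl, f} \<union> pvars an P" by blast
    then show ?thesis by (simp only: op_vars.simps) blast
  qed auto
  then show ?thesis using assms(1) F by (auto simp: it_def)
qed

lemma time_le_it:
  assumes "\<And>sg. time_le B l (bwo pl act rt sg f P) s" "11 \<le> B" "1 \<le> l"
  shows "time_le B l it (2 * s + 2)"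
proof -
  have 1: "time_le B l [R g] 1" if "length (fst g) \<le> 10" for g
    using one_step_single[OF that assms(2,3), of "fst (snd g)" "snd (snd g)"] by (intro time_le_one_step) simp
  have "time_le B l ([R ([(act, True), (flag f P, False)], rt, 2 * t + pi)] @ (rev bwU @ ([R ([(act, True), (rt, False)], lv, pi)] @ bwS)))
      (1 + (s + (1 + s)))"
    by (intro time_le_append time_le_rev assms(1) 1) simp_all
  then show ?thesis unfolding it_def append_Cons append_Nil by (rule time_le_mono) simp
qed

text \<open>As the powers double, the number of iterations is \<open>N\<close> times a geometric
  sum; every clock adds four operations of its own.\<close>

lemma time_le_detect:
  assumes "time_le B l it s" "11 \<le> B" "1 \<le> l"
  shows "time_le B l (detect N ws) (4 * length ws + N * (2 ^ length ws - 1) * s)"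
proof -
  have 1: "time_le B l [R g, R h] 2" if "length (fst g) \<le> 10" "length (fst h) \<le> 10" for g h
    using time_le_singles[of "[R g, R h]" B l] that assms(2,3) by (cases g; cases h) (auto simp: numeral_2_eq_2)
  have d: "time_le B l (dstep w N) (2 + (N * s + 2))" for w N
    unfolding dstep_def by (intro time_le_append time_le_power assms(1) 1) simp_all
  show ?thesis
  proof (induction N ws rule: detect.induct)
    case (2 N w ws)
    have "time_le B l (detect N (w # ws)) (2 + (N * s + 2) + (4 * length ws + 2 * N * (2 ^ length ws - 1) * s))"
      unfolding detect.simps by (intro time_le_append d 2)
    moreover obtain p where "2 ^ length ws = Suc p" using not0_implies_Suc[of "2 ^ length ws"] by auto
    ultimately show ?case by (elim time_le_mono) (simp add: algebra_simps)
  qed (simp add: time_le_Nil)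
qed

end

section \<open>A classical algorithm for large depth\<close>

fun cops :: "nat instr list \<Rightarrow> op list" where
  "cops [] = []"
| "cops (Asg t ls # P) = R (ls, t, pi / 2) # cops P"
| "cops (Qry # P) = Q # cops P"
| "cops (Ch q z ls k p # P) = cops P"

fun cl_ok :: "'v instr list \<Rightarrow> bool" where
  "cl_ok [] \<longleftrightarrow> True"
| "cl_ok (Asg t ls # P) \<longleftrightarrow> distinct (t # map fst ls) \<and> length ls \<le> 10 \<and> cl_ok P"
| "cl_ok (Qry # P) \<longleftrightarrow> cl_ok P"
| "cl_ok (Ch q z ls k p # P) \<longleftrightarrow> False"

lemma cl_ok_append [simp]: "cl_ok (P @ P') \<longleftrightarrow> cl_ok P \<and> cl_ok P'"
  by (induction P rule: chvars.induct) auto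

lemma cl_ok_map:
  assumes "inj e"
  shows "cl_ok (mp e P) \<longleftrightarrow> cl_ok P"
proof (induction P rule: chvars.induct)
  case ("3_1" t ls P)
  have "map fst (map (map_prod e id) ls) = map e (map fst ls)" by simp
  moreover have "distinct (map e ys) = distinct ys" for ys
    using assms by (auto simp: distinct_map intro: inj_on_subset)
  from this[of "t # map fst ls"] have "distinct (map e (t # map fst ls)) = distinct (t # map fst ls)" .
  ultimately show ?case using "3_1" by (simp only: mp_simps cl_ok.simps length_map list.map)
qed simp_all

lemma length_cops: "length (cops P) \<le> length P"
  by (induction P rule: chvars.induct) auto

lemma cops_ok: "cl_ok P \<Longrightarrow> pvars an P \<subseteq> {..<m} \<Longrightarrow>
    \<forall>g \<in> set (cops P). wf_op m g \<and> (g = Q \<or> (\<exists>ls q \<theta>. g = R (ls, q, \<theta>) \<and> length ls \<le> 10))"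
  by (induction P rule: chvars.induct) (auto simp: wf_refl_def intro!: exI[of _ "pi / 2"])

lemma ket_perm:
  assumes "\<And>b. F (F b) = b"
  shows "ket b \<circ> F = ket (F b)"
proof
  fix b'
  have "F b' = b \<longleftrightarrow> b' = F b" using assms by metis
  then show "(ket b \<circ> F) b' = ket (F b) b'" by (simp add: ket_def)
qed

lemma run_cops:
  "cl_ok P \<Longrightarrow> \<exists>b'. run x (cops P) (ket b) = ket b' \<and> bit b' = exec (ceillog2 (length x)) (reads x) P (bit b)"
proof (induction P arbitrary: b rule: chvars.induct)
  case ("3_1" t ls P)
  then have t: "t \<notin> fst ` set ls" by auto
  have "ket b \<circ> asg ls t = ket (asg ls t b)" by (rule ket_perm) (rule asg_asg[OF t])
  moreover have "bit (asg ls t b) = (bit b)(t := (bit b t \<noteq> holds (bit b) ls))"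
    by (auto simp: fun_eq_iff bit_asg)
  moreover obtain b' where "run x (cops P) (ket (asg ls t b)) = ket b'"
    "bit b' = exec (ceillog2 (length x)) (reads x) P (bit (asg ls t b))" using "3_1.IH"[of "asg ls t b"] "3_1"(2) by auto
  ultimately show ?case by (intro exI[of _ b']) (simp only: cops.simps run_simps run1.simps cr_not exec.simps)
next
  case ("3_2" P)
  have "ket b \<circ> query_basis x = ket (query_basis x b)" by (rule ket_perm) (rule query_basis_invol)
  moreover have "bit (query_basis x b) = (bit b)(ceillog2 (length x) := (bit b (ceillog2 (length x)) \<noteq> reads x (bit b)))"
    by (auto simp: fun_eq_iff query_basis_reads bit_flip)
  moreover obtain b' where "run x (cops P) (ket (query_basis x b)) = ket b'"
    "bit b' = exec (ceillog2 (length x)) (reads x) P (bit (query_basis x b))" using "3_2.IH"[of "query_basis x b"] "3_2"(2) by auto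
  ultimately show ?case by (intro exI[of _ b']) (simp only: cops.simps run_simps run1.simps exec.simps)
qed auto

text \<open>\<open>Cnt i d\<close> becomes true if the first \<open>i\<close> scan have balance \<open>d\<close> and depth at most \<open>K\<close>.\<close>

definition address :: "nat \<Rightarrow> nat \<Rightarrow> var instr list" where
  "address a i = map (\<lambda>j. Asg (Ad j) []) (filter (bit i) [0..<a])"

text \<open>Every letter gets new counters, since a reversible computation cannot overwrite the old
  ones.\<close>

fun row :: "nat \<Rightarrow> nat \<Rightarrow> nat \<Rightarrow> var instr list" where
  "row K i 0 = []"
| "row K i (Suc d) = row K i d @
     (if d = 0 then [] else [Asg (Cnt (Suc i) d) [(Cnt i (d - 1), True), (Ans, False)]]) @
     (if d = K then [] else [Asg (Cnt (Suc i) d) [(Cnt i (Suc d), True), (Ans, True)]])"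

text \<open>The second query and the second address clean up the answer and the index for the next
  letter.\<close>

definition letter_part :: "nat \<Rightarrow> nat \<Rightarrow> nat \<Rightarrow> var instr list" where
  "letter_part K a i = address a i @ [Qry] @ row K i (Suc K) @ [Qry] @ address a i"

fun scan :: "nat \<Rightarrow> nat \<Rightarrow> nat \<Rightarrow> var instr list" where
  "scan K a 0 = [Asg (Cnt 0 0) []]"
| "scan K a (Suc i) = scan K a i @ letter_part K a i"

lemma scan_ok: "cl_ok (scan K a i)"
proof -
  have r: "cl_ok (row K i d)" for i d by (induction d) auto
  have a: "cl_ok (map (\<lambda>j. Asg (Ad j) []) js)" for js by (induction js) auto
  show ?thesis by (induction i) (auto simp: letter_part_def address_def r a)
qed

lemma length_scan: "length (scan K a i) \<le> 1 + i * (2 * a + 4 + 2 * K)"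
proof -
  have r: "length (row K i d) \<le> 2 * d" for i d by (induction d) auto
  have l: "length (letter_part K a i) \<le> 2 * a + 4 + 2 * K" for i
    using r[of i "Suc K"] length_filter_le[of "bit i" "[0..<a]"] unfolding letter_part_def address_def length_append length_map by simp
  show ?thesis
  proof (induction i)
    case (Suc i)
    then show ?case using l[of i] by simp
  qed simp
qed

lemma exec_address: "distinct js \<Longrightarrow> exec an orc (map (\<lambda>j. Asg (Ad j) []) js) st = (\<lambda>v. st v \<noteq> (\<exists>j \<in> set js. v = Ad j))"
  by (induction js arbitrary: st) (auto simp: fun_eq_iff)

lemma exec_row:
  "exec Ans orc (row K i D) st = (\<lambda>v. case v of Cnt i' d \<Rightarrow> st v \<noteq> (i' = Suc i \<and> d < D \<and>
     (if st Ans then d \<noteq> K \<and> st (Cnt i (Suc d)) else d \<noteq> 0 \<and> st (Cnt i (d - 1)))) | _ \<Rightarrow> st v)" (is "_ = ?g D")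
proof (induction D)
  case 0
  then show ?case by (auto simp: fun_eq_iff split: var.split)
next
  case (Suc D)
  define G where "G = ?g D"
  have g: "G Ans = st Ans" "G (Cnt i d) = st (Cnt i d)" "G (Cnt (Suc i) D) = st (Cnt (Suc i) D)" for d
    by (auto simp: G_def)
  have s: "?g (Suc D) = G(Cnt (Suc i) D := (st (Cnt (Suc i) D) \<noteq>
     (if st Ans then D \<noteq> K \<and> st (Cnt i (Suc D)) else D \<noteq> 0 \<and> st (Cnt i (D - 1)))))"
    by (rule ext) (auto split: var.split simp: less_Suc_eq G_def)
  show ?case unfolding row.simps exec_append Suc s G_def[symmetric]
    using g by (cases "D = 0"; cases "D = K"; cases "st Ans") (auto simp: fun_eq_iff)
qed

lemma exec_letter_part:
  assumes i: "i < length x" "length x \<le> 2 ^ a" and st: "\<And>j. \<not> st (Ad j)" "\<not> st Ans"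
  shows "exec Ans (vreads x a) (letter_part K a i) st = (\<lambda>v. case v of Cnt i' d \<Rightarrow> st v \<noteq> (i' = Suc i \<and> d \<le> K \<and>
     (if x ! i then d \<noteq> K \<and> st (Cnt i (Suc d)) else d \<noteq> 0 \<and> st (Cnt i (d - 1)))) | _ \<Rightarrow> st v)" (is "_ = ?g")
proof -
  have ad: "exec Ans (vreads x a) (address a i) s = (\<lambda>v. s v \<noteq> (\<exists>j < a. bit i j \<and> v = Ad j))" for s
    unfolding address_def by (subst exec_address) (auto simp: fun_eq_iff)
  have rd: "vreads x a s = x ! i" if "\<And>j. s (Ad j) = (j < a \<and> bit i j)" for s
  proof -
    have "low a s = horner_sum of_bool 2 (map (bit i) [0..<a])"
      unfolding horner_sum_eq_sum low_def by (intro sum.cong) (auto simp: that atLeast0LessThan)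
    also have "\<dots> = take_bit a i" by (rule horner_sum_bit_eq_take_bit)
    also have "\<dots> = i" using i by (intro take_bit_nat_eq_self) simp
    finally show ?thesis using i by (simp add: vreads_def)
  qed
  define s1 where "s1 = (\<lambda>v. st v \<noteq> (\<exists>j < a. bit i j \<and> v = Ad j))"
  define s2 where "s2 = s1(Ans := x ! i)"
  define s3 where "s3 = exec Ans (vreads x a) (row K i (Suc K)) s2"
  have 1: "s1 (Ad j) = (j < a \<and> bit i j)" "\<not> s1 Ans" "s1 (Cnt i' d) = st (Cnt i' d)" for j i' d
    using st by (auto simp: s1_def)
  have 3: "s3 (Ad j) = (j < a \<and> bit i j)" "s3 Ans = x ! i" for j
    using 1 unfolding s3_def exec_row by (simp_all add: s2_def)
  have "exec Ans (vreads x a) (letter_part K a i) st = (\<lambda>v. (s3(Ans := False)) v \<noteq> (\<exists>j < a. bit i j \<and> v = Ad j))"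
    unfolding letter_part_def exec_append ad s1_def[symmetric]
    by (simp add: rd[of s1, OF 1(1)] 1(2) s2_def[symmetric] s3_def[symmetric] rd[of s3, OF 3(1)] 3(2) del: row.simps)
  also have "\<dots> = ?g"
  proof
    fix v
    show "((s3(Ans := False)) v \<noteq> (\<exists>j < a. bit i j \<and> v = Ad j)) = ?g v"
      unfolding s3_def exec_row using st by (cases v) (auto simp: s2_def s1_def)
  qed
  finally show ?thesis .
qed

lemma balance_take_Suc: "i < length x \<Longrightarrow> balance (take (Suc i) x) = balance (take i x) + (if x ! i then - 1 else 1)"
  by (simp add: take_Suc_conv_app_nth balance_def)

lemma exec_scan:
  fixes x :: "bool list" and K :: nat
  assumes "length x \<le> 2 ^ a" "i \<le> length x"
  defines "s \<equiv> exec Ans (vreads x a) (scan K a i) (\<lambda>_. False)"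
  shows "(\<forall>j. \<not> s (Ad j)) \<and> \<not> s Ans \<and> (\<forall>i' > i. \<forall>d. \<not> s (Cnt i' d)) \<and>
    (\<forall>d \<le> K. s (Cnt i d) = ((\<forall>i' \<le> i. 0 \<le> balance (take i' x) \<and> balance (take i' x) \<le> int K) \<and> balance (take i x) = int d))"
  using assms(2) unfolding s_def
proof (induction i)
  case 0
  then show ?case by (auto simp: balance_def)
next
  case (Suc i)
  define s where "s = exec Ans (vreads x a) (scan K a i) (\<lambda>_. False)"
  define g where "g = (\<lambda>i. \<forall>i' \<le> i. 0 \<le> balance (take i' x) \<and> balance (take i' x) \<le> int K)"
  have IH: "\<And>j. \<not> s (Ad j)" "\<not> s Ans" "\<And>i' d. i < i' \<Longrightarrow> \<not> s (Cnt i' d)"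
    "\<And>d. d \<le> K \<Longrightarrow> s (Cnt i d) = (g i \<and> balance (take i x) = int d)"
    using Suc unfolding s_def g_def by auto
  have i: "i < length x" using Suc by simp
  have e: "exec Ans (vreads x a) (scan K a (Suc i)) (\<lambda>_. False) = (\<lambda>v. case v of Cnt i' d \<Rightarrow> s v \<noteq> (i' = Suc i \<and> d \<le> K \<and>
     (if x ! i then d \<noteq> K \<and> s (Cnt i (Suc d)) else d \<noteq> 0 \<and> s (Cnt i (d - 1)))) | _ \<Rightarrow> s v)"
    using exec_letter_part[OF i assms(1) IH(1,2), of K] by (simp add: s_def)
  have gS: "g (Suc i) \<longleftrightarrow> g i \<and> 0 \<le> balance (take (Suc i) x) \<and> balance (take (Suc i) x) \<le> int K"
    unfolding g_def le_Suc_eq by auto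
  have gi: "g i \<Longrightarrow> 0 \<le> balance (take i x) \<and> balance (take i x) \<le> int K" by (simp add: g_def)
  have c: "(if x ! i then d \<noteq> K \<and> s (Cnt i (Suc d)) else d \<noteq> 0 \<and> s (Cnt i (d - 1))) =
      (g (Suc i) \<and> balance (take (Suc i) x) = int d)" if d: "d \<le> K" for d
  proof (cases "x ! i")
    case True
    have "s (Cnt i (Suc d)) = (g i \<and> balance (take i x) = int (Suc d))" if "d \<noteq> K" using IH(4)[of "Suc d"] d that by simp
    then show ?thesis using True gS gi d unfolding balance_take_Suc[OF i] by auto
  next
    case False
    have "s (Cnt i (d - 1)) = (g i \<and> balance (take i x) = int (d - 1))" using IH(4)[of "d - 1"] d by simp
    then show ?thesis using False gS gi d unfolding balance_take_Suc[OF i] by auto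
  qed
  have "(\<forall>i' \<le> Suc i. 0 \<le> balance (take i' x) \<and> balance (take i' x) \<le> int K) = g (Suc i)" by (simp add: g_def)
  then show ?case unfolding e using IH c by simp
qed

lemma dyck_take: "dyck k x \<longleftrightarrow> balance x = 0 \<and> (\<forall>i \<le> length x. 0 \<le> balance (take i x) \<and> balance (take i x) \<le> int k)"
proof -
  have "(\<forall>p. prefix p x \<longrightarrow> P p) \<longleftrightarrow> (\<forall>i \<le> length x. P (take i x))" for P
    by (metis append_eq_conv_conj prefixE prefix_length_le take_is_prefix)
  then show ?thesis unfolding dyck_def by simp
qed

text \<open>Keeps the number of counters per letter linear in the input length, however large
  \<open>k\<close> is.\<close>

lemma dyck_min: "dyck (min k (length x)) x = dyck k x"
proof -
  have b: "balance (take i x) \<le> int (length x)" for i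
    using count_le_length[of "take i x" False] by (simp add: balance_def)
  have "balance (take i x) \<le> int k" if "\<not> k \<le> length x" for i using b[of i] that by linarith
  then show ?thesis using b by (cases "k \<le> length x") (simp_all add: dyck_take min_def)
qed

text \<open>Serves for small \<open>n\<close> and for depths above
  \<open>3 * ceillog2 n\<close>.\<close>

theorem classical_algorithm:
  assumes n: "1 \<le> n" and e: "0 \<le> \<epsilon>" and c: "size_ok c n 11 1"
  shows "\<exists>A. is_query_algorithm c n A \<and> computes_with_error A n (dyck k) \<epsilon> \<and> queries A \<le> 9 * n\<^sup>2 \<and> running_time A \<le> 9 * n\<^sup>2"
proof -
  define a where "a = ceillog2 n"
  define K where "K = min k n"
  define P where "P = scan K a n"
  define V where "V = pvars Ans P \<union> {Ans, Cnt n 0}"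
  define m where "m = Suc (Max (enc a ` V))"
  have m: "enc a v < m" if "v \<in> V" for v
    using that unfolding m_def by (intro le_imp_less_Suc Max_ge) (auto simp: V_def)
  have ok: "cl_ok (mp (enc a) P)" unfolding cl_ok_map[OF inj_enc] P_def by (rule scan_ok)
  have pv: "pvars (enc a Ans) (mp (enc a) P) \<subseteq> {..<m}" unfolding image_sets using m by (auto simp: V_def)
  note co = cops_ok[OF ok pv]
  have a: "a \<le> n" unfolding a_def by (subst ceillog2_le_iff) (use n in auto)
  have "length (cops (mp (enc a) P)) \<le> length P" using length_cops[of "mp (enc a) P"] by (simp add: mp_def)
  also have "\<dots> \<le> 1 + n * (2 * a + 4 + 2 * K)" unfolding P_def by (rule length_scan)
  also have "\<dots> \<le> 1 + n * (2 * n + 4 + 2 * n)" using a by (intro add_left_mono mult_le_mono) (auto simp: K_def)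
  also have "\<dots> \<le> 9 * n\<^sup>2"
    using n by (cases n) (simp_all add: power2_eq_square algebra_simps)
  finally have len: "length (cops (mp (enc a) P)) \<le> 9 * n\<^sup>2" .
  have "\<exists>A. is_query_algorithm c n A \<and> computes_with_error A n (dyck k) \<epsilon> \<and> queries A \<le> length (cops (mp (enc a) P)) \<and>
      running_time A \<le> length (cops (mp (enc a) P))"
  proof (rule algorithm_of_ops[where m = m and out = "enc a (Cnt n 0)"])
    show "time_le 11 1 (cops (mp (enc a) P)) (length (cops (mp (enc a) P)))"
      by (rule time_le_singles) (use co in auto)
    show "\<forall>g \<in> set (cops (mp (enc a) P)). wf_op m g" using co by blast
    show "size_ok c n 11 1" by (rule c)
    have "enc a Ans < m" by (rule m) (simp add: V_def)
    then show "ceillog2 n < m" by (simp add: a_def)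
    show "enc a (Cnt n 0) < m" by (rule m) (simp add: V_def)
    fix x :: "bool list" assume x: "length x = n"
    obtain b' where b': "run x (cops (mp (enc a) P)) (ket 0) = ket b'"
      "bit b' = exec (ceillog2 (length x)) (reads x) (mp (enc a) P) (bit (0 :: nat))" using run_cops[OF ok, of x 0] by blast
    have ax: "ceillog2 (length x) = enc a Ans" using x by (simp add: a_def)
    have "bit b' (enc a (Cnt n 0)) = (exec (enc a Ans) (reads x) (mp (enc a) P) (bit (0 :: nat)) \<circ> enc a) (Cnt n 0)"
      using b'(2) ax by simp
    also have "exec (enc a Ans) (reads x) (mp (enc a) P) (bit (0 :: nat)) \<circ> enc a = exec Ans (vreads x a) P (bit (0 :: nat) \<circ> enc a)"
      by (rule exec_map[OF inj_enc]) (rule reads_enc, simp add: a_def x)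
    also have "(bit (0 :: nat) \<circ> enc a) = (\<lambda>_. False)" by auto
    also have "exec Ans (vreads x a) P (\<lambda>_. False) (Cnt n 0) = dyck K x"
      using exec_scan[of x a n K] x le_two_power_ceillog2[of n] unfolding P_def dyck_take by (auto simp: a_def)
    also have "\<dots> = dyck k x" using dyck_min[of k x] x by (simp add: K_def)
    finally have "(if bit b (enc a (Cnt n 0)) = (\<not> dyck k x) then run x (cops (mp (enc a) P)) (ket 0) b else 0) = 0" for b
      unfolding b'(1) by (auto simp: ket_def)
    then show "norm2 m (\<lambda>b. if bit b (enc a (Cnt n 0)) = (\<not> dyck k x) then run x (cops (mp (enc a) P)) (ket 0) b else 0) \<le> \<epsilon>"
      using e by (simp add: norm2_def)
  qed
  then show ?thesis using len by (meson order_trans)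
qed

section \<open>The quantum algorithm\<close>

lemma mp_facts:
  "Qry \<in> set (mp e P) \<longleftrightarrow> Qry \<in> set P"
  "(\<forall>i \<in> set (mp e P). length (controls i) \<le> 6) \<longleftrightarrow> (\<forall>i \<in> set P. length (controls i) \<le> 6)"
  "length (mp e P) = length P"
  by (induction P rule: chvars.induct) auto

lemma time_le_piece:
  assumes "Qry \<notin> set P" "\<forall>i \<in> set P. length (controls i) \<le> 6" "card (pvars an P) + 4 \<le> B" "4 * length P \<le> l"
  shows "time_le B l (bwo pl act rt sg f (mp e P)) 1"
proof (rule time_le_bwo[where an = "e an"])
  show "card (pvars (e an) (mp e P)) + 4 \<le> B"
    unfolding image_sets using card_image_le[of "pvars an P" e] assms(3) by simp
qed (use assms in \<open>simp_all only: mp_facts not_False_eq_True\<close>)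

lemma cell_simple:
  "Qry \<notin> set (cell k i j)" "\<forall>s \<in> set (cell k i j). length (controls s) \<le> 6" "length (cell k i j) \<le> 4 * k + 70"
proof -
  note d = cell_def jump_part_def range_choices_def range_moves_def final_part_def sel_def
  show "Qry \<notin> set (cell k i j)" by (auto simp: d)
  show "\<forall>s \<in> set (cell k i j). length (controls s) \<le> 6" by (auto simp: d)
  show "length (cell k i j) \<le> 4 * k + 70" by (simp add: d)
qed

lemma cells_simple:
  "Qry \<notin> set (cells k i j)" "\<forall>s \<in> set (cells k i j). length (controls s) \<le> 6" "length (cells k i j) \<le> j * (4 * k + 70)"
proof -
  have "Qry \<notin> set (cells k i j) \<and> (\<forall>s \<in> set (cells k i j). length (controls s) \<le> 6) \<and> length (cells k i j) \<le> j * (4 * k + 70)"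
  proof (induction j)
    case (Suc j)
    show ?case
    proof (cases "i = 0")
      case False
      then have c: "cells k i (Suc j) = cell k i (Suc j) @ cells k i j" by simp
      show ?thesis unfolding c length_append set_append
        using Suc cell_simple[where k = k and i = i and j = "Suc j"] by (auto simp: ball_Un)
    qed simp
  qed simp
  then show "Qry \<notin> set (cells k i j)" "\<forall>s \<in> set (cells k i j). length (controls s) \<le> 6"
    "length (cells k i j) \<le> j * (4 * k + 70)" by simp_all
qed

lemma card_cells:
  assumes "1 \<le> i" "i \<le> k + 1"
  shows "card (pvars Ans (cells k i j)) \<le> 79 * j + 3 * (k + 2)"
proof -
  define xs where "xs = (\<lambda>j'. [W i (j' - 1) 0, W i (j' - 1) 1, jl i j', jl (i - 1) j', Rho i, Ad (j' - 1), Sg, Pl, Lv])"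
  define A where "A = (\<lambda>j'. (\<lambda>r. W i j' r) ` {..<70} \<union> set (xs j'))"
  define C where "C = Cnt i ` {..<k + 2} \<union> Cnt (i - 1) ` {..<k + 2} \<union> Cm i ` {..<k + 2}"
  have cv: "cvars k i j' = A j' \<union> C" for j' unfolding cvars_def A_def C_def xs_def by simp
  have A: "card (A j') \<le> 79" for j'
  proof -
    have "card (A j') \<le> card ((\<lambda>r. W i j' r) ` {..<70}) + card (set (xs j'))" unfolding A_def by (rule card_Un_le)
    also have "\<dots> \<le> 70 + 9" using card_image_le[of "{..<70}" "\<lambda>r. W i j' r"] card_length[of "xs j'"]
      by (intro add_mono) (simp_all add: xs_def)
    finally show ?thesis by simp
  qed
  have C: "card C \<le> 3 * (k + 2)"
  proof -
    have 1: "card (g ` {..<k + 2}) \<le> k + 2" for g :: "nat \<Rightarrow> var" using card_image_le[of "{..<k + 2}" g] by simp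
    have 2: "card (X \<union> Y \<union> Z) \<le> 3 * r" if "card X \<le> r" "card Y \<le> r" "card Z \<le> r" for X Y Z :: "var set" and r
      using card_Un_le[of "X \<union> Y" Z] card_Un_le[of X Y] that by linarith
    show ?thesis unfolding C_def by (intro 2 1)
  qed
  have "(\<Union>j' \<in> {1..j}. cvars k i j') \<subseteq> (\<Union>j' \<in> {1..j}. A j') \<union> C" unfolding cv by blast
  then have "pvars Ans (cells k i j) \<subseteq> (\<Union>j' \<in> {1..j}. A j') \<union> C" using cells_wf(3)[OF assms, of j] by (rule subset_trans[rotated])
  then have "card (pvars Ans (cells k i j)) \<le> card ((\<Union>j' \<in> {1..j}. A j') \<union> C)"
    by (rule card_mono[rotated]) (simp add: A_def C_def)
  also have "\<dots> \<le> card (\<Union>j' \<in> {1..j}. A j') + card C" by (rule card_Un_le)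
  also have "card (\<Union>j' \<in> {1..j}. A j') \<le> (\<Sum>j' \<in> {1..j}. card (A j'))" by (rule card_UN_le) simp
  also have "\<dots> \<le> (\<Sum>j' \<in> {1..j}. 79)" by (intro sum_mono A)
  finally show ?thesis using C by simp
qed

lemma compare_simple:
  "Qry \<notin> set (compare a s c)" "\<forall>i \<in> set (compare a s c). length (controls i) \<le> 6" "length (compare a s c) \<le> 1 + 2 * a"
  "card (pvars Ans (compare a s c)) \<le> 2 * a + 1"
proof -
  have "Qry \<notin> set (compare a s c) \<and> (\<forall>i \<in> set (compare a s c). length (controls i) \<le> 6) \<and> length (compare a s c) \<le> 1 + 2 * a"
  proof (induction a)
    case (Suc a)
    then show ?case unfolding compare_Suc length_append set_append by (cases "bit c a") auto
  qed (simp add: compare_def)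
  then show "Qry \<notin> set (compare a s c)" "\<forall>i \<in> set (compare a s c). length (controls i) \<le> 6" "length (compare a s c) \<le> 1 + 2 * a"
    by simp_all
  have "card (pvars Ans (compare a s c)) \<le> card (Le s ` {..a} \<union> Ad ` {..<a})" by (rule card_mono[OF _ compare_wf(3)]) simp
  also have "\<dots> \<le> card (Le s ` {..a}) + card (Ad ` {..<a})" by (rule card_Un_le)
  also have "\<dots> \<le> Suc a + a" using card_image_le[of "{..a}" "Le s"] card_image_le[of "{..<a}" Ad] by (intro add_mono) simp_all
  finally show "card (pvars Ans (compare a s c)) \<le> 2 * a + 1" by simp
qed

lemma time_le_last_part:
  assumes "16 \<le> B" "36 \<le> l"
  shows "time_le B l (bwo pl act rt sg f (mp e (last_part a))) 2"
proof -
  define P where "P = tl (last_part a)"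
  have l: "last_part a = Qry # P" by (simp add: P_def last_part_def leaf_part_def)
  let ?V = "[Ans, Lv, Pl, Sg, W 1 0 0, W 1 0 1, W 0 0 2, Cnt 0 0, Ad a, Ad (Suc a), Le False a, Le True a]"
  have "pvars Ans P \<subseteq> set ?V" using last_part_wf(3)[of a] unfolding l by simp
  then have "card (pvars Ans P) \<le> card (set ?V)" by (rule card_mono[rotated]) simp
  also have "\<dots> \<le> 12" by (rule order_trans[OF card_length]) simp
  finally have "card (pvars Ans P) \<le> 12" .
  then have "time_le B l (bwo pl act rt sg f (mp e P)) 1"
    using assms by (intro time_le_piece[where an = Ans]) (simp_all add: P_def last_part_def leaf_part_def)
  from time_le_append[OF this time_le_Q] show ?thesis unfolding l by (simp add: numeral_2_eq_2)
qed

text \<open>A plane counts as one step: all its cells together touch at most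
  \<open>79 * (a + 2) + 3 * (k + 2)\<close> variables, which is logarithmic in \<open>n\<close>
  because \<open>k \<le> 3 * a\<close>. This is the origin of \<open>B\<close>; \<open>l\<close>
  bounds the operations in the same way.\<close>

lemma time_le_planes:
  assumes "i \<le> k + 1" "k \<le> 3 * a" "B = 88 * a + 170" "l = 4 * (a + 2) * (12 * a + 70)"
  shows "time_le B l (bwo pl act rt sg f (mp e (planes n k a i))) (i + 4)"
  using assms(1)
proof (induction i arbitrary: f)
  case 0
  have pl: "planes n k a 0 = compare a False (k - 1) @ (compare a True (n - 1) @ last_part a)"
    unfolding planes.simps fin_part_def last_part_def append_assoc ..
  have c: "time_le B l (bwo pl act rt sg f (mp e (compare a s c))) 1" for s c f
    by (rule time_le_piece[where an = Ans])
      (use compare_simple[where a = a and s = s and c = c] assms(3,4) in \<open>simp_all add: algebra_simps\<close>)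
  have lp: "time_le B l (bwo pl act rt sg f (mp e (last_part a))) 2" for f
    by (rule time_le_last_part) (use assms(3,4) in \<open>simp_all add: algebra_simps\<close>)
  have "time_le B l (bwo pl act rt sg f (mp e (planes n k a 0))) (2 + 1 + 1)"
    unfolding pl mp_simps by (intro time_le_bwo_append c lp)
  then show ?case by simp
next
  case (Suc i)
  have c: "time_le B l (bwo pl act rt sg f (mp e (cells k (Suc i) (a + 2)))) 1" for f
  proof (rule time_le_piece[where an = Ans])
    show "card (pvars Ans (cells k (Suc i) (a + 2))) + 4 \<le> B"
      using card_cells[of "Suc i" k "a + 2"] Suc(2) assms(2,3) by simp
    have "4 * length (cells k (Suc i) (a + 2)) \<le> 4 * ((a + 2) * (4 * k + 70))"
      using cells_simple(3)[of k "Suc i" "a + 2"] by simp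
    also have "\<dots> \<le> 4 * ((a + 2) * (12 * a + 70))" using assms(2) by (intro mult_le_mono) auto
    finally show "4 * length (cells k (Suc i) (a + 2)) \<le> l" unfolding assms(4) mult.assoc .
  qed (rule cells_simple)+
  have "time_le B l (bwo pl act rt sg f (mp e (planes n k a (Suc i)))) ((i + 4) + 1)"
    unfolding planes.simps mp_simps by (intro time_le_bwo_append c Suc) (use Suc(2) in simp)
  then show ?case by simp
qed

lemma dyck_prog_controls: "\<forall>s \<in> set (dyck_prog n k a). length (controls s) \<le> 6"
proof -
  have "\<forall>s \<in> set (planes n k a i). length (controls s) \<le> 6" for i
  proof (induction i)
    case 0
    show ?case unfolding planes.simps fin_part_def set_append ball_Un using compare_simple(2) by (simp add: leaf_part_def)
  next
    case (Suc i)
    then show ?case unfolding planes.simps set_append ball_Un using cells_simple(2) by blast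
  qed
  from this[of "k + 1"] show ?thesis unfolding dyck_prog_def by (simp del: planes.simps)
qed

lemma Aux_dyck_prog: "Aux q \<notin> pvars Ans (dyck_prog n k a)"
proof -
  have "Aux q \<notin> pvars Ans (planes n k a i)" if "i \<le> k + 1" for i
    using that
  proof (induction i)
    case 0
    have "Aux q \<notin> Le s ` {..a} \<union> Ad ` {..<a}" for s by auto
    then have "Aux q \<notin> pvars Ans (compare a s c)" for s c using compare_wf(3)[of a s c] by blast
    then show ?case using last_part_wf(3)[of a] by (auto simp: fin_part_def last_part_def)
  next
    case (Suc i)
    have "Aux q \<notin> cvars k (Suc i) j" for j by (auto simp: cvars_def jl_def)
    then have "Aux q \<notin> pvars Ans (cells k (Suc i) (a + 2))" using cells_wf(3)[of "Suc i" k "a + 2"] Suc(2) by auto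
    then show ?case using Suc by (simp del: cells.simps)
  qed
  from this[of "k + 1"] show ?thesis unfolding dyck_prog_def by (simp del: planes.simps)
qed

text \<open>Tests whether all clocks are zero: each pair consists of a clock and a fresh qubit.\<close>

fun chain :: "nat \<Rightarrow> (nat \<times> nat) list \<Rightarrow> op list" where
  "chain g [] = [R ([], g, pi / 2)]"
| "chain g ((w, h) # ps) = R ([(g, True), (w, False)], h, pi / 2) # chain h ps"

fun chain_end :: "nat \<Rightarrow> (nat \<times> nat) list \<Rightarrow> nat" where
  "chain_end g [] = g"
| "chain_end g ((w, h) # ps) = chain_end h ps"

lemma length_chain [simp]: "length (chain g ps) = Suc (length ps)"
  by (induction g ps rule: chain.induct) auto

lemma chain_end: "chain_end g ps \<in> set (g # map snd ps)"
  by (induction g ps rule: chain.induct) auto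

lemma chain_ops:
  assumes "distinct (g # map snd ps)" "set (map fst ps) \<inter> set (g # map snd ps) = {}" "set (g # map fst ps @ map snd ps) \<subseteq> {..<m}"
  shows "\<forall>o' \<in> set (chain g ps). wf_op m o' \<and> (\<exists>ls q \<theta>. o' = R (ls, q, \<theta>) \<and> length ls \<le> 10)"
  using assms
proof (induction g ps rule: chain.induct)
  case (1 g)
  then show ?case by (auto simp: wf_refl_def intro!: exI[of _ "pi / 2"])
next
  case (2 g w h ps)
  have "wf_op m (R ([(g, True), (w, False)], h, pi / 2))" using 2(2-4) by (auto simp: wf_refl_def)
  moreover have "\<exists>ls q \<theta>. R ([(g, True), (w, False)], h, pi / 2) = R (ls, q, \<theta>) \<and> length ls \<le> 10" by (intro exI conjI, rule refl) simp
  moreover have "\<forall>o' \<in> set (chain h ps). wf_op m o' \<and> (\<exists>ls q \<theta>. o' = R (ls, q, \<theta>) \<and> length ls \<le> 10)"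
    by (rule "2.IH") (use 2(2-4) in auto)
  ultimately show ?case by simp
qed

text \<open>Each \<open>h\<close> receives the conjunction up to its clock. The NOT at the end is
  there because clocks at zero indicate that the word is not a Dyck word.\<close>

lemma chain_supp:
  assumes "supp (\<lambda>b. (\<forall>h \<in> set (map snd ps). \<not> bit b h) \<and> ((bit b g \<and> (\<forall>w \<in> set (map fst ps). \<not> bit b w)) = v)) \<psi>"
    "distinct (g # map snd ps)" "set (map fst ps) \<inter> set (g # map snd ps) = {}"
  shows "supp (\<lambda>b. bit b (chain_end g ps) = (\<not> v)) (run x (chain g ps) \<psi>)"
  using assms
proof (induction g ps arbitrary: \<psi> rule: chain.induct)
  case (1 g)
  show ?case unfolding supp_def
  proof (intro allI impI)
    fix b assume "run x (chain g []) \<psi> b \<noteq> 0"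
    then have "\<psi> (flip_bit g b) \<noteq> 0" by (simp add: cr_not asg_def)
    then have "bit (flip_bit g b) g = v" using 1 unfolding supp_def by fastforce
    then show "bit b (chain_end g []) = (\<not> v)" by (auto simp: bit_flip)
  qed
next
  case (2 g w h ps)
  let ?S = "\<lambda>b. (\<forall>h \<in> set (map snd ps). \<not> bit b h) \<and> ((bit b h \<and> (\<forall>w \<in> set (map fst ps). \<not> bit b w)) = v)"
  have "supp ?S (\<psi> \<circ> asg [(g, True), (w, False)] h)" unfolding supp_def
  proof (intro allI impI)
    fix b assume nz: "(\<psi> \<circ> asg [(g, True), (w, False)] h) b \<noteq> 0"
    define b' where "b' = asg [(g, True), (w, False)] h b"
    have s: "\<forall>h' \<in> set (h # map snd ps). \<not> bit b' h'" "(bit b' g \<and> (\<forall>w' \<in> set (w # map fst ps). \<not> bit b' w')) = v"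
      using 2(2) nz unfolding supp_def b'_def by auto
    have e: "bit b' v = bit b v" if "v \<noteq> h" for v using that by (simp add: b'_def bit_asg)
    have h: "bit b' h = (bit b h \<noteq> (bit b g \<and> \<not> bit b w))" by (simp add: b'_def bit_asg)
    have ne: "g \<noteq> h" "w \<noteq> h" "\<And>v. v \<in> set (map snd ps) \<Longrightarrow> v \<noteq> h" "\<And>v. v \<in> set (map fst ps) \<Longrightarrow> v \<noteq> h"
      using 2(3,4) by auto
    have "\<forall>h' \<in> set (map snd ps). \<not> bit b h'" using s(1) e ne(3) by auto
    moreover have "(\<forall>w' \<in> set (map fst ps). \<not> bit b' w') = (\<forall>w' \<in> set (map fst ps). \<not> bit b w')" using e ne(4) by blast
    moreover have "bit b h = (bit b g \<and> \<not> bit b w)" using h s(1) by simp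
    moreover have "bit b' g = bit b g" "bit b' w = bit b w" using e ne(1,2) by blast+
    ultimately show "?S b" using s(2) by (simp only: list.set ball_simps insert_iff) blast
  qed
  then have "supp (\<lambda>b. bit b (chain_end h ps) = (\<not> v)) (run x (chain h ps) (\<psi> \<circ> asg [(g, True), (w, False)] h))"
    by (rule "2.IH") (use 2(3,4) in auto)
  then show ?case by (simp add: cr_not)
qed

lemma run_not_ket: "run x [R ([], q, pi / 2)] (ket b) = ket (flip_bit q b)"
proof -
  have "(ket b \<circ> asg [] q) b' = ket (flip_bit q b) b'" for b'
  proof -
    have "flip_bit q b' = b \<longleftrightarrow> b' = flip_bit q b" by (metis flip_flip)
    then show ?thesis by (simp add: asg_def ket_def)
  qed
  then show ?thesis by (simp add: cr_not fun_eq_iff)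
qed

theorem quantum_algorithm:
  fixes n k C :: nat and t \<epsilon> :: real
  assumes n: "1 \<le> n" and k: "1 \<le> k" "k \<le> 3 * ceillog2 n" "k \<le> 2 ^ ceillog2 n"
    and t: "sin t \<noteq> 0" "cos t \<noteq> 0"
    and err: "(sin t)\<^sup>2 / (cos t)\<^sup>2 * ecost (k + 1) (ceillog2 n + 2) \<le> \<epsilon>"
      "ecost (k + 1) (ceillog2 n + 2) / ((sin t)\<^sup>2 * (2 ^ C)\<^sup>2) \<le> \<epsilon>"
    and c: "size_ok c n (88 * ceillog2 n + 170) (4 * (ceillog2 n + 2) * (12 * ceillog2 n + 70))"
  shows "\<exists>A. is_query_algorithm c n A \<and> computes_with_error A n (dyck k) \<epsilon> \<and>
    queries A \<le> 2 ^ C * (2 * k + 23) \<and> running_time A \<le> 2 ^ C * (2 * k + 23)"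
proof -
  define a B l c0 where "a = ceillog2 n" and "B = 88 * a + 170" and "l = 4 * (a + 2) * (12 * a + 70)" and "c0 = ecost (k + 1) (a + 2)"
  define e where "e = enc a"
  have e: "inj e" "e Ans = a" by (simp_all add: e_def inj_enc)
  note ee = inj_eq[OF e(1)]
  define P where "P = mp e (dyck_prog n k a)"
  \<comment> \<open>\<open>Aux\<close> 0 to 2 control the walk, 3 starts the chain, and from 4 on
    even numbers are clocks and odd ones belong to the chain.\<close>
  define Vs where "Vs = pvars Ans (dyck_prog n k a) \<union> {Ans, Pl, Lv} \<union> Aux ` {..<2 * C + 6}"
  define m where "m = Suc (Max (e ` Vs))"
  have m: "e v < m" if "v \<in> Vs" for v
    using that unfolding m_def by (intro le_imp_less_Suc Max_ge) (auto simp: Vs_def)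
  have mA: "e (Aux q) < m" if "q < 2 * C + 6" for q by (rule m) (use that in \<open>simp add: Vs_def\<close>)
  have m3: "e Ans < m" "e Pl < m" "e Lv < m" by (rule m, simp add: Vs_def)+
  define f act rt g ws hs where "f = e (Aux 0)" and "act = e (Aux 1)" and "rt = e (Aux 2)" and "g = e (Aux 3)"
    and "ws = map (\<lambda>i. e (Aux (4 + 2 * i))) [0..<C]" and "hs = map (\<lambda>i. e (Aux (5 + 2 * i))) [0..<C]"
  define ps where "ps = zip ws hs"
  have ps: "map fst ps = ws" "map snd ps = hs" "length ps = C" by (simp_all add: ps_def ws_def hs_def)
  have ws_iff: "v \<in> set ws \<longleftrightarrow> (\<exists>i < C. v = e (Aux (4 + 2 * i)))" and hs_iff: "v \<in> set hs \<longleftrightarrow> (\<exists>i < C. v = e (Aux (5 + 2 * i)))" for v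
    by (auto simp: ws_def hs_def)
  have par: "4 + 2 * i \<noteq> 5 + 2 * (j :: nat)" for i j by presburger
  have d: "distinct ws" "distinct (g # hs)" "set ws \<inter> set (g # hs) = {}"
  proof -
    show "distinct ws" "distinct (g # hs)" by (auto simp: ws_def hs_def g_def distinct_map inj_on_def ee)
    have "v \<notin> set (g # hs)" if "v \<in> set ws" for v
      using that par unfolding list.set insert_iff ws_iff hs_iff g_def by (auto simp: ee)
    then show "set ws \<inter> set (g # hs) = {}" by blast
  qed
  have sm: "set (g # ws @ hs) \<subseteq> {..<m}"
  proof -
    have "v < m" if "v \<in> set (g # ws @ hs)" for v
      using that mA unfolding list.set set_append insert_iff Un_iff ws_iff hs_iff g_def by auto
    then show ?thesis by blast
  qed
  have pv: "pvars a P = e ` pvars Ans (dyck_prog n k a)" unfolding P_def e(2)[symmetric] image_sets ..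
  have fits: "fits m P" by (rule fits_pvars[of a]) (use m pv in \<open>auto simp: Vs_def\<close>)
  have wfP: "wf_prog (e Pl) a (e ` XA) P"
    using wf_prog_map[OF e(1) dyck_prog_wf, of n k a] unfolding P_def e(2) .
  have noaux: "e (Aux q) \<notin> pvars a P" for q unfolding pv using Aux_dyck_prog ee by (auto simp: image_iff)
  have ctl: "\<forall>i \<in> set P. length (controls i) \<le> 6" unfolding P_def mp_facts(2) by (rule dyck_prog_controls)
  have W: "walk m a x (e Pl) (e Lv) act rt f (e ` XA) P" if x: "length x = n" for x
  proof
    show "a = ceillog2 (length x)" "a < m" using m3 e(2) x by (simp_all add: a_def)
    show "{f, act, rt} \<subseteq> e ` XA" "e Pl \<notin> e ` XA" by (auto simp: XA_def f_def act_def rt_def ee)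
    show "f < m" "act < m" "rt < m" by (simp_all add: f_def act_def rt_def mA)
  qed (use wfP fits m3 in \<open>simp_all add: f_def act_def rt_def ee\<close>)
  define D where "D = walk.detect (e Pl) (e Lv) act rt f P t 1 ws"
  define I where "I = [R ([], g, pi / 2)] @ [R ([], act, pi / 2)] @ [R ([], rt, pi / 2)]"
  define L where "L = I @ D @ chain g ps"
  have len: "n \<le> 2 ^ a" unfolding a_def by (rule le_two_power_ceillog2)
  have clk: "walk.clock m a (e Pl) (e Lv) act rt f P t w" if x: "length x = n" and w: "w \<in> set ws" for x :: "bool list" and w
  proof -
    interpret walk m a x "e Pl" "e Lv" act rt f "e ` XA" P t by (rule W[OF x])
    obtain i where i: "i < C" "w = e (Aux (4 + 2 * i))" using w ws_iff by blast
    have "a < w" unfolding i(2) e_def by (rule enc_gt) simp_all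
    moreover have "w \<notin> {act, rt, e Pl, e Lv, f}" by (simp add: i(2) act_def rt_def f_def ee)
    moreover have "w \<notin> pvars a P" using noaux i(2) by simp
    ultimately have "w \<notin> op_vars a o'" if "o' \<in> set it" for o' using it_vars[OF that ctl] by auto
    moreover have "w < m" "w \<noteq> act" using i mA by (simp_all add: act_def ee)
    ultimately show ?thesis unfolding clock_def by blast
  qed
  have cw: "\<forall>o' \<in> set (chain g ps). wf_op m o' \<and> (\<exists>ls q \<theta>. o' = R (ls, q, \<theta>) \<and> length ls \<le> 10)"
    by (rule chain_ops) (use d sm ps in \<open>simp_all only: map_append\<close>)
  have "time_le B l L (3 + ((4 * length ws + 1 * (2 ^ length ws - 1) * (2 * (k + 6) + 2)) + Suc C))"
    unfolding L_def
  proof (intro time_le_append)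
    have B: "11 \<le> B" "1 \<le> l" by (simp_all add: B_def l_def)
    have "time_le B l I (length I)" by (rule time_le_singles) (use B in \<open>auto simp: I_def intro!: exI[of _ "pi / 2"]\<close>)
    then show "time_le B l I 3" by (simp add: I_def numeral_3_eq_3)
    have "time_le B l (chain g ps) (length (chain g ps))" by (rule time_le_singles) (use B cw in blast)+
    then show "time_le B l (chain g ps) (Suc C)" using ps by simp
    interpret walk m a "replicate n False" "e Pl" "e Lv" act rt f "e ` XA" P t by (rule W) simp
    have "time_le B l (bwo (e Pl) act rt sg f P) (k + 6)" for sg
    proof -
      have "time_le B l (bwo (e Pl) act rt sg f (mp e (planes n k a (k + 1)))) (k + 1 + 4)"
        by (rule time_le_planes) (use k in \<open>simp_all add: B_def l_def a_def\<close>)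
      moreover have "time_le B l [R ([], e (W (k + 1) (a + 2) 0), pi / 2)] 1"
        by (rule time_le_one_step, rule one_step_single) (use B in simp_all)
      ultimately have "time_le B l (bwo (e Pl) act rt sg f (mp e (planes n k a (k + 1))) @ [R ([], e (W (k + 1) (a + 2) 0), pi / 2)]) (k + 1 + 4 + 1)"
        by (rule time_le_append)
      then show ?thesis unfolding P_def dyck_prog_def mp_simps bwo.simps by (simp add: eval_nat_numeral)
    qed
    from time_le_detect[OF time_le_it[OF this B] B, of 1 ws]
    show "time_le B l D (4 * length ws + 1 * (2 ^ length ws - 1) * (2 * (k + 6) + 2))" unfolding D_def .
  qed
  moreover have "3 + ((4 * length ws + 1 * (2 ^ length ws - 1) * (2 * (k + 6) + 2)) + Suc C) \<le> 2 ^ C * (2 * k + 23)"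
  proof -
    have lw: "length ws = C" by (simp add: ws_def)
    obtain q where q: "(2 :: nat) ^ C = Suc q" using not0_implies_Suc[of "2 ^ C"] by auto
    have "C < 2 ^ C" by (rule less_exp)
    \<comment> \<open>The term \<open>5 * C\<close> is paid for by \<open>5 * q\<close>, where
      \<open>q\<close> is the number of iterations.\<close>
    then show ?thesis unfolding lw q by (simp add: algebra_simps)
  qed
  ultimately have time: "time_le B l L (2 ^ C * (2 * k + 23))" by (rule time_le_mono)
  have wD: "\<forall>o' \<in> set D. wf_op m o'"
  proof -
    interpret walk m a "replicate n False" "e Pl" "e Lv" act rt f "e ` XA" P t by (rule W) simp
    have "\<forall>w \<in> set ws. clock w" using clk[of "replicate n False"] by simp
    then show ?thesis unfolding D_def by (rule detect_wf)
  qed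
  show ?thesis
  proof (rule algorithm_of_ops[OF time, where m = m and out = "chain_end g ps"])
    show "size_ok c n B l" using c unfolding B_def l_def a_def .
    show "ceillog2 n < m" using m3 e(2) unfolding a_def by simp
    have "chain_end g ps \<in> set (g # ws @ hs)" using chain_end[of g ps] unfolding ps by auto
    then show "chain_end g ps < m" using sm by blast
    have wI: "\<forall>o' \<in> set I. wf_op m o'" using mA by (auto simp: I_def wf_refl_def g_def act_def rt_def)
    show "\<forall>o' \<in> set L. wf_op m o'" using wI cw wD unfolding L_def by auto
    fix x :: "bool list" assume x: "length x = n"
    interpret walk m a x "e Pl" "e Lv" act rt f "e ` XA" P t by (rule W[OF x])
    define b where "b = flip_bit act (flip_bit g (0 :: nat))"
    define \<Psi> where "\<Psi> = run x (detect 1 ws) (ket (flip_bit rt b))"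
    have bb: "bit b v \<longleftrightarrow> v = act \<or> v = g" for v
    proof -
      have "act \<noteq> g" by (simp add: act_def g_def ee)
      then show ?thesis unfolding b_def bit_flip by auto
    qed
    have start: "run x I (ket 0) = ket (flip_bit rt b)" unfolding I_def run_simps(3) run_not_ket b_def ..
    have bm: "b < 2 ^ m" using mA by (simp add: b_def act_def g_def)
    have ev: "ev (e Pl) (e Lv) a (reads x) P (bit b) (\<not> dyck k x) c0"
    proof -
      interpret dyck_text n k a x by unfold_locales (use x k n len in \<open>simp_all add: a_def\<close>)
      have "ev Pl Lv Ans (vreads x a) (dyck_prog n k a) (bit b \<circ> e) (\<not> dyck k x) c0"
        unfolding c0_def
      proof (rule dyck_prog_rel)
        fix v assume "\<And>q. v \<noteq> Aux q"
        then show "\<not> (bit b \<circ> e) v" using bb by (simp add: act_def g_def ee)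
      qed
      from ev_map[OF this refl e(1), of "reads x"] show ?thesis
        unfolding P_def e(2) using reads_enc[of a x] x by (simp add: e_def a_def)
    qed
    have wr: "writes a P \<subseteq> pvars a P" by (rule writes_pvars)
    have ch: "\<not> bit b w" if "w \<in> chvars P" for w
    proof -
      have "w \<in> pvars a P" using that chvars_writes[of P a] wr by blast
      then have "w \<noteq> act" "w \<noteq> g" using noaux[of 1] noaux[of 3] unfolding act_def g_def by metis+
      then show ?thesis using bb by simp
    qed
    have bits: "\<not> bit b f" "bit b act" "\<not> bit b rt" using bb by (auto simp: f_def act_def rt_def g_def ee)
    have wsb: "\<forall>w \<in> set ws. \<not> bit b w \<and> w \<noteq> rt \<and> w \<notin> writes a P"
    proof
      fix w assume "w \<in> set ws"
      then obtain i where i: "w = e (Aux (4 + 2 * i))" using ws_iff by blast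
      then have "w \<notin> writes a P" using wr noaux by blast
      then show "\<not> bit b w \<and> w \<noteq> rt \<and> w \<notin> writes a P" unfolding bb i by (simp add: act_def g_def rt_def ee)
    qed
    have c0: "1 \<le> c0" using ecost_ge(2)[of "k + 1" "a + 2"] by (simp add: c0_def)
    have ck: "\<forall>w \<in> set ws. clock w" using clk[OF x] by blast
    note det = detection[OF bm ch bits ev ck d(1) wsb t c0]
    have lw: "length ws = C" by (simp add: ws_def)
    have detT: "norm2 m (\<lambda>b'. \<Psi> b' - clock0 ws \<Psi> b') \<le> \<epsilon>" if "\<not> dyck k x"
      unfolding \<Psi>_def by (rule order_trans[OF det(1)[OF _ that]], assumption) (rule err(1)[folded a_def, folded c0_def])
    have detF: "norm2 m (clock0 ws \<Psi>) \<le> \<epsilon>" if "dyck k x"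
    proof -
      have "\<not> \<not> dyck k x" using that by simp
      show ?thesis unfolding \<Psi>_def
        by (rule order_trans[OF det(2)[OF _ \<open>\<not> \<not> dyck k x\<close>]], assumption, unfold lw) (rule err(2)[folded a_def, folded c0_def])
    qed
    define S where "S = (\<lambda>b. bit (b :: nat) g \<and> (\<forall>h \<in> set hs. \<not> bit b h))"
    have aux_t: "v \<notin> insert g (set hs)" if "v \<in> set ws \<union> insert act (insert rt (insert (e Lv) (writes a P)))" for v
    proof
      assume "v \<in> insert g (set hs)"
      then have "(\<exists>q. v = e (Aux q)) \<and> v \<notin> set ws \<and> v \<noteq> act \<and> v \<noteq> rt \<and> v \<noteq> e Lv"
        using d(3) unfolding insert_iff hs_iff by (auto simp: g_def act_def rt_def ee hs_iff)
      then show False using that wr noaux by blast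
    qed
    have sS: "supp S \<Psi>" unfolding \<Psi>_def
    proof (rule supp_run)
      fix o' b' assume "o' \<in> set (detect 1 ws)"
      then have "target a o' \<in> set ws \<union> insert act (target a ` set it)" by (rule detect_target)
      moreover have "target a ` set it \<subseteq> insert rt (insert (e Lv) (writes a P))" by (rule image_subsetI) (rule it_target)
      ultimately have "target a o' \<in> set ws \<union> insert act (insert rt (insert (e Lv) (writes a P)))"
        using subsetD[OF Un_mono[OF subset_refl insert_mono]] by metis
      then have "target a o' \<notin> insert g (set hs)" by (rule aux_t)
      then show "S (flip_bit (target a o') b') = S b'" unfolding S_def by (auto simp: bit_flip)
    next
      have "S (flip_bit rt b)" unfolding S_def
        using bb by (auto simp: bit_flip hs_iff g_def rt_def act_def ee)
      then show "supp S (ket (flip_bit rt b))" by (auto simp: supp_def ket_def)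
    qed
    \<comment> \<open>The state is split by whether all clocks are zero. The chain sends the two
      parts to different output values, so each error probability is the squared norm of one
      part.\<close>
    define \<psi>0 where "\<psi>0 = clock0 ws \<Psi>"
    define \<psi>1 where "\<psi>1 = (\<lambda>b'. \<Psi> b' - clock0 ws \<Psi> b')"
    let ?F = "run x (chain g ps)"
    have s: "supp (\<lambda>b. bit b (chain_end g ps) = (\<not> True)) (?F \<psi>0)" "supp (\<lambda>b. bit b (chain_end g ps) = (\<not> False)) (?F \<psi>1)"
    proof (rule_tac[!] chain_supp)
      show "supp (\<lambda>b. (\<forall>h \<in> set (map snd ps). \<not> bit b h) \<and> ((bit b g \<and> (\<forall>w \<in> set (map fst ps). \<not> bit b w)) = True)) \<psi>0"
        using sS unfolding ps supp_def S_def \<psi>0_def clock0_def by auto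
      show "supp (\<lambda>b. (\<forall>h \<in> set (map snd ps). \<not> bit b h) \<and> ((bit b g \<and> (\<forall>w \<in> set (map fst ps). \<not> bit b w)) = False)) \<psi>1"
        using sS unfolding ps supp_def S_def \<psi>1_def clock0_def by (auto split: if_splits)
    qed (use d ps in simp_all)
    have "\<Psi> = (\<lambda>b'. \<psi>0 b' + \<psi>1 b')" by (simp add: \<psi>0_def \<psi>1_def)
    then have sum: "?F \<Psi> = (\<lambda>b'. ?F \<psi>0 b' + ?F \<psi>1 b')" using linop_add[OF linop_run] by simp
    have runL: "run x L (ket 0) = ?F \<Psi>" unfolding L_def run_simps(3) start \<Psi>_def D_def ..
    have nF: "norm2 m (?F \<psi>) = norm2 m \<psi>" for \<psi> by (rule norm2_run) (use cw in blast)
    show "norm2 m (\<lambda>b. if bit b (chain_end g ps) = (\<not> dyck k x) then run x L (ket 0) b else 0) \<le> \<epsilon>"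
    proof (cases "dyck k x")
      case True
      have "(\<lambda>b. if bit b (chain_end g ps) = (\<not> dyck k x) then run x L (ket 0) b else 0) = ?F \<psi>0"
        unfolding runL sum using s True by (auto simp: supp_def fun_eq_iff)
      then show ?thesis using nF[of \<psi>0] detF[OF True] by (simp add: \<psi>0_def)
    next
      case False
      have "(\<lambda>b. if bit b (chain_end g ps) = (\<not> dyck k x) then run x L (ket 0) b else 0) = ?F \<psi>1"
        unfolding runL sum using s False by (auto simp: supp_def fun_eq_iff)
      then show ?thesis using nF[of \<psi>1] detT[OF False] by (simp add: \<psi>1_def)
    qed
  qed
qed

section \<open>Asymptotics\<close>

lemma power_fact_le_exp: "0 \<le> (x :: real) \<Longrightarrow> x ^ k / fact k \<le> exp x"
proof -
  assume x: "0 \<le> x"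
  have "(\<Sum>i \<in> {k}. x ^ i /\<^sub>R fact i) \<le> exp x"
    unfolding exp_def by (rule sum_le_suminf[OF summable_exp_generic]) (use x in auto)
  then show ?thesis by (simp add: field_simps)
qed

lemma log_bounds:
  assumes "9 \<le> n"
  shows "3 \<le> log 2 (real n)" "real (ceillog2 n) \<le> 1 + log 2 (real n)" "log 2 (real n) \<le> real (ceillog2 n)"
proof -
  have "log 2 (2 ^ 3) \<le> log 2 (real n)" using assms by (subst log_le_cancel_iff) auto
  then show "3 \<le> log 2 (real n)" by (subst (asm) log_nat_power) auto
  show "real (ceillog2 n) \<le> 1 + log 2 (real n)" using ceillog2_less_log[of n] assms by simp
  show "log 2 (real n) \<le> real (ceillog2 n)" using ceillog2_ge_log[of n] assms by simp
qed

lemma powr_half_sq: "0 < l \<Longrightarrow> (l powr (0.5 * real k))\<^sup>2 = l ^ k"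
  by (simp add: power2_eq_square powr_add[symmetric] powr_realpow)

text \<open>After squaring, the factors exponential in \<open>k\<close> are 1024 from the costs, 6
  from the binomial coefficient and 4 from the number of steps per iteration. The power of their
  product 24576 is absorbed by \<open>fact k\<close>. The constant 5120000 is 1024 * 8 *
  625.\<close>

lemma main_cost:
  fixes n k :: nat
  assumes n: "9 \<le> n" and k: "k \<le> 3 * ceillog2 n"
  shows "ecost (k + 1) (ceillog2 n + 2) * (2 * real k + 23) \<le>
    sqrt (5120000 * exp 24576) * (sqrt (real n) * log 2 (real n) powr (0.5 * real k))"
proof (rule power2_le_imp_le)
  define a l where "a = ceillog2 n" and "l = log 2 (real n)"
  have l: "3 \<le> l" "real a \<le> 1 + l" using log_bounds[OF n] unfolding a_def l_def by simp_all
  have "(a + 2 + k choose (a + 2)) * fact k = (a + 2 + k choose k) * fact k"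
    using binomial_symmetric[of k "a + 2 + k"] by simp
  also have "\<dots> \<le> (a + 2 + k) ^ k" by (rule binomial_fact_pow)
  finally have "real ((a + 2 + k choose (a + 2)) * fact k) \<le> real ((a + 2 + k) ^ k)" by (rule of_nat_mono)
  also have "real ((a + 2 + k) ^ k) = real (a + 2 + k) ^ k" by simp
  \<comment> \<open>Here \<open>a + 2 + k\<close> is at most \<open>4 * a + 2\<close>, hence at most
    \<open>4 * l + 6\<close>, and \<open>l\<close> is at least 3.\<close>
  also have "\<dots> \<le> (6 * l) ^ k"
  proof (rule power_mono)
    have "real k \<le> 3 * real a" using k unfolding a_def by (metis of_nat_le_iff of_nat_mult of_nat_numeral)
    then show "real (a + 2 + k) \<le> 6 * l" using l by simp
  qed simp
  finally have bin: "real (a + 2 + k choose (a + 2)) \<le> (6 * l) ^ k / fact k" by (simp add: field_simps)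
  have "(2 :: nat) ^ (a + 2) \<le> 8 * n" using two_power_ceillog2_gt[of n] n unfolding a_def by simp
  then have "real (2 ^ (a + 2)) \<le> real (8 * n)" by (rule of_nat_mono)
  then have two: "(2 :: real) ^ (a + 2) \<le> 8 * real n" by simp
  have "2 * real k + 23 \<le> 25 * 2 ^ k"
  proof (induction k)
    case (Suc k)
    have "(1 :: real) \<le> 2 ^ k" by simp
    then show ?case using Suc by simp
  qed simp
  then have "(2 * real k + 23)\<^sup>2 \<le> (25 * 2 ^ k)\<^sup>2" by (rule power_mono) simp
  also have "(25 * 2 ^ k :: real)\<^sup>2 = 625 * 4 ^ k" by (simp add: power_mult_distrib flip: power_mult power_even_eq) (simp add: power_mult power2_eq_square flip: power_mult_distrib)
  finally have poly: "(2 * real k + 23)\<^sup>2 \<le> 625 * 4 ^ k" .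
  have "(ecost (k + 1) (a + 2))\<^sup>2 = 1024 * 1024 ^ k * (2 ^ (a + 2) * real (a + 2 + k choose (a + 2)))"
    unfolding ecost_sq by simp
  also have "\<dots> \<le> 1024 * 1024 ^ k * (8 * real n * ((6 * l) ^ k / fact k))"
    using two bin by (intro mult_left_mono mult_mono) auto
  finally have "(ecost (k + 1) (a + 2))\<^sup>2 * (2 * real k + 23)\<^sup>2 \<le>
      1024 * 1024 ^ k * (8 * real n * ((6 * l) ^ k / fact k)) * (625 * 4 ^ k)"
    using poly l by (intro mult_mono) auto
  also have "\<dots> = 5120000 * real n * l ^ k * ((1024 * 6 * 4) ^ k / fact k)"
    unfolding power_mult_distrib by simp
  also have "\<dots> \<le> 5120000 * real n * l ^ k * exp 24576"
    using power_fact_le_exp[of 24576 k] l by (intro mult_left_mono) auto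
  finally show "(ecost (k + 1) (ceillog2 n + 2) * (2 * real k + 23))\<^sup>2 \<le>
     (sqrt (5120000 * exp 24576) * (sqrt (real n) * log 2 (real n) powr (0.5 * real k)))\<^sup>2"
    using powr_half_sq[of l k] l unfolding a_def[symmetric] l_def[symmetric] power_mult_distrib
    by (simp add: mult_ac)
qed auto

text \<open>For such \<open>k\<close> the power of the logarithm is at least
  \<open>3 powr (1.5 * l)\<close>. As \<open>3 powr 1.5\<close> exceeds 4, this is at least the
  square of \<open>2 powr l\<close>, which is \<open>n\<close>.\<close>

lemma classical_cost:
  fixes n k :: nat
  assumes n: "9 \<le> n" and k: "3 * ceillog2 n < k"
  shows "(real n)\<^sup>2 \<le> sqrt (real n) * log 2 (real n) powr (0.5 * real k)"
proof -
  define l where "l = log 2 (real n)"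
  have l: "3 \<le> l" "l \<le> real (ceillog2 n)" using log_bounds[OF n] unfolding l_def by simp_all
  have "3 * real (ceillog2 n) \<le> real k" using k by linarith
  then have lk: "l * 1.5 \<le> 0.5 * real k" using l by simp
  have three: "(4 :: real) \<le> 3 powr 1.5"
  proof (rule power2_le_imp_le)
    show "(4 :: real)\<^sup>2 \<le> (3 powr 1.5)\<^sup>2" using powr_half_sq[of 3 3] by simp
  qed simp
  have "(real n)\<^sup>2 = (2 powr l)\<^sup>2" using n by (simp add: l_def)
  also have "\<dots> = 4 powr l" by (simp add: power2_eq_square flip: powr_mult)
  also have "\<dots> \<le> (3 powr 1.5) powr l" using three l by (intro powr_mono2) auto
  also have "\<dots> = 3 powr (l * 1.5)" by (simp add: powr_powr mult.commute)
  also have "\<dots> \<le> 3 powr (0.5 * real k)" using lk by (intro powr_mono) auto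
  also have "\<dots> \<le> l powr (0.5 * real k)" using l by (intro powr_mono2) auto
  finally have 1: "(real n)\<^sup>2 \<le> l powr (0.5 * real k)" .
  have "1 \<le> sqrt (real n)" using n by simp
  then have "1 * l powr (0.5 * real k) \<le> sqrt (real n) * l powr (0.5 * real k)" by (intro mult_right_mono) auto
  then show ?thesis using 1 unfolding l_def by simp
qed

lemma size_ok_small:
  assumes "1 \<le> n"
  shows "size_ok 1000000000 n 11 1"
proof -
  have l: "0 \<le> log 2 (real n)" using assms by simp
  then have "1 \<le> (1 + log 2 (real n)) ^ 1000000000" by (intro one_le_power) simp
  moreover have "real (1 * (2 * 3 ^ 10 + 1)) \<le> real 1000000000 * X" if "1 \<le> X" for X using that by simp
  ultimately show ?thesis using l unfolding size_ok_def by (intro conjI) (simp, blast)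
qed

lemma size_ok_main:
  fixes n :: nat
  assumes n: "1 \<le> n"
  defines "a \<equiv> ceillog2 n"
  shows "size_ok 1000000000 n (88 * a + 170) (4 * (a + 2) * (12 * a + 70))"
proof -
  define z where "z = 1 + log 2 (real n)"
  have z: "1 \<le> z" "real a \<le> z" using n ceillog2_less_log[of n] by (simp_all add: z_def a_def)
  have "real (a + 2) * real (12 * a + 70) \<le> (3 * z) * (82 * z)" using z by (intro mult_mono) auto
  \<comment> \<open>472396 is \<open>4 * (2 * 3 ^ 10 + 1)\<close>.\<close>
  then have "472396 * (real (a + 2) * real (12 * a + 70)) \<le> 1000000000 * z ^ 2"
    using zero_le_square[of z] unfolding power2_eq_square by linarith
  also have "472396 * (real (a + 2) * real (12 * a + 70)) = real (4 * (a + 2) * (12 * a + 70) * (2 * 3 ^ 10 + 1))"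
    by (simp add: algebra_simps)
  finally have "real (4 * (a + 2) * (12 * a + 70) * (2 * 3 ^ 10 + 1)) \<le> 1000000000 * z ^ 2" .
  also have "\<dots> \<le> 1000000000 * z ^ 1000000000" using z by (intro mult_left_mono power_increasing) auto
  finally show ?thesis using z unfolding size_ok_def z_def[symmetric] by simp
qed

lemma parameters:
  fixes c \<epsilon> :: real
  assumes c: "1 \<le> c" and e: "0 < \<epsilon>" "\<epsilon> < 1 / 2"
  obtains t C where "sin t \<noteq> 0" "cos t \<noteq> 0" "(sin t)\<^sup>2 / (cos t)\<^sup>2 * c \<le> \<epsilon>" "c / ((sin t)\<^sup>2 * (2 ^ C)\<^sup>2) \<le> \<epsilon>"
    "2 ^ C \<le> 6 / \<epsilon> * c"
proof -
  \<comment> \<open>This will be the square of \<open>sin t\<close>. The error for true values is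
    then about half of \<open>\<epsilon>\<close>, and a power of the walk of order
    \<open>c / \<epsilon>\<close> makes the other error at most \<open>\<epsilon>\<close>.\<close>
  define s where "s = \<epsilon> / (2 * c)"
  have s: "0 < s" "s * c = \<epsilon> / 2" using c e by (simp_all add: s_def)
  have s4: "s \<le> 1 / 4" using c e mult_left_mono[of 1 c s] s by simp
  define t where "t = arcsin (sqrt s)"
  have sq: "sqrt s \<le> 1" "- 1 \<le> sqrt s" using s s4 real_sqrt_ge_zero[of s] by (auto intro: order_trans[of _ 0])
  have sin: "(sin t)\<^sup>2 = s" using s sq by (simp add: t_def)
  have cos: "(cos t)\<^sup>2 = 1 - s" using sin sin_cos_squared_add[of t] by simp
  define N where "N = nat \<lceil>2 * c / \<epsilon>\<rceil>"
  have ce: "1 \<le> c / \<epsilon>" using c e by (simp add: field_simps)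
  have N: "2 * c / \<epsilon> \<le> real N" "real N \<le> 3 * (c / \<epsilon>)" "0 < N"
  proof -
    show 1: "2 * c / \<epsilon> \<le> real N" unfolding N_def by linarith
    show "real N \<le> 3 * (c / \<epsilon>)" using ce unfolding N_def by simp linarith
    show "0 < N" using 1 ce by (cases N) simp_all
  qed
  define C where "C = ceillog2 N"
  have "real N \<le> 2 ^ C" using of_nat_mono[OF le_two_power_ceillog2[of N], where 'a = real] unfolding C_def by simp
  then have C1: "2 * c / \<epsilon> \<le> 2 ^ C" using N(1) by linarith
  have "real (2 ^ C) \<le> real (2 * N)" using two_power_ceillog2_gt[OF N(3)] unfolding C_def by (intro of_nat_mono) simp
  then have C2: "2 ^ C \<le> 6 / \<epsilon> * c" using N(2) by simp
  show ?thesis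
  proof (rule that[OF _ _ _ _ C2])
    show "sin t \<noteq> 0" "cos t \<noteq> 0" using sin cos s s4 by auto
    have "s / (1 - s) * c = (\<epsilon> / 2) / (1 - s)" unfolding s(2)[symmetric] by simp
    also have "\<dots> \<le> (\<epsilon> / 2) / (1 / 2)" using s4 e by (intro divide_left_mono) auto
    finally show "(sin t)\<^sup>2 / (cos t)\<^sup>2 * c \<le> \<epsilon>" unfolding sin cos by simp
    have "(2 * c / \<epsilon>)\<^sup>2 \<le> (2 ^ C)\<^sup>2" using C1 c e by (intro power_mono) auto
    then have "s * (2 * c / \<epsilon>)\<^sup>2 \<le> s * (2 ^ C)\<^sup>2" using s by (intro mult_left_mono) auto
    moreover have "s * (2 * c / \<epsilon>)\<^sup>2 = 2 * c / \<epsilon>" using c e by (simp add: s_def power2_eq_square field_simps)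
    ultimately have "2 * c / \<epsilon> \<le> s * (2 ^ C)\<^sup>2" by simp
    then have "c / (s * (2 ^ C)\<^sup>2) \<le> c / (2 * c / \<epsilon>)" using c e s by (intro divide_left_mono mult_pos_pos) auto
    also have "\<dots> \<le> \<epsilon>" using c e by (simp add: field_simps)
    finally show "c / ((sin t)\<^sup>2 * (2 ^ C)\<^sup>2) \<le> \<epsilon>" unfolding sin .
  qed
qed

theorem theorem3:
  fixes \<epsilon> :: real
  assumes "0 < \<epsilon>" and "\<epsilon> < 1 / 2"
  shows "\<exists>(A :: nat \<Rightarrow> nat \<Rightarrow> query_algorithm) (c :: nat).
    (\<forall>n k. 1 \<le> n \<and> 1 \<le> k \<longrightarrow>
       is_query_algorithm c n (A n k) \<and> computes_with_error (A n k) n (dyck k) \<epsilon>) \<and>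
    (\<forall>\<kappa> :: nat \<Rightarrow> nat. (\<forall>n. 1 \<le> \<kappa> n) \<longrightarrow>
       (\<lambda>n. real (queries (A n (\<kappa> n))))
         \<in> O(\<lambda>n. sqrt (real n) * log 2 (real n) powr (0.5 * real (\<kappa> n))) \<and>
       (\<lambda>n. real (running_time (A n (\<kappa> n))))
         \<in> O(\<lambda>n. sqrt (real n) * log 2 (real n) powr (0.5 * real (\<kappa> n))))"
proof -
  define c :: nat where "c = 1000000000"
  \<comment> \<open>The first constant comes from the quantum algorithm, 9 from the classical
    one.\<close>
  define K where "K = max (6 / \<epsilon> * sqrt (5120000 * exp 24576)) 9"
  define h where "h n k = sqrt (real n) * log 2 (real n) powr (0.5 * real k)" for n k :: nat
  define ok where "ok n k A \<longleftrightarrow> is_query_algorithm c n A \<and> computes_with_error A n (dyck k) \<epsilon> \<and>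
    (9 \<le> n \<longrightarrow> real (queries A) \<le> K * h n k \<and> real (running_time A) \<le> K * h n k)" for n k :: nat and A
  have ex: "\<exists>A. ok n k A" if n: "1 \<le> n" and k: "1 \<le> k" for n k
  \<comment> \<open>Below 9 letters the growth bound demands nothing, and the classical algorithm
    serves for every \<open>k\<close>.\<close>
  proof (cases "9 \<le> n \<and> k \<le> 3 * ceillog2 n")
    case True
    define a where "a = ceillog2 n"
    have "4 \<le> a" unfolding a_def by (subst ceillog2_ge_iff) (use True in auto)
    \<comment> \<open>The \<open>k\<close> letters of the padding must fit into one quarter of the
      text.\<close>
    then have "3 * a \<le> 2 ^ a" by (induction a rule: dec_induct) auto
    then have k2: "k \<le> 2 ^ a" using True unfolding a_def by linarith
    define c0 where "c0 = ecost (k + 1) (a + 2)"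
    have c0: "1 \<le> c0" using ecost_ge(2)[of "k + 1" "a + 2"] by (simp add: c0_def)
    from parameters[OF this assms] obtain t C where t: "sin t \<noteq> 0" "cos t \<noteq> 0"
      "(sin t)\<^sup>2 / (cos t)\<^sup>2 * c0 \<le> \<epsilon>" "c0 / ((sin t)\<^sup>2 * (2 ^ C)\<^sup>2) \<le> \<epsilon>" "2 ^ C \<le> 6 / \<epsilon> * c0" by metis
    have "\<exists>A. is_query_algorithm c n A \<and> computes_with_error A n (dyck k) \<epsilon> \<and>
        queries A \<le> 2 ^ C * (2 * k + 23) \<and> running_time A \<le> 2 ^ C * (2 * k + 23)"
      using quantum_algorithm[OF n k _ _ t(1,2), where C = C and \<epsilon> = \<epsilon> and c = c] True k2 t(3,4) size_ok_main[OF n]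
      unfolding c0_def a_def c_def by blast
    then obtain A where A: "is_query_algorithm c n A" "computes_with_error A n (dyck k) \<epsilon>"
      "queries A \<le> 2 ^ C * (2 * k + 23)" "running_time A \<le> 2 ^ C * (2 * k + 23)" by blast
    have "real (2 ^ C * (2 * k + 23)) = 2 ^ C * (2 * real k + 23)" by simp
    also have "\<dots> \<le> 6 / \<epsilon> * c0 * (2 * real k + 23)" using t(5) by (rule mult_right_mono) simp
    also have "\<dots> = 6 / \<epsilon> * (c0 * (2 * real k + 23))" by simp
    also have "\<dots> \<le> 6 / \<epsilon> * (sqrt (5120000 * exp 24576) * h n k)"
      using main_cost[of n k] True assms(1) unfolding c0_def a_def h_def by (intro mult_left_mono) auto
    also have "\<dots> = 6 / \<epsilon> * sqrt (5120000 * exp 24576) * h n k" by simp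
    also have "\<dots> \<le> K * h n k" unfolding K_def h_def by (intro mult_right_mono max.cobounded1) simp
    finally have le: "real (2 ^ C * (2 * k + 23)) \<le> K * h n k" .
    have "real (queries A) \<le> K * h n k" "real (running_time A) \<le> K * h n k"
      using order_trans[OF of_nat_mono[OF A(3)] le] order_trans[OF of_nat_mono[OF A(4)] le] .
    then show ?thesis unfolding ok_def using A by blast
  next
    case False
    obtain A where A: "is_query_algorithm c n A" "computes_with_error A n (dyck k) \<epsilon>"
      "queries A \<le> 9 * n\<^sup>2" "running_time A \<le> 9 * n\<^sup>2"
      using classical_algorithm[OF n, of \<epsilon> c k] size_ok_small[OF n] assms(1) unfolding c_def by auto
    have le: "real (9 * n\<^sup>2) \<le> K * h n k" if "9 \<le> n"
    proof -
      have "(real n)\<^sup>2 \<le> h n k" using classical_cost[of n k] that False unfolding h_def by auto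
      then have "9 * (real n)\<^sup>2 \<le> K * h n k" by (intro mult_mono) (auto simp: K_def h_def)
      then show ?thesis by simp
    qed
    have "real (queries A) \<le> K * h n k" "real (running_time A) \<le> K * h n k" if "9 \<le> n"
      using order_trans[OF of_nat_mono[OF A(3)] le[OF that]] order_trans[OF of_nat_mono[OF A(4)] le[OF that]] .
    then show ?thesis unfolding ok_def using A by blast
  qed
  \<comment> \<open>One algorithm is chosen for each pair. As \<open>K\<close> depends on
    \<open>\<epsilon>\<close> alone, the pointwise bounds give the asymptotic claim for every choice
    of depths.\<close>
  define A where "A n k = (SOME A. ok n k A)" for n k
  have A: "ok n k (A n k)" if "1 \<le> n" "1 \<le> k" for n k
    unfolding A_def by (rule someI_ex) (rule ex[OF that])
  have O: "(\<lambda>n. real (q (A n (\<kappa> n)))) \<in> O(\<lambda>n. sqrt (real n) * log 2 (real n) powr (0.5 * real (\<kappa> n)))"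
    if "\<And>n k A. ok n k A \<Longrightarrow> 9 \<le> n \<Longrightarrow> real (q A) \<le> K * h n k" "\<forall>n. 1 \<le> \<kappa> n" for q :: "query_algorithm \<Rightarrow> nat" and \<kappa>
  proof (rule bigoI[where c = K])
    show "\<forall>\<^sub>F n in sequentially. norm (real (q (A n (\<kappa> n)))) \<le>
        K * norm (sqrt (real n) * log 2 (real n) powr (0.5 * real (\<kappa> n)))"
      using eventually_ge_at_top[of 9]
    proof eventually_elim
      case (elim n)
      then have "real (q (A n (\<kappa> n))) \<le> K * h n (\<kappa> n)" using that A[of n "\<kappa> n"] by auto
      moreover have e: "norm (sqrt (real n) * log 2 (real n) powr (0.5 * real (\<kappa> n))) = h n (\<kappa> n)" by (simp add: h_def)
      ultimately show ?case unfolding e by simp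
    qed
  qed
  show ?thesis
  proof (intro exI[of _ A] exI[of _ c] conjI allI impI)
    fix n k :: nat assume "1 \<le> n \<and> 1 \<le> k"
    then show "is_query_algorithm c n (A n k)" "computes_with_error (A n k) n (dyck k) \<epsilon>"
      using A[of n k] by (auto simp: ok_def)
  qed (rule O; simp add: ok_def)+
qed

end
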